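(* Let $\mathcal M$ be a cofibration $\mathcal V$-category and $\mathcal C$ a small locally flat $\mathcal V$-category; equip $[\mathcal C,\mathcal M]$ with projective cofibrations and pointwise weak equivalences. Let $W:\mathcal C^{\mathrm{op}}\to\mathcal V$ be a weight which is pointwise flat (every $Wc$ is flat). Then the weighted colimit functor $W\otimes_{\mathcal C}-:[\mathcal C,\mathcal M]\to\mathcal M$ is left Quillen.
   Context: **Categories with cofibrations.** All categories of homotopical nature are assumed to have an initial object $0$, and functors between them to preserve it. A left closed class in a category $\mathcal M$ is a subcategory $\mathsf C\subseteq\mathcal M$, whose morphisms are called cofibrations and whose objects are called good, such that: (i) (small) coproducts of good objects exist in $\mathcal M$ and are good, in particular $0$ is good; (ii) every isomorphism with good domain is a cofibration; (iii) a pushout of a cofibration along a map between good objects exists in $\mathcal M$ and is a cofibration; (iv) a transfinite composite of cofibrations exists in $\mathcal M$ and is a cofibration. An object $M$ is cofibrant if $0\to M$ is a cofibration; a strong cofibration is a cofibration between cofibrant objects. **Cofibration categories.** A cofibration category is a category with subcategories $\mathsf C$ (cofibrations) and $\mathsf W$ (weak equivalences) such that: weak equivalences satisfy 2-out-of-3 and contain all isomorphisms; both $\mathsf C$ and $\mathsf W\cap\mathsf C$ (trivial cofibrations) are left closed classes (they share the same good objects); every map with good domain factors as a cofibration followed by a weak equivalence. For the given $\mathcal M$ all good objects are assumed cofibrant. A functor is left Quillen if it preserves cofibrations between cofibrant objects and weak equivalences between cofibrant objects. **Enrichment.** $\mathcal V$ is a cocomplete symmetric monoidal category with unit $\mathsf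 I$, whose tensor product preserves colimits in each variable. A cofibration $\mathcal V$-category is a cofibration category equipped with an action $\otimes:\mathcal V\otimes\mathcal M\to\mathcal M$ (associative and unital up to coherent isomorphism), preserving existing colimits in each variable. **Flatness.** A map $i:K\to L$ of $\mathcal V$ is flat if $i\otimes-:\mathcal M\to\mathcal M^{[1]}$ (the arrow category) is left Quillen, i.e.: for each strong cofibration $M\to N$ in $\mathcal M$, in the square with corners $K\otimes M,\ L\otimes M,\ K\otimes N,\ L\otimes N$ all objects are cofibrant and all four maps, as well as the map $K\otimes N+_{K\otimes M}L\otimes M\to L\otimes N$, are cofibrations; and $K\otimes-$, $L\otimes-$ preserve weak equivalences between cofibrant objects. An object $K$ is flat if $0\to K$ is flat, i.e. $K\otimes-$ is left Quillen. $\mathcal C$ is locally flat if all hom-objects $\mathcal C(c',c)$ are flat. **Diagrams.** $[\mathcal C,\mathcal M]$ is the category of $\mathcal V$-enriched diagrams: families $Xc\in\mathcal M$ with associative and unital maps $\mathcal C(c,c')\otimes Xc\to Xc'$. Good objects of $[\mathcal C,\mathcal M]$ are the pointwise good diagrams. Projective cofibrations are the maps (with good domain) in the closure of $\{\mathcal C(c,-)\otimes M\to\mathcal C(c,-)\otimes N\mid c\in\mathcal C,\ M\to N\text{ a cofibration in }\mathcal M\}$ under coproducts, cobase change (along maps between good objects) and transfinite composites. A diagram $X$ is cofibrant if $0\to X$ is a projective cofibration. **Weighted colimit.** $W\otimes_{\mathcal C}X=\int^{c\in\mathcal C}Wc\otimes Xc$, the enriched coend, i.e. the coequalizer of the two maps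 $\sum_{c_0,c_1}\mathcal C(c_0,c_1)\otimes Wc_1\otimes Xc_0\rightrightarrows\sum_c Wc\otimes Xc$. In general it is only a partially defined functor; the assertion includes that it is defined on cofibrant diagrams. *)

theory Defs
  imports Main "HOL-Library.FuncSet" "HOL-Library.Countable_Set"
begin

unbundle cardinal_syntax

section \<open>Smallness\<close>

text \<open>
  A type \<open>'s\<close> plays the role of the universe of small sets: a set (over any type) is small if
  its cardinality is strictly less than that of \<open>'s\<close>.  The cardinality of \<open>'s\<close> is only required
  to be regular and uncountable; the case of an inaccessible cardinality is the usual notion of
  smallness with respect to a Grothendieck universe.  Every small set is in bijection with a small
  subset of \<open>'s\<close>, so small index sets, small ordinals and small index categories may be taken
  to live on subsets of \<open>'s\<close>.
\<close>

definition universe :: "'s itself \<Rightarrow> bool" where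
  "universe U \<longleftrightarrow> uncountable (UNIV :: 's set) \<and> regularCard |UNIV :: 's set|"

definition small :: "'s itself \<Rightarrow> 'x set \<Rightarrow> bool" where
  "small U A \<longleftrightarrow> |A| <o |UNIV :: 's set|"


section \<open>Categories\<close>

record ('o, 'a) cat =
  Ob :: "'o set"
  Ar :: "'a set"
  Dom :: "'a \<Rightarrow> 'o"
  Cod :: "'a \<Rightarrow> 'o"
  Idn :: "'o \<Rightarrow> 'a"
  Comp :: "'a \<Rightarrow> 'a \<Rightarrow> 'a"  (infixl "\<cdot>\<index>" 55)

definition hom :: "('o, 'a, 'z) cat_scheme \<Rightarrow> 'o \<Rightarrow> 'o \<Rightarrow> 'a set" where
  "hom A x y = {f \<in> Ar A. Dom A f = x \<and> Cod A f = y}"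

locale category =
  fixes A :: "('o, 'a, 'z) cat_scheme" (structure)
  assumes Dom_in: "f \<in> Ar A \<Longrightarrow> Dom A f \<in> Ob A"
    and Cod_in: "f \<in> Ar A \<Longrightarrow> Cod A f \<in> Ob A"
    and Idn_in: "x \<in> Ob A \<Longrightarrow> Idn A x \<in> hom A x x"
    and Comp_in: "\<lbrakk>f \<in> hom A x y; g \<in> hom A y z\<rbrakk> \<Longrightarrow> g \<cdot> f \<in> hom A x z"
    and Comp_Idn_left: "f \<in> hom A x y \<Longrightarrow> Idn A y \<cdot> f = f"
    and Comp_Idn_right: "f \<in> hom A x y \<Longrightarrow> f \<cdot> Idn A x = f"
    and Comp_assoc: "\<lbrakk>f \<in> hom A w x; g \<in> hom A x y; h \<in> hom A y z\<rbrakk>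
      \<Longrightarrow> (h \<cdot> g) \<cdot> f = h \<cdot> (g \<cdot> f)"

definition inverse_arrows :: "('o, 'a, 'z) cat_scheme \<Rightarrow> 'a \<Rightarrow> 'a \<Rightarrow> bool" where
  "inverse_arrows A f g \<longleftrightarrow> f \<in> Ar A \<and> g \<in> hom A (Cod A f) (Dom A f)
     \<and> g \<cdot>\<^bsub>A\<^esub> f = Idn A (Dom A f) \<and> f \<cdot>\<^bsub>A\<^esub> g = Idn A (Cod A f)"

definition is_iso :: "('o, 'a, 'z) cat_scheme \<Rightarrow> 'a \<Rightarrow> bool" where
  "is_iso A f \<longleftrightarrow> (\<exists>g. inverse_arrows A f g)"

definition inv_ar :: "('o, 'a, 'z) cat_scheme \<Rightarrow> 'a \<Rightarrow> 'a" where
  "inv_ar A f = (THE g. inverse_arrows A f g)"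

definition subcategory :: "('o, 'a, 'z) cat_scheme \<Rightarrow> 'a set \<Rightarrow> bool" where
  "subcategory A S \<longleftrightarrow> S \<subseteq> Ar A
     \<and> (\<forall>f\<in>S. Idn A (Dom A f) \<in> S \<and> Idn A (Cod A f) \<in> S)
     \<and> (\<forall>f\<in>S. \<forall>g\<in>S. Cod A f = Dom A g \<longrightarrow> g \<cdot>\<^bsub>A\<^esub> f \<in> S)"

definition full_subcat :: "('o, 'a, 'z) cat_scheme \<Rightarrow> 'o set \<Rightarrow> ('o, 'a, 'z) cat_scheme" where
  "full_subcat A D = A\<lparr>Ob := D, Ar := {f \<in> Ar A. Dom A f \<in> D \<and> Cod A f \<in> D}\<rparr>"

record ('o, 'a, 'p, 'b) funct =
  FOb :: "'o \<Rightarrow> 'p"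
  FAr :: "'a \<Rightarrow> 'b"

definition is_functor :: "('o, 'a, 'z) cat_scheme \<Rightarrow> ('p, 'b, 'y) cat_scheme
    \<Rightarrow> ('o, 'a, 'p, 'b) funct \<Rightarrow> bool" where
  "is_functor A B F \<longleftrightarrow> category A \<and> category B
     \<and> (\<forall>x\<in>Ob A. FOb F x \<in> Ob B)
     \<and> (\<forall>f\<in>Ar A. FAr F f \<in> hom B (FOb F (Dom A f)) (FOb F (Cod A f)))
     \<and> (\<forall>x\<in>Ob A. FAr F (Idn A x) = Idn B (FOb F x))
     \<and> (\<forall>f\<in>Ar A. \<forall>g\<in>Ar A. Cod A f = Dom A g \<longrightarrow>
          FAr F (g \<cdot>\<^bsub>A\<^esub> f) = FAr F g \<cdot>\<^bsub>B\<^esub> FAr F f)"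

definition funct_comp :: "('p, 'b, 'q, 'd) funct \<Rightarrow> ('o, 'a, 'p, 'b) funct
    \<Rightarrow> ('o, 'a, 'q, 'd) funct" where
  "funct_comp G F = \<lparr>FOb = \<lambda>x. FOb G (FOb F x), FAr = \<lambda>f. FAr G (FAr F f)\<rparr>"

definition is_bifunctor :: "('o, 'a, 'z) cat_scheme \<Rightarrow> ('p, 'b, 'y) cat_scheme
    \<Rightarrow> ('q, 'd, 'x) cat_scheme \<Rightarrow> ('o \<Rightarrow> 'p \<Rightarrow> 'q) \<Rightarrow> ('a \<Rightarrow> 'b \<Rightarrow> 'd) \<Rightarrow> bool" where
  "is_bifunctor A B D t T \<longleftrightarrow> category A \<and> category B \<and> category D
     \<and> (\<forall>x\<in>Ob A. \<forall>y\<in>Ob B. t x y \<in> Ob D)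
     \<and> (\<forall>f\<in>Ar A. \<forall>g\<in>Ar B.
          T f g \<in> hom D (t (Dom A f) (Dom B g)) (t (Cod A f) (Cod B g)))
     \<and> (\<forall>x\<in>Ob A. \<forall>y\<in>Ob B. T (Idn A x) (Idn B y) = Idn D (t x y))
     \<and> (\<forall>f\<in>Ar A. \<forall>f'\<in>Ar A. \<forall>g\<in>Ar B. \<forall>g'\<in>Ar B. Cod A f = Dom A f' \<and> Cod B g = Dom B g' \<longrightarrow>
          T (f' \<cdot>\<^bsub>A\<^esub> f) (g' \<cdot>\<^bsub>B\<^esub> g) = T f' g' \<cdot>\<^bsub>D\<^esub> T f g)"


section \<open>Colimits\<close>

definition is_cocone :: "('j, 'k, 'y) cat_scheme \<Rightarrow> ('o, 'a, 'z) cat_scheme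
    \<Rightarrow> ('j, 'k, 'o, 'a) funct \<Rightarrow> 'o \<Rightarrow> ('j \<Rightarrow> 'a) \<Rightarrow> bool" where
  "is_cocone J A F L \<iota> \<longleftrightarrow> L \<in> Ob A \<and> (\<forall>j\<in>Ob J. \<iota> j \<in> hom A (FOb F j) L)
     \<and> (\<forall>u\<in>Ar J. \<iota> (Cod J u) \<cdot>\<^bsub>A\<^esub> FAr F u = \<iota> (Dom J u))"

definition is_colimit :: "('j, 'k, 'y) cat_scheme \<Rightarrow> ('o, 'a, 'z) cat_scheme
    \<Rightarrow> ('j, 'k, 'o, 'a) funct \<Rightarrow> 'o \<Rightarrow> ('j \<Rightarrow> 'a) \<Rightarrow> bool" where
  "is_colimit J A F L \<iota> \<longleftrightarrow> is_cocone J A F L \<iota>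
     \<and> (\<forall>L' \<iota>'. is_cocone J A F L' \<iota>' \<longrightarrow>
          (\<exists>!h. h \<in> hom A L L' \<and> (\<forall>j\<in>Ob J. h \<cdot>\<^bsub>A\<^esub> \<iota> j = \<iota>' j)))"

definition small_category :: "'s itself \<Rightarrow> ('j, 'k, 'y) cat_scheme \<Rightarrow> bool" where
  "small_category U J \<longleftrightarrow> category J \<and> small U (Ob J) \<and> small U (Ar J)"

definition cocomplete :: "'s itself \<Rightarrow> ('o, 'a, 'z) cat_scheme \<Rightarrow> bool" where
  "cocomplete U A \<longleftrightarrow> category A \<and> (\<forall>(J :: ('s, 's) cat) F.
     small_category U J \<and> is_functor J A F \<longrightarrow> (\<exists>L \<iota>. is_colimit J A F L \<iota>))"

definition preserves_colimits :: "'s itself \<Rightarrow> ('o, 'a, 'z) cat_scheme \<Rightarrow> ('p, 'b, 'y) cat_scheme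
    \<Rightarrow> ('o, 'a, 'p, 'b) funct \<Rightarrow> bool" where
  "preserves_colimits U A B F \<longleftrightarrow> (\<forall>(J :: ('s, 's) cat) D L \<iota>.
     small_category U J \<and> is_functor J A D \<and> is_colimit J A D L \<iota> \<longrightarrow>
     is_colimit J B (funct_comp F D) (FOb F L) (\<lambda>j. FAr F (\<iota> j)))"

definition is_initial :: "('o, 'a, 'z) cat_scheme \<Rightarrow> 'o \<Rightarrow> bool" where
  "is_initial A Z \<longleftrightarrow> Z \<in> Ob A \<and> (\<forall>x\<in>Ob A. \<exists>!f. f \<in> hom A Z x)"

definition is_coproduct :: "('o, 'a, 'z) cat_scheme \<Rightarrow> 'i set \<Rightarrow> ('i \<Rightarrow> 'o) \<Rightarrow> 'o \<Rightarrow> ('i \<Rightarrow> 'a) \<Rightarrow> bool"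
  where "is_coproduct A I X S \<iota> \<longleftrightarrow> S \<in> Ob A \<and> (\<forall>i\<in>I. \<iota> i \<in> hom A (X i) S)
     \<and> (\<forall>S' \<iota>'. S' \<in> Ob A \<and> (\<forall>i\<in>I. \<iota>' i \<in> hom A (X i) S') \<longrightarrow>
          (\<exists>!h. h \<in> hom A S S' \<and> (\<forall>i\<in>I. h \<cdot>\<^bsub>A\<^esub> \<iota> i = \<iota>' i)))"

definition is_coequalizer :: "('o, 'a, 'z) cat_scheme \<Rightarrow> 'a \<Rightarrow> 'a \<Rightarrow> 'a \<Rightarrow> bool" where
  "is_coequalizer A s t q \<longleftrightarrow> s \<in> Ar A \<and> t \<in> hom A (Dom A s) (Cod A s)
     \<and> q \<in> Ar A \<and> Dom A q = Cod A s \<and> q \<cdot>\<^bsub>A\<^esub> s = q \<cdot>\<^bsub>A\<^esub> t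
     \<and> (\<forall>q'\<in>Ar A. Dom A q' = Cod A s \<and> q' \<cdot>\<^bsub>A\<^esub> s = q' \<cdot>\<^bsub>A\<^esub> t \<longrightarrow>
          (\<exists>!h. h \<in> hom A (Cod A q) (Cod A q') \<and> h \<cdot>\<^bsub>A\<^esub> q = q'))"

text \<open>\<open>p\<close> is the cobase change of \<open>g\<close> along \<open>f\<close>, and \<open>q\<close> that of \<open>f\<close> along \<open>g\<close>.\<close>

definition pushout_cocone :: "('o, 'a, 'z) cat_scheme \<Rightarrow> 'a \<Rightarrow> 'a \<Rightarrow> 'a \<Rightarrow> 'a \<Rightarrow> bool" where
  "pushout_cocone A f g p q \<longleftrightarrow> f \<in> Ar A \<and> g \<in> Ar A \<and> Dom A f = Dom A g
     \<and> p \<in> Ar A \<and> q \<in> Ar A \<and> Dom A p = Cod A f \<and> Dom A q = Cod A g \<and> Cod A p = Cod A q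
     \<and> p \<cdot>\<^bsub>A\<^esub> f = q \<cdot>\<^bsub>A\<^esub> g"

definition is_pushout :: "('o, 'a, 'z) cat_scheme \<Rightarrow> 'a \<Rightarrow> 'a \<Rightarrow> 'a \<Rightarrow> 'a \<Rightarrow> bool" where
  "is_pushout A f g p q \<longleftrightarrow> pushout_cocone A f g p q
     \<and> (\<forall>p' q'. pushout_cocone A f g p' q' \<longrightarrow>
          (\<exists>!h. h \<in> hom A (Cod A p) (Cod A p') \<and> h \<cdot>\<^bsub>A\<^esub> p = p' \<and> h \<cdot>\<^bsub>A\<^esub> q = q'))"


section \<open>Transfinite composition\<close>

text \<open>The part on \<open>K\<close> of the (well-)order \<open>r\<close>, as a category with one arrow \<open>(j, k)\<close> for \<open>j \<le> k\<close>.\<close>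

definition ord_cat :: "'s rel \<Rightarrow> 's set \<Rightarrow> ('s, 's \<times> 's) cat" where
  "ord_cat r K = \<lparr>Ob = K, Ar = {(j, k). j \<in> K \<and> k \<in> K \<and> (j, k) \<in> r}, Dom = fst, Cod = snd,
     Idn = \<lambda>j. (j, j), Comp = \<lambda>v u. (fst u, snd v)\<rparr>"

definition is_least :: "'s rel \<Rightarrow> 's \<Rightarrow> bool" where
  "is_least r k \<longleftrightarrow> k \<in> Field r \<and> underS r k = {}"

definition is_succ :: "'s rel \<Rightarrow> 's \<Rightarrow> 's \<Rightarrow> bool" where
  "is_succ r j k \<longleftrightarrow> j \<in> underS r k \<and> (\<forall>i\<in>underS r k. (i, j) \<in> r)"

definition is_limit :: "'s rel \<Rightarrow> 's \<Rightarrow> bool" where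
  "is_limit r k \<longleftrightarrow> k \<in> Field r \<and> underS r k \<noteq> {} \<and> (\<nexists>j. is_succ r j k)"

definition transfinite_seq :: "'s itself \<Rightarrow> ('o, 'a, 'z) cat_scheme \<Rightarrow> 's rel
    \<Rightarrow> ('s, 's \<times> 's, 'o, 'a) funct \<Rightarrow> bool" where
  "transfinite_seq U A r X \<longleftrightarrow> Well_order r \<and> small U (Field r) \<and> Field r \<noteq> {}
     \<and> is_functor (ord_cat r (Field r)) A X
     \<and> (\<forall>k. is_limit r k \<longrightarrow>
          is_colimit (ord_cat r (underS r k)) A X (FOb X k) (\<lambda>j. FAr X (j, k)))"


section \<open>Left closed classes and cofibration categories\<close>

definition good_obs :: "('o, 'a, 'z) cat_scheme \<Rightarrow> 'a set \<Rightarrow> 'o set" where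
  "good_obs A S = {x \<in> Ob A. Idn A x \<in> S}"

locale left_closed = category A for A :: "('o, 'a, 'z) cat_scheme" (structure) +
  fixes U :: "'s itself" and S :: "'a set"
  assumes subcat: "subcategory A S"
    and coproduct_exists: "\<And>(I :: 's set) X. \<lbrakk>small U I; \<forall>i\<in>I. X i \<in> good_obs A S\<rbrakk>
      \<Longrightarrow> \<exists>Y \<iota>. is_coproduct A I X Y \<iota>"
    and coproduct_good: "\<And>(I :: 's set) X Y \<iota>. \<lbrakk>small U I; \<forall>i\<in>I. X i \<in> good_obs A S;
        is_coproduct A I X Y \<iota>\<rbrakk> \<Longrightarrow> Y \<in> good_obs A S"
    and iso_in: "\<lbrakk>is_iso A f; Dom A f \<in> good_obs A S\<rbrakk> \<Longrightarrow> f \<in> S"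
    and pushout_exists: "\<lbrakk>f \<in> S; g \<in> Ar A; Dom A g = Dom A f; Cod A g \<in> good_obs A S\<rbrakk>
      \<Longrightarrow> \<exists>p q. is_pushout A f g p q"
    and pushout_in: "\<lbrakk>f \<in> S; g \<in> Ar A; Dom A g = Dom A f; Cod A g \<in> good_obs A S;
        is_pushout A f g p q\<rbrakk> \<Longrightarrow> q \<in> S"
    and transfinite_exists: "\<And>(r :: 's rel) X. \<lbrakk>transfinite_seq U A r X;
        \<forall>j k. is_succ r j k \<longrightarrow> FAr X (j, k) \<in> S;
        \<forall>k. is_least r k \<longrightarrow> FOb X k \<in> good_obs A S\<rbrakk>
      \<Longrightarrow> \<exists>L \<iota>. is_colimit (ord_cat r (Field r)) A X L \<iota>"
    and transfinite_in: "\<And>(r :: 's rel) X L \<iota> k. \<lbrakk>transfinite_seq U A r X;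
        \<forall>j k. is_succ r j k \<longrightarrow> FAr X (j, k) \<in> S;
        \<forall>k. is_least r k \<longrightarrow> FOb X k \<in> good_obs A S;
        is_colimit (ord_cat r (Field r)) A X L \<iota>; is_least r k\<rbrakk> \<Longrightarrow> \<iota> k \<in> S"

record ('o, 'a) cofcat = "('o, 'a) cat" +
  Cof :: "'a set"
  Weq :: "'a set"

abbreviation good :: "('o, 'a, 'z) cofcat_scheme \<Rightarrow> 'o set" where
  "good M \<equiv> good_obs M (Cof M)"

definition cofibrant :: "('o, 'a, 'z) cofcat_scheme \<Rightarrow> 'o \<Rightarrow> bool" where
  "cofibrant M X \<longleftrightarrow> (\<exists>Z f. is_initial M Z \<and> f \<in> hom M Z X \<and> f \<in> Cof M)"

definition strong_cofibration :: "('o, 'a, 'z) cofcat_scheme \<Rightarrow> 'a \<Rightarrow> bool" where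
  "strong_cofibration M f \<longleftrightarrow> f \<in> Cof M \<and> cofibrant M (Dom M f) \<and> cofibrant M (Cod M f)"

locale cofibration_category = category M for M :: "('o, 'a, 'z) cofcat_scheme" (structure) +
  fixes U :: "'s itself"
  assumes Weq_subcat: "subcategory M (Weq M)"
    and Weq_iso: "is_iso M f \<Longrightarrow> f \<in> Weq M"
    and Weq_cancel_left: "\<lbrakk>f \<in> Ar M; g \<in> Ar M; Cod M f = Dom M g; g \<in> Weq M; g \<cdot> f \<in> Weq M\<rbrakk>
      \<Longrightarrow> f \<in> Weq M"
    and Weq_cancel_right: "\<lbrakk>f \<in> Ar M; g \<in> Ar M; Cod M f = Dom M g; f \<in> Weq M; g \<cdot> f \<in> Weq M\<rbrakk>
      \<Longrightarrow> g \<in> Weq M"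
    and Cof_left_closed: "left_closed M U (Cof M)"
    and trivial_Cof_left_closed: "left_closed M U (Weq M \<inter> Cof M)"
    and factorization: "\<lbrakk>f \<in> Ar M; Dom M f \<in> good M\<rbrakk>
      \<Longrightarrow> \<exists>i\<in>Cof M. \<exists>w\<in>Weq M. Cod M i = Dom M w \<and> f = w \<cdot> i"

text \<open>
  Left Quillen functors from \<open>A\<close> to \<open>B\<close>, allowing for partially defined ones: \<open>D\<close> is the class
  of objects on which \<open>F\<close> is defined, and it is required to contain all cofibrant objects.  For a
  total functor take \<open>D = Ob A\<close>.  Like all functors between categories with cofibrations,
  \<open>F\<close> has to preserve the initial object.
\<close>

definition left_quillen :: "('o, 'a, 'z) cofcat_scheme \<Rightarrow> ('p, 'b, 'y) cofcat_scheme
    \<Rightarrow> 'o set \<Rightarrow> ('o, 'a, 'p, 'b) funct \<Rightarrow> bool" where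
  "left_quillen A B D F \<longleftrightarrow> D \<subseteq> Ob A \<and> {X \<in> Ob A. cofibrant A X} \<subseteq> D
     \<and> is_functor (full_subcat A D) B F
     \<and> (\<forall>Z\<in>D. is_initial A Z \<longrightarrow> is_initial B (FOb F Z))
     \<and> (\<forall>f. strong_cofibration A f \<longrightarrow> strong_cofibration B (FAr F f))
     \<and> (\<forall>f\<in>Weq A. cofibrant A (Dom A f) \<and> cofibrant A (Cod A f) \<longrightarrow> FAr F f \<in> Weq B)"


section \<open>Symmetric monoidal categories and their actions\<close>

record ('o, 'a) moncat = "('o, 'a) cat" +
  TOb :: "'o \<Rightarrow> 'o \<Rightarrow> 'o"
  TAr :: "'a \<Rightarrow> 'a \<Rightarrow> 'a"
  Unit :: "'o"
  TAssoc :: "'o \<Rightarrow> 'o \<Rightarrow> 'o \<Rightarrow> 'a"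
  LUnit :: "'o \<Rightarrow> 'a"
  RUnit :: "'o \<Rightarrow> 'a"
  Symm :: "'o \<Rightarrow> 'o \<Rightarrow> 'a"

locale symmetric_monoidal = category V for V :: "('o, 'a, 'z) moncat_scheme" (structure) +
  assumes tensor: "is_bifunctor V V V (TOb V) (TAr V)"
    and Unit_in: "Unit V \<in> Ob V"
    and TAssoc_in: "\<lbrakk>K \<in> Ob V; L \<in> Ob V; N \<in> Ob V\<rbrakk>
      \<Longrightarrow> TAssoc V K L N \<in> hom V (TOb V (TOb V K L) N) (TOb V K (TOb V L N))"
    and TAssoc_iso: "\<lbrakk>K \<in> Ob V; L \<in> Ob V; N \<in> Ob V\<rbrakk> \<Longrightarrow> is_iso V (TAssoc V K L N)"
    and TAssoc_natural: "\<lbrakk>f \<in> hom V K K'; g \<in> hom V L L'; h \<in> hom V N N'\<rbrakk>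
      \<Longrightarrow> TAssoc V K' L' N' \<cdot> TAr V (TAr V f g) h = TAr V f (TAr V g h) \<cdot> TAssoc V K L N"
    and LUnit_in: "K \<in> Ob V \<Longrightarrow> LUnit V K \<in> hom V (TOb V (Unit V) K) K"
    and LUnit_iso: "K \<in> Ob V \<Longrightarrow> is_iso V (LUnit V K)"
    and LUnit_natural: "f \<in> hom V K K'
      \<Longrightarrow> LUnit V K' \<cdot> TAr V (Idn V (Unit V)) f = f \<cdot> LUnit V K"
    and RUnit_in: "K \<in> Ob V \<Longrightarrow> RUnit V K \<in> hom V (TOb V K (Unit V)) K"
    and RUnit_iso: "K \<in> Ob V \<Longrightarrow> is_iso V (RUnit V K)"
    and RUnit_natural: "f \<in> hom V K K'
      \<Longrightarrow> RUnit V K' \<cdot> TAr V f (Idn V (Unit V)) = f \<cdot> RUnit V K"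
    and Symm_in: "\<lbrakk>K \<in> Ob V; L \<in> Ob V\<rbrakk> \<Longrightarrow> Symm V K L \<in> hom V (TOb V K L) (TOb V L K)"
    and Symm_natural: "\<lbrakk>f \<in> hom V K K'; g \<in> hom V L L'\<rbrakk>
      \<Longrightarrow> Symm V K' L' \<cdot> TAr V f g = TAr V g f \<cdot> Symm V K L"
    and pentagon: "\<lbrakk>K \<in> Ob V; L \<in> Ob V; N \<in> Ob V; P \<in> Ob V\<rbrakk>
      \<Longrightarrow> TAssoc V K L (TOb V N P) \<cdot> TAssoc V (TOb V K L) N P
        = TAr V (Idn V K) (TAssoc V L N P) \<cdot> TAssoc V K (TOb V L N) P
            \<cdot> TAr V (TAssoc V K L N) (Idn V P)"
    and triangle: "\<lbrakk>K \<in> Ob V; L \<in> Ob V\<rbrakk>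
      \<Longrightarrow> TAr V (Idn V K) (LUnit V L) \<cdot> TAssoc V K (Unit V) L = TAr V (RUnit V K) (Idn V L)"
    and hexagon: "\<lbrakk>K \<in> Ob V; L \<in> Ob V; N \<in> Ob V\<rbrakk>
      \<Longrightarrow> TAssoc V L N K \<cdot> Symm V K (TOb V L N) \<cdot> TAssoc V K L N
        = TAr V (Idn V L) (Symm V K N) \<cdot> TAssoc V L K N \<cdot> TAr V (Symm V K L) (Idn V N)"
    and Symm_Symm: "\<lbrakk>K \<in> Ob V; L \<in> Ob V\<rbrakk> \<Longrightarrow> Symm V L K \<cdot> Symm V K L = Idn V (TOb V K L)"

text \<open>
  An action of a monoidal category (with objects \<open>'v\<close> and arrows \<open>'w\<close>) on a category (with objects
  \<open>'o\<close> and arrows \<open>'a\<close>), with \<open>AAssoc T K L X : (K \<otimes> L) \<otimes> X \<rightarrow> K \<otimes> (L \<otimes> X)\<close>.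
\<close>

record ('v, 'w, 'o, 'a) act =
  AOb :: "'v \<Rightarrow> 'o \<Rightarrow> 'o"
  AAr :: "'w \<Rightarrow> 'a \<Rightarrow> 'a"
  AAssoc :: "'v \<Rightarrow> 'v \<Rightarrow> 'o \<Rightarrow> 'a"
  AUnit :: "'o \<Rightarrow> 'a"

locale monoidal_action =
  fixes V :: "('v, 'w, 'z) moncat_scheme" and M :: "('o, 'a, 'y) cat_scheme" (structure)
    and T :: "('v, 'w, 'o, 'a) act"
  assumes action: "is_bifunctor V M M (AOb T) (AAr T)"
    and AAssoc_in: "\<lbrakk>K \<in> Ob V; L \<in> Ob V; X \<in> Ob M\<rbrakk>
      \<Longrightarrow> AAssoc T K L X \<in> hom M (AOb T (TOb V K L) X) (AOb T K (AOb T L X))"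
    and AAssoc_iso: "\<lbrakk>K \<in> Ob V; L \<in> Ob V; X \<in> Ob M\<rbrakk> \<Longrightarrow> is_iso M (AAssoc T K L X)"
    and AAssoc_natural: "\<lbrakk>f \<in> hom V K K'; g \<in> hom V L L'; h \<in> hom M X X'\<rbrakk>
      \<Longrightarrow> AAssoc T K' L' X' \<cdot> AAr T (TAr V f g) h = AAr T f (AAr T g h) \<cdot> AAssoc T K L X"
    and AUnit_in: "X \<in> Ob M \<Longrightarrow> AUnit T X \<in> hom M (AOb T (Unit V) X) X"
    and AUnit_iso: "X \<in> Ob M \<Longrightarrow> is_iso M (AUnit T X)"
    and AUnit_natural: "h \<in> hom M X X'
      \<Longrightarrow> AUnit T X' \<cdot> AAr T (Idn V (Unit V)) h = h \<cdot> AUnit T X"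
    and act_pentagon: "\<lbrakk>K \<in> Ob V; L \<in> Ob V; N \<in> Ob V; X \<in> Ob M\<rbrakk>
      \<Longrightarrow> AAssoc T K L (AOb T N X) \<cdot> AAssoc T (TOb V K L) N X
        = AAr T (Idn V K) (AAssoc T L N X) \<cdot> AAssoc T K (TOb V L N) X
            \<cdot> AAr T (TAssoc V K L N) (Idn M X)"
    and act_triangle_right: "\<lbrakk>K \<in> Ob V; X \<in> Ob M\<rbrakk>
      \<Longrightarrow> AAr T (Idn V K) (AUnit T X) \<cdot> AAssoc T K (Unit V) X = AAr T (RUnit V K) (Idn M X)"
    and act_triangle_left: "\<lbrakk>K \<in> Ob V; X \<in> Ob M\<rbrakk>
      \<Longrightarrow> AUnit T (AOb T K X) \<cdot> AAssoc T (Unit V) K X = AAr T (LUnit V K) (Idn M X)"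

definition act_left :: "('v, 'w, 'z) moncat_scheme \<Rightarrow> ('v, 'w, 'o, 'a) act \<Rightarrow> 'v
    \<Rightarrow> ('o, 'a, 'o, 'a) funct" where
  "act_left V T K = \<lparr>FOb = AOb T K, FAr = AAr T (Idn V K)\<rparr>"

definition act_right :: "('o, 'a, 'y) cat_scheme \<Rightarrow> ('v, 'w, 'o, 'a) act \<Rightarrow> 'o
    \<Rightarrow> ('v, 'w, 'o, 'a) funct" where
  "act_right M T X = \<lparr>FOb = \<lambda>K. AOb T K X, FAr = \<lambda>f. AAr T f (Idn M X)\<rparr>"

definition preserves_colimits_each_variable :: "'s itself \<Rightarrow> ('v, 'w, 'z) moncat_scheme \<Rightarrow> ('o, 'a, 'y) cat_scheme
    \<Rightarrow> ('v, 'w, 'o, 'a) act \<Rightarrow> bool" where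
  "preserves_colimits_each_variable U V M T \<longleftrightarrow>
     (\<forall>K\<in>Ob V. preserves_colimits U M M (act_left V T K))
     \<and> (\<forall>X\<in>Ob M. preserves_colimits U V M (act_right M T X))"

definition self_action :: "('v, 'w, 'z) moncat_scheme \<Rightarrow> ('v, 'w, 'v, 'w) act" where
  "self_action V = \<lparr>AOb = TOb V, AAr = TAr V, AAssoc = TAssoc V, AUnit = LUnit V\<rparr>"

definition cocomplete_symmetric_monoidal :: "'s itself \<Rightarrow> ('v, 'w, 'z) moncat_scheme \<Rightarrow> bool" where
  "cocomplete_symmetric_monoidal U V \<longleftrightarrow> symmetric_monoidal V \<and> cocomplete U V
     \<and> preserves_colimits_each_variable U V V (self_action V)"

definition cofibration_V_category :: "'s itself \<Rightarrow> ('v, 'w, 'z) moncat_scheme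
    \<Rightarrow> ('o, 'a, 'y) cofcat_scheme \<Rightarrow> ('v, 'w, 'o, 'a) act \<Rightarrow> bool" where
  "cofibration_V_category U V M T \<longleftrightarrow> cofibration_category M U \<and> monoidal_action V M T
     \<and> preserves_colimits_each_variable U V M T"


section \<open>Flatness\<close>

definition flat_map :: "('v, 'w, 'z) moncat_scheme \<Rightarrow> ('o, 'a, 'y) cofcat_scheme
    \<Rightarrow> ('v, 'w, 'o, 'a) act \<Rightarrow> 'w \<Rightarrow> bool" where
  "flat_map V M T i \<longleftrightarrow> i \<in> Ar V \<and> (let K = Dom V i; L = Cod V i in
     (\<forall>f. strong_cofibration M f \<longrightarrow> (let X = Dom M f; Y = Cod M f in
        cofibrant M (AOb T K X) \<and> cofibrant M (AOb T L X)
        \<and> cofibrant M (AOb T K Y) \<and> cofibrant M (AOb T L Y)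
        \<and> AAr T i (Idn M X) \<in> Cof M \<and> AAr T i (Idn M Y) \<in> Cof M
        \<and> AAr T (Idn V K) f \<in> Cof M \<and> AAr T (Idn V L) f \<in> Cof M
        \<and> (\<exists>p q u. is_pushout M (AAr T (Idn V K) f) (AAr T i (Idn M X)) p q
             \<and> u \<in> hom M (Cod M p) (AOb T L Y)
             \<and> u \<cdot>\<^bsub>M\<^esub> p = AAr T i (Idn M Y) \<and> u \<cdot>\<^bsub>M\<^esub> q = AAr T (Idn V L) f
             \<and> u \<in> Cof M)))
     \<and> (\<forall>w\<in>Weq M. cofibrant M (Dom M w) \<and> cofibrant M (Cod M w) \<longrightarrow>
          AAr T (Idn V K) w \<in> Weq M \<and> AAr T (Idn V L) w \<in> Weq M))"

definition flat_ob :: "('v, 'w, 'z) moncat_scheme \<Rightarrow> ('o, 'a, 'y) cofcat_scheme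
    \<Rightarrow> ('v, 'w, 'o, 'a) act \<Rightarrow> 'v \<Rightarrow> bool" where
  "flat_ob V M T K \<longleftrightarrow> (\<exists>Z i. is_initial V Z \<and> i \<in> hom V Z K \<and> flat_map V M T i)"


section \<open>Enriched categories and enriched diagrams\<close>

text \<open>\<open>VComp C x y z : C(y, z) \<otimes> C(x, y) \<rightarrow> C(x, z)\<close>\<close>

record ('c, 'v, 'w) vcat =
  VOb :: "'c set"
  VHom :: "'c \<Rightarrow> 'c \<Rightarrow> 'v"
  VComp :: "'c \<Rightarrow> 'c \<Rightarrow> 'c \<Rightarrow> 'w"
  VId :: "'c \<Rightarrow> 'w"

locale V_category =
  fixes V :: "('v, 'w, 'z) moncat_scheme" (structure) and C :: "('c, 'v, 'w) vcat"
  assumes VHom_in: "\<lbrakk>x \<in> VOb C; y \<in> VOb C\<rbrakk> \<Longrightarrow> VHom C x y \<in> Ob V"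
    and VComp_in: "\<lbrakk>x \<in> VOb C; y \<in> VOb C; z \<in> VOb C\<rbrakk>
      \<Longrightarrow> VComp C x y z \<in> hom V (TOb V (VHom C y z) (VHom C x y)) (VHom C x z)"
    and VId_in: "x \<in> VOb C \<Longrightarrow> VId C x \<in> hom V (Unit V) (VHom C x x)"
    and VComp_assoc: "\<lbrakk>w \<in> VOb C; x \<in> VOb C; y \<in> VOb C; z \<in> VOb C\<rbrakk>
      \<Longrightarrow> VComp C w x z \<cdot> TAr V (VComp C x y z) (Idn V (VHom C w x))
        = VComp C w y z \<cdot> TAr V (Idn V (VHom C y z)) (VComp C w x y)
            \<cdot> TAssoc V (VHom C y z) (VHom C x y) (VHom C w x)"
    and VComp_VId_left: "\<lbrakk>x \<in> VOb C; y \<in> VOb C\<rbrakk>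
      \<Longrightarrow> VComp C x y y \<cdot> TAr V (VId C y) (Idn V (VHom C x y)) = LUnit V (VHom C x y)"
    and VComp_VId_right: "\<lbrakk>x \<in> VOb C; y \<in> VOb C\<rbrakk>
      \<Longrightarrow> VComp C x x y \<cdot> TAr V (Idn V (VHom C x y)) (VId C x) = RUnit V (VHom C x y)"

definition op_vcat :: "('v, 'w, 'z) moncat_scheme \<Rightarrow> ('c, 'v, 'w) vcat \<Rightarrow> ('c, 'v, 'w) vcat" where
  "op_vcat V C = \<lparr>VOb = VOb C, VHom = \<lambda>x y. VHom C y x,
     VComp = \<lambda>x y z. VComp C z y x \<cdot>\<^bsub>V\<^esub> Symm V (VHom C z y) (VHom C y x), VId = VId C\<rparr>"

definition locally_flat :: "('v, 'w, 'z) moncat_scheme \<Rightarrow> ('o, 'a, 'y) cofcat_scheme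
    \<Rightarrow> ('v, 'w, 'o, 'a) act \<Rightarrow> ('c, 'v, 'w) vcat \<Rightarrow> bool" where
  "locally_flat V M T C \<longleftrightarrow> (\<forall>x\<in>VOb C. \<forall>y\<in>VOb C. flat_ob V M T (VHom C x y))"

text \<open>
  Enriched diagrams \<open>X\<close> with structure maps \<open>DAct X x y : C(x, y) \<otimes> X x \<rightarrow> X y\<close>.  All families are
  taken to be extensional so that equality of diagrams and of their maps is the intended one.
\<close>

record ('c, 'o, 'a) diagram =
  DOb :: "'c \<Rightarrow> 'o"
  DAct :: "'c \<Rightarrow> 'c \<Rightarrow> 'a"

definition restrict2 :: "('c \<Rightarrow> 'c \<Rightarrow> 'a) \<Rightarrow> 'c set \<Rightarrow> 'c \<Rightarrow> 'c \<Rightarrow> 'a" where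
  "restrict2 f K = (\<lambda>x y. if x \<in> K \<and> y \<in> K then f x y else undefined)"

definition is_diagram :: "('v, 'w, 'z) moncat_scheme \<Rightarrow> ('c, 'v, 'w) vcat
    \<Rightarrow> ('o, 'a, 'y) cat_scheme \<Rightarrow> ('v, 'w, 'o, 'a) act \<Rightarrow> ('c, 'o, 'a) diagram \<Rightarrow> bool" where
  "is_diagram V C M T X \<longleftrightarrow>
     DOb X \<in> extensional (VOb C) \<and> DAct X = restrict2 (DAct X) (VOb C)
     \<and> (\<forall>x\<in>VOb C. DOb X x \<in> Ob M)
     \<and> (\<forall>x\<in>VOb C. \<forall>y\<in>VOb C. DAct X x y \<in> hom M (AOb T (VHom C x y) (DOb X x)) (DOb X y))
     \<and> (\<forall>x\<in>VOb C. \<forall>y\<in>VOb C. \<forall>z\<in>VOb C.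
          DAct X x z \<cdot>\<^bsub>M\<^esub> AAr T (VComp C x y z) (Idn M (DOb X x))
          = DAct X y z \<cdot>\<^bsub>M\<^esub> AAr T (Idn V (VHom C y z)) (DAct X x y)
              \<cdot>\<^bsub>M\<^esub> AAssoc T (VHom C y z) (VHom C x y) (DOb X x))
     \<and> (\<forall>x\<in>VOb C. DAct X x x \<cdot>\<^bsub>M\<^esub> AAr T (VId C x) (Idn M (DOb X x)) = AUnit T (DOb X x))"

type_synonym ('c, 'o, 'a) diagram_map =
  "('c, 'o, 'a) diagram \<times> ('c, 'o, 'a) diagram \<times> ('c \<Rightarrow> 'a)"

definition is_diagram_map :: "('v, 'w, 'z) moncat_scheme \<Rightarrow> ('c, 'v, 'w) vcat
    \<Rightarrow> ('o, 'a, 'y) cat_scheme \<Rightarrow> ('v, 'w, 'o, 'a) act \<Rightarrow> ('c, 'o, 'a) diagram_map \<Rightarrow> bool" where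
  "is_diagram_map V C M T = (\<lambda>(X, Y, \<tau>). is_diagram V C M T X \<and> is_diagram V C M T Y
     \<and> \<tau> \<in> extensional (VOb C)
     \<and> (\<forall>x\<in>VOb C. \<tau> x \<in> hom M (DOb X x) (DOb Y x))
     \<and> (\<forall>x\<in>VOb C. \<forall>y\<in>VOb C. \<tau> y \<cdot>\<^bsub>M\<^esub> DAct X x y
          = DAct Y x y \<cdot>\<^bsub>M\<^esub> AAr T (Idn V (VHom C x y)) (\<tau> x)))"

definition diagram_cat :: "('v, 'w, 'z) moncat_scheme \<Rightarrow> ('c, 'v, 'w) vcat
    \<Rightarrow> ('o, 'a, 'y) cat_scheme \<Rightarrow> ('v, 'w, 'o, 'a) act
    \<Rightarrow> (('c, 'o, 'a) diagram, ('c, 'o, 'a) diagram_map) cat" where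
  "diagram_cat V C M T = \<lparr>Ob = Collect (is_diagram V C M T), Ar = Collect (is_diagram_map V C M T),
     Dom = (\<lambda>(X, Y, \<tau>). X), Cod = (\<lambda>(X, Y, \<tau>). Y),
     Idn = (\<lambda>X. (X, X, \<lambda>x\<in>VOb C. Idn M (DOb X x))),
     Comp = (\<lambda>(Y', Z, \<sigma>) (X, Y, \<tau>). (X, Z, \<lambda>x\<in>VOb C. \<sigma> x \<cdot>\<^bsub>M\<^esub> \<tau> x))\<rparr>"


section \<open>The projective structure on diagrams\<close>

text \<open>\<open>C(c, -) \<otimes> N\<close>, with structure maps
  \<open>C(x, y) \<otimes> (C(c, x) \<otimes> N) \<cong> (C(x, y) \<otimes> C(c, x)) \<otimes> N \<rightarrow> C(c, y) \<otimes> N\<close>\<close>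

definition free_diagram :: "('c, 'v, 'w) vcat \<Rightarrow> ('o, 'a, 'y) cat_scheme \<Rightarrow> ('v, 'w, 'o, 'a) act
    \<Rightarrow> 'c \<Rightarrow> 'o \<Rightarrow> ('c, 'o, 'a) diagram" where
  "free_diagram C M T c N = \<lparr>DOb = (\<lambda>x\<in>VOb C. AOb T (VHom C c x) N),
     DAct = restrict2 (\<lambda>x y. AAr T (VComp C c x y) (Idn M N)
       \<cdot>\<^bsub>M\<^esub> inv_ar M (AAssoc T (VHom C x y) (VHom C c x) N)) (VOb C)\<rparr>"

definition free_diagram_map :: "('v, 'w, 'z) moncat_scheme \<Rightarrow> ('c, 'v, 'w) vcat
    \<Rightarrow> ('o, 'a, 'y) cat_scheme \<Rightarrow> ('v, 'w, 'o, 'a) act \<Rightarrow> 'c \<Rightarrow> 'a \<Rightarrow> ('c, 'o, 'a) diagram_map" where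
  "free_diagram_map V C M T c i = (free_diagram C M T c (Dom M i), free_diagram C M T c (Cod M i),
     \<lambda>x\<in>VOb C. AAr T (Idn V (VHom C c x)) i)"

text \<open>
  The closure of a class \<open>G\<close> of maps of \<open>A\<close> under small coproducts (of arrows), cobase change along
  maps between objects of \<open>Gd\<close> and transfinite composites.
\<close>

inductive_set cell_closure :: "'s itself \<Rightarrow> ('o, 'a, 'z) cat_scheme \<Rightarrow> 'o set \<Rightarrow> 'a set \<Rightarrow> 'a set"
  for U :: "'s itself" and A :: "('o, 'a, 'z) cat_scheme" and Gd :: "'o set" and G :: "'a set"
where
  generator: "f \<in> G \<Longrightarrow> f \<in> cell_closure U A Gd G"
| coproduct: "\<lbrakk>small U (I :: 's set); \<And>i. i \<in> I \<Longrightarrow> f i \<in> cell_closure U A Gd G;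
    is_coproduct A I (\<lambda>i. Dom A (f i)) X \<iota>; is_coproduct A I (\<lambda>i. Cod A (f i)) Y \<kappa>;
    h \<in> hom A X Y; \<And>i. i \<in> I \<Longrightarrow> h \<cdot>\<^bsub>A\<^esub> \<iota> i = \<kappa> i \<cdot>\<^bsub>A\<^esub> f i\<rbrakk>
    \<Longrightarrow> h \<in> cell_closure U A Gd G"
| cobase_change: "\<lbrakk>f \<in> cell_closure U A Gd G; Dom A f \<in> Gd; Cod A g \<in> Gd; is_pushout A f g p q\<rbrakk>
    \<Longrightarrow> q \<in> cell_closure U A Gd G"
| transfinite_composite: "\<lbrakk>transfinite_seq U A (r :: 's rel) X;
    \<And>j k. is_succ r j k \<Longrightarrow> FAr X (j, k) \<in> cell_closure U A Gd G;
    is_least r k0; FOb X k0 \<in> Gd; is_colimit (ord_cat r (Field r)) A X L \<iota>\<rbrakk>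
    \<Longrightarrow> \<iota> k0 \<in> cell_closure U A Gd G"

definition pointwise_good :: "('v, 'w, 'z) moncat_scheme \<Rightarrow> ('c, 'v, 'w) vcat
    \<Rightarrow> ('o, 'a, 'y) cofcat_scheme \<Rightarrow> ('v, 'w, 'o, 'a) act \<Rightarrow> ('c, 'o, 'a) diagram set" where
  "pointwise_good V C M T = {X. is_diagram V C M T X \<and> (\<forall>x\<in>VOb C. DOb X x \<in> good M)}"

definition projective_cofibrations :: "'s itself \<Rightarrow> ('v, 'w, 'z) moncat_scheme \<Rightarrow> ('c, 'v, 'w) vcat
    \<Rightarrow> ('o, 'a, 'y) cofcat_scheme \<Rightarrow> ('v, 'w, 'o, 'a) act \<Rightarrow> ('c, 'o, 'a) diagram_map set" where
  "projective_cofibrations U V C M T =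
     {f \<in> cell_closure U (diagram_cat V C M T) (pointwise_good V C M T)
            {free_diagram_map V C M T c i | c i. c \<in> VOb C \<and> i \<in> Cof M}.
      Dom (diagram_cat V C M T) f \<in> pointwise_good V C M T}"

definition pointwise_weqs :: "('v, 'w, 'z) moncat_scheme \<Rightarrow> ('c, 'v, 'w) vcat
    \<Rightarrow> ('o, 'a, 'y) cofcat_scheme \<Rightarrow> ('v, 'w, 'o, 'a) act \<Rightarrow> ('c, 'o, 'a) diagram_map set" where
  "pointwise_weqs V C M T =
     {(X, Y, \<tau>). is_diagram_map V C M T (X, Y, \<tau>) \<and> (\<forall>x\<in>VOb C. \<tau> x \<in> Weq M)}"

definition projective_cofcat :: "'s itself \<Rightarrow> ('v, 'w, 'z) moncat_scheme \<Rightarrow> ('c, 'v, 'w) vcat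
    \<Rightarrow> ('o, 'a, 'y) cofcat_scheme \<Rightarrow> ('v, 'w, 'o, 'a) act
    \<Rightarrow> (('c, 'o, 'a) diagram, ('c, 'o, 'a) diagram_map) cofcat" where
  "projective_cofcat U V C M T = cat.extend (diagram_cat V C M T)
     (cofcat.fields (projective_cofibrations U V C M T) (pointwise_weqs V C M T))"


section \<open>Weighted colimits\<close>

definition is_weight :: "('v, 'w, 'z) moncat_scheme \<Rightarrow> ('c, 'v, 'w) vcat
    \<Rightarrow> ('c, 'v, 'w) diagram \<Rightarrow> bool" where
  "is_weight V C W \<longleftrightarrow> is_diagram V (op_vcat V C) V (self_action V) W"

definition coend_source :: "('c, 'v, 'w) vcat \<Rightarrow> ('v, 'w, 'z) moncat_scheme
    \<Rightarrow> ('v, 'w, 'o, 'a) act \<Rightarrow> ('c, 'v, 'w) diagram \<Rightarrow> ('c, 'o, 'a) diagram \<Rightarrow> 'c \<times> 'c \<Rightarrow> 'o" where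
  "coend_source C V T W X =
     (\<lambda>(c0, c1). AOb T (TOb V (VHom C c0 c1) (DOb W c1)) (DOb X c0))"

definition coend_target :: "('v, 'w, 'o, 'a) act \<Rightarrow> ('c, 'v, 'w) diagram
    \<Rightarrow> ('c, 'o, 'a) diagram \<Rightarrow> 'c \<Rightarrow> 'o" where
  "coend_target T W X = (\<lambda>c. AOb T (DOb W c) (DOb X c))"

text \<open>The two maps \<open>(C(c0, c1) \<otimes> W c1) \<otimes> X c0 \<rightarrow> W c0 \<otimes> X c0\<close> and
  \<open>(C(c0, c1) \<otimes> W c1) \<otimes> X c0 \<cong> W c1 \<otimes> (C(c0, c1) \<otimes> X c0) \<rightarrow> W c1 \<otimes> X c1\<close>\<close>

definition coend_left :: "('o, 'a, 'y) cat_scheme \<Rightarrow> ('v, 'w, 'o, 'a) act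
    \<Rightarrow> ('c, 'v, 'w) diagram \<Rightarrow> ('c, 'o, 'a) diagram \<Rightarrow> 'c \<times> 'c \<Rightarrow> 'a" where
  "coend_left M T W X = (\<lambda>(c0, c1). AAr T (DAct W c1 c0) (Idn M (DOb X c0)))"

definition coend_right :: "('v, 'w, 'z) moncat_scheme \<Rightarrow> ('c, 'v, 'w) vcat
    \<Rightarrow> ('o, 'a, 'y) cat_scheme \<Rightarrow> ('v, 'w, 'o, 'a) act
    \<Rightarrow> ('c, 'v, 'w) diagram \<Rightarrow> ('c, 'o, 'a) diagram \<Rightarrow> 'c \<times> 'c \<Rightarrow> 'a" where
  "coend_right V C M T W X = (\<lambda>(c0, c1). AAr T (Idn V (DOb W c1)) (DAct X c0 c1)
     \<cdot>\<^bsub>M\<^esub> AAssoc T (DOb W c1) (VHom C c0 c1) (DOb X c0)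
     \<cdot>\<^bsub>M\<^esub> AAr T (Symm V (VHom C c0 c1) (DOb W c1)) (Idn M (DOb X c0)))"

text \<open>\<open>L\<close> is a coend \<open>W \<otimes>\<^sub>C X\<close>, with canonical maps \<open>\<omega> c : W c \<otimes> X c \<rightarrow> L\<close>\<close>

definition is_weighted_colimit :: "('v, 'w, 'z) moncat_scheme \<Rightarrow> ('c, 'v, 'w) vcat
    \<Rightarrow> ('o, 'a, 'y) cat_scheme \<Rightarrow> ('v, 'w, 'o, 'a) act \<Rightarrow> ('c, 'v, 'w) diagram
    \<Rightarrow> ('c, 'o, 'a) diagram \<Rightarrow> 'o \<Rightarrow> ('c \<Rightarrow> 'a) \<Rightarrow> bool" where
  "is_weighted_colimit V C M T W X L \<omega> \<longleftrightarrow> (\<exists>P \<pi> Q \<kappa> s t q.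
     is_coproduct M (VOb C \<times> VOb C) (coend_source C V T W X) P \<pi>
     \<and> is_coproduct M (VOb C) (coend_target T W X) Q \<kappa>
     \<and> s \<in> hom M P Q
     \<and> (\<forall>c0\<in>VOb C. \<forall>c1\<in>VOb C. s \<cdot>\<^bsub>M\<^esub> \<pi> (c0, c1) = \<kappa> c0 \<cdot>\<^bsub>M\<^esub> coend_left M T W X (c0, c1))
     \<and> t \<in> hom M P Q
     \<and> (\<forall>c0\<in>VOb C. \<forall>c1\<in>VOb C. t \<cdot>\<^bsub>M\<^esub> \<pi> (c0, c1) = \<kappa> c1 \<cdot>\<^bsub>M\<^esub> coend_right V C M T W X (c0, c1))
     \<and> is_coequalizer M s t q \<and> Cod M q = L
     \<and> (\<forall>c\<in>VOb C. \<omega> c = q \<cdot>\<^bsub>M\<^esub> \<kappa> c))"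

definition wcolim_domain :: "('v, 'w, 'z) moncat_scheme \<Rightarrow> ('c, 'v, 'w) vcat
    \<Rightarrow> ('o, 'a, 'y) cat_scheme \<Rightarrow> ('v, 'w, 'o, 'a) act \<Rightarrow> ('c, 'v, 'w) diagram
    \<Rightarrow> ('c, 'o, 'a) diagram set" where
  "wcolim_domain V C M T W =
     {X. is_diagram V C M T X \<and> (\<exists>L \<omega>. is_weighted_colimit V C M T W X L \<omega>)}"

text \<open>
  \<open>F\<close> is the partially defined functor \<open>W \<otimes>\<^sub>C -\<close>, for the choice \<open>\<omega>\<close> of coend cocones on the
  diagrams for which the coend exists; on maps it is determined by naturality of \<open>\<omega>\<close>.
\<close>

definition is_weighted_colimit_functor :: "('v, 'w, 'z) moncat_scheme \<Rightarrow> ('c, 'v, 'w) vcat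
    \<Rightarrow> ('o, 'a, 'y) cat_scheme \<Rightarrow> ('v, 'w, 'o, 'a) act \<Rightarrow> ('c, 'v, 'w) diagram
    \<Rightarrow> (('c, 'o, 'a) diagram, ('c, 'o, 'a) diagram_map, 'o, 'a) funct
    \<Rightarrow> (('c, 'o, 'a) diagram \<Rightarrow> 'c \<Rightarrow> 'a) \<Rightarrow> bool" where
  "is_weighted_colimit_functor V C M T W F \<omega> \<longleftrightarrow>
     is_functor (full_subcat (diagram_cat V C M T) (wcolim_domain V C M T W)) M F
     \<and> (\<forall>X\<in>wcolim_domain V C M T W. is_weighted_colimit V C M T W X (FOb F X) (\<omega> X))
     \<and> (\<forall>X\<in>wcolim_domain V C M T W. \<forall>Y\<in>wcolim_domain V C M T W. \<forall>\<tau>.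
          is_diagram_map V C M T (X, Y, \<tau>) \<longrightarrow>
          (\<forall>c\<in>VOb C. FAr F (X, Y, \<tau>) \<cdot>\<^bsub>M\<^esub> \<omega> X c
             = \<omega> Y c \<cdot>\<^bsub>M\<^esub> AAr T (Idn V (DOb W c)) (\<tau> c)))"

end

(* Instead of constructing W \<otimes>_C X for the diagrams X occurring in a cell complex, consider the maps
   f : X -> Y such that every W-cocone from X to a good object m extends universally to a W-cocone from
   Y to some m', with m -> m' a cofibration. For free maps C(c,-) \<otimes> i the universal extension is a
   pushout of Wc \<otimes> i, and the class is closed under cobase change and transfinite composition. Taking X
   and m initial yields the existence of W \<otimes>_C Y and the preservation of (trivial) cofibrations.

   For a pointwise weak equivalence f between cofibrant diagrams there is no retract argument, but
   cofibrations lift against pointwise weak equivalences after composing with a cell complex of trivial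
   cofibrations. Hence, up to maps known to be sent to weak equivalences, f is a retraction p with a
   section s, s is a retraction q with a section t, and q t = id and t q are both sent to weak
   equivalences. This forces the image of q to be one, by a telescope of cofibrations. *)

theory Submission
  imports Defs
begin

unbundle cardinal_syntax

section \<open>Small sets and their cardinal arithmetic\<close>

section \<open>Small sets\<close>

text \<open>A coend is a coequalizer, and the axioms on \<open>M\<close> provide none: what they
  provide are coproducts of good objects, pushouts of cofibrations and transfinite composites of
  cofibrations. Hence \<open>W \<otimes>\<^sub>C X\<close> has to be produced cell by cell.

  The usual passage from trivial cofibrations to weak equivalences (Ken Brown's lemma) does not
  suffice. It leads to projective cofibrations that are pointwise weak equivalences, and these are
  not known to be cell complexes on trivial cofibrations of \<open>M\<close>, whose images are the
  only ones under control. Nor is a factorization of maps of diagrams at hand. A lifting step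
  therefore attaches just the one trivial cell that a lifting problem asks for, found by a
  factorization in \<open>M\<close> at a single object of \<open>C\<close>.

  Weak equivalences of \<open>M\<close> satisfy 2-out-of-3, but closure under retracts or 2-out-of-6
  is not assumed. A map inverted on both sides up to weak equivalence is thus not formally a weak
  equivalence; closure of trivial cofibrations under countable composites supplies this.

  Cofibrations and trivial cofibrations are treated at once, with a left closed class
  \<open>S\<close> as a parameter.\<close>

lemma universe_infinite: "universe (U :: 's itself) \<Longrightarrow> infinite (UNIV :: 's set)"
  unfolding universe_def using countable_finite by blast

lemma small_subset: "small U B \<Longrightarrow> A \<subseteq> B \<Longrightarrow> small U A"
  unfolding small_def using card_of_mono1 ordLeq_ordLess_trans by blast

lemma small_image: "small U A \<Longrightarrow> small U (f ` A)"
  unfolding small_def using card_of_image ordLeq_ordLess_trans by blast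

lemma small_finite:
  fixes U :: "'s itself"
  assumes "universe U" "finite A" shows "small U A"
  unfolding small_def
  by (rule finite_ordLess_infinite[OF card_of_Well_order card_of_Well_order])
    (use assms universe_infinite[OF assms(1)] in \<open>auto simp: Field_card_of\<close>)

lemma small_Un:
  fixes U :: "'s itself"
  assumes "universe U" "small U A" "small U B" shows "small U (A \<union> B)"
  using assms universe_infinite[OF assms(1)] unfolding small_def
  by (metis card_of_Un_ordLess_infinite)

lemma small_Times:
  fixes U :: "'s itself"
  assumes "universe U" "small U A" "small U B" shows "small U (A \<times> B)"
proof -
  \<comment> \<open>Reduction to a square: \<open>A \<times> B\<close> lies in an image of
    \<open>E \<times> E\<close>, and squaring an infinite set does not change its
    cardinality.\<close>
  define E where "E = (Inl ` A \<union> Inr ` B)"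
  have E: "small U E" unfolding E_def by (intro small_Un assms small_image)
  have "small U (E \<times> E)"
  proof (cases "finite E")
    case True then show ?thesis by (intro small_finite[OF assms(1)]) auto
  next
    case False
    from card_of_Times_same_infinite[OF this] E show ?thesis
      unfolding small_def using ordIso_ordLess_trans by blast
  qed
  moreover have "A \<times> B \<subseteq> (\<lambda>(x, y). (projl x, projr y)) ` (E \<times> E)"
    by (force simp: E_def)
  ultimately show ?thesis using small_subset small_image by metis
qed

lemma small_inj:
  fixes U :: "'s itself"
  assumes "small U A" shows "\<exists>f :: 'x \<Rightarrow> 's. inj_on f A"
  using assms unfolding small_def by (meson card_of_ordLeq ordLess_imp_ordLeq)

text \<open>Provides the new top element of an index set in \<open>coproduct_in_closure\<close>: a
  set of smaller cardinality than the type cannot exhaust it.\<close>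

lemma small_fresh:
  fixes U :: "'s itself" and A :: "'s set"
  assumes "small U A" shows "\<exists>t. t \<notin> A"
  using assms unfolding small_def by (metis UNIV_eq_I ordLess_irreflexive)

text \<open>The uncountability of the universe enters here. It makes sequences indexed by the
  natural numbers admissible as transfinite sequences.\<close>

lemma small_countable:
  fixes U :: "'s itself"
  assumes "universe U" "countable A" shows "small U A"
proof -
  have "\<not> |UNIV :: 's set| \<le>o |A|"
  proof
    assume "|UNIV :: 's set| \<le>o |A|"
    then obtain f where "inj f" "f ` (UNIV :: 's set) \<subseteq> A" unfolding card_of_ordLeq[symmetric] by blast
    then have "countable (UNIV :: 's set)" using assms(2) by (meson countable_image_inj_on countable_subset)
    then show False using assms(1) by (simp add: universe_def)
  qed
  then show ?thesis
    unfolding small_def using not_ordLeq_iff_ordLess[OF card_of_Well_order card_of_Well_order] by blast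
qed

section \<open>Categories and colimits through their universal properties\<close>

section \<open>Categories\<close>

lemma ex1_eqI: "\<lbrakk>\<exists>!x. P x; P a; P b\<rbrakk> \<Longrightarrow> a = b"
  by blast

lemma hom_iff: "f \<in> hom A x y \<longleftrightarrow> f \<in> Ar A \<and> Dom A f = x \<and> Cod A f = y"
  by (auto simp: hom_def)

context category
begin

lemma comp_Ar [simp]: "\<lbrakk>f \<in> Ar A; g \<in> Ar A; Dom A g = Cod A f\<rbrakk> \<Longrightarrow> g \<cdot> f \<in> Ar A"
  and Dom_comp [simp]: "\<lbrakk>f \<in> Ar A; g \<in> Ar A; Dom A g = Cod A f\<rbrakk> \<Longrightarrow> Dom A (g \<cdot> f) = Dom A f"
  and Cod_comp [simp]: "\<lbrakk>f \<in> Ar A; g \<in> Ar A; Dom A g = Cod A f\<rbrakk> \<Longrightarrow> Cod A (g \<cdot> f) = Cod A g"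
  using Comp_in[of f "Dom A f" "Cod A f" g "Cod A g"] by (auto simp: hom_iff)

lemma comp_assoc [simp]: "\<lbrakk>f \<in> Ar A; g \<in> Ar A; h \<in> Ar A; Dom A g = Cod A f; Dom A h = Cod A g\<rbrakk>
  \<Longrightarrow> h \<cdot> g \<cdot> f = h \<cdot> (g \<cdot> f)"
  using Comp_assoc[of f "Dom A f" "Cod A f" g "Cod A g" h "Cod A h"] by (auto simp: hom_iff)

lemma Idn_Ar [simp]: "x \<in> Ob A \<Longrightarrow> Idn A x \<in> Ar A"
  and Dom_Idn [simp]: "x \<in> Ob A \<Longrightarrow> Dom A (Idn A x) = x"
  and Cod_Idn [simp]: "x \<in> Ob A \<Longrightarrow> Cod A (Idn A x) = x"
  using Idn_in[of x] by (auto simp: hom_iff)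

lemma comp_Idn_left [simp]: "\<lbrakk>f \<in> Ar A; Cod A f = y\<rbrakk> \<Longrightarrow> Idn A y \<cdot> f = f"
  and comp_Idn_right [simp]: "\<lbrakk>f \<in> Ar A; Dom A f = x\<rbrakk> \<Longrightarrow> f \<cdot> Idn A x = f"
  using Comp_Idn_left[of f x y] Comp_Idn_left[of f "Dom A f" y] Comp_Idn_right[of f x "Cod A f"]
  by (auto simp: hom_iff)

declare Dom_in [simp] Cod_in [simp]

text \<open>Simplification associates composites to the right, so \<open>g \<cdot> f\<close> is no
  longer a subterm of \<open>g \<cdot> (f \<cdot> h)\<close>. This allows an equation for
  \<open>g \<cdot> f\<close> to be used there all the same.\<close>

lemma comp_cong_left:
  assumes "g \<cdot> f = k" "f \<in> Ar A" "g \<in> Ar A" "Dom A g = Cod A f" "h \<in> Ar A" "Cod A h = Dom A f"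
  shows "g \<cdot> (f \<cdot> h) = k \<cdot> h"
  using assms by (metis comp_assoc)

lemma is_isoD:
  assumes "is_iso A f"
  shows "f \<in> Ar A" "inv_ar A f \<in> Ar A" "Dom A (inv_ar A f) = Cod A f" "Cod A (inv_ar A f) = Dom A f"
    "inv_ar A f \<cdot> f = Idn A (Dom A f)" "f \<cdot> inv_ar A f = Idn A (Cod A f)"
proof -
  obtain g where g: "inverse_arrows A f g" using assms by (auto simp: is_iso_def)
  \<comment> \<open>Uniqueness of inverses, so that the definite description in
    \<open>inv_ar\<close> denotes \<open>g\<close>.\<close>
  have "h = g" if "inverse_arrows A f h" for h
  proof -
    have fg: "f \<in> Ar A" "g \<in> Ar A" "h \<in> Ar A" "Dom A g = Cod A f" "Dom A h = Cod A f"
        "Cod A g = Dom A f" "Cod A h = Dom A f"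
        "f \<cdot> g = Idn A (Cod A f)" "h \<cdot> f = Idn A (Dom A f)"
      using g that by (auto simp: inverse_arrows_def hom_iff)
    then have "h = h \<cdot> (f \<cdot> g)" by simp
    also have "\<dots> = h \<cdot> f \<cdot> g" by (rule comp_assoc[symmetric]) (use fg in auto)
    also have "\<dots> = g" using fg by (simp del: comp_assoc)
    finally show ?thesis .
  qed
  then have "inv_ar A f = g" unfolding inv_ar_def using g by (rule the_equality[rotated])
  with g show "f \<in> Ar A" "inv_ar A f \<in> Ar A" "Dom A (inv_ar A f) = Cod A f"
    "Cod A (inv_ar A f) = Dom A f"
    "inv_ar A f \<cdot> f = Idn A (Dom A f)" "f \<cdot> inv_ar A f = Idn A (Cod A f)"
    by (auto simp: inverse_arrows_def hom_iff)
qed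

lemma is_isoI:
  assumes "f \<in> Ar A" "g \<in> Ar A" "Dom A g = Cod A f" "Cod A g = Dom A f"
    "g \<cdot> f = Idn A (Dom A f)" "f \<cdot> g = Idn A (Cod A f)"
  shows "is_iso A f"
  using assms by (auto simp: is_iso_def inverse_arrows_def hom_iff)

lemma is_iso_Idn: "x \<in> Ob A \<Longrightarrow> is_iso A (Idn A x)"
  by (rule is_isoI[of _ "Idn A x"]) auto

lemma iso_epi:
  assumes "is_iso A e" "f \<cdot> e = g \<cdot> e" "f \<in> Ar A" "g \<in> Ar A" "Dom A f = Cod A e" "Dom A g = Cod A e"
  shows "f = g"
proof -
  have "f \<cdot> e \<cdot> inv_ar A e = g \<cdot> e \<cdot> inv_ar A e" using assms(2) by simp
  then show ?thesis using assms(3-) is_isoD[OF assms(1)] by simp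
qed

lemma iso_mono:
  assumes "is_iso A e" "e \<cdot> f = e \<cdot> g" "f \<in> Ar A" "g \<in> Ar A" "Cod A f = Dom A e" "Cod A g = Dom A e"
  shows "f = g"
proof -
  note e = is_isoD[OF assms(1)]
  have "inv_ar A e \<cdot> (e \<cdot> f) = inv_ar A e \<cdot> (e \<cdot> g)" using assms(2) by simp
  then show ?thesis using assms(3-) e by (simp add: comp_cong_left[OF e(5)])
qed

lemma colimit_eqI:
  assumes "is_colimit J A F L \<iota>" "is_functor J A F" "f \<in> hom A L n" "g \<in> hom A L n"
    "\<And>j. j \<in> Ob J \<Longrightarrow> f \<cdot> \<iota> j = g \<cdot> \<iota> j"
  shows "f = g"
proof -
  have c: "is_cocone J A F L \<iota>" using assms(1) by (simp add: is_colimit_def)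
  have J: "category J" using assms(2) by (simp add: is_functor_def)
  have FA: "FAr F u \<in> hom A (FOb F (Dom J u)) (FOb F (Cod J u))" if "u \<in> Ar J" for u
    using assms(2) that by (simp add: is_functor_def)
  have "is_cocone J A F n (\<lambda>j. f \<cdot> \<iota> j)"
    using c FA assms(3) J category.Dom_in[OF J] category.Cod_in[OF J]
    by (auto simp: is_cocone_def hom_iff)
  then have "\<exists>!h. h \<in> hom A L n \<and> (\<forall>j\<in>Ob J. h \<cdot> \<iota> j = f \<cdot> \<iota> j)"
    using assms(1) by (simp add: is_colimit_def)
  from this show ?thesis by (rule ex1_eqI) (use assms(3,4,5) in simp_all)
qed

lemma colimit_map:
  assumes "is_colimit J A F L \<iota>" "is_cocone J A F n \<tau>"
  obtains h where "h \<in> hom A L n" "\<And>j. j \<in> Ob J \<Longrightarrow> h \<cdot> \<iota> j = \<tau> j"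
  using assms unfolding is_colimit_def by blast

lemma is_colimitI:
  assumes "is_cocone J A F L \<iota>"
    "\<And>n \<tau>. is_cocone J A F n \<tau> \<Longrightarrow> \<exists>h. h \<in> hom A L n \<and> (\<forall>j\<in>Ob J. h \<cdot> \<iota> j = \<tau> j)"
    "\<And>n f g. \<lbrakk>f \<in> hom A L n; g \<in> hom A L n; \<forall>j\<in>Ob J. f \<cdot> \<iota> j = g \<cdot> \<iota> j\<rbrakk> \<Longrightarrow> f = g"
  shows "is_colimit J A F L \<iota>"
  unfolding is_colimit_def
proof (intro conjI allI impI)
  fix n \<tau> assume n: "is_cocone J A F n \<tau>"
  from assms(2)[OF this] obtain h where h: "h \<in> hom A L n" "\<forall>j\<in>Ob J. h \<cdot> \<iota> j = \<tau> j" by blast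
  then show "\<exists>!h. h \<in> hom A L n \<and> (\<forall>j\<in>Ob J. h \<cdot> \<iota> j = \<tau> j)"
    using assms(3)[of _ n] by (intro ex1I[of _ h]) auto
qed (fact assms)

lemma colimit_iso:
  assumes "is_colimit J A F L \<iota>" "is_colimit J A F L' \<iota>'" "is_functor J A F"
  obtains u where "is_iso A u" "u \<in> hom A L L'" "\<And>j. j \<in> Ob J \<Longrightarrow> u \<cdot> \<iota> j = \<iota>' j"
proof -
  have c: "is_cocone J A F L \<iota>" and c': "is_cocone J A F L' \<iota>'"
    using assms by (auto simp: is_colimit_def)
  obtain u where u: "u \<in> hom A L L'" "\<And>j. j \<in> Ob J \<Longrightarrow> u \<cdot> \<iota> j = \<iota>' j"
    using colimit_map[OF assms(1) c'] by blast
  obtain v where v: "v \<in> hom A L' L" "\<And>j. j \<in> Ob J \<Longrightarrow> v \<cdot> \<iota>' j = \<iota> j"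
    using colimit_map[OF assms(2) c] by blast
  have j: "\<iota> j \<in> hom A (FOb F j) L" "\<iota>' j \<in> hom A (FOb F j) L'" if "j \<in> Ob J" for j
    using c c' that by (auto simp: is_cocone_def)
  have L: "L \<in> Ob A" "L' \<in> Ob A" using c c' by (auto simp: is_cocone_def)
  have "v \<cdot> u = Idn A L"
    by (rule colimit_eqI[OF assms(1,3), of _ L]) (use u v j L in \<open>auto simp: hom_iff\<close>)
  moreover have "u \<cdot> v = Idn A L'"
    by (rule colimit_eqI[OF assms(2,3), of _ L']) (use u v j L in \<open>auto simp: hom_iff\<close>)
  ultimately have "is_iso A u" using u v by (intro is_isoI[of u v]) (auto simp: hom_iff)
  with u that show thesis by blast
qed

text \<open>Functors and cocones are total functions with arbitrary values outside the index
  category; agreement on it is all that a colimit sees.\<close>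

lemma colimit_cong:
  assumes "is_colimit J A F L \<iota>" "\<And>j. j \<in> Ob J \<Longrightarrow> FOb G j = FOb F j"
    "\<And>u. u \<in> Ar J \<Longrightarrow> FAr G u = FAr F u" "\<And>j. j \<in> Ob J \<Longrightarrow> \<kappa> j = \<iota> j" "category J"
  shows "is_colimit J A G L \<kappa>"
proof -
  note J = category.Dom_in[OF assms(5)] category.Cod_in[OF assms(5)]
  have "is_cocone J A G n \<tau> \<longleftrightarrow> is_cocone J A F n \<tau>" for n \<tau>
    using assms(2,3) by (auto simp: is_cocone_def)
  moreover have "is_cocone J A F n \<kappa> \<longleftrightarrow> is_cocone J A F n \<iota>" for n
    using assms(4) J by (auto simp: is_cocone_def)
  ultimately show ?thesis using assms(1,4) unfolding is_colimit_def by (auto cong: conj_cong)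
qed

lemma colimit_iso_transfer:
  assumes "is_colimit J A F L \<iota>" "is_functor J A F" "is_iso A u" "u \<in> hom A L L'"
  shows "is_colimit J A F L' (\<lambda>j. u \<cdot> \<iota> j)"
proof (rule is_colimitI)
  note u = is_isoD[OF assms(3)]
  have u': "u \<in> Ar A" "Dom A u = L" "Cod A u = L'" using assms(4) by (auto simp: hom_iff)
  have c: "L \<in> Ob A" "\<And>j. j \<in> Ob J \<Longrightarrow> \<iota> j \<in> hom A (FOb F j) L"
      "\<And>a. a \<in> Ar J \<Longrightarrow> \<iota> (Cod J a) \<cdot> FAr F a = \<iota> (Dom J a)"
    using assms(1) by (auto simp: is_colimit_def is_cocone_def)
  have J: "category J" "\<And>a. a \<in> Ar J \<Longrightarrow> FAr F a \<in> hom A (FOb F (Dom J a)) (FOb F (Cod J a))"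
    using assms(2) by (auto simp: is_functor_def)
  note J' = category.Dom_in[OF J(1)] category.Cod_in[OF J(1)]
  show "is_cocone J A F L' (\<lambda>j. u \<cdot> \<iota> j)"
    unfolding is_cocone_def
    using c u' J(2) J' Cod_in[OF u'(1)] by (auto simp: hom_iff)
  show "\<exists>h. h \<in> hom A L' n \<and> (\<forall>j\<in>Ob J. h \<cdot> (u \<cdot> \<iota> j) = \<tau> j)" if n: "is_cocone J A F n \<tau>" for n \<tau>
  proof -
    obtain h where h: "h \<in> hom A L n" "\<And>j. j \<in> Ob J \<Longrightarrow> h \<cdot> \<iota> j = \<tau> j"
      using colimit_map[OF assms(1) n] by blast
    have "(h \<cdot> inv_ar A u) \<cdot> (u \<cdot> \<iota> j) = \<tau> j" if "j \<in> Ob J" for j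
      using h c(2)[OF that] u u' comp_cong_left[OF u(5)] that by (auto simp: hom_iff)
    moreover have "h \<cdot> inv_ar A u \<in> hom A L' n" using h u u' by (auto simp: hom_iff)
    ultimately show ?thesis by blast
  qed
  show "f = g" if "f \<in> hom A L' n" "g \<in> hom A L' n" "\<forall>j\<in>Ob J. f \<cdot> (u \<cdot> \<iota> j) = g \<cdot> (u \<cdot> \<iota> j)" for n f g
  proof -
    have fg: "f \<in> Ar A" "Dom A f = L'" "Cod A f = n" "g \<in> Ar A" "Dom A g = L'" "Cod A g = n"
      using that(1,2) by (auto simp: hom_iff)
    have "f \<cdot> u = g \<cdot> u"
    proof (rule colimit_eqI[OF assms(1,2), of _ n])
      fix j assume j: "j \<in> Ob J"
      show "f \<cdot> u \<cdot> \<iota> j = g \<cdot> u \<cdot> \<iota> j"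
        using that(3) j c(2)[OF j] fg u' by (simp add: hom_iff)
    qed (use fg u' in \<open>simp_all add: hom_iff\<close>)
    then show ?thesis by (rule iso_epi[OF assms(3)]) (use fg u' in simp_all)
  qed
qed

lemma coproduct_ex1:
  assumes "is_coproduct A I X S \<iota>" "n \<in> Ob A" "\<forall>i\<in>I. \<tau> i \<in> hom A (X i) n"
  shows "\<exists>!h. h \<in> hom A S n \<and> (\<forall>i\<in>I. h \<cdot> \<iota> i = \<tau> i)"
  by (rule assms(1)[unfolded is_coproduct_def, THEN conjunct2, THEN conjunct2,
        THEN spec[of _ n], THEN spec[of _ \<tau>], THEN mp]) (use assms(2,3) in simp)

lemma coproduct_eqI:
  assumes "is_coproduct A I X S \<iota>" "f \<in> hom A S n" "g \<in> hom A S n"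
    "\<And>i. i \<in> I \<Longrightarrow> f \<cdot> \<iota> i = g \<cdot> \<iota> i"
  shows "f = g"
proof -
  have "n \<in> Ob A" "\<forall>i\<in>I. f \<cdot> \<iota> i \<in> hom A (X i) n"
    using assms(1,2) by (auto simp: is_coproduct_def hom_iff)
  show ?thesis
    by (rule ex1_eqI[OF coproduct_ex1[OF assms(1) \<open>n \<in> Ob A\<close> \<open>\<forall>i\<in>I. f \<cdot> \<iota> i \<in> hom A (X i) n\<close>]])
      (use assms(2-4) in auto)
qed

lemma coproduct_map:
  assumes "is_coproduct A I X S \<iota>" "n \<in> Ob A" "\<And>i. i \<in> I \<Longrightarrow> \<tau> i \<in> hom A (X i) n"
  obtains h where "h \<in> hom A S n" "\<And>i. i \<in> I \<Longrightarrow> h \<cdot> \<iota> i = \<tau> i"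
proof -
  from ex1_implies_ex[OF coproduct_ex1[OF assms(1,2)], of \<tau>] assms(3) that show thesis by auto
qed

lemma is_coproductI:
  assumes "S \<in> Ob A" "\<And>i. i \<in> I \<Longrightarrow> \<iota> i \<in> hom A (X i) S"
    "\<And>n \<tau>. \<lbrakk>n \<in> Ob A; \<forall>i\<in>I. \<tau> i \<in> hom A (X i) n\<rbrakk> \<Longrightarrow> \<exists>h. h \<in> hom A S n \<and> (\<forall>i\<in>I. h \<cdot> \<iota> i = \<tau> i)"
    "\<And>n f g. \<lbrakk>f \<in> hom A S n; g \<in> hom A S n; \<forall>i\<in>I. f \<cdot> \<iota> i = g \<cdot> \<iota> i\<rbrakk> \<Longrightarrow> f = g"
  shows "is_coproduct A I X S \<iota>"
  unfolding is_coproduct_def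
proof (intro conjI allI impI ballI)
  fix n \<tau> assume n: "n \<in> Ob A \<and> (\<forall>i\<in>I. \<tau> i \<in> hom A (X i) n)"
  then obtain h where h: "h \<in> hom A S n" "\<forall>i\<in>I. h \<cdot> \<iota> i = \<tau> i" using assms(3) by blast
  then show "\<exists>!h. h \<in> hom A S n \<and> (\<forall>i\<in>I. h \<cdot> \<iota> i = \<tau> i)"
    using assms(4)[of _ n] by (intro ex1I[of _ h]) auto
qed (use assms in auto)

lemma pushoutD:
  assumes "is_pushout A f g p q"
  shows "f \<in> Ar A" "g \<in> Ar A" "Dom A f = Dom A g" "p \<in> Ar A" "q \<in> Ar A" "Dom A p = Cod A f"
    "Dom A q = Cod A g" "Cod A p = Cod A q" "p \<cdot> f = q \<cdot> g"
  using assms by (auto simp: is_pushout_def pushout_cocone_def)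

lemma pushout_map:
  assumes "is_pushout A f g p q" "p' \<in> hom A (Cod A f) n" "q' \<in> hom A (Cod A g) n" "p' \<cdot> f = q' \<cdot> g"
  obtains h where "h \<in> hom A (Cod A p) n" "h \<cdot> p = p'" "h \<cdot> q = q'"
proof -
  have "pushout_cocone A f g p' q'"
    using assms pushoutD[OF assms(1)] by (simp add: pushout_cocone_def hom_iff)
  then show thesis using assms(1,2) that unfolding is_pushout_def hom_iff by blast
qed

lemma pushout_eqI:
  assumes "is_pushout A f g p q" "h \<in> hom A (Cod A p) n" "h' \<in> hom A (Cod A p) n"
    "h \<cdot> p = h' \<cdot> p" "h \<cdot> q = h' \<cdot> q"
  shows "h = h'"
proof -
  note P = pushoutD[OF assms(1)]
  have "pushout_cocone A f g (h \<cdot> p) (h \<cdot> q)"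
    using P assms(2) by (auto simp: pushout_cocone_def hom_iff)
  then have "\<exists>!k. k \<in> hom A (Cod A p) (Cod A (h \<cdot> p)) \<and> k \<cdot> p = h \<cdot> p \<and> k \<cdot> q = h \<cdot> q"
    using assms(1) by (auto simp: is_pushout_def)
  moreover have "Cod A (h \<cdot> p) = n" using P assms(2) by (auto simp: hom_iff)
  ultimately have "\<exists>!k. k \<in> hom A (Cod A p) n \<and> k \<cdot> p = h \<cdot> p \<and> k \<cdot> q = h \<cdot> q" by simp
  from this show ?thesis by (rule ex1_eqI) (use assms(2-5) in simp_all)
qed

lemma is_pushoutI:
  assumes "pushout_cocone A f g p q"
    "\<And>n p' q'. \<lbrakk>p' \<in> hom A (Cod A f) n; q' \<in> hom A (Cod A g) n; p' \<cdot> f = q' \<cdot> g\<rbrakk>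
       \<Longrightarrow> \<exists>h. h \<in> hom A (Cod A p) n \<and> h \<cdot> p = p' \<and> h \<cdot> q = q'"
    "\<And>n h h'. \<lbrakk>h \<in> hom A (Cod A p) n; h' \<in> hom A (Cod A p) n; h \<cdot> p = h' \<cdot> p; h \<cdot> q = h' \<cdot> q\<rbrakk> \<Longrightarrow> h = h'"
  shows "is_pushout A f g p q"
  unfolding is_pushout_def
proof (intro conjI allI impI)
  fix p' q' assume c: "pushout_cocone A f g p' q'"
  then have "\<exists>h. h \<in> hom A (Cod A p) (Cod A p') \<and> h \<cdot> p = p' \<and> h \<cdot> q = q'"
    by (intro assms(2)) (auto simp: pushout_cocone_def hom_iff)
  then obtain h where h: "h \<in> hom A (Cod A p) (Cod A p')" "h \<cdot> p = p'" "h \<cdot> q = q'" by blast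
  then show "\<exists>!h. h \<in> hom A (Cod A p) (Cod A p') \<and> h \<cdot> p = p' \<and> h \<cdot> q = q'"
    using assms(3)[of _ "Cod A p'"] by (intro ex1I[of _ h]) auto
qed (fact assms)

end

lemma ord_cat_simps [simp]:
  "Ob (ord_cat r K) = K" "Ar (ord_cat r K) = {(j, k). j \<in> K \<and> k \<in> K \<and> (j, k) \<in> r}"
  "Dom (ord_cat r K) = fst" "Cod (ord_cat r K) = snd" "Idn (ord_cat r K) = (\<lambda>j. (j, j))"
  "Comp (ord_cat r K) = (\<lambda>v u. (fst u, snd v))"
  by (auto simp: ord_cat_def)

lemma category_ord_cat:
  assumes "\<And>j. j \<in> K \<Longrightarrow> (j, j) \<in> r" "trans r" shows "category (ord_cat r K)"
  using assms by unfold_locales (auto simp: hom_iff dest: transD)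

lemma small_category_ord_cat:
  fixes U :: "'s itself"
  assumes "universe U" "\<And>j. j \<in> K \<Longrightarrow> (j, j) \<in> r" "trans r" "small U K"
  shows "small_category U (ord_cat r K)"
  using assms small_subset[OF small_Times[OF assms(1,4,4)], of "Ar (ord_cat r K)"]
  by (auto simp: small_category_def intro: category_ord_cat)

text \<open>The constraint on types in \<^const>\<open>preserves_colimits\<close> is harmless, as every small category
  is isomorphic to one living on subsets of \<^typ>\<open>'s\<close>.\<close>

lemma preserves_colimits_small:
  fixes U :: "'s itself" and J :: "('j, 'k, 'y) cat_scheme"
    and A :: "('o, 'a, 'z) cat_scheme" and B :: "('p, 'b, 'x) cat_scheme"
  assumes P: "preserves_colimits U A B F" and J: "small_category U J"
    and D: "is_functor J A D" and L: "is_colimit J A D L \<iota>" and A: "category A" and B: "category B"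
  shows "is_colimit J B (funct_comp F D) (FOb F L) (\<lambda>j. FAr F (\<iota> j))"
proof -
  interpret J: category J using J by (simp add: small_category_def)
  obtain f :: "'j \<Rightarrow> 's" where f: "inj_on f (Ob J)"
    using J small_inj[of U "Ob J"] by (auto simp: small_category_def)
  obtain g :: "'k \<Rightarrow> 's" where g: "inj_on g (Ar J)"
    using J small_inj[of U "Ar J"] by (auto simp: small_category_def)
  define f' where "f' = inv_into (Ob J) f"
  define g' where "g' = inv_into (Ar J) g"
  have f'[simp]: "f' (f x) = x" if "x \<in> Ob J" for x using f that by (simp add: f'_def)
  have g'[simp]: "g' (g x) = x" if "x \<in> Ar J" for x using g that by (simp add: g'_def)
  define J' :: "('s, 's) cat" where "J' = \<lparr>Ob = f ` Ob J, Ar = g ` Ar J, Dom = \<lambda>a. f (Dom J (g' a)),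
    Cod = \<lambda>a. f (Cod J (g' a)), Idn = \<lambda>x. g (Idn J (f' x)), Comp = \<lambda>b a. g (Comp J (g' b) (g' a))\<rparr>"
  have J'[simp]: "Ob J' = f ` Ob J" "Ar J' = g ` Ar J" "Dom J' = (\<lambda>a. f (Dom J (g' a)))"
    "Cod J' = (\<lambda>a. f (Cod J (g' a)))" "Idn J' = (\<lambda>x. g (Idn J (f' x)))"
    "Comp J' = (\<lambda>b a. g (Comp J (g' b) (g' a)))" by (auto simp: J'_def)
  have feq[simp]: "f x = f y \<longleftrightarrow> x = y" if "x \<in> Ob J" "y \<in> Ob J" for x y
    using f that by (auto dest: inj_onD)
  have catJ': "category J'"
    by unfold_locales (auto simp: hom_iff)
  have "small_category U J'"
    using J catJ' by (auto simp: small_category_def intro: small_image)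
  \<comment> \<open>\<open>tr\<close> and \<open>tr2\<close> are the same transport along
    \<open>f'\<close> and \<open>g'\<close>, for diagrams in \<open>A\<close> and in
    \<open>B\<close>: a local definition has a single type, so each target needs its own
    copy.\<close>
  define tr where "tr = (\<lambda>D :: ('j, 'k, 'o, 'a) funct. \<lparr>FOb = \<lambda>x. FOb D (f' x), FAr = \<lambda>a. FAr D (g' a)\<rparr>)"
  define tr2 where "tr2 = (\<lambda>D :: ('j, 'k, 'p, 'b) funct. \<lparr>FOb = \<lambda>x. FOb D (f' x), FAr = \<lambda>a. FAr D (g' a)\<rparr>)"
  have "is_functor J' A (tr D)"
    using D catJ' A unfolding is_functor_def tr_def by auto
  have cc: "is_cocone J' A (tr D) n \<sigma> \<longleftrightarrow> is_cocone J A D n (\<lambda>j. \<sigma> (f j))" for n \<sigma>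
    unfolding is_cocone_def tr_def by auto
  have cc': "is_cocone J A D n \<tau> \<longleftrightarrow> is_cocone J' A (tr D) n (\<lambda>j. \<tau> (f' j))" for n \<tau>
    unfolding is_cocone_def tr_def by auto
  have dd: "is_cocone J' B (tr2 E) n \<sigma> \<longleftrightarrow> is_cocone J B E n (\<lambda>j. \<sigma> (f j))" for n \<sigma> E
    unfolding is_cocone_def tr2_def by auto
  have dd': "is_cocone J B E n \<tau> \<longleftrightarrow> is_cocone J' B (tr2 E) n (\<lambda>j. \<tau> (f' j))" for n \<tau> E
    unfolding is_cocone_def tr2_def by auto
  have "is_colimit J' A (tr D) L (\<lambda>j. \<iota> (f' j))"
    using L unfolding is_colimit_def cc by (auto cong: conj_cong simp: is_cocone_def)
  then have *: "is_colimit J' B (funct_comp F (tr D)) (FOb F L) (\<lambda>j. FAr F (\<iota> (f' j)))"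
    using P \<open>small_category U J'\<close> \<open>is_functor J' A (tr D)\<close> unfolding preserves_colimits_def by blast
  have eq: "funct_comp F (tr D) = tr2 (funct_comp F D)"
    by (auto simp: funct_comp_def tr_def tr2_def)
  have **: "is_cocone J' B (tr2 (funct_comp F D)) (FOb F L) (\<lambda>j. FAr F (\<iota> (f' j)))"
    "\<And>n \<tau>. is_cocone J' B (tr2 (funct_comp F D)) n \<tau> \<Longrightarrow>
       \<exists>!h. h \<in> hom B (FOb F L) n \<and> (\<forall>j\<in>f ` Ob J. Comp B h (FAr F (\<iota> (f' j))) = \<tau> j)"
    using * unfolding eq is_colimit_def by auto
  show ?thesis
    unfolding is_colimit_def
  proof (intro conjI allI impI)
    show "is_cocone J B (funct_comp F D) (FOb F L) (\<lambda>j. FAr F (\<iota> j))"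
      using **(1) unfolding dd is_cocone_def by (auto simp: tr2_def)
    fix n \<tau> assume "is_cocone J B (funct_comp F D) n \<tau>"
    then have "is_cocone J' B (tr2 (funct_comp F D)) n (\<lambda>j. \<tau> (f' j))" using dd' by blast
    from **(2)[OF this]
    show "\<exists>!h. h \<in> hom B (FOb F L) n \<and> (\<forall>j\<in>Ob J. Comp B h (FAr F (\<iota> j)) = \<tau> j)"
      by (simp cong: ball_cong)
  qed
qed

text \<open>Turns a family into a functor on the discrete category \<open>ord_cat Id I\<close>, so
  that coproducts become colimits of functors and pointwise computation applies to them.\<close>

definition disc :: "('o, 'a, 'z) cat_scheme \<Rightarrow> ('i \<Rightarrow> 'o) \<Rightarrow> ('i, 'i \<times> 'i, 'o, 'a) funct" where
  "disc A X = \<lparr>FOb = X, FAr = \<lambda>(i, j). Idn A (X i)\<rparr>"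

text \<open>The span with apex \<open>0\<close> and feet \<open>1\<close> and \<open>2\<close>,
  encoded as a partial order so that its category is an instance of \<open>ord_cat\<close>.\<close>

definition span_ord :: "nat rel" where "span_ord = {(0,0),(1,1),(2,2),(0,1),(0,2)}"

definition span_cat :: "(nat, nat \<times> nat) cat" where "span_cat = ord_cat span_ord {0,1,2}"

definition span :: "('o, 'a, 'z) cat_scheme \<Rightarrow> 'a \<Rightarrow> 'a \<Rightarrow> (nat, nat \<times> nat, 'o, 'a) funct" where
  "span A f g = \<lparr>FOb = \<lambda>i. if i = 0 then Dom A f else if i = 1 then Cod A f else Cod A g,
     FAr = \<lambda>(i, j). if (i, j) = (0, 1) then f else if (i, j) = (0, 2) then g else
        Idn A (if i = 0 then Dom A f else if i = 1 then Cod A f else Cod A g)\<rparr>"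

definition span_cocone :: "'a \<Rightarrow> 'a \<Rightarrow> 'a \<Rightarrow> nat \<Rightarrow> 'a" where
  "span_cocone d p q = (\<lambda>i. if i = 0 then d else if i = 1 then p else q)"

lemma span_cat: "small_category U span_cat" if "universe U"
  unfolding span_cat_def
  by (rule small_category_ord_cat[OF that]) (auto simp: span_ord_def trans_def intro: small_finite[OF that])

lemma disc_cat: "small_category U (ord_cat Id I)" if "universe U" "small U I"
  by (rule small_category_ord_cat[OF that(1)]) (use that in \<open>auto simp: trans_def\<close>)

lemma span_cat_simps [simp]:
  "Ob span_cat = {0, 1, 2}" "Ar span_cat = {(0,0),(1,1),(2,2),(0,1),(0,2)}"
  "Dom span_cat = fst" "Cod span_cat = snd"
  by (auto simp: span_cat_def span_ord_def)

context category
begin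

lemma disc_functor:
  assumes "\<And>i. i \<in> I \<Longrightarrow> X i \<in> Ob A" shows "is_functor (ord_cat Id I) A (disc A X)"
  using assms category_axioms category_ord_cat[of I Id]
  by (auto simp: is_functor_def disc_def hom_iff trans_def)

lemma disc_cocone:
  "is_cocone (ord_cat Id I) A (disc A X) n \<tau> \<longleftrightarrow> n \<in> Ob A \<and> (\<forall>i\<in>I. \<tau> i \<in> hom A (X i) n)"
  by (auto simp: is_cocone_def disc_def hom_iff)

lemma coproduct_iff_colimit:
  "is_coproduct A I X S \<iota> \<longleftrightarrow> is_colimit (ord_cat Id I) A (disc A X) S \<iota>"
  unfolding is_coproduct_def is_colimit_def disc_cocone by auto

lemma span_functor:
  assumes "f \<in> Ar A" "g \<in> Ar A" "Dom A f = Dom A g" shows "is_functor span_cat A (span A f g)"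
proof -
  have "category span_cat"
    unfolding span_cat_def by (rule category_ord_cat) (auto simp: span_ord_def trans_def)
  with assms category_axioms show ?thesis
    unfolding is_functor_def by (auto simp: span_def hom_iff) (auto simp: span_cat_def)
qed

lemma span_cocone_iff:
  assumes "f \<in> Ar A" "g \<in> Ar A" "Dom A f = Dom A g"
  shows "is_cocone span_cat A (span A f g) n \<tau> \<longleftrightarrow>
    \<tau> 1 \<in> hom A (Cod A f) n \<and> \<tau> 2 \<in> hom A (Cod A g) n \<and> \<tau> 1 \<cdot> f = \<tau> 2 \<cdot> g \<and> \<tau> 0 = \<tau> 1 \<cdot> f"
proof
  assume "is_cocone span_cat A (span A f g) n \<tau>"
  then have "\<tau> 1 \<in> hom A (Cod A f) n" "\<tau> 2 \<in> hom A (Cod A g) n" "\<tau> 1 \<cdot> f = \<tau> 0" "\<tau> 2 \<cdot> g = \<tau> 0"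
    unfolding is_cocone_def by (simp_all add: span_def)
  then show "\<tau> 1 \<in> hom A (Cod A f) n \<and> \<tau> 2 \<in> hom A (Cod A g) n \<and> \<tau> 1 \<cdot> f = \<tau> 2 \<cdot> g \<and> \<tau> 0 = \<tau> 1 \<cdot> f"
    by simp
next
  assume t: "\<tau> 1 \<in> hom A (Cod A f) n \<and> \<tau> 2 \<in> hom A (Cod A g) n \<and> \<tau> 1 \<cdot> f = \<tau> 2 \<cdot> g \<and> \<tau> 0 = \<tau> 1 \<cdot> f"
  then have h: "\<tau> 1 \<in> Ar A" "Dom A (\<tau> 1) = Cod A f" "Cod A (\<tau> 1) = n"
    "\<tau> 2 \<in> Ar A" "Dom A (\<tau> 2) = Cod A g" "Cod A (\<tau> 2) = n"
    and e: "\<tau> 0 = \<tau> 1 \<cdot> f" "\<tau> 2 \<cdot> g = \<tau> 0" by (simp_all add: hom_iff)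
  have 0: "\<tau> 0 \<in> Ar A" "Dom A (\<tau> 0) = Dom A f" "Cod A (\<tau> 0) = n"
    using h assms unfolding e(1) by simp_all
  have n: "n \<in> Ob A" using h by force
  show "is_cocone span_cat A (span A f g) n \<tau>"
    unfolding is_cocone_def using h 0 e(1)[symmetric] e(2) n assms(1,2)
    by (simp add: span_def hom_iff)
qed

lemma pushout_iff_colimit:
  assumes "f \<in> Ar A" "g \<in> Ar A" "Dom A f = Dom A g" "p \<in> Ar A"
  shows "is_pushout A f g p q \<longleftrightarrow>
    is_colimit span_cat A (span A f g) (Cod A p) (span_cocone (p \<cdot> f) p q)"
proof -
  have 1: "is_cocone span_cat A (span A f g) (Cod A p) (span_cocone (p \<cdot> f) p q) \<longleftrightarrow> pushout_cocone A f g p q"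
    unfolding span_cocone_iff[OF assms(1-3)] using assms
    by (auto simp: span_cocone_def pushout_cocone_def hom_iff)
  show ?thesis
  proof
    assume P: "is_pushout A f g p q"
    note PD = pushoutD[OF P]
    show "is_colimit span_cat A (span A f g) (Cod A p) (span_cocone (p \<cdot> f) p q)"
    proof (rule is_colimitI)
      show "is_cocone span_cat A (span A f g) (Cod A p) (span_cocone (p \<cdot> f) p q)"
        using P 1 by (simp add: is_pushout_def)
      fix n \<tau> assume "is_cocone span_cat A (span A f g) n \<tau>"
      then have t: "\<tau> 1 \<in> hom A (Cod A f) n" "\<tau> 2 \<in> hom A (Cod A g) n" "\<tau> 1 \<cdot> f = \<tau> 2 \<cdot> g" "\<tau> 0 = \<tau> 1 \<cdot> f"
        using span_cocone_iff[OF assms(1-3)] by auto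
      obtain h where h: "h \<in> hom A (Cod A p) n" "h \<cdot> p = \<tau> 1" "h \<cdot> q = \<tau> 2"
        using pushout_map[OF P t(1-3)] by blast
      have "h \<cdot> (p \<cdot> f) = \<tau> 0" using h(1) t(1,4) PD(1-8) comp_cong_left[OF h(2), of f] by (simp add: hom_iff)
      with h show "\<exists>h. h \<in> hom A (Cod A p) n \<and> (\<forall>j\<in>Ob span_cat. h \<cdot> span_cocone (p \<cdot> f) p q j = \<tau> j)"
        by (intro exI[of _ h]) (auto simp: span_cocone_def)
    next
      fix n h h' assume "h \<in> hom A (Cod A p) n" "h' \<in> hom A (Cod A p) n"
        "\<forall>j\<in>Ob span_cat. h \<cdot> span_cocone (p \<cdot> f) p q j = h' \<cdot> span_cocone (p \<cdot> f) p q j"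
      then show "h = h'" by (intro pushout_eqI[OF P, of h n h']) (auto simp: span_cocone_def)
    qed
  next
    assume C: "is_colimit span_cat A (span A f g) (Cod A p) (span_cocone (p \<cdot> f) p q)"
    show "is_pushout A f g p q"
    proof (rule is_pushoutI)
      show pc: "pushout_cocone A f g p q" using 1 C by (simp add: is_colimit_def)
      fix n p' q' assume "p' \<in> hom A (Cod A f) n" "q' \<in> hom A (Cod A g) n" "p' \<cdot> f = q' \<cdot> g"
      then have "is_cocone span_cat A (span A f g) n (span_cocone (p' \<cdot> f) p' q')"
        unfolding span_cocone_iff[OF assms(1-3)] by (auto simp: span_cocone_def)
      from colimit_map[OF C this] obtain h where "h \<in> hom A (Cod A p) n"
        "\<And>j. j \<in> Ob span_cat \<Longrightarrow> h \<cdot> span_cocone (p \<cdot> f) p q j = span_cocone (p' \<cdot> f) p' q' j" by blast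
      then show "\<exists>h. h \<in> hom A (Cod A p) n \<and> h \<cdot> p = p' \<and> h \<cdot> q = q'"
        by (intro exI[of _ h]) (force simp: span_cocone_def)
    next
      fix n h h' assume h: "h \<in> hom A (Cod A p) n" "h' \<in> hom A (Cod A p) n" "h \<cdot> p = h' \<cdot> p" "h \<cdot> q = h' \<cdot> q"
      have pc: "pushout_cocone A f g p q" using 1 C by (simp add: is_colimit_def)
      have "h \<cdot> (p \<cdot> f) = h' \<cdot> (p \<cdot> f)"
        using h(1,2) pushout_cocone_def[of A f g p q] pc
          comp_cong_left[OF h(3), of f] by (simp add: hom_iff)
      with h show "h = h'"
        by (intro colimit_eqI[OF C span_functor[OF assms(1-3)] h(1,2)]) (auto simp: span_cocone_def)
    qed
  qed
qed

text \<open>Initial objects as empty coproducts: existence and goodness of an initial object then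
  come from closure under small coproducts.\<close>

lemma initial_iff_coproduct: "is_initial A Z \<longleftrightarrow> is_coproduct A {} X Z \<iota>"
  by (auto simp: is_initial_def is_coproduct_def)

end

section \<open>Well-orders, their initial segments, and transfinite sequences\<close>

section \<open>Well-orders\<close>

lemma Well_orderD:
  assumes "Well_order r"
  shows "\<And>k. k \<in> Field r \<Longrightarrow> (k, k) \<in> r" "trans r" "antisym r"
    "\<And>j k. \<lbrakk>j \<in> Field r; k \<in> Field r\<rbrakk> \<Longrightarrow> (j, k) \<in> r \<or> (k, j) \<in> r" "wf (r - Id)"
proof -
  show "(k, k) \<in> r" if "k \<in> Field r" for k
    using assms that by (auto simp: order_on_defs refl_on_def)
  then show "(j, k) \<in> r \<or> (k, j) \<in> r" if "j \<in> Field r" "k \<in> Field r" for j k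
    using assms that by (cases "j = k") (auto simp: order_on_defs total_on_def)
qed (use assms in \<open>auto simp: order_on_defs\<close>)

lemma underS_iff: "j \<in> underS r k \<longleftrightarrow> j \<noteq> k \<and> (j, k) \<in> r"
  by (auto simp: underS_def)

lemma Well_order_induct [consumes 2, case_names step]:
  assumes "Well_order r" "k \<in> Field r"
    "\<And>k. \<lbrakk>k \<in> Field r; \<And>j. j \<in> underS r k \<Longrightarrow> P j\<rbrakk> \<Longrightarrow> P k"
  shows "P k"
  using Well_orderD(5)[OF assms(1)] assms(2)
proof (induction k rule: wf_induct_rule)
  case (less k)
  show ?case
  proof (rule assms(3)[OF less.prems])
    fix j assume "j \<in> underS r k"
    then show "P j" using less.IH[of j] by (auto simp: underS_iff Field_def)
  qed
qed

lemma Well_order_cases: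
  assumes "k \<in> Field r"
  obtains (least) "is_least r k" | (succ) j where "is_succ r j k" | (limit) "is_limit r k"
  using assms by (auto simp: is_least_def is_limit_def)

lemma is_succD: "is_succ r j k \<Longrightarrow> (j, k) \<in> r" "is_succ r j k \<Longrightarrow> j \<noteq> k"
  "is_succ r j k \<Longrightarrow> j \<in> Field r" "is_succ r j k \<Longrightarrow> k \<in> Field r"
  by (auto simp: is_succ_def underS_iff Field_def)

lemma least_exists:
  assumes "Well_order r" "Field r \<noteq> {}" obtains k0 where "is_least r k0"
proof -
  obtain k where "k \<in> Field r" using assms(2) by blast
  with assms(1) have "\<exists>k0. is_least r k0"
  proof (induction rule: Well_order_induct)
    case (step k)
    then show ?case by (cases "underS r k = {}") (auto simp: is_least_def)
  qed
  then show thesis using that by blast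
qed

lemma least_le:
  assumes "Well_order r" "is_least r k0" "k \<in> Field r" shows "(k0, k) \<in> r"
  using Well_orderD(4)[OF assms(1), of k0 k] assms(2,3) Well_orderD(1)[OF assms(1), of k0]
  by (cases "k = k0") (auto simp: is_least_def underS_iff)

lemma least_in: "is_least r k0 \<Longrightarrow> k0 \<in> Field r"
  by (simp add: is_least_def)

lemma least_unique:
  assumes "Well_order r" "is_least r k" "is_least r k'" shows "k = k'"
  using least_le[OF assms(1,2)] least_le[OF assms(1,3)] assms Well_orderD(3)
  by (meson antisymD least_in)

text \<open>Otherwise \<open>j\<close> would be an immediate predecessor of the limit
  \<open>k\<close>.\<close>

lemma limit_ex:
  assumes "Well_order r" "is_limit r k" "j \<in> underS r k"
  obtains l where "l \<in> underS r k" "j \<in> underS r l"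
proof -
  obtain i where i: "i \<in> underS r k" "(i, j) \<notin> r"
    using assms(2,3) by (auto simp: is_limit_def is_succ_def)
  have "i \<in> Field r" "j \<in> Field r" using i assms(3) by (auto simp: underS_iff Field_def)
  then have "j \<in> underS r i"
    using i(2) Well_orderD(1,4)[OF assms(1)] by (auto simp: underS_iff)
  with i(1) that show thesis by blast
qed

lemma under_trans:
  assumes "Well_order r" "(i, j) \<in> r" "j \<in> underS r k" shows "i \<in> underS r k"
  using assms Well_orderD(2,3)[OF assms(1)] unfolding underS_iff
  by (metis antisymD transD)

lemma underS_Field: "j \<in> underS r k \<Longrightarrow> j \<in> Field r"
  by (auto simp: underS_iff Field_def)

lemma least_not_succ:
  assumes "is_least r k" "is_succ r j k" shows False
  using assms by (auto simp: is_least_def is_succ_def)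

lemma least_under: 
  assumes "Well_order r" "is_least r k0" "k \<in> Field r" "underS r k \<noteq> {}" shows "k0 \<in> underS r k"
  using assms least_le[OF assms(1-3)] by (auto simp: underS_iff is_least_def)

lemma succ_underS:
  assumes "Well_order r" "is_succ r j k"
  shows "i \<in> underS r k \<longleftrightarrow> (i, j) \<in> r"
  using assms under_trans[OF assms(1)] by (auto simp: is_succ_def)

text \<open>Makes the stages below \<open>k\<close> a well-order in its own right. Statements on the
  colimit of a complete sequence thereby apply at a limit stage \<open>k\<close> of a longer
  one.\<close>

definition init_seg :: "'s rel \<Rightarrow> 's \<Rightarrow> 's rel" where
  "init_seg r k = {(i, j). (i, j) \<in> r \<and> j \<in> underS r k}"

context
  fixes r :: "'s rel" and k
  assumes r: "Well_order r" and k: "k \<in> Field r"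
begin

lemma init_seg_iff: "(i, j) \<in> init_seg r k \<longleftrightarrow> i \<in> underS r k \<and> j \<in> underS r k \<and> (i, j) \<in> r"
  using under_trans[OF r] by (auto simp: init_seg_def)

lemma Field_init_seg: "Field (init_seg r k) = underS r k"
  using Well_orderD(1)[OF r] underS_Field[of _ r k] by (fastforce simp: Field_def init_seg_iff)

lemma Well_order_init_seg: "Well_order (init_seg r k)"
proof -
  note R = Well_orderD[OF r]
  have "refl_on (underS r k) (init_seg r k)"
    using R(1) underS_Field[of _ r k] by (auto simp: refl_on_def init_seg_iff)
  moreover have "trans (init_seg r k)"
    using R(2) unfolding trans_def init_seg_iff by blast
  moreover have "antisym (init_seg r k)"
    using R(3) unfolding antisym_def init_seg_iff by blast
  moreover have "total_on (underS r k) (init_seg r k)"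
    using R(4) underS_Field[of _ r k] by (fastforce simp: total_on_def init_seg_iff)
  moreover have "wf (init_seg r k - Id)"
    by (rule wf_subset[OF R(5)]) (auto simp: init_seg_iff)
  moreover have "init_seg r k \<subseteq> underS r k \<times> underS r k" by (auto simp: init_seg_iff)
  ultimately show ?thesis unfolding Field_init_seg by (auto simp: order_on_defs)
qed

lemma underS_init_seg:
  assumes "j \<in> underS r k" shows "underS (init_seg r k) j = underS r j"
proof (rule set_eqI)
  fix i
  show "i \<in> underS (init_seg r k) j \<longleftrightarrow> i \<in> underS r j"
    unfolding underS_iff[of i "init_seg r k" j] underS_iff[of i r j] init_seg_iff using under_trans[OF r _ assms, of i] assms by blast
qed

lemma is_succ_init_seg: "is_succ (init_seg r k) i j \<longleftrightarrow> j \<in> underS r k \<and> is_succ r i j"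
proof (cases "j \<in> underS r k")
  case True
  show ?thesis
    unfolding is_succ_def underS_init_seg[OF True] init_seg_iff
    using under_trans[OF r _ True] True by (auto simp: underS_iff[of _ r j])
next
  case False
  then show ?thesis by (auto simp: is_succ_def underS_iff init_seg_iff)
qed

lemma is_limit_init_seg: "is_limit (init_seg r k) j \<longleftrightarrow> j \<in> underS r k \<and> is_limit r j"
  using underS_init_seg[of j] is_succ_init_seg[of _ j] Field_init_seg underS_Field[of j r k]
  by (auto simp: is_limit_def)

lemma is_least_init_seg:
  assumes "underS r k \<noteq> {}" shows "is_least (init_seg r k) j \<longleftrightarrow> is_least r j"
proof -
  have "is_least r j \<Longrightarrow> j \<in> underS r k" using least_under[OF r _ k assms] .
  then show ?thesis
    using underS_init_seg[of j] Field_init_seg underS_Field[of j r k] by (auto simp: is_least_def)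
qed

lemma ord_cat_init_seg: "K \<subseteq> underS r k \<Longrightarrow> ord_cat (init_seg r k) K = ord_cat r K"
  by (auto simp: ord_cat_def init_seg_iff)

end

lemma ord_category:
  assumes "Well_order r" "K \<subseteq> Field r" shows "category (ord_cat r K)"
  by (rule category_ord_cat) (use Well_orderD[OF assms(1)] assms(2) in auto)

lemma small_category_ord:
  fixes U :: "'s itself"
  assumes "universe U" "Well_order r" "K \<subseteq> Field r" "small U (Field r)"
  shows "small_category U (ord_cat r K)"
  by (rule small_category_ord_cat[OF assms(1)])
    (use Well_orderD[OF assms(2)] assms(3) small_subset[OF assms(4,3)] in auto)

lemma ord_cocone_iff:
  "is_cocone (ord_cat r K) A X n \<tau> \<longleftrightarrow> n \<in> Ob A \<and> (\<forall>j\<in>K. \<tau> j \<in> hom A (FOb X j) n)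
     \<and> (\<forall>j\<in>K. \<forall>k\<in>K. (j, k) \<in> r \<longrightarrow> \<tau> k \<cdot>\<^bsub>A\<^esub> FAr X (j, k) = \<tau> j)"
  by (auto simp: is_cocone_def)

definition ord_funct :: "('s \<Rightarrow> 'o) \<Rightarrow> ('s \<Rightarrow> 's \<Rightarrow> 'a) \<Rightarrow> ('s, 's \<times> 's, 'o, 'a) funct" where
  "ord_funct x e = \<lparr>FOb = x, FAr = \<lambda>(j, k). e j k\<rparr>"

lemma ord_funct_simps [simp]: "FOb (ord_funct x e) = x" "FAr (ord_funct x e) (j, k) = e j k"
  by (auto simp: ord_funct_def)

lemma ord_functorI:
  assumes "category A" "category (ord_cat r K)" "\<And>k. k \<in> K \<Longrightarrow> FOb X k \<in> Ob A"
    "\<And>j k. \<lbrakk>j \<in> K; k \<in> K; (j, k) \<in> r\<rbrakk> \<Longrightarrow> FAr X (j, k) \<in> hom A (FOb X j) (FOb X k)"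
    "\<And>k. k \<in> K \<Longrightarrow> FAr X (k, k) = Idn A (FOb X k)"
    "\<And>i j k. \<lbrakk>i \<in> K; j \<in> K; k \<in> K; (i, j) \<in> r; (j, k) \<in> r\<rbrakk>
       \<Longrightarrow> FAr X (i, k) = FAr X (j, k) \<cdot>\<^bsub>A\<^esub> FAr X (i, j)"
  shows "is_functor (ord_cat r K) A X"
  using assms by (auto simp: is_functor_def)

lemma ord_functorD:
  assumes "is_functor (ord_cat r K) A X"
  shows "\<And>k. k \<in> K \<Longrightarrow> FOb X k \<in> Ob A"
    "\<And>j k. \<lbrakk>j \<in> K; k \<in> K; (j, k) \<in> r\<rbrakk> \<Longrightarrow> FAr X (j, k) \<in> hom A (FOb X j) (FOb X k)"
    "\<And>k. \<lbrakk>k \<in> K; (k, k) \<in> r\<rbrakk> \<Longrightarrow> FAr X (k, k) = Idn A (FOb X k)"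
    "\<And>i j k. \<lbrakk>i \<in> K; j \<in> K; k \<in> K; (i, j) \<in> r; (j, k) \<in> r\<rbrakk>
       \<Longrightarrow> FAr X (i, k) = FAr X (j, k) \<cdot>\<^bsub>A\<^esub> FAr X (i, j)"
proof -
  note a = assms[unfolded is_functor_def, simplified]
  show "FOb X k \<in> Ob A" if "k \<in> K" for k using a that by blast
  show "FAr X (j, k) \<in> hom A (FOb X j) (FOb X k)" if "j \<in> K" "k \<in> K" "(j, k) \<in> r" for j k
    using a that by blast
  show "FAr X (k, k) = Idn A (FOb X k)" if "k \<in> K" "(k, k) \<in> r" for k
    using a that by blast
  show "FAr X (i, k) = FAr X (j, k) \<cdot>\<^bsub>A\<^esub> FAr X (i, j)"
    if "i \<in> K" "j \<in> K" "k \<in> K" "(i, j) \<in> r" "(j, k) \<in> r" for i j k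
    using a that by blast
qed

lemma ord_functor_subset:
  assumes "is_functor (ord_cat r (Field r)) A X" "Well_order r" "K \<subseteq> Field r"
  shows "is_functor (ord_cat r K) A X"
proof (rule ord_functorI)
  note D = ord_functorD[OF assms(1)]
  show "category A" using assms(1) by (simp add: is_functor_def)
  show "category (ord_cat r K)" using ord_category[OF assms(2,3)] .
  show "FAr X (i, k) = FAr X (j, k) \<cdot>\<^bsub>A\<^esub> FAr X (i, j)"
    if "i \<in> K" "j \<in> K" "k \<in> K" "(i, j) \<in> r" "(j, k) \<in> r" for i j k
    by (rule D(4)) (use that assms(3) in auto)
  show "FOb X k \<in> Ob A" if "k \<in> K" for k by (rule D(1)) (use that assms(3) in auto)
  show "FAr X (j, k) \<in> hom A (FOb X j) (FOb X k)" if "j \<in> K" "k \<in> K" "(j, k) \<in> r" for j k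
    by (rule D(2)) (use that assms(3) in auto)
  show "FAr X (k, k) = Idn A (FOb X k)" if "k \<in> K" for k
    by (rule D(3)) (use that assms(3) Well_orderD(1)[OF assms(2)] in auto)
qed

lemma transfinite_seqD:
  assumes "transfinite_seq U A r X"
  shows "Well_order r" "small U (Field r)" "Field r \<noteq> {}" "is_functor (ord_cat r (Field r)) A X"
    "\<And>k. is_limit r k \<Longrightarrow> is_colimit (ord_cat r (underS r k)) A X (FOb X k) (\<lambda>j. FAr X (j, k))"
  using assms by (auto simp: transfinite_seq_def)

lemma seq_hom:
  assumes "transfinite_seq U A r X" "(j, k) \<in> r"
  shows "FAr X (j, k) \<in> hom A (FOb X j) (FOb X k)"
  by (rule ord_functorD(2)[OF transfinite_seqD(4)[OF assms(1)]]) (use assms(2) in \<open>auto simp: Field_def\<close>)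

lemma seq_Idn:
  assumes "transfinite_seq U A r X" "k \<in> Field r"
  shows "FAr X (k, k) = Idn A (FOb X k)"
  by (rule ord_functorD(3)[OF transfinite_seqD(4)[OF assms(1)]])
    (use assms(2) Well_orderD(1)[OF transfinite_seqD(1)[OF assms(1)]] in auto)

lemma seq_comp:
  assumes "transfinite_seq U A r X" "(i, j) \<in> r" "(j, k) \<in> r"
  shows "FAr X (j, k) \<cdot>\<^bsub>A\<^esub> FAr X (i, j) = FAr X (i, k)"
  by (rule ord_functorD(4)[OF transfinite_seqD(4)[OF assms(1)], symmetric])
    (use assms(2,3) in \<open>auto simp: Field_def\<close>)

lemma transfinite_seq_init_seg:
  assumes "transfinite_seq U A r X" "k \<in> Field r" "underS r k \<noteq> {}"
  shows "transfinite_seq U A (init_seg r k) X"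
  unfolding transfinite_seq_def
proof (intro conjI allI impI)
  note D = transfinite_seqD[OF assms(1)]
  note F = Field_init_seg[OF D(1) assms(2)]
  have sub: "underS r k \<subseteq> Field r" using underS_Field by fast
  show "Well_order (init_seg r k)" using Well_order_init_seg[OF D(1) assms(2)] .
  show "small U (Field (init_seg r k))" unfolding F using small_subset[OF D(2) sub] .
  show "Field (init_seg r k) \<noteq> {}" unfolding F by (fact assms(3))
  show "is_functor (ord_cat (init_seg r k) (Field (init_seg r k))) A X"
    unfolding F ord_cat_init_seg[OF D(1) assms(2) subset_refl]
    by (rule ord_functor_subset[OF D(4,1) sub])
  fix j assume "is_limit (init_seg r k) j"
  then have j: "j \<in> underS r k" "is_limit r j" using is_limit_init_seg[OF D(1) assms(2)] by auto
  have "underS r j \<subseteq> underS r k"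
    using under_trans[OF D(1) _ j(1)] by (auto simp: underS_iff)
  then show "is_colimit (ord_cat (init_seg r k) (underS (init_seg r k) j)) A X (FOb X j) (\<lambda>i. FAr X (i, j))"
    unfolding underS_init_seg[OF D(1) assms(2) j(1)]
    using ord_cat_init_seg[OF D(1) assms(2)] D(5)[OF j(2)] by simp
qed

context category
begin

text \<open>A greatest index is terminal, so the value there is already the colimit. This is how a
  sequence over a well-order with top element ends.\<close>

lemma colimit_top:
  assumes "is_functor (ord_cat r K) A X" "t \<in> K" "\<And>k. k \<in> K \<Longrightarrow> (k, t) \<in> r"
  shows "is_colimit (ord_cat r K) A X (FOb X t) (\<lambda>k. FAr X (k, t))"
proof (rule is_colimitI)
  note D = ord_functorD[OF assms(1)]
  have tt: "FAr X (t, t) = Idn A (FOb X t)" by (rule D(3)) (use assms in auto)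
  show "is_cocone (ord_cat r K) A X (FOb X t) (\<lambda>k. FAr X (k, t))"
    unfolding ord_cocone_iff
  proof (intro conjI ballI impI)
    show "FAr X (k, t) \<cdot> FAr X (j, k) = FAr X (j, t)" if "j \<in> K" "k \<in> K" "(j, k) \<in> r" for j k
      by (rule D(4)[symmetric]) (use that assms in auto)
  qed (use D(1)[OF assms(2)] D(2)[OF _ assms(2) assms(3)] in auto)
  { fix n \<tau> assume "is_cocone (ord_cat r K) A X n \<tau>"
    then show "\<exists>h. h \<in> hom A (FOb X t) n \<and> (\<forall>j\<in>Ob (ord_cat r K). h \<cdot> FAr X (j, t) = \<tau> j)"
      unfolding ord_cocone_iff using assms by (intro exI[of _ "\<tau> t"]) auto }
  { fix n f g assume f: "f \<in> hom A (FOb X t) n" "g \<in> hom A (FOb X t) n"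
      "\<forall>j\<in>Ob (ord_cat r K). f \<cdot> FAr X (j, t) = g \<cdot> FAr X (j, t)"
    then have "f \<cdot> FAr X (t, t) = g \<cdot> FAr X (t, t)" using assms by auto
    then show "f = g" using f(1,2) D(1)[OF assms(2)] unfolding tt by (simp add: hom_iff) }
qed

end

lemma small_empty:
  fixes U :: "'s itself" shows "small U {}"
proof -
  have "\<not> |UNIV :: 's set| \<le>o |{}|" unfolding card_of_ordLeq[symmetric] by simp
  then show ?thesis
    unfolding small_def using not_ordLeq_iff_ordLess[OF card_of_Well_order card_of_Well_order] by blast
qed

section \<open>Colimits of sequences and of their subsequences\<close>

section \<open>Sequences indexed by natural numbers\<close>

text \<open>Compatibility is required for the generating maps \<open>i n\<close> only, which keeps
  the passage to subsequences elementary; \<open>seq_transfinite\<close> identifies this with a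
  colimit over a well-order.\<close>

definition seq_colim :: "('o, 'a, 'z) cat_scheme \<Rightarrow> (nat \<Rightarrow> 'o) \<Rightarrow> (nat \<Rightarrow> 'a) \<Rightarrow> 'o \<Rightarrow> (nat \<Rightarrow> 'a) \<Rightarrow> bool" where
  "seq_colim A x i L \<iota> \<longleftrightarrow> L \<in> Ob A \<and> (\<forall>n. \<iota> n \<in> hom A (x n) L \<and> \<iota> (Suc n) \<cdot>\<^bsub>A\<^esub> i n = \<iota> n)
     \<and> (\<forall>m \<tau>. m \<in> Ob A \<and> (\<forall>n. \<tau> n \<in> hom A (x n) m \<and> \<tau> (Suc n) \<cdot>\<^bsub>A\<^esub> i n = \<tau> n) \<longrightarrow>
          (\<exists>!h. h \<in> hom A L m \<and> (\<forall>n. h \<cdot>\<^bsub>A\<^esub> \<iota> n = \<tau> n)))"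

text \<open>The composite of \<open>d\<close> successive maps from stage \<open>m\<close>. Indexing
  by the length rather than by the final stage avoids a side condition
  \<open>m \<le> n\<close>.\<close>

primrec path :: "('o, 'a, 'z) cat_scheme \<Rightarrow> (nat \<Rightarrow> 'o) \<Rightarrow> (nat \<Rightarrow> 'a) \<Rightarrow> nat \<Rightarrow> nat \<Rightarrow> 'a" where
  "path A x i m 0 = Idn A (x m)"
| "path A x i m (Suc d) = i (m + d) \<cdot>\<^bsub>A\<^esub> path A x i m d"

context category
begin

context
  fixes x :: "nat \<Rightarrow> 'o" and i :: "nat \<Rightarrow> 'a"
  assumes i: "\<And>n. i n \<in> hom A (x n) (x (Suc n))"
begin

lemma seq_Ob: "x n \<in> Ob A"
  using i[of n] Dom_in[of "i n"] by (simp add: hom_iff)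

lemma path_hom: "path A x i m d \<in> hom A (x m) (x (m + d))"
proof (induction d)
  case 0 then show ?case using seq_Ob by (simp add: hom_iff)
next
  case (Suc d) then show ?case using i[of "m + d"] by (simp add: hom_iff)
qed

lemma path_add: "path A x i m (d + d') = path A x i (m + d) d' \<cdot> path A x i m d"
proof (induction d')
  case 0 then show ?case using path_hom[of m d] by (simp add: hom_iff)
next
  case (Suc d') then show ?case
    using path_hom[of m d] path_hom[of "m + d" d'] i[of "m + d + d'"] by (simp add: hom_iff add.assoc)
qed

lemma cocone_path:
  assumes "\<And>n. \<tau> n \<in> hom A (x n) m" "\<And>n. \<tau> (Suc n) \<cdot> i n = \<tau> n"
  shows "\<tau> (n + d) \<cdot> path A x i n d = \<tau> n"
proof (induction d)
  case 0 then show ?case using assms(1)[of n] by (simp add: hom_iff)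
next
  case (Suc d)
  have "\<tau> (n + Suc d) \<cdot> path A x i n (Suc d) = \<tau> (Suc (n + d)) \<cdot> i (n + d) \<cdot> path A x i n d"
    using path_hom[of n d] i[of "n + d"] assms(1)[of "Suc (n + d)"] by (simp add: hom_iff)
  then show ?case using Suc assms(2) by simp
qed

text \<open>Cofinality of the even terms: a cocone on them extends to an odd term by composing the
  next even component with the map into it. In \<open>two_sided_weq\<close> two successive maps form
  a trivial cofibration while a single one is not yet known to.\<close>

lemma seq_colim_even:
  assumes "seq_colim A x i L \<iota>"
  shows "seq_colim A (\<lambda>n. x (2 * n)) (\<lambda>n. i (Suc (2 * n)) \<cdot> i (2 * n)) L (\<lambda>n. \<iota> (2 * n))"
proof -
  have L: "L \<in> Ob A" "\<And>n. \<iota> n \<in> hom A (x n) L" "\<And>n. \<iota> (Suc n) \<cdot> i n = \<iota> n"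
    using assms by (auto simp: seq_colim_def)
  have two: "\<tau> (Suc (Suc n)) \<cdot> (i (Suc n) \<cdot> i n) = \<tau> n"
    if "\<And>n. \<tau> n \<in> hom A (x n) m" "\<And>n. \<tau> (Suc n) \<cdot> i n = \<tau> n" for \<tau> m n
    using comp_cong_left[OF that(2)[of "Suc n"], of "i n"] that(1)[of "Suc (Suc n)"] that(2)[of n]
      i[of n] i[of "Suc n"] by (simp add: hom_iff)
  show ?thesis
    unfolding seq_colim_def
  proof (intro conjI allI impI)
    show "\<iota> (2 * Suc n) \<cdot> (i (Suc (2 * n)) \<cdot> i (2 * n)) = \<iota> (2 * n)" for n
      using two[of \<iota> L "2 * n"] L by simp
    fix m \<tau> assume t: "m \<in> Ob A \<and> (\<forall>n. \<tau> n \<in> hom A (x (2 * n)) m \<and>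
      \<tau> (Suc n) \<cdot> (i (Suc (2 * n)) \<cdot> i (2 * n)) = \<tau> n)"
    define \<sigma> where "\<sigma> n = (if even n then \<tau> (n div 2) else \<tau> (Suc (n div 2)) \<cdot> i n)" for n
    have t1: "\<tau> n \<in> Ar A" "Dom A (\<tau> n) = x (2 * n)" "Cod A (\<tau> n) = m" for n
      using t by (auto simp: hom_iff)
    have i1: "i n \<in> Ar A" "Dom A (i n) = x n" "Cod A (i n) = x (Suc n)" for n
      using i[of n] by (auto simp: hom_iff)
    have s1: "\<sigma> n \<in> hom A (x n) m" for n
      using t1 i1 by (cases "even n") (auto simp: \<sigma>_def hom_iff elim!: evenE oddE)
    have s2: "\<sigma> (Suc n) \<cdot> i n = \<sigma> n" for n
      using t t1 i1 by (cases "even n") (auto simp: \<sigma>_def hom_iff elim!: evenE oddE)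
    have "\<exists>!h. h \<in> hom A L m \<and> (\<forall>n. h \<cdot> \<iota> n = \<sigma> n)"
      using assms t s1 s2 unfolding seq_colim_def by (elim conjE allE[of _ m] allE[of _ \<sigma>]) auto
    moreover have "(\<forall>n. h \<cdot> \<iota> n = \<sigma> n) \<longleftrightarrow> (\<forall>n. h \<cdot> \<iota> (2 * n) = \<tau> n)" if h: "h \<in> hom A L m" for h
    proof
      assume *: "\<forall>n. h \<cdot> \<iota> (2 * n) = \<tau> n"
      show "\<forall>n. h \<cdot> \<iota> n = \<sigma> n"
      proof
        fix n
        show "h \<cdot> \<iota> n = \<sigma> n"
        proof (cases "even n")
          case True then show ?thesis using *[rule_format, of "n div 2"] by (simp add: \<sigma>_def)
        next
          case False
          then have "2 * Suc (n div 2) = Suc n" by presburger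
          then have "h \<cdot> \<iota> (Suc n) = \<tau> (Suc (n div 2))" using *[rule_format, of "Suc (n div 2)"] by simp
          then have "h \<cdot> (\<iota> (Suc n) \<cdot> i n) = \<tau> (Suc (n div 2)) \<cdot> i n"
            using comp_cong_left[of h "\<iota> (Suc n)" "\<tau> (Suc (n div 2))" "i n"] h L(2)[of "Suc n"] i1
            by (simp add: hom_iff)
          with False L(3) show ?thesis by (simp add: \<sigma>_def)
        qed
      qed
    qed (auto simp: \<sigma>_def dest: spec[of _ "2 * _"])
    ultimately show "\<exists>!h. h \<in> hom A L m \<and> (\<forall>n. h \<cdot> \<iota> (2 * n) = \<tau> n)" by (metis (no_types, lifting))
  qed (use L in auto)
qed

text \<open>Together with \<open>seq_colim_even\<close> this presents the same colimit by the odd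
  terms.\<close>

lemma seq_colim_shift:
  assumes "seq_colim A x i L \<iota>"
  shows "seq_colim A (\<lambda>n. x (Suc n)) (\<lambda>n. i (Suc n)) L (\<lambda>n. \<iota> (Suc n))"
proof -
  have L: "L \<in> Ob A" "\<And>n. \<iota> n \<in> hom A (x n) L" "\<And>n. \<iota> (Suc n) \<cdot> i n = \<iota> n"
    using assms by (auto simp: seq_colim_def)
  show ?thesis
    unfolding seq_colim_def
  proof (intro conjI allI impI)
    fix m \<tau> assume t: "m \<in> Ob A \<and> (\<forall>n. \<tau> n \<in> hom A (x (Suc n)) m \<and> \<tau> (Suc n) \<cdot> i (Suc n) = \<tau> n)"
    define \<sigma> where "\<sigma> n = (case n of 0 \<Rightarrow> \<tau> 0 \<cdot> i 0 | Suc k \<Rightarrow> \<tau> k)" for n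
    have i1: "i n \<in> Ar A" "Dom A (i n) = x n" "Cod A (i n) = x (Suc n)" for n
      using i[of n] by (auto simp: hom_iff)
    have t1: "\<tau> n \<in> Ar A" "Dom A (\<tau> n) = x (Suc n)" "Cod A (\<tau> n) = m" for n
      using t by (auto simp: hom_iff)
    have s1: "\<sigma> n \<in> hom A (x n) m" for n
      using t1 i1 by (cases n) (auto simp: \<sigma>_def hom_iff)
    have s2: "\<sigma> (Suc n) \<cdot> i n = \<sigma> n" for n
      using t by (cases n) (auto simp: \<sigma>_def)
    have "\<exists>!h. h \<in> hom A L m \<and> (\<forall>n. h \<cdot> \<iota> n = \<sigma> n)"
      using assms t s1 s2 unfolding seq_colim_def by (elim conjE allE[of _ m] allE[of _ \<sigma>]) auto
    moreover have "(\<forall>n. h \<cdot> \<iota> n = \<sigma> n) \<longleftrightarrow> (\<forall>n. h \<cdot> \<iota> (Suc n) = \<tau> n)" if h: "h \<in> hom A L m" for h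
    proof
      assume *: "\<forall>n. h \<cdot> \<iota> (Suc n) = \<tau> n"
      have "h \<cdot> \<iota> 0 = h \<cdot> (\<iota> (Suc 0) \<cdot> i 0)" using L(3) by simp
      also have "\<dots> = \<tau> 0 \<cdot> i 0"
        using comp_cong_left[of h "\<iota> (Suc 0)" "\<tau> 0" "i 0"] * h L(2)[of "Suc 0"] i1 by (simp add: hom_iff)
      finally show "\<forall>n. h \<cdot> \<iota> n = \<sigma> n" using * by (auto simp: \<sigma>_def split: nat.split)
    qed (auto simp: \<sigma>_def dest: spec[of _ "Suc _"])
    ultimately show "\<exists>!h. h \<in> hom A L m \<and> (\<forall>n. h \<cdot> \<iota> (Suc n) = \<tau> n)" by (metis (no_types, lifting))
  qed (use L in auto)
qed

end

text \<open>A sequence is a transfinite sequence without limit stages: \<^term>\<open>e\<close> embeds the natural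
  numbers into the universe.\<close>

lemma seq_transfinite:
  fixes U :: "'s itself" and x :: "nat \<Rightarrow> 'o"
  assumes U: "universe U" and i: "\<And>n. i n \<in> hom A (x n) (x (Suc n))"
  obtains r :: "'s rel" and e :: "nat \<Rightarrow> 's" and X where
    "transfinite_seq U A r X" "inj e" "is_least r (e 0)" "\<And>n. FOb X (e n) = x n"
    "\<And>j k. is_succ r j k \<Longrightarrow> \<exists>n. j = e n \<and> k = e (Suc n)"
    "\<And>n. FAr X (e n, e (Suc n)) = i n"
    "\<And>L \<iota>. is_colimit (ord_cat r (Field r)) A X L \<iota> \<longleftrightarrow> seq_colim A x i L (\<lambda>n. \<iota> (e n))"
proof -
  obtain e :: "nat \<Rightarrow> 's" where e: "inj e"
    using universe_infinite[OF U] infinite_countable_subset by blast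
  define r where "r = {(e m, e n) | m n. m \<le> n}"
  have r: "(e m, e n) \<in> r \<longleftrightarrow> m \<le> n" for m n using e by (auto simp: r_def dest: injD)
  have F: "Field r = range e" by (force simp: Field_def r_def)
  have ee: "e m = e n \<longleftrightarrow> m = n" for m n using e by (auto dest: injD)
  have rD: "\<exists>m n. j = e m \<and> k = e n \<and> m \<le> n" if "(j, k) \<in> r" for j k
    using that by (auto simp: r_def)
  have uS: "underS r (e n) = e ` {..<n}" for n
  proof (rule set_eqI)
    fix j
    show "j \<in> underS r (e n) \<longleftrightarrow> j \<in> e ` {..<n}"
      using rD[of j "e n"] by (auto simp: underS_iff r ee)
  qed
  define e' where "e' = inv e"
  have e': "e' (e n) = n" for n using e by (simp add: e'_def)
  have wo: "Well_order r"
  proof -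
    have "wf (r - Id)"
      by (rule wf_subset[OF wf_inv_image[OF wf_less_than, of e']])
        (use e in \<open>auto simp: r_def e' le_less\<close>)
    moreover have "refl_on (range e) r" by (auto simp: refl_on_def r)
    moreover have "trans r"
      unfolding trans_def by (auto dest!: rD simp: r ee)
    moreover have "antisym r" unfolding antisym_def by (auto dest!: rD simp: ee)
    moreover have "total_on (range e) r" by (auto simp: total_on_def r)
    moreover have "r \<subseteq> range e \<times> range e" by (auto simp: r_def)
    ultimately show ?thesis unfolding F by (auto simp: order_on_defs)
  qed
  have su: "\<exists>n. j = e n \<and> k = e (Suc n)" if s: "is_succ r j k" for j k
  proof -
    obtain m n where mn: "j = e m" "k = e n" "m < n"
      using s uS is_succD(3,4)[OF s] F by (auto simp: is_succ_def)
    then have "(e (n - 1), e m) \<in> r" using s uS[of n] by (auto simp: is_succ_def)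
    with mn have "n = Suc m" unfolding r by simp
    with mn show ?thesis by blast
  qed
  define X where "X = ord_funct (\<lambda>k. x (e' k)) (\<lambda>j k. path A x i (e' j) (e' k - e' j))"
  have X: "FOb X (e n) = x n" "FAr X (e m, e n) = path A x i m (n - m)" for m n
    by (simp_all add: X_def e')
  have Xs: "FAr X (e n, e (Suc n)) = i n" for n
    unfolding X using i[of n] by (simp add: hom_iff)
  note path_hom = path_hom[of i x, OF i] and path_add = path_add[of i x, OF i]
    and cocone_path = cocone_path[of i x, OF i] and seq_Ob = seq_Ob[of i x, OF i]
  have fX: "is_functor (ord_cat r (Field r)) A X"
  proof (rule ord_functorI)
    show "FAr X (j, k) \<in> hom A (FOb X j) (FOb X k)" if "j \<in> Field r" "k \<in> Field r" "(j, k) \<in> r" for j k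
    proof -
      obtain m n where "j = e m" "k = e n" "m \<le> n" using \<open>(j, k) \<in> r\<close> by (auto simp: r_def)
      then show ?thesis using path_hom[of m "n - m"] by (simp add: X)
    qed
    show "FAr X (j, l) = FAr X (k, l) \<cdot> FAr X (j, k)"
      if "j \<in> Field r" "k \<in> Field r" "l \<in> Field r" "(j, k) \<in> r" "(k, l) \<in> r" for j k l
    proof -
      obtain m n where mn: "j = e m" "k = e n" "m \<le> n" using \<open>(j, k) \<in> r\<close> by (auto simp: r_def)
      moreover obtain p where p: "l = e p" "n \<le> p" using rD[OF \<open>(k, l) \<in> r\<close>] mn ee by auto
      ultimately show ?thesis using path_add[of m "n - m" "p - n"] by (simp add: X)
    qed
  qed (use category_axioms ord_category[OF wo subset_refl] seq_Ob in \<open>auto simp: F X\<close>)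
  \<comment> \<open>Every index is the least one or a successor, so the continuity condition at
    limit stages is vacuous.\<close>
  have "\<exists>n. is_succ r n k \<or> underS r k = {}" if "k \<in> Field r" for k
  proof -
    from that obtain n where n: "k = e n" by (auto simp: F)
    show ?thesis
    proof (cases n)
      case (Suc m)
      then have "is_succ r (e m) k" unfolding is_succ_def n uS by (auto simp: r)
      then show ?thesis by blast
    qed (simp add: n uS)
  qed
  then have "\<not> is_limit r k" for k by (auto simp: is_limit_def)
  then have ts: "transfinite_seq U A r X"
    unfolding transfinite_seq_def using wo fX F small_countable[OF U, of "range e"] by auto
  have le: "is_least r (e 0)" by (simp add: is_least_def uS F)
  have cc: "is_cocone (ord_cat r (Field r)) A X m \<tau> \<longleftrightarrow>
      m \<in> Ob A \<and> (\<forall>n. \<tau> (e n) \<in> hom A (x n) m \<and> \<tau> (e (Suc n)) \<cdot> i n = \<tau> (e n))" for m \<tau>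
  proof
    assume c: "is_cocone (ord_cat r (Field r)) A X m \<tau>"
    then show "m \<in> Ob A \<and> (\<forall>n. \<tau> (e n) \<in> hom A (x n) m \<and> \<tau> (e (Suc n)) \<cdot> i n = \<tau> (e n))"
      unfolding ord_cocone_iff F by (auto simp: X(1) r Xs[symmetric])
  next
    assume c: "m \<in> Ob A \<and> (\<forall>n. \<tau> (e n) \<in> hom A (x n) m \<and> \<tau> (e (Suc n)) \<cdot> i n = \<tau> (e n))"
    have "\<tau> (e n) \<cdot> FAr X (e k, e n) = \<tau> (e k)" if "k \<le> n" for k n
      using cocone_path[of "\<lambda>n. \<tau> (e n)" m k "n - k"] c that by (simp add: X)
    with c show "is_cocone (ord_cat r (Field r)) A X m \<tau>"
      unfolding ord_cocone_iff F by (auto simp: X(1) r)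
  qed
  have "is_colimit (ord_cat r (Field r)) A X L \<iota> \<longleftrightarrow> seq_colim A x i L (\<lambda>n. \<iota> (e n))" for L \<iota>
  proof
    assume c: "is_colimit (ord_cat r (Field r)) A X L \<iota>"
    show "seq_colim A x i L (\<lambda>n. \<iota> (e n))"
      unfolding seq_colim_def
    proof (intro conjI allI impI)
      fix m \<tau> assume "m \<in> Ob A \<and> (\<forall>n. \<tau> n \<in> hom A (x n) m \<and> \<tau> (Suc n) \<cdot> i n = \<tau> n)"
      then have "is_cocone (ord_cat r (Field r)) A X m (\<lambda>k. \<tau> (e' k))" unfolding cc by (simp add: e')
      then have "\<exists>!h. h \<in> hom A L m \<and> (\<forall>j\<in>Field r. h \<cdot> \<iota> j = \<tau> (e' j))"
        using c by (simp add: is_colimit_def)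
      then show "\<exists>!h. h \<in> hom A L m \<and> (\<forall>n. h \<cdot> \<iota> (e n) = \<tau> n)" by (simp add: F e')
    qed (use c cc in \<open>auto simp: is_colimit_def\<close>)
  next
    assume c: "seq_colim A x i L (\<lambda>n. \<iota> (e n))"
    show "is_colimit (ord_cat r (Field r)) A X L \<iota>"
      unfolding is_colimit_def
    proof (intro conjI allI impI)
      show "is_cocone (ord_cat r (Field r)) A X L \<iota>" unfolding cc using c by (simp add: seq_colim_def)
      fix m \<tau> assume "is_cocone (ord_cat r (Field r)) A X m \<tau>"
      then have t: "m \<in> Ob A \<and> (\<forall>n. \<tau> (e n) \<in> hom A (x n) m \<and> \<tau> (e (Suc n)) \<cdot> i n = \<tau> (e n))"
        unfolding cc .
      have "\<exists>!h. h \<in> hom A L m \<and> (\<forall>n. h \<cdot> \<iota> (e n) = \<tau> (e n))"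
        by (rule c[unfolded seq_colim_def, THEN conjunct2, THEN conjunct2, THEN spec[of _ m],
              THEN spec[of _ "\<lambda>n. \<tau> (e n)"], THEN mp, OF t])
      then show "\<exists>!h. h \<in> hom A L m \<and> (\<forall>j\<in>Ob (ord_cat r (Field r)). h \<cdot> \<iota> j = \<tau> j)" by (simp add: F)
    qed
  qed
  from that[OF ts e le X(1) su Xs this] show thesis .
qed

end

section \<open>Countable composites in a left closed class\<close>

section \<open>Left closed classes\<close>

context left_closed
begin

lemma S_Ar: "f \<in> S \<Longrightarrow> f \<in> Ar A"
  using subcat by (auto simp: subcategory_def)

lemma S_comp: "\<lbrakk>f \<in> S; g \<in> S; Dom A g = Cod A f\<rbrakk> \<Longrightarrow> g \<cdot> f \<in> S"
  using subcat by (auto simp: subcategory_def)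

lemma S_good: "f \<in> S \<Longrightarrow> Dom A f \<in> good_obs A S" "f \<in> S \<Longrightarrow> Cod A f \<in> good_obs A S"
  using subcat S_Ar by (auto simp: subcategory_def good_obs_def)

lemma good_Ob: "x \<in> good_obs A S \<Longrightarrow> x \<in> Ob A"
  by (simp add: good_obs_def)

lemma iso_good:
  assumes "is_iso A u" "Dom A u \<in> good_obs A S" shows "Cod A u \<in> good_obs A S"
  using iso_in[OF assms] S_good by blast

lemma initial_good: "is_initial A Z \<Longrightarrow> Z \<in> good_obs A S"
  using coproduct_good[of "{}" "\<lambda>_. Z" Z "\<lambda>_. undefined"] initial_iff_coproduct small_empty
  by auto

lemma seq_colim_exists:
  assumes "universe U" "\<And>n. i n \<in> hom A (x n) (x (Suc n))" "\<And>n. i n \<in> S"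
  shows "\<exists>L \<iota>. seq_colim A x i L \<iota>"
proof -
  obtain r :: "'s rel" and e :: "nat \<Rightarrow> 's" and X where X:
    "transfinite_seq U A r X" "inj e" "is_least r (e 0)" "\<And>n. FOb X (e n) = x n"
    "\<And>j k. is_succ r j k \<Longrightarrow> \<exists>n. j = e n \<and> k = e (Suc n)"
    "\<And>n. FAr X (e n, e (Suc n)) = i n"
    "\<And>L \<iota>. is_colimit (ord_cat r (Field r)) A X L \<iota> \<longleftrightarrow> seq_colim A x i L (\<lambda>n. \<iota> (e n))"
    by (rule seq_transfinite[of U i x, OF assms(1,2)]) (rule that)
  have "\<exists>L \<iota>. is_colimit (ord_cat r (Field r)) A X L \<iota>"
  proof (rule transfinite_exists[OF X(1)])
    show "\<forall>j k. is_succ r j k \<longrightarrow> FAr X (j, k) \<in> S" by (auto dest!: X(5) simp: X(6) assms(3))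
    have "x 0 \<in> good_obs A S" using S_good(1)[OF assms(3)[of 0]] assms(2)[of 0] by (simp add: hom_iff)
    then show "\<forall>k. is_least r k \<longrightarrow> FOb X k \<in> good_obs A S"
      using least_unique[OF transfinite_seqD(1)[OF X(1)] X(3)] X(4)[of 0] by auto
  qed
  then show ?thesis using X(7) by blast
qed

lemma seq_colim_in:
  assumes "universe U" "\<And>n. i n \<in> hom A (x n) (x (Suc n))" "\<And>n. i n \<in> S" "seq_colim A x i L \<iota>"
  shows "\<iota> 0 \<in> S"
proof -
  obtain r :: "'s rel" and e :: "nat \<Rightarrow> 's" and X where X:
    "transfinite_seq U A r X" "inj e" "is_least r (e 0)" "\<And>n. FOb X (e n) = x n"
    "\<And>j k. is_succ r j k \<Longrightarrow> \<exists>n. j = e n \<and> k = e (Suc n)"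
    "\<And>n. FAr X (e n, e (Suc n)) = i n"
    "\<And>L \<iota>. is_colimit (ord_cat r (Field r)) A X L \<iota> \<longleftrightarrow> seq_colim A x i L (\<lambda>n. \<iota> (e n))"
    by (rule seq_transfinite[of U i x, OF assms(1,2)]) (rule that)
  have "is_colimit (ord_cat r (Field r)) A X L (\<lambda>k. \<iota> (inv e k))"
    unfolding X(7) using assms(4) X(2) by simp
  then have "\<iota> (inv e (e 0)) \<in> S"
  proof (rule transfinite_in[OF X(1), rotated 2, OF _ X(3)])
    show "\<forall>j k. is_succ r j k \<longrightarrow> FAr X (j, k) \<in> S" by (auto dest!: X(5) simp: X(6) assms(3))
    have "x 0 \<in> good_obs A S" using S_good(1)[OF assms(3)[of 0]] assms(2)[of 0] by (simp add: hom_iff)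
    then show "\<forall>k. is_least r k \<longrightarrow> FOb X k \<in> good_obs A S"
      using least_unique[OF transfinite_seqD(1)[OF X(1)] X(3)] X(4)[of 0] by auto
  qed
  then show ?thesis using X(2) by simp
qed

end

section \<open>Saturation of weak equivalences, as far as it is needed\<close>

section \<open>Weak equivalences\<close>

context cofibration_category
begin

text \<open>Identities are weak equivalences. Hence the developments for the two left closed classes
  speak of the same good diagrams.\<close>

lemma good_trivial: "good_obs M (Weq M \<inter> Cof M) = good M"
  using Weq_iso is_iso_Idn by (auto simp: good_obs_def)

lemma Weq_Ar: "w \<in> Weq M \<Longrightarrow> w \<in> Ar M"
  using Weq_subcat by (auto simp: subcategory_def)

lemma Weq_comp: "\<lbrakk>f \<in> Weq M; g \<in> Weq M; Cod M f = Dom M g\<rbrakk> \<Longrightarrow> g \<cdot> f \<in> Weq M"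
  using Weq_subcat by (auto simp: subcategory_def)

text \<open>One step of the replacement in \<open>two_sided_weq\<close>: for a weak equivalence
  \<open>v\<close> onto the source of \<open>g\<close>, factoring \<open>g \<cdot> v\<close>
  replaces \<open>g\<close> by a cofibration \<open>i\<close> and continues the comparison by
  \<open>v'\<close>.\<close>

lemma factorization_step:
  assumes "v \<in> Weq M" "g \<in> Ar M" "Dom M g = Cod M v" "Dom M v \<in> good M"
  obtains i v' where "i \<in> Cof M" "v' \<in> Weq M" "Cod M i = Dom M v'" "Dom M i = Dom M v"
    "v' \<cdot> i = g \<cdot> v" "Cod M v' = Cod M g"
proof -
  have gv: "g \<cdot> v \<in> Ar M" "Dom M (g \<cdot> v) \<in> good M" using assms Weq_Ar[OF assms(1)] by auto
  obtain i v' where *: "i \<in> Cof M" "v' \<in> Weq M" "Cod M i = Dom M v'" "g \<cdot> v = v' \<cdot> i"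
    using factorization[OF gv] by blast
  have "i \<in> Ar M" using *(1) left_closed.S_Ar[OF Cof_left_closed] by blast
  then have "Dom M (v' \<cdot> i) = Dom M i" "Cod M (v' \<cdot> i) = Cod M v'" using * Weq_Ar[OF *(2)] by auto
  moreover have "Dom M (g \<cdot> v) = Dom M v" "Cod M (g \<cdot> v) = Cod M g"
    using assms Weq_Ar[OF assms(1)] by auto
  ultimately have "Dom M i = Dom M v" "Cod M v' = Cod M g" unfolding *(4) by simp_all
  then show thesis
    by (intro that[OF *(1-3)]) (simp_all add: *(4))
qed

text \<open>The special case of saturation that is needed.  Replace the composable sequence
  \<^term>\<open>f\<close>, \<^term>\<open>g\<close>, \<^term>\<open>f\<close>, \<^term>\<open>g\<close>, \<dots> by a weakly equivalent sequence of cofibrations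
  \<^term>\<open>i n\<close>. The composites of two successive cofibrations are trivial, so that both the even and
  the odd terms include into the colimit by trivial cofibrations.\<close>

lemma two_sided_weq:
  assumes U: "universe U" and f: "f \<in> hom M a b" and g: "g \<in> hom M b a" and a: "a \<in> good M"
    and gf: "g \<cdot> f \<in> Weq M" and fg: "f \<cdot> g \<in> Weq M"
  shows "f \<in> Weq M"
proof -
  define h where "h n = (if even n then f else g)" for n :: nat
  define ob where "ob n = (if even n then a else b)" for n :: nat
  have h: "h n \<in> Ar M" "Dom M (h n) = ob n" "Cod M (h n) = ob (Suc n)" for n
    using f g by (auto simp: h_def ob_def hom_iff)
  have hh: "h (Suc n) \<cdot> h n \<in> Weq M" for n using gf fg by (auto simp: h_def)
  \<comment> \<open>The sequence is chosen as pairs: the second component compares stage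
    \<open>n\<close> with \<open>ob n\<close>, the first is the cofibration arriving from stage
    \<open>n - 1\<close>. At stage \<open>0\<close> nothing arrives, and an identity fills the
    place.\<close>
  define P where "P n p \<longleftrightarrow> snd p \<in> Weq M \<and> Cod M (snd p) = ob n \<and> Dom M (snd p) \<in> good M" for n and p :: "'a \<times> 'a"
  define Q where "Q n p q \<longleftrightarrow> fst q \<in> Cof M \<and> Cod M (fst q) = Dom M (snd q) \<and>
      Dom M (fst q) = Dom M (snd p) \<and> snd q \<cdot> fst q = h n \<cdot> snd p" for n and p q :: "'a \<times> 'a"
  have aO: "a \<in> Ob M" using a by (simp add: good_obs_def)
  obtain F where F: "P 0 (F 0)" "\<And>n. P n (F n)" "\<And>n. Q n (F n) (F (Suc n))" "F 0 = (Idn M a, Idn M a)"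
  proof -
    have "\<exists>F. \<forall>n. (P n (F n) \<and> (n = 0 \<longrightarrow> F n = (Idn M a, Idn M a))) \<and> Q n (F n) (F (Suc n))"
    proof (rule dependent_nat_choice)
      show "\<exists>p. P 0 p \<and> (0 = (0::nat) \<longrightarrow> p = (Idn M a, Idn M a))"
        using a aO Weq_iso[OF is_iso_Idn] by (auto simp: P_def ob_def)
      fix p n assume "P n p \<and> (n = 0 \<longrightarrow> p = (Idn M a, Idn M a))"
      then have p: "snd p \<in> Weq M" "h n \<in> Ar M" "Dom M (h n) = Cod M (snd p)" "Dom M (snd p) \<in> good M"
        using h by (auto simp: P_def)
      obtain i v' where *: "i \<in> Cof M" "v' \<in> Weq M" "Cod M i = Dom M v'" "Dom M i = Dom M (snd p)"
          "v' \<cdot> i = h n \<cdot> snd p" "Cod M v' = Cod M (h n)"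
        by (rule factorization_step[OF p])
      then show "\<exists>q. (P (Suc n) q \<and> (Suc n = 0 \<longrightarrow> q = (Idn M a, Idn M a))) \<and> Q n p q"
        using h left_closed.S_good(2)[OF Cof_left_closed *(1)]
        by (intro exI[of _ "(i, v')"]) (simp add: P_def Q_def)
    qed
    then show thesis using that by blast
  qed
  define v where "v n = snd (F n)" for n
  define i where "i n = fst (F (Suc n))" for n
  define x where "x n = Dom M (v n)" for n
  have v: "v n \<in> Weq M" "v n \<in> Ar M" "Dom M (v n) = x n" "Cod M (v n) = ob n" for n
    using F(2)[of n] Weq_Ar by (auto simp: v_def x_def P_def)
  have i: "i n \<in> Cof M" "i n \<in> Ar M" "Dom M (i n) = x n" "Cod M (i n) = x (Suc n)"
      and vi: "v (Suc n) \<cdot> i n = h n \<cdot> v n" for n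
    using F(3)[of n] left_closed.S_Ar[OF Cof_left_closed] by (auto simp: i_def x_def v_def Q_def)
  have ih: "i n \<in> hom M (x n) (x (Suc n))" for n using i by (simp add: hom_iff)
  \<comment> \<open>The comparison maps are weak equivalences and so is
    \<open>h (Suc n) \<cdot> h n\<close>, being \<open>g \<cdot> f\<close> or
    \<open>f \<cdot> g\<close>; 2-out-of-3 transfers this to the replaced maps.\<close>
  have ii: "i (Suc n) \<cdot> i n \<in> Weq M \<inter> Cof M" for n
  proof -
    have "v (Suc (Suc n)) \<cdot> (i (Suc n) \<cdot> i n) = h (Suc n) \<cdot> h n \<cdot> v n"
      using comp_cong_left[OF vi[of "Suc n"], of "i n"] vi[of n] i v h by simp
    then have "v (Suc (Suc n)) \<cdot> (i (Suc n) \<cdot> i n) \<in> Weq M"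
      using Weq_comp[OF v(1)[of n] hh[of n]] v h by simp
    then have "i (Suc n) \<cdot> i n \<in> Weq M"
      by (intro Weq_cancel_left[of "i (Suc n) \<cdot> i n" "v (Suc (Suc n))"]) (use i v in simp_all)
    then show ?thesis using left_closed.S_comp[OF Cof_left_closed i(1) i(1)] i by simp
  qed
  obtain L \<iota> where L: "seq_colim M x i L \<iota>"
    using left_closed.seq_colim_exists[of M U "Cof M" i x, OF Cof_left_closed U ih i(1)] by blast
  note even = seq_colim_even[of i x, OF ih L]
  note shift = seq_colim_shift[of i x, OF ih L]
  note odd = seq_colim_even[of "\<lambda>n. i (Suc n)" "\<lambda>n. x (Suc n)", OF ih shift]
  note in_S = left_closed.seq_colim_in[OF trivial_Cof_left_closed U]
  have "\<iota> (2 * 0) \<in> Weq M \<inter> Cof M"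
    by (rule in_S[OF _ _ even]) (use ii i in \<open>auto simp: hom_iff\<close>)
  moreover have "\<iota> (Suc (2 * 0)) \<in> Weq M \<inter> Cof M"
    by (rule in_S[OF _ _ odd]) (use ii i in \<open>auto simp: hom_iff\<close>)
  moreover have "\<iota> (Suc 0) \<in> hom M (x 1) L" "\<iota> (Suc 0) \<cdot> i 0 = \<iota> 0"
    using L unfolding seq_colim_def by auto
  \<comment> \<open>The inclusions of the terms \<open>0\<close> and \<open>1\<close> are both
    trivial and differ by \<open>i 0\<close>, so 2-out-of-3 applies. Since \<open>v 0\<close> is an
    identity, \<open>f\<close> is then the composite of \<open>i 0\<close> and
    \<open>v 1\<close>.\<close>
  ultimately have "i 0 \<in> Weq M"
    by (intro Weq_cancel_left[of "i 0" "\<iota> (Suc 0)"]) (use i in \<open>auto simp: hom_iff\<close>)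
  then have "v (Suc 0) \<cdot> i 0 \<in> Weq M" using v i by (intro Weq_comp) auto
  moreover have "v 0 = Idn M a" using F(4) by (simp add: v_def)
  ultimately show ?thesis using vi[of 0] f by (simp add: h_def hom_iff)
qed

end

section \<open>Reduction of coproducts of maps to cobase change and transfinite composition\<close>

section \<open>Coproducts as transfinite composites of cobase changes\<close>

text \<open>With \<open>t\<close> above all of \<open>I\<close>, every element of \<open>I\<close>
  lies strictly below \<open>t\<close>, so the stage at \<open>t\<close> accounts for every index
  even if \<open>I\<close> has a greatest element.\<close>

lemma wellorder_with_top:
  assumes "t \<notin> I"
  obtains r where "Well_order r" "Field r = insert t I" "\<And>i. i \<in> insert t I \<Longrightarrow> (i, t) \<in> r"
proof -
  obtain r0 where r0: "well_order_on I r0" using well_order_on by blast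
  have sub: "r0 \<subseteq> I \<times> I" using r0 by (auto simp: order_on_defs)
  define r where "r = r0 \<union> insert t I \<times> {t}"
  have F: "Field r = insert t I" using sub by (auto simp: r_def Field_def)
  have "wf (r - Id)"
  proof -
    have "wf (I \<times> {t})"
      by (rule wf_subset[OF wf_inv_image[OF wf_less_than, of "\<lambda>x. if x = t then 1 else 0 :: nat"]])
        (use assms in auto)
    moreover have "wf (r0 - Id)" using r0 by (simp add: order_on_defs)
    ultimately have "wf ((r0 - Id) \<union> I \<times> {t})"
      by (intro wf_Un) (use sub assms in auto)
    then show ?thesis by (rule wf_subset) (auto simp: r_def)
  qed
  moreover have "refl_on (insert t I) r"
    using r0 by (auto simp: r_def order_on_defs refl_on_def)
  moreover have "trans r" using r0 sub assms unfolding r_def order_on_defs trans_def by blast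
  moreover have "antisym r" using r0 sub assms unfolding r_def order_on_defs antisym_def by blast
  moreover have "total_on (insert t I) r"
    using r0 by (auto simp: r_def order_on_defs total_on_def)
  moreover have "r \<subseteq> insert t I \<times> insert t I" using sub by (auto simp: r_def)
  ultimately have "Well_order r" unfolding F by (auto simp: order_on_defs)
  moreover have "(i, t) \<in> r" if "i \<in> insert t I" for i using that by (auto simp: r_def)
  ultimately show thesis using that F by blast
qed

context category
begin

lemma coproduct_iso:
  assumes "is_coproduct A I X S \<iota>" "is_coproduct A I X S' \<iota>'" "\<And>i. i \<in> I \<Longrightarrow> X i \<in> Ob A"
  obtains u where "is_iso A u" "u \<in> hom A S S'" "\<And>i. i \<in> I \<Longrightarrow> u \<cdot> \<iota> i = \<iota>' i"
proof -
  have F: "is_functor (ord_cat Id I) A (disc A X)" by (rule disc_functor) (rule assms(3))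
  from colimit_iso[OF assms(1,2)[unfolded coproduct_iff_colimit] F] that show thesis by auto
qed

text \<open>The comparison map of the coproducts of the domains and of the codomains of a family \<^term>\<open>f\<close>
  is the transfinite composite of the mixed coproducts \<^term>\<open>Z k\<close>, which have the codomains of
  those \<^term>\<open>f i\<close> with \<^term>\<open>i\<close> below \<^term>\<open>k\<close>; the index set is well-ordered and given a new top
  element.\<close>

lemma coproduct_in_closure:
  fixes U :: "'s itself" and I :: "'s set" and \<Phi> :: "'a \<Rightarrow> bool"
  assumes U: "universe U" and I: "small U I"
    and f: "\<And>i. i \<in> I \<Longrightarrow> \<Phi> (f i)" "\<And>i. i \<in> I \<Longrightarrow> f i \<in> Ar A"
      "\<And>i. i \<in> I \<Longrightarrow> Dom A (f i) \<in> G" "\<And>i. i \<in> I \<Longrightarrow> Cod A (f i) \<in> G"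
    and G: "\<And>(X :: 's \<Rightarrow> 'o). (\<And>i. i \<in> I \<Longrightarrow> X i \<in> G) \<Longrightarrow> \<exists>Y \<iota>. is_coproduct A I X Y \<iota>"
      "\<And>(X :: 's \<Rightarrow> 'o) Y \<iota>. \<lbrakk>\<And>i. i \<in> I \<Longrightarrow> X i \<in> G; is_coproduct A I X Y \<iota>\<rbrakk> \<Longrightarrow> Y \<in> G"
    and cobase: "\<And>f g p q. \<lbrakk>\<Phi> f; Cod A g \<in> G; is_pushout A f g p q\<rbrakk> \<Longrightarrow> \<Phi> q"
    and trans: "\<And>(r :: 's rel) X L \<iota> k0. \<lbrakk>transfinite_seq U A r X;
        \<And>j k. is_succ r j k \<Longrightarrow> \<Phi> (FAr X (j, k)); is_least r k0; FOb X k0 \<in> G;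
        is_colimit (ord_cat r (Field r)) A X L \<iota>\<rbrakk> \<Longrightarrow> \<Phi> (\<iota> k0)"
    and X: "is_coproduct A I (\<lambda>i. Dom A (f i)) X \<iota>" and Y: "is_coproduct A I (\<lambda>i. Cod A (f i)) Y \<kappa>"
    and h: "h \<in> hom A X Y" "\<And>i. i \<in> I \<Longrightarrow> h \<cdot> \<iota> i = \<kappa> i \<cdot> f i"
  shows "\<Phi> h"
proof -
  obtain t where t: "t \<notin> I" using small_fresh[OF I] by blast
  obtain r where r: "Well_order r" "Field r = insert t I" "\<And>i. i \<in> insert t I \<Longrightarrow> (i, t) \<in> r"
    using wellorder_with_top[OF t] by blast
  obtain k0 where k0: "is_least r k0" using least_exists[OF r(1)] r(2) by auto
  note R = Well_orderD[OF r(1)]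
  have top: "underS r t = I"
    using underS_Field[of _ r t] r(2,3) t by (auto simp: underS_iff[of _ r t])
  have t_max: "k = t" if "(t, k) \<in> r" for k
    using that r(3)[of k] R(3) r(2) by (auto simp: antisym_def Field_def)
  \<comment> \<open>\<open>c j k i\<close> is \<open>f i\<close> exactly when
    \<open>j \<le> i < k\<close>, and an identity otherwise: the summand with index \<open>i\<close>
    changes from domain to codomain in the step that starts at \<open>i\<close>.\<close>
  define c where "c j k i = (if i \<in> underS r j then Idn A (Cod A (f i)) else if i \<in> underS r k then f i
    else Idn A (Dom A (f i)))" for j k i
  define F where "F k i = (if i \<in> underS r k then Cod A (f i) else Dom A (f i))" for k i
  have FG: "F k i \<in> G" if "i \<in> I" for k i using that f by (simp add: F_def)
  have c: "c j k i \<in> Ar A" "Dom A (c j k i) = F j i" "Cod A (c j k i) = F k i"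
    if "i \<in> I" "(j, k) \<in> r" for i j k
    using f(2)[OF that(1)] under_trans[OF r(1), of i j k] that(2) R(3)
    unfolding c_def F_def underS_iff antisym_def by (auto dest: transD[OF R(2)])
  have cc: "c k l i \<cdot> c j k i = c j l i" if "i \<in> I" "(j, k) \<in> r" "(k, l) \<in> r" for i j k l
  proof -
    have "i \<in> underS r k" if "i \<in> underS r j"
      using that \<open>(j, k) \<in> r\<close> R(2,3) unfolding underS_iff antisym_def trans_def by blast
    moreover have "i \<in> underS r l" if "i \<in> underS r k"
      using that \<open>(k, l) \<in> r\<close> R(2,3) unfolding underS_iff antisym_def trans_def by blast
    ultimately show ?thesis using f(2)[OF \<open>i \<in> I\<close>] by (simp add: c_def)
  qed
  \<comment> \<open>The coproduct at the least stage is chosen to be the given \<open>X\<close>, so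
    that the composite starts at the domain of \<open>h\<close> itself and not at an isomorphic
    object.\<close>
  have "\<exists>z. is_coproduct A I (F k) (fst z) (snd z) \<and> (k = k0 \<longrightarrow> z = (X, \<iota>))" for k
  proof (cases "k = k0")
    case True
    have "F k0 = (\<lambda>i. Dom A (f i))" using k0 by (intro ext) (simp add: F_def is_least_def)
    then show ?thesis using X True by auto
  next
    case False
    then show ?thesis using G(1)[of "F k"] FG by auto
  qed
  then obtain z where z: "\<And>k. is_coproduct A I (F k) (fst (z k)) (snd (z k))" "z k0 = (X, \<iota>)" by metis
  define Z where "Z k = fst (z k)" for k
  define \<eta> where "\<eta> k = snd (z k)" for k
  have Z: "is_coproduct A I (F k) (Z k) (\<eta> k)" "Z k0 = X" "\<eta> k0 = \<iota>" for k
    using z by (simp_all add: Z_def \<eta>_def)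
  have ZO: "Z k \<in> Ob A" "Z k \<in> G" for k
    using Z(1)[of k] G(2)[OF FG Z(1)] by (auto simp: is_coproduct_def)
  have \<eta>: "\<eta> k i \<in> Ar A" "Dom A (\<eta> k i) = F k i" "Cod A (\<eta> k i) = Z k" if "i \<in> I" for k i
    using Z(1)[of k] that by (auto simp: is_coproduct_def hom_iff)
  have "\<exists>e. e \<in> hom A (Z j) (Z k) \<and> (\<forall>i\<in>I. e \<cdot> \<eta> j i = \<eta> k i \<cdot> c j k i)" if jk: "(j, k) \<in> r" for j k
  proof -
    obtain e where "e \<in> hom A (Z j) (Z k)" "\<And>i. i \<in> I \<Longrightarrow> e \<cdot> \<eta> j i = \<eta> k i \<cdot> c j k i"
      by (rule coproduct_map[OF Z(1)[of j] ZO(1)[of k], of "\<lambda>i. \<eta> k i \<cdot> c j k i"])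
        (use c[OF _ jk] \<eta> in \<open>simp_all add: hom_iff\<close>)
    then show ?thesis by blast
  qed
  then obtain e where e0: "\<And>j k. (j, k) \<in> r \<Longrightarrow> e j k \<in> hom A (Z j) (Z k)"
    and e1: "\<And>j k i. \<lbrakk>(j, k) \<in> r; i \<in> I\<rbrakk> \<Longrightarrow> e j k \<cdot> \<eta> j i = \<eta> k i \<cdot> c j k i" by metis
  have e: "e j k \<in> Ar A" "Dom A (e j k) = Z j" "Cod A (e j k) = Z k" if "(j, k) \<in> r" for j k
    using e0[OF that] by (auto simp: hom_iff)
  have e_id: "e k k = Idn A (Z k)" if "k \<in> Field r" for k
  proof (rule coproduct_eqI[OF Z(1)[of k]])
    fix i assume i: "i \<in> I"
    have "c k k i = Idn A (F k i)" by (simp add: c_def F_def)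
    then show "e k k \<cdot> \<eta> k i = Idn A (Z k) \<cdot> \<eta> k i"
      using e1[OF R(1)[OF that] i] \<eta>[OF i] by simp
  qed (use e0[OF R(1)[OF that]] ZO in \<open>auto simp: hom_iff\<close>)
  have e_comp: "e j l = e k l \<cdot> e j k" if jk: "(j, k) \<in> r" and kl: "(k, l) \<in> r" for j k l
  proof (rule coproduct_eqI[OF Z(1)[of j]])
    have jl: "(j, l) \<in> r" using R(2) jk kl by (rule transD)
    show "e j l \<in> hom A (Z j) (Z l)" using e0[OF jl] .
    fix i assume i: "i \<in> I"
    have "e k l \<cdot> e j k \<cdot> \<eta> j i = e k l \<cdot> \<eta> k i \<cdot> c j k i"
      using e1[OF jk i] e[OF jk] e[OF kl] \<eta>[OF i] c[OF i jk] by simp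
    also have "\<dots> = \<eta> l i \<cdot> (c k l i \<cdot> c j k i)"
      using e1[OF kl i] e[OF kl] \<eta>[OF i] c[OF i jk] c[OF i kl] by (simp add: comp_cong_left[OF e1[OF kl i]])
    finally show "e j l \<cdot> \<eta> j i = e k l \<cdot> e j k \<cdot> \<eta> j i"
      using e1[OF jl i] cc[OF i jk kl] by simp
  qed (use e[OF jk] e[OF kl] in \<open>simp add: hom_iff\<close>)
  define E where "E = ord_funct Z e"
  have E: "FOb E = Z" "\<And>j k. FAr E (j, k) = e j k" by (simp_all add: E_def)
  have fE: "is_functor (ord_cat r (Field r)) A E"
    by (rule ord_functorI)
      (use category_axioms ord_category[OF r(1)] ZO e0 e_id e_comp in \<open>simp_all add: E\<close>)
  have lim: "is_colimit (ord_cat r (underS r k)) A E (Z k) (\<lambda>j. e j k)" if k: "is_limit r k" for k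
  proof (rule is_colimitI)
    have kF: "k \<in> Field r" and ne: "underS r k \<noteq> {}" using k by (auto simp: is_limit_def)
    have sub: "\<And>j. j \<in> underS r k \<Longrightarrow> (j, k) \<in> r" by (auto simp: underS_iff)
    have k0k: "k0 \<in> underS r k" using least_under[OF r(1) k0 kF ne] .
    show "is_cocone (ord_cat r (underS r k)) A E (Z k) (\<lambda>j. e j k)"
      unfolding ord_cocone_iff E using ZO e0[OF sub] e_comp sub by auto
    { fix n \<tau> assume n: "is_cocone (ord_cat r (underS r k)) A E n \<tau>"
      have nO: "n \<in> Ob A" using n by (simp add: ord_cocone_iff)
      have \<tau>: "\<tau> j \<in> Ar A" "Dom A (\<tau> j) = Z j" "Cod A (\<tau> j) = n" if "j \<in> underS r k" for j
        using n that by (auto simp: ord_cocone_iff E hom_iff)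
      have \<tau>e: "\<tau> b \<cdot> e a b = \<tau> a" if "a \<in> underS r k" "b \<in> underS r k" "(a, b) \<in> r" for a b
        using n that by (auto simp: ord_cocone_iff E)
      have step: "\<tau> b \<cdot> \<eta> b i \<cdot> c a b i = \<tau> a \<cdot> \<eta> a i"
        if "a \<in> underS r k" "b \<in> underS r k" "(a, b) \<in> r" "i \<in> I" for a b i
        using comp_cong_left[OF \<tau>e[OF that(1-3)], of "\<eta> a i"] e1[OF that(3,4)] \<tau>[OF that(1)] \<tau>[OF that(2)]
          e[OF that(3)] \<eta>[OF that(4)] c[OF that(4,3)] by simp
      \<comment> \<open>An index \<open>i\<close> below the limit \<open>k\<close> has already been
        changed at some stage \<open>l i\<close> that is still below \<open>k\<close>, and the
        component of the sought map at \<open>i\<close> is read off there. For \<open>i\<close> not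
        below \<open>k\<close> no stage under \<open>k\<close> has changed it, and the least stage
        serves.\<close>
      obtain l where l: "\<And>i. i \<in> underS r k \<Longrightarrow> l i \<in> underS r k \<and> i \<in> underS r (l i)"
      proof -
        have "\<exists>l. i \<in> underS r k \<longrightarrow> l \<in> underS r k \<and> i \<in> underS r l" for i
          using limit_ex[OF r(1) k, of i] by blast
        then show thesis using that by metis
      qed
      have ll: "\<tau> a \<cdot> \<eta> a i = \<tau> b \<cdot> \<eta> b i"
        if "a \<in> underS r k" "b \<in> underS r k" "i \<in> underS r a" "i \<in> underS r b" "i \<in> I" for a b i
      proof -
        have *: "\<tau> a \<cdot> \<eta> a i = \<tau> b \<cdot> \<eta> b i"
          if "a \<in> underS r k" "b \<in> underS r k" "i \<in> underS r a" "i \<in> underS r b" "(a, b) \<in> r" for a b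
        proof -
          have "c a b i = Idn A (F b i)" using that by (simp add: c_def F_def)
          then show ?thesis using step[OF that(1,2,5) \<open>i \<in> I\<close>] \<eta>[OF \<open>i \<in> I\<close>] \<tau>[OF that(2)] by simp
        qed
        have "(a, b) \<in> r \<or> (b, a) \<in> r" using R(4) underS_Field that(1,2) by metis
        then show ?thesis using *[of a b] *[of b a] that by metis
      qed
      define d where "d i = (if i \<in> underS r k then \<tau> (l i) \<cdot> \<eta> (l i) i else \<tau> k0 \<cdot> \<eta> k0 i)" for i
      have dh: "d i \<in> hom A (F k i) n" if "i \<in> I" for i
        using that \<tau>[OF k0k] \<tau>[of "l i"] l[of i] \<eta>[OF that] k0
        by (auto simp: d_def F_def hom_iff is_least_def)
      obtain h where h: "h \<in> hom A (Z k) n" "\<And>i. i \<in> I \<Longrightarrow> h \<cdot> \<eta> k i = d i"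
        by (rule coproduct_map[OF Z(1)[of k] nO, of d]) (use dh in auto)
      have dc: "d i \<cdot> c j k i = \<tau> j \<cdot> \<eta> j i" if j: "j \<in> underS r k" and i: "i \<in> I" for j i
      proof (cases "i \<in> underS r k")
        case True
        note li = l[OF True, THEN conjunct1] l[OF True, THEN conjunct2]
        show ?thesis
        proof (cases "i \<in> underS r j")
          case ij: True
          then have "c j k i = Idn A (F (l i) i)" using li by (simp add: c_def F_def)
          then show ?thesis
            unfolding ll[OF j li(1) ij li(2) i] using True \<tau>[OF li(1)] \<eta>[OF i] by (simp add: d_def)
        next
          case False
          have iF: "i \<in> Field r" "j \<in> Field r" using True j underS_Field by fast+
          then have "(j, i) \<in> r" using False R(1,4)[of i] R(4)[of i j] by (auto simp: underS_iff)
          then have jl: "(j, l i) \<in> r" using li(2) R(2) unfolding underS_iff trans_def by blast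
          have "c j k i = c j (l i) i" using li True False by (simp add: c_def)
          then show ?thesis using step[OF j li(1) jl i] True by (simp add: d_def)
        qed
      next
        case False
        have ni: "i \<notin> underS r j" "i \<notin> underS r k0"
          using False under_trans[OF r(1) _ j, of i] k0 by (auto simp: underS_iff is_least_def)
        have k0j: "(k0, j) \<in> r" using least_le[OF r(1) k0] underS_Field[OF j] .
        have "c k0 j i = Idn A (F j i)" "c j k i = Idn A (F k0 i)" using ni False by (simp_all add: c_def F_def)
        then show ?thesis
          using step[OF k0k j k0j i] False \<tau>[OF j] \<tau>[OF k0k] \<eta>[OF i] by (simp add: d_def)
      qed
      have "h \<cdot> e j k = \<tau> j" if j: "j \<in> underS r k" for j
      proof (rule coproduct_eqI[OF Z(1)[of j]])
        fix i assume i: "i \<in> I"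
        show "h \<cdot> e j k \<cdot> \<eta> j i = \<tau> j \<cdot> \<eta> j i"
          using e1[OF sub[OF j] i] h(1) e[OF sub[OF j]] \<eta>[OF i] c[OF i sub[OF j]] dc[OF j i]
            comp_cong_left[OF h(2)[OF i], of "c j k i"] by (simp add: hom_iff)
      qed (use h(1) e[OF sub[OF j]] \<tau>[OF j] in \<open>auto simp: hom_iff\<close>)
      then show "\<exists>h. h \<in> hom A (Z k) n \<and> (\<forall>j\<in>Ob (ord_cat r (underS r k)). h \<cdot> e j k = \<tau> j)"
        using h(1) by auto }
    { fix n g g' assume g: "g \<in> hom A (Z k) n" "g' \<in> hom A (Z k) n"
        "\<forall>j\<in>Ob (ord_cat r (underS r k)). g \<cdot> e j k = g' \<cdot> e j k"
      have g': "g \<in> Ar A" "Dom A g = Z k" "Cod A g = n" "g' \<in> Ar A" "Dom A g' = Z k" "Cod A g' = n"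
        using g by (auto simp: hom_iff)
      show "g = g'"
      proof (rule coproduct_eqI[OF Z(1)[of k] g(1,2)])
        fix i assume i: "i \<in> I"
        obtain j where j: "j \<in> underS r k" "c j k i = Idn A (F k i)"
        proof (cases "i \<in> underS r k")
          case True
          then obtain l where l: "l \<in> underS r k" "i \<in> underS r l" using limit_ex[OF r(1) k] by blast
          with True show thesis by (intro that[OF l(1)]) (simp add: c_def F_def)
        next
          case False
          with k0 show thesis by (intro that[OF k0k]) (simp add: c_def F_def is_least_def)
        qed
        have "e j k \<cdot> \<eta> j i = \<eta> k i" using e1[OF sub[OF j(1)] i] j(2) \<eta>[OF i] by simp
        moreover have "g \<cdot> e j k \<cdot> \<eta> j i = g' \<cdot> e j k \<cdot> \<eta> j i" using g(3) j(1) by simp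
        ultimately show "g \<cdot> \<eta> k i = g' \<cdot> \<eta> k i"
          using g' e[OF sub[OF j(1)]] \<eta>[OF i] by simp
      qed }
  qed
  have ts: "transfinite_seq U A r E"
    unfolding transfinite_seq_def
    using r(1) fE lim small_Un[OF U small_finite[OF U, of "{t}"] I] r(2) by (auto simp: E)
  have steps: "\<Phi> (e j k)" if s: "is_succ r j k" for j k
  proof -
    note S = is_succD[OF s]
    have jI: "j \<in> I" using S r(2) t_max by auto
    have uk: "i \<in> underS r k \<longleftrightarrow> i = j \<or> i \<in> underS r j" for i
      using succ_underS[OF r(1) s, of i] R(1)[OF S(3)] by (auto simp: underS_iff)
    have cj: "c j k j = f j" using uk[of j] by (simp add: c_def underS_iff)
    have ci: "c j k i = Idn A (F k i)" "F k i = F j i" if "i \<noteq> j" for i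
      using uk[of i] that by (simp_all add: c_def F_def)
    have Fj: "F j j = Dom A (f j)" "F k j = Cod A (f j)" using uk[of j] by (auto simp: F_def underS_iff)
    \<comment> \<open>From \<open>j\<close> to its successor only the summand \<open>j\<close>
      changes; such a change is the cobase change of \<open>f j\<close> along the inclusion of that
      summand.\<close>
    have "is_pushout A (f j) (\<eta> j j) (\<eta> k j) (e j k)"
    proof (rule is_pushoutI)
      show "pushout_cocone A (f j) (\<eta> j j) (\<eta> k j) (e j k)"
        unfolding pushout_cocone_def
        using f(2)[OF jI] \<eta>[OF jI] e[OF S(1)] e1[OF S(1) jI] Fj cj by simp
      { fix n p' q' assume a: "p' \<in> hom A (Cod A (f j)) n" "q' \<in> hom A (Cod A (\<eta> j j)) n"
          "p' \<cdot> f j = q' \<cdot> \<eta> j j"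
        have a': "p' \<in> Ar A" "Dom A p' = Cod A (f j)" "Cod A p' = n" "q' \<in> Ar A" "Dom A q' = Z j" "Cod A q' = n"
          using a \<eta>[OF jI] by (auto simp: hom_iff)
        have nO: "n \<in> Ob A" using a' by force
        obtain h where h: "h \<in> hom A (Z k) n" "\<And>i. i \<in> I \<Longrightarrow> h \<cdot> \<eta> k i = (if i = j then p' else q' \<cdot> \<eta> j i)"
          by (rule coproduct_map[OF Z(1)[of k] nO, of "\<lambda>i. if i = j then p' else q' \<cdot> \<eta> j i"])
            (use a' \<eta> ci(2) Fj in \<open>auto simp: hom_iff\<close>)
        have "h \<cdot> e j k = q'"
        proof (rule coproduct_eqI[OF Z(1)[of j]])
          fix i assume i: "i \<in> I"
          have "h \<cdot> e j k \<cdot> \<eta> j i = (if i = j then p' else q' \<cdot> \<eta> j i) \<cdot> c j k i"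
            using h(1) e1[OF S(1) i] e[OF S(1)] \<eta>[OF i] c[OF i S(1)]
              comp_cong_left[OF h(2)[OF i], of "c j k i"] by (simp add: hom_iff)
          also have "\<dots> = q' \<cdot> \<eta> j i"
            using a(3) a' cj ci(1)[of i] ci(2)[of i] \<eta>[OF i] by (cases "i = j") simp_all
          finally show "h \<cdot> e j k \<cdot> \<eta> j i = q' \<cdot> \<eta> j i" .
        qed (use h(1) e[OF S(1)] a' in \<open>auto simp: hom_iff\<close>)
        then show "\<exists>h. h \<in> hom A (Cod A (\<eta> k j)) n \<and> h \<cdot> \<eta> k j = p' \<and> h \<cdot> e j k = q'"
          using h h(2)[OF jI] \<eta>[OF jI] by (intro exI[of _ h]) simp }
      { fix n g g' assume g: "g \<in> hom A (Cod A (\<eta> k j)) n" "g' \<in> hom A (Cod A (\<eta> k j)) n"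
          "g \<cdot> \<eta> k j = g' \<cdot> \<eta> k j" "g \<cdot> e j k = g' \<cdot> e j k"
        have g': "g \<in> Ar A" "Dom A g = Z k" "Cod A g = n" "g' \<in> Ar A" "Dom A g' = Z k" "Cod A g' = n"
          using g \<eta>[OF jI] by (auto simp: hom_iff)
        show "g = g'"
        proof (rule coproduct_eqI[OF Z(1)[of k]])
          fix i assume i: "i \<in> I"
          show "g \<cdot> \<eta> k i = g' \<cdot> \<eta> k i"
          proof (cases "i = j")
            case False
            then have "\<eta> k i = e j k \<cdot> \<eta> j i" using e1[OF S(1) i] ci(1)[OF False] \<eta>[OF i] by simp
            then show ?thesis
              using comp_cong_left[OF g(4), of "\<eta> j i"] g' e[OF S(1)] \<eta>[OF i] by simp
          qed (use g(3) in simp)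
        qed (use g' in \<open>simp_all add: hom_iff\<close>) }
    qed
    then show ?thesis using cobase[OF f(1)[OF jI], of "\<eta> j j"] \<eta>[OF jI] ZO(2) by simp
  qed
  have tF: "t \<in> Field r" using r(2) by simp
  have "is_colimit (ord_cat r (Field r)) A E (Z t) (\<lambda>k. e k t)"
    using colimit_top[OF fE tF] r(2,3) by (simp add: E)
  \<comment> \<open>The stage at \<open>t\<close> is a coproduct of the codomains but need not be
    the given \<open>Y\<close>; the comparison isomorphism is absorbed into the colimit
    cocone.\<close>
  moreover obtain u where u: "is_iso A u" "u \<in> hom A (Z t) Y" "\<And>i. i \<in> I \<Longrightarrow> u \<cdot> \<eta> t i = \<kappa> i"
  proof -
    have Ft: "F t i = Cod A (f i)" if "i \<in> I" for i using that top by (simp add: F_def)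
    then have Y': "is_coproduct A I (F t) Y \<kappa>"
      using Y by (simp add: is_coproduct_def cong: ball_cong_simp)
    have FO: "F t i \<in> Ob A" if "i \<in> I" for i using Ft[OF that] f(2)[OF that] by simp
    show thesis by (rule coproduct_iso[OF Z(1)[of t] Y' FO]) (auto intro: that)
  qed
  ultimately have col: "is_colimit (ord_cat r (Field r)) A E Y (\<lambda>k. u \<cdot> e k t)"
    using colimit_iso_transfer fE by blast
  have "\<Phi> (u \<cdot> e k0 t)"
    by (rule trans[OF ts _ k0 _ col]) (use steps ZO in \<open>simp_all add: E\<close>)
  moreover have "h = u \<cdot> e k0 t"
  proof (rule coproduct_eqI[OF X h(1)])
    have k0t: "(k0, t) \<in> r" using r(2,3) least_in[OF k0] by simp
    show "u \<cdot> e k0 t \<in> hom A X Y" using u(2) e[OF k0t] Z(2) by (simp add: hom_iff)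
    fix i assume i: "i \<in> I"
    have "c k0 t i = f i" using i top k0 by (simp add: c_def is_least_def)
    moreover have "F t i = Cod A (f i)" using i top by (simp add: F_def)
    ultimately show "h \<cdot> \<iota> i = u \<cdot> e k0 t \<cdot> \<iota> i"
      using e1[OF k0t i] h(2)[OF i] u(2) e[OF k0t] \<eta>[OF i, of t] \<eta>[OF i, of k0] Z f(2)[OF i]
        comp_cong_left[OF u(3)[OF i], of "f i"] by (simp add: hom_iff)
  qed
  ultimately show ?thesis by simp
qed

end

section \<open>Enriched diagrams and their pointwise colimits\<close>

section \<open>Enriched diagrams\<close>

lemma bifunctorD:
  assumes "is_bifunctor A B D t T"
  shows "\<lbrakk>x \<in> Ob A; y \<in> Ob B\<rbrakk> \<Longrightarrow> t x y \<in> Ob D"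
    "\<lbrakk>f \<in> Ar A; g \<in> Ar B\<rbrakk> \<Longrightarrow> T f g \<in> Ar D"
    "\<lbrakk>f \<in> Ar A; g \<in> Ar B\<rbrakk> \<Longrightarrow> Dom D (T f g) = t (Dom A f) (Dom B g)"
    "\<lbrakk>f \<in> Ar A; g \<in> Ar B\<rbrakk> \<Longrightarrow> Cod D (T f g) = t (Cod A f) (Cod B g)"
    "\<lbrakk>x \<in> Ob A; y \<in> Ob B\<rbrakk> \<Longrightarrow> T (Idn A x) (Idn B y) = Idn D (t x y)"
    "\<lbrakk>f \<in> Ar A; f' \<in> Ar A; g \<in> Ar B; g' \<in> Ar B; Dom A f' = Cod A f; Dom B g' = Cod B g\<rbrakk>
      \<Longrightarrow> T f' g' \<cdot>\<^bsub>D\<^esub> T f g = T (f' \<cdot>\<^bsub>A\<^esub> f) (g' \<cdot>\<^bsub>B\<^esub> g)"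
  using assms by (simp_all add: is_bifunctor_def hom_iff)

text \<open>\<open>M\<close> is a plain category here, without cofibrations, so that the results can
  serve both left closed classes as well as the lifting argument.\<close>

locale enriched =
  fixes U :: "'s itself" and V :: "('v, 'w, 'z) moncat_scheme"
    and M :: "('o, 'a, 'y) cat_scheme" (structure)
    and T :: "('v, 'w, 'o, 'a) act" and C :: "('c, 'v, 'w) vcat"
  assumes universe: "universe U"
    and symmetric_monoidal: "symmetric_monoidal V"
    and monoidal_action: "monoidal_action V M T"
    and preserves: "K \<in> Ob V \<Longrightarrow> preserves_colimits U M M (act_left V T K)"
    and V_category: "V_category V C"
    and small_C: "small U (VOb C)"
begin

sublocale V: symmetric_monoidal V by (rule symmetric_monoidal)
sublocale T: monoidal_action V M T by (rule monoidal_action)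
sublocale C: V_category V C by (rule V_category)
sublocale M: category M using T.action by (simp add: is_bifunctor_def)

lemmas AAr_simps [simp] = bifunctorD[OF T.action]
lemmas TAr_simps [simp] = bifunctorD[OF V.tensor]

text \<open>Functoriality of the action adapted to right-associated composites: neighbouring actions
  are fused even when a further factor follows. With this, simplification settles most bookkeeping
  in the equations between structure maps.\<close>

lemma AAr_merge [simp]:
  assumes "f \<in> Ar V" "f' \<in> Ar V" "g \<in> Ar M" "g' \<in> Ar M" "Dom V f' = Cod V f" "Dom M g' = Cod M g"
    "h \<in> Ar M" "Cod M h = AOb T (Dom V f) (Dom M g)"
  shows "AAr T f' g' \<cdot> (AAr T f g \<cdot> h) = AAr T (f' \<cdot>\<^bsub>V\<^esub> f) (g' \<cdot> g) \<cdot> h"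
  using assms by (simp add: M.comp_assoc[symmetric] del: M.comp_assoc)

lemma TAr_merge [simp]:
  assumes "f \<in> Ar V" "f' \<in> Ar V" "g \<in> Ar V" "g' \<in> Ar V" "Dom V f' = Cod V f" "Dom V g' = Cod V g"
    "h \<in> Ar V" "Cod V h = TOb V (Dom V f) (Dom V g)"
  shows "TAr V f' g' \<cdot>\<^bsub>V\<^esub> (TAr V f g \<cdot>\<^bsub>V\<^esub> h) = TAr V (f' \<cdot>\<^bsub>V\<^esub> f) (g' \<cdot>\<^bsub>V\<^esub> g) \<cdot>\<^bsub>V\<^esub> h"
  using assms by (simp add: V.comp_assoc[symmetric] del: V.comp_assoc)

lemma AAssoc_simps [simp]:
  assumes "K \<in> Ob V" "L \<in> Ob V" "X \<in> Ob M"
  shows "AAssoc T K L X \<in> Ar M" "Dom M (AAssoc T K L X) = AOb T (TOb V K L) X"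
    "Cod M (AAssoc T K L X) = AOb T K (AOb T L X)"
  using T.AAssoc_in[OF assms] by (auto simp: hom_iff)

lemma TAssoc_simps [simp]:
  assumes "K \<in> Ob V" "L \<in> Ob V" "X \<in> Ob V"
  shows "TAssoc V K L X \<in> Ar V" "Dom V (TAssoc V K L X) = TOb V (TOb V K L) X"
    "Cod V (TAssoc V K L X) = TOb V K (TOb V L X)"
  using V.TAssoc_in[OF assms] by (auto simp: hom_iff)

lemma Symm_simps [simp]:
  assumes "K \<in> Ob V" "L \<in> Ob V"
  shows "Symm V K L \<in> Ar V" "Dom V (Symm V K L) = TOb V K L" "Cod V (Symm V K L) = TOb V L K"
  using V.Symm_in[OF assms] by (auto simp: hom_iff)

lemma unit_simps [simp]:
  "Unit V \<in> Ob V"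
  "K \<in> Ob V \<Longrightarrow> LUnit V K \<in> Ar V" "K \<in> Ob V \<Longrightarrow> Dom V (LUnit V K) = TOb V (Unit V) K"
  "K \<in> Ob V \<Longrightarrow> Cod V (LUnit V K) = K"
  "K \<in> Ob V \<Longrightarrow> RUnit V K \<in> Ar V" "K \<in> Ob V \<Longrightarrow> Dom V (RUnit V K) = TOb V K (Unit V)"
  "K \<in> Ob V \<Longrightarrow> Cod V (RUnit V K) = K"
  "X \<in> Ob M \<Longrightarrow> AUnit T X \<in> Ar M" "X \<in> Ob M \<Longrightarrow> Dom M (AUnit T X) = AOb T (Unit V) X"
  "X \<in> Ob M \<Longrightarrow> Cod M (AUnit T X) = X"
  using V.LUnit_in[of K] V.RUnit_in[of K] T.AUnit_in[of X] V.Unit_in by (auto simp: hom_iff)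

lemma C_simps [simp]:
  "\<lbrakk>x \<in> VOb C; y \<in> VOb C\<rbrakk> \<Longrightarrow> VHom C x y \<in> Ob V"
  "\<lbrakk>x \<in> VOb C; y \<in> VOb C; z \<in> VOb C\<rbrakk> \<Longrightarrow> VComp C x y z \<in> Ar V"
  "\<lbrakk>x \<in> VOb C; y \<in> VOb C; z \<in> VOb C\<rbrakk> \<Longrightarrow> Dom V (VComp C x y z) = TOb V (VHom C y z) (VHom C x y)"
  "\<lbrakk>x \<in> VOb C; y \<in> VOb C; z \<in> VOb C\<rbrakk> \<Longrightarrow> Cod V (VComp C x y z) = VHom C x z"
  "x \<in> VOb C \<Longrightarrow> VId C x \<in> Ar V" "x \<in> VOb C \<Longrightarrow> Dom V (VId C x) = Unit V"
  "x \<in> VOb C \<Longrightarrow> Cod V (VId C x) = VHom C x x"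
  using C.VHom_in[of x y] C.VComp_in[of x y z] C.VId_in[of x] by (auto simp: hom_iff)

abbreviation lact :: "'v \<Rightarrow> 'a \<Rightarrow> 'a" where "lact K f \<equiv> AAr T (Idn V K) f"

lemma AAssoc_nat:
  assumes "f \<in> Ar V" "g \<in> Ar V" "h \<in> Ar M"
  shows "AAssoc T (Cod V f) (Cod V g) (Cod M h) \<cdot> AAr T (TAr V f g) h
    = AAr T f (AAr T g h) \<cdot> AAssoc T (Dom V f) (Dom V g) (Dom M h)"
  using T.AAssoc_natural[of f "Dom V f" "Cod V f" g "Dom V g" "Cod V g" h "Dom M h" "Cod M h"] assms
  by (simp add: hom_iff)

context
  fixes J :: "('j, 'k, 'x) cat_scheme" and D L \<iota> K
  assumes J: "small_category U J" and D: "is_functor J M D" and L: "is_colimit J M D L \<iota>"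
    and K: "K \<in> Ob V"
begin

text \<open>This is how preservation of colimits is used: maps out of \<open>K \<otimes> L\<close>
  are compared (\<open>lact_eqI\<close>) and constructed (\<open>lact_map\<close>) on the objects
  \<open>K \<otimes> D j\<close>.\<close>

lemma lact_colimit: "is_colimit J M (funct_comp (act_left V T K) D) (AOb T K L) (\<lambda>j. lact K (\<iota> j))"
  using preserves_colimits_small[OF preserves[OF K] J D L M.category_axioms M.category_axioms]
  by (simp add: act_left_def)

lemma lact_functor: "is_functor J M (funct_comp (act_left V T K) D)"
  using D K by (auto simp: is_functor_def funct_comp_def act_left_def hom_iff)

lemma lact_eqI:
  assumes "f \<in> hom M (AOb T K L) n" "g \<in> hom M (AOb T K L) n"
    "\<And>j. j \<in> Ob J \<Longrightarrow> f \<cdot> lact K (\<iota> j) = g \<cdot> lact K (\<iota> j)"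
  shows "f = g"
  using M.colimit_eqI[OF lact_colimit lact_functor assms] .

lemma lact_map:
  assumes "n \<in> Ob M" "\<And>j. j \<in> Ob J \<Longrightarrow> \<tau> j \<in> hom M (AOb T K (FOb D j)) n"
    "\<And>u. u \<in> Ar J \<Longrightarrow> \<tau> (Cod J u) \<cdot> lact K (FAr D u) = \<tau> (Dom J u)"
  obtains h where "h \<in> hom M (AOb T K L) n" "\<And>j. j \<in> Ob J \<Longrightarrow> h \<cdot> lact K (\<iota> j) = \<tau> j"
proof -
  have "is_cocone J M (funct_comp (act_left V T K) D) n \<tau>"
    using assms by (auto simp: is_cocone_def funct_comp_def act_left_def)
  from M.colimit_map[OF lact_colimit this] that show thesis by blast
qed

end

abbreviation DC where "DC \<equiv> diagram_cat V C M T"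

definition cmp :: "('c, 'o, 'a) diagram_map \<Rightarrow> 'c \<Rightarrow> 'a" where "cmp f = snd (snd f)"

definition dmap where "dmap X Y \<tau> = (X, Y, restrict \<tau> (VOb C))"

lemma diagramD:
  assumes "is_diagram V C M T X"
  shows "c \<in> VOb C \<Longrightarrow> DOb X c \<in> Ob M"
    "\<lbrakk>c \<in> VOb C; d \<in> VOb C\<rbrakk> \<Longrightarrow> DAct X c d \<in> Ar M"
    "\<lbrakk>c \<in> VOb C; d \<in> VOb C\<rbrakk> \<Longrightarrow> Dom M (DAct X c d) = AOb T (VHom C c d) (DOb X c)"
    "\<lbrakk>c \<in> VOb C; d \<in> VOb C\<rbrakk> \<Longrightarrow> Cod M (DAct X c d) = DOb X d"
    "\<lbrakk>x \<in> VOb C; y \<in> VOb C; z \<in> VOb C\<rbrakk> \<Longrightarrow>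
        DAct X x z \<cdot> AAr T (VComp C x y z) (Idn M (DOb X x))
        = DAct X y z \<cdot> (lact (VHom C y z) (DAct X x y) \<cdot> AAssoc T (VHom C y z) (VHom C x y) (DOb X x))"
    "x \<in> VOb C \<Longrightarrow> DAct X x x \<cdot> AAr T (VId C x) (Idn M (DOb X x)) = AUnit T (DOb X x)"
proof -
  note X = assms[unfolded is_diagram_def]
  show 1: "DOb X c \<in> Ob M" if "c \<in> VOb C" for c using X that by blast
  show 2: "DAct X c d \<in> Ar M" "Dom M (DAct X c d) = AOb T (VHom C c d) (DOb X c)" "Cod M (DAct X c d) = DOb X d"
    if "c \<in> VOb C" "d \<in> VOb C" for c d using X that by (auto simp: hom_iff)
  show "DAct X x z \<cdot> AAr T (VComp C x y z) (Idn M (DOb X x))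
        = DAct X y z \<cdot> (lact (VHom C y z) (DAct X x y) \<cdot> AAssoc T (VHom C y z) (VHom C x y) (DOb X x))"
    if "x \<in> VOb C" "y \<in> VOb C" "z \<in> VOb C" for x y z
  proof -
    have "DAct X x z \<cdot> AAr T (VComp C x y z) (Idn M (DOb X x))
        = DAct X y z \<cdot> lact (VHom C y z) (DAct X x y) \<cdot> AAssoc T (VHom C y z) (VHom C x y) (DOb X x)"
      using X that by blast
    then show ?thesis using that 1 2 by simp
  qed
  show "DAct X x x \<cdot> AAr T (VId C x) (Idn M (DOb X x)) = AUnit T (DOb X x)" if "x \<in> VOb C" for x
    using X that by blast
qed

lemma diagramI:
  assumes "\<And>c. c \<in> VOb C \<Longrightarrow> x c \<in> Ob M"
    "\<And>c d. \<lbrakk>c \<in> VOb C; d \<in> VOb C\<rbrakk> \<Longrightarrow> e c d \<in> hom M (AOb T (VHom C c d) (x c)) (x d)"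
    "\<And>a b c. \<lbrakk>a \<in> VOb C; b \<in> VOb C; c \<in> VOb C\<rbrakk> \<Longrightarrow>
       e a c \<cdot> AAr T (VComp C a b c) (Idn M (x a))
        = e b c \<cdot> (lact (VHom C b c) (e a b) \<cdot> AAssoc T (VHom C b c) (VHom C a b) (x a))"
    "\<And>c. c \<in> VOb C \<Longrightarrow> e c c \<cdot> AAr T (VId C c) (Idn M (x c)) = AUnit T (x c)"
  shows "is_diagram V C M T \<lparr>DOb = restrict x (VOb C), DAct = restrict2 e (VOb C)\<rparr>"
  unfolding is_diagram_def
  using assms by (auto simp: restrict2_def hom_iff intro!: ext)

lemma DC_simps [simp]:
  "Ob DC = Collect (is_diagram V C M T)" "Ar DC = Collect (is_diagram_map V C M T)"
  by (simp_all add: diagram_cat_def)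

lemma dmapD:
  assumes "f \<in> Ar DC"
  shows "is_diagram V C M T (Dom DC f)" "is_diagram V C M T (Cod DC f)"
    "c \<in> VOb C \<Longrightarrow> cmp f c \<in> Ar M" "c \<in> VOb C \<Longrightarrow> Dom M (cmp f c) = DOb (Dom DC f) c"
    "c \<in> VOb C \<Longrightarrow> Cod M (cmp f c) = DOb (Cod DC f) c"
    "\<lbrakk>c \<in> VOb C; d \<in> VOb C\<rbrakk> \<Longrightarrow>
       cmp f d \<cdot> DAct (Dom DC f) c d = DAct (Cod DC f) c d \<cdot> lact (VHom C c d) (cmp f c)"
  using assms by (cases f; simp add: is_diagram_map_def diagram_cat_def cmp_def hom_iff)+

lemma dmap_eqI:
  assumes "f \<in> hom DC X Y" "g \<in> hom DC X Y" "\<And>c. c \<in> VOb C \<Longrightarrow> cmp f c = cmp g c"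
  shows "f = g"
proof -
  obtain \<tau> where f: "f = (X, Y, \<tau>)" "\<tau> \<in> extensional (VOb C)"
    using assms(1) by (cases f) (auto simp: hom_iff is_diagram_map_def diagram_cat_def)
  obtain \<sigma> where g: "g = (X, Y, \<sigma>)" "\<sigma> \<in> extensional (VOb C)"
    using assms(2) by (cases g) (auto simp: hom_iff is_diagram_map_def diagram_cat_def)
  have "\<tau> = \<sigma>" by (rule extensionalityI[OF f(2) g(2)]) (use assms(3) in \<open>simp add: f g cmp_def\<close>)
  then show ?thesis by (simp add: f g)
qed

lemma dmap_in:
  assumes "is_diagram V C M T X" "is_diagram V C M T Y"
    "\<And>c. c \<in> VOb C \<Longrightarrow> \<tau> c \<in> hom M (DOb X c) (DOb Y c)"
    "\<And>c d. \<lbrakk>c \<in> VOb C; d \<in> VOb C\<rbrakk> \<Longrightarrow> \<tau> d \<cdot> DAct X c d = DAct Y c d \<cdot> lact (VHom C c d) (\<tau> c)"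
  shows "dmap X Y \<tau> \<in> hom DC X Y"
  using assms by (auto simp: hom_iff is_diagram_map_def diagram_cat_def dmap_def)

lemma cmp_dmap [simp]: "c \<in> VOb C \<Longrightarrow> cmp (dmap X Y \<tau>) c = \<tau> c"
  by (simp add: cmp_def dmap_def)

lemma cmp_comp [simp]: "c \<in> VOb C \<Longrightarrow> cmp (g \<cdot>\<^bsub>DC\<^esub> f) c = cmp g c \<cdot> cmp f c"
  by (cases f; cases g) (simp add: cmp_def diagram_cat_def)

lemma cmp_Idn [simp]: "c \<in> VOb C \<Longrightarrow> cmp (Idn DC X) c = Idn M (DOb X c)"
  by (simp add: cmp_def diagram_cat_def)

lemma category_DC: "category DC"
proof
  show "Dom DC f \<in> Ob DC" "Cod DC f \<in> Ob DC" if "f \<in> Ar DC" for f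
    using dmapD[OF that] by auto
  show I: "Idn DC X \<in> hom DC X X" if X: "X \<in> Ob DC" for X
  proof -
    note D = diagramD[OF X[simplified]]
    have "dmap X X (\<lambda>c. Idn M (DOb X c)) \<in> hom DC X X"
      by (rule dmap_in) (use X D in \<open>auto simp: hom_iff\<close>)
    then show ?thesis by (simp add: diagram_cat_def dmap_def)
  qed
  show cp: "g \<cdot>\<^bsub>DC\<^esub> f \<in> hom DC X Z" if f: "f \<in> hom DC X Y" and g: "g \<in> hom DC Y Z" for f g X Y Z
  proof -
    have f': "f \<in> Ar DC" "Dom DC f = X" "Cod DC f = Y" and g': "g \<in> Ar DC" "Dom DC g = Y" "Cod DC g = Z"
      using f g by (auto simp: hom_iff)
    note F = dmapD[OF f'(1), unfolded f'] and G = dmapD[OF g'(1), unfolded g']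
    note X = diagramD[OF F(1)] and Y = diagramD[OF F(2)] and Z = diagramD[OF G(2)]
    have "dmap X Z (\<lambda>c. cmp g c \<cdot> cmp f c) \<in> hom DC X Z"
    proof (rule dmap_in[OF F(1) G(2)])
      fix c d assume c: "c \<in> VOb C" "d \<in> VOb C"
      have "cmp g d \<cdot> cmp f d \<cdot> DAct X c d = cmp g d \<cdot> DAct Y c d \<cdot> lact (VHom C c d) (cmp f c)"
        using F(3-6) G(3-5) X(1-4) Y(1-4) c by simp
      also have "\<dots> = DAct Z c d \<cdot> lact (VHom C c d) (cmp g c \<cdot> cmp f c)"
        using F(3-5) G(3-5) X(1-4) Y(1-4) Z(1-4) c
          M.comp_cong_left[OF G(6)[OF c], of "lact (VHom C c d) (cmp f c)"] by simp
      finally show "cmp g d \<cdot> cmp f d \<cdot> DAct X c d = DAct Z c d \<cdot> lact (VHom C c d) (cmp g c \<cdot> cmp f c)" .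
    qed (use F(3-5) G(3-5) in \<open>simp add: hom_iff\<close>)
    moreover have "g \<cdot>\<^bsub>DC\<^esub> f = dmap X Z (\<lambda>c. cmp g c \<cdot> cmp f c)"
      using f' g' by (cases f; cases g) (simp add: diagram_cat_def dmap_def cmp_def)
    ultimately show ?thesis by simp
  qed
  show "Idn DC Y \<cdot>\<^bsub>DC\<^esub> f = f" if f: "f \<in> hom DC X Y" for f X Y
  proof (rule dmap_eqI[OF cp[OF f I] f])
    show Y: "Y \<in> Ob DC" using f dmapD(2)[of f] by (auto simp: hom_iff)
    show "cmp (Idn DC Y \<cdot>\<^bsub>DC\<^esub> f) c = cmp f c" if "c \<in> VOb C" for c
      using that f dmapD[of f] by (simp add: hom_iff)
  qed
  show "f \<cdot>\<^bsub>DC\<^esub> Idn DC X = f" if f: "f \<in> hom DC X Y" for f X Y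
  proof (rule dmap_eqI[OF cp[OF I f] f])
    show X: "X \<in> Ob DC" using f dmapD(1)[of f] by (auto simp: hom_iff)
    show "cmp (f \<cdot>\<^bsub>DC\<^esub> Idn DC X) c = cmp f c" if "c \<in> VOb C" for c
      using that f dmapD[of f] by (simp add: hom_iff)
  qed
  show "(h \<cdot>\<^bsub>DC\<^esub> g) \<cdot>\<^bsub>DC\<^esub> f = h \<cdot>\<^bsub>DC\<^esub> (g \<cdot>\<^bsub>DC\<^esub> f)"
    if f: "f \<in> hom DC W X" and g: "g \<in> hom DC X Y" and h: "h \<in> hom DC Y Z" for f g h W X Y Z
  proof (rule dmap_eqI[OF cp[OF f cp[OF g h]] cp[OF cp[OF f g] h]])
    show "cmp (h \<cdot>\<^bsub>DC\<^esub> g \<cdot>\<^bsub>DC\<^esub> f) c = cmp (h \<cdot>\<^bsub>DC\<^esub> (g \<cdot>\<^bsub>DC\<^esub> f)) c" if "c \<in> VOb C" for c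
      using that f g h dmapD(3-5)[of f] dmapD(3-5)[of g] dmapD(3-5)[of h] by (simp add: hom_iff)
  qed
qed

sublocale DC: category DC by (rule category_DC)

definition ev :: "'c \<Rightarrow> ('j, 'k, ('c, 'o, 'a) diagram, ('c, 'o, 'a) diagram_map) funct \<Rightarrow> ('j, 'k, 'o, 'a) funct"
  where "ev c D = \<lparr>FOb = \<lambda>j. DOb (FOb D j) c, FAr = \<lambda>u. cmp (FAr D u) c\<rparr>"

lemma ev_simps [simp]: "FOb (ev c D) j = DOb (FOb D j) c" "FAr (ev c D) u = cmp (FAr D u) c"
  by (simp_all add: ev_def)

lemma ev_functor:
  assumes "is_functor J DC D" "c \<in> VOb C" shows "is_functor J M (ev c D)"
  unfolding is_functor_def
proof (intro conjI ballI impI)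
  note F = assms(1)[unfolded is_functor_def]
  show "category J" "category M" using F M.category_axioms by auto
  have a: "FAr D f \<in> Ar DC" "Dom DC (FAr D f) = FOb D (Dom J f)" "Cod DC (FAr D f) = FOb D (Cod J f)"
    if "f \<in> Ar J" for f using F that unfolding hom_iff by blast+
  show "FOb (ev c D) j \<in> Ob M" if "j \<in> Ob J" for j
    using F that assms(2) diagramD(1)[of "FOb D j" c] by simp
  show "FAr (ev c D) u \<in> hom M (FOb (ev c D) (Dom J u)) (FOb (ev c D) (Cod J u))" if "u \<in> Ar J" for u
    using a[OF that] dmapD[OF a(1)[OF that]] assms(2) by (simp add: hom_iff)
  show "FAr (ev c D) (Idn J j) = Idn M (FOb (ev c D) j)" if "j \<in> Ob J" for j
    using F that assms(2) by simp
  show "FAr (ev c D) (Comp J v u) = FAr (ev c D) v \<cdot> FAr (ev c D) u"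
    if "u \<in> Ar J" "v \<in> Ar J" "Cod J u = Dom J v" for u v
    using F that assms(2) by simp
qed

context
  fixes J :: "('j, 'k, 'x) cat_scheme" and D
  assumes J: "small_category U J" and D: "is_functor J DC D"
begin

lemma functor_objects:
  "j \<in> Ob J \<Longrightarrow> is_diagram V C M T (FOb D j)"
  "u \<in> Ar J \<Longrightarrow> FAr D u \<in> Ar DC" "u \<in> Ar J \<Longrightarrow> Dom DC (FAr D u) = FOb D (Dom J u)"
  "u \<in> Ar J \<Longrightarrow> Cod DC (FAr D u) = FOb D (Cod J u)"
  using D unfolding is_functor_def hom_iff by (simp_all del: DC_simps(2))

lemma index_category: "category J"
  using D by (simp add: is_functor_def)

lemmas index_Ob = category.Dom_in[OF index_category] category.Cod_in[OF index_category]

lemma cocone_dmap: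
  assumes "is_cocone J DC D n \<tau>" "c \<in> VOb C"
  shows "is_cocone J M (ev c D) (DOb n c) (\<lambda>j. cmp (\<tau> j) c)"
proof -
  have n: "is_diagram V C M T n" and t: "\<And>j. j \<in> Ob J \<Longrightarrow> \<tau> j \<in> hom DC (FOb D j) n"
    and c: "\<And>u. u \<in> Ar J \<Longrightarrow> \<tau> (Cod J u) \<cdot>\<^bsub>DC\<^esub> FAr D u = \<tau> (Dom J u)"
    using assms(1) by (auto simp: is_cocone_def)
  have "cmp (\<tau> (Cod J u)) c \<cdot> cmp (FAr D u) c = cmp (\<tau> (Dom J u)) c" if "u \<in> Ar J" for u
    using c[OF that] assms(2) cmp_comp[OF assms(2), of "\<tau> (Cod J u)" "FAr D u"] by simp
  then show ?thesis
    unfolding is_cocone_def using diagramD(1)[OF n assms(2)] dmapD(3-5)[of "\<tau> _" c] t assms(2)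
    by (simp add: hom_iff)
qed

text \<open>Since \<open>C(c, d) \<otimes> -\<close> preserves the colimit at \<open>c\<close>, the
  structure maps are induced by those of the diagrams \<open>D j\<close>. The associativity law is
  tested after tensoring the colimit cocone with \<open>C(b, c) \<otimes> C(a, b)\<close>, the unit
  law after tensoring it with the unit.\<close>

lemma pointwise_colimit:
  assumes L: "\<And>c. c \<in> VOb C \<Longrightarrow> is_colimit J M (ev c D) (L c) (\<iota> c)"
  obtains X \<kappa> where "is_colimit J DC D X \<kappa>"
    "\<And>c. c \<in> VOb C \<Longrightarrow> DOb X c = L c" "\<And>c j. \<lbrakk>c \<in> VOb C; j \<in> Ob J\<rbrakk> \<Longrightarrow> cmp (\<kappa> j) c = \<iota> c j"
proof -
  note Dj = functor_objects
  note evF = ev_functor[OF D]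
  have LO: "L c \<in> Ob M" if "c \<in> VOb C" for c
    using L[OF that] by (simp add: is_colimit_def is_cocone_def)
  have \<iota>h: "\<iota> c j \<in> Ar M" "Dom M (\<iota> c j) = DOb (FOb D j) c" "Cod M (\<iota> c j) = L c"
    if "c \<in> VOb C" "j \<in> Ob J" for c j
    using L[OF that(1)] that(2) by (simp_all add: is_colimit_def is_cocone_def hom_iff)
  have \<iota>c: "\<iota> c (Cod J u) \<cdot> cmp (FAr D u) c = \<iota> c (Dom J u)" if "c \<in> VOb C" "u \<in> Ar J" for c u
    using L[OF that(1)] that(2) by (simp add: is_colimit_def is_cocone_def)
  have "\<exists>e. e \<in> hom M (AOb T (VHom C c d) (L c)) (L d) \<and>
      (\<forall>j\<in>Ob J. e \<cdot> lact (VHom C c d) (\<iota> c j) = \<iota> d j \<cdot> DAct (FOb D j) c d)"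
    if c: "c \<in> VOb C" "d \<in> VOb C" for c d
  proof -
    obtain e where "e \<in> hom M (AOb T (VHom C c d) (L c)) (L d)"
      "\<And>j. j \<in> Ob J \<Longrightarrow> e \<cdot> lact (VHom C c d) (\<iota> c j) = \<iota> d j \<cdot> DAct (FOb D j) c d"
    proof (rule lact_map[OF J evF[OF c(1)] L[OF c(1)], of "VHom C c d" "L d" "\<lambda>j. \<iota> d j \<cdot> DAct (FOb D j) c d"])
      show "\<iota> d j \<cdot> DAct (FOb D j) c d \<in> hom M (AOb T (VHom C c d) (FOb (ev c D) j)) (L d)" if j: "j \<in> Ob J" for j
        using diagramD(1-4)[OF Dj(1)[OF j]] c \<iota>h[OF c(2) j] by (simp add: hom_iff)
      fix u assume u: "u \<in> Ar J"
      note uO = index_Ob[OF u]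
      note m = dmapD(3-)[OF Dj(2)[OF u]]
      have "\<iota> d (Cod J u) \<cdot> DAct (FOb D (Cod J u)) c d \<cdot> lact (VHom C c d) (cmp (FAr D u) c)
        = \<iota> d (Cod J u) \<cdot> (cmp (FAr D u) d \<cdot> DAct (FOb D (Dom J u)) c d)"
        using m c \<iota>h[OF c(2) uO(2)] Dj(3,4)[OF u] diagramD(1-4)[OF Dj(1)[OF uO(2)]] by simp
      also have "\<dots> = \<iota> d (Dom J u) \<cdot> DAct (FOb D (Dom J u)) c d"
        using m(1-3) c \<iota>h[OF c(2) uO(2)] Dj(3,4)[OF u] diagramD(1-4)[OF Dj(1)[OF uO(1)]]
          M.comp_cong_left[OF \<iota>c[OF c(2) u], of "DAct (FOb D (Dom J u)) c d"] by simp
      finally show "\<iota> d (Cod J u) \<cdot> DAct (FOb D (Cod J u)) c d \<cdot> lact (VHom C c d) (FAr (ev c D) u)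
        = \<iota> d (Dom J u) \<cdot> DAct (FOb D (Dom J u)) c d" by simp
    qed (use c LO in auto)
    then show ?thesis by blast
  qed
  then obtain e where e: "\<And>c d. \<lbrakk>c \<in> VOb C; d \<in> VOb C\<rbrakk> \<Longrightarrow> e c d \<in> hom M (AOb T (VHom C c d) (L c)) (L d)"
    and e\<iota>: "\<And>c d j. \<lbrakk>c \<in> VOb C; d \<in> VOb C; j \<in> Ob J\<rbrakk> \<Longrightarrow>
      e c d \<cdot> lact (VHom C c d) (\<iota> c j) = \<iota> d j \<cdot> DAct (FOb D j) c d" by metis
  have eA: "e c d \<in> Ar M" "Dom M (e c d) = AOb T (VHom C c d) (L c)" "Cod M (e c d) = L d"
    if "c \<in> VOb C" "d \<in> VOb C" for c d using e[OF that] by (simp_all add: hom_iff)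
  define X where "X = \<lparr>DOb = restrict L (VOb C), DAct = restrict2 e (VOb C)\<rparr>"
  have XD: "DOb X c = L c" if "c \<in> VOb C" for c using that by (simp add: X_def)
  have XA: "DAct X c d = e c d" if "c \<in> VOb C" "d \<in> VOb C" for c d
    using that by (simp add: X_def restrict2_def)
  have X: "is_diagram V C M T X"
    unfolding X_def
  proof (rule diagramI)
    fix a b c assume abc: "a \<in> VOb C" "b \<in> VOb C" "c \<in> VOb C"
    show "e a c \<cdot> AAr T (VComp C a b c) (Idn M (L a))
        = e b c \<cdot> (lact (VHom C b c) (e a b) \<cdot> AAssoc T (VHom C b c) (VHom C a b) (L a))"
    proof (rule lact_eqI[OF J evF[OF abc(1)] L[OF abc(1)]])
      show "TOb V (VHom C b c) (VHom C a b) \<in> Ob V" using abc by simp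
      show "e a c \<cdot> AAr T (VComp C a b c) (Idn M (L a))
          \<in> hom M (AOb T (TOb V (VHom C b c) (VHom C a b)) (L a)) (L c)"
        using abc LO eA by (simp add: hom_iff)
      show "e b c \<cdot> (lact (VHom C b c) (e a b) \<cdot> AAssoc T (VHom C b c) (VHom C a b) (L a))
          \<in> hom M (AOb T (TOb V (VHom C b c) (VHom C a b)) (L a)) (L c)"
        using abc LO eA by (simp add: hom_iff)
      fix j assume j: "j \<in> Ob J"
      note Y = diagramD[OF Dj(1)[OF j]]
      let ?Y = "FOb D j"
      let ?P = "AAssoc T (VHom C b c) (VHom C a b)"
      have 1: "lact (TOb V (VHom C b c) (VHom C a b)) (\<iota> a j)
          = AAr T (TAr V (Idn V (VHom C b c)) (Idn V (VHom C a b))) (\<iota> a j)"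
        using abc by simp
      have nat: "?P (L a) \<cdot> lact (TOb V (VHom C b c) (VHom C a b)) (\<iota> a j)
          = lact (VHom C b c) (lact (VHom C a b) (\<iota> a j)) \<cdot> ?P (DOb ?Y a)"
        unfolding 1 using AAssoc_nat[of "Idn V (VHom C b c)" "Idn V (VHom C a b)" "\<iota> a j"] abc \<iota>h[OF abc(1) j]
        by simp
      have "e a c \<cdot> AAr T (VComp C a b c) (Idn M (L a)) \<cdot> lact (TOb V (VHom C b c) (VHom C a b)) (\<iota> a j)
          = e a c \<cdot> lact (VHom C a c) (\<iota> a j) \<cdot> AAr T (VComp C a b c) (Idn M (DOb ?Y a))"
        using abc LO eA \<iota>h[OF abc(1) j] Y(1) by simp
      also have "\<dots> = \<iota> c j \<cdot> (DAct ?Y a c \<cdot> AAr T (VComp C a b c) (Idn M (DOb ?Y a)))"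
        using abc Y(1-4) \<iota>h[OF abc(3) j] by (simp add: e\<iota> j)
      also have "\<dots> = \<iota> c j \<cdot> DAct ?Y b c \<cdot> (lact (VHom C b c) (DAct ?Y a b) \<cdot> ?P (DOb ?Y a))"
        unfolding Y(5)[OF abc] using abc Y(1-4) \<iota>h[OF abc(3) j] by simp
      also have "\<dots> = e b c \<cdot> lact (VHom C b c) (\<iota> b j \<cdot> DAct ?Y a b) \<cdot> ?P (DOb ?Y a)"
        unfolding e\<iota>[OF abc(2,3) j, symmetric] using abc Y(1-4) \<iota>h[OF abc(2) j] eA by simp
      also have "\<dots> = e b c \<cdot> lact (VHom C b c) (e a b) \<cdot> (lact (VHom C b c) (lact (VHom C a b) (\<iota> a j)) \<cdot> ?P (DOb ?Y a))"
        unfolding e\<iota>[OF abc(1,2) j, symmetric] using abc Y(1-4) \<iota>h[OF abc(1) j] eA LO by simp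
      also have "\<dots> = e b c \<cdot> (lact (VHom C b c) (e a b) \<cdot> ?P (L a)) \<cdot> lact (TOb V (VHom C b c) (VHom C a b)) (\<iota> a j)"
        unfolding nat[symmetric] using abc Y(1-4) \<iota>h[OF abc(1) j] eA LO by simp
      finally show "e a c \<cdot> AAr T (VComp C a b c) (Idn M (L a)) \<cdot> lact (TOb V (VHom C b c) (VHom C a b)) (\<iota> a j)
        = e b c \<cdot> (lact (VHom C b c) (e a b) \<cdot> ?P (L a)) \<cdot> lact (TOb V (VHom C b c) (VHom C a b)) (\<iota> a j)" .
    qed
  next
    fix c assume c: "c \<in> VOb C"
    show "e c c \<cdot> AAr T (VId C c) (Idn M (L c)) = AUnit T (L c)"
    proof (rule lact_eqI[OF J evF[OF c] L[OF c]])
      fix j assume j: "j \<in> Ob J"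
      note Y = diagramD[OF Dj(1)[OF j]]
      have "e c c \<cdot> AAr T (VId C c) (Idn M (L c)) \<cdot> lact (Unit V) (\<iota> c j)
        = e c c \<cdot> lact (VHom C c c) (\<iota> c j) \<cdot> AAr T (VId C c) (Idn M (DOb (FOb D j) c))"
        using c LO eA \<iota>h[OF c j] Y(1) by simp
      also have "\<dots> = \<iota> c j \<cdot> AUnit T (DOb (FOb D j) c)"
        using c Y(1-4) \<iota>h[OF c j] by (simp add: e\<iota> j Y(6))
      also have "\<dots> = AUnit T (L c) \<cdot> lact (Unit V) (\<iota> c j)"
        using T.AUnit_natural[of "\<iota> c j" "DOb (FOb D j) c" "L c"] \<iota>h[OF c j] by (simp add: hom_iff)
      finally show "e c c \<cdot> AAr T (VId C c) (Idn M (L c)) \<cdot> lact (Unit V) (\<iota> c j) = AUnit T (L c) \<cdot> lact (Unit V) (\<iota> c j)" .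
    qed (use c LO eA in \<open>auto simp: hom_iff\<close>)
  qed (use LO e in auto)
  define \<kappa> where "\<kappa> j = dmap (FOb D j) X (\<lambda>c. \<iota> c j)" for j
  have \<kappa>h: "\<kappa> j \<in> hom DC (FOb D j) X" if j: "j \<in> Ob J" for j
    unfolding \<kappa>_def
    by (rule dmap_in) (use Dj(1)[OF j] X \<iota>h[OF _ j] j in \<open>simp_all add: XD XA hom_iff e\<iota>\<close>)
  have \<kappa>\<iota>: "cmp (\<kappa> j) c = \<iota> c j" if "c \<in> VOb C" for c j using that by (simp add: \<kappa>_def)
  have "is_colimit J DC D X \<kappa>"
  proof (rule DC.is_colimitI)
    show "is_cocone J DC D X \<kappa>"
      unfolding is_cocone_def
    proof (intro conjI ballI)
      fix u assume u: "u \<in> Ar J"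
      note uO = index_Ob[OF u]
      have "FAr D u \<in> hom DC (FOb D (Dom J u)) (FOb D (Cod J u))"
        using Dj(2-)[OF u] by (simp add: hom_iff)
      then have 1: "\<kappa> (Cod J u) \<cdot>\<^bsub>DC\<^esub> FAr D u \<in> hom DC (FOb D (Dom J u)) X"
        using \<kappa>h[OF uO(2)] by (rule DC.Comp_in)
      show "\<kappa> (Cod J u) \<cdot>\<^bsub>DC\<^esub> FAr D u = \<kappa> (Dom J u)"
        by (rule dmap_eqI[OF 1 \<kappa>h[OF uO(1)]]) (simp add: \<kappa>\<iota> \<iota>c u)
    qed (use X \<kappa>h in auto)
    { fix n \<tau> assume n: "is_cocone J DC D n \<tau>"
      have nd: "is_diagram V C M T n" and t: "\<And>j. j \<in> Ob J \<Longrightarrow> \<tau> j \<in> hom DC (FOb D j) n"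
        using n by (auto simp: is_cocone_def)
      note N = diagramD[OF nd]
      have "\<exists>h. h \<in> hom M (L c) (DOb n c) \<and> (\<forall>j\<in>Ob J. h \<cdot> \<iota> c j = cmp (\<tau> j) c)" if c: "c \<in> VOb C" for c
        by (rule M.colimit_map[OF L[OF c] cocone_dmap[OF n c]]) blast
      then obtain h where h: "\<And>c. c \<in> VOb C \<Longrightarrow> h c \<in> hom M (L c) (DOb n c)"
        "\<And>c j. \<lbrakk>c \<in> VOb C; j \<in> Ob J\<rbrakk> \<Longrightarrow> h c \<cdot> \<iota> c j = cmp (\<tau> j) c" by metis
      have hA: "h c \<in> Ar M" "Dom M (h c) = L c" "Cod M (h c) = DOb n c" if "c \<in> VOb C" for c
        using h(1)[OF that] by (simp_all add: hom_iff)
      have H: "dmap X n h \<in> hom DC X n"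
      proof (rule dmap_in[OF X nd])
        fix c d assume c: "c \<in> VOb C" "d \<in> VOb C"
        have "h d \<cdot> e c d = DAct n c d \<cdot> lact (VHom C c d) (h c)"
        proof (rule lact_eqI[OF J evF[OF c(1)] L[OF c(1)]])
          fix j assume j: "j \<in> Ob J"
          note Y = diagramD[OF Dj(1)[OF j]]
          have tj: "\<tau> j \<in> Ar DC" "Dom DC (\<tau> j) = FOb D j" "Cod DC (\<tau> j) = n" using t[OF j] by (auto simp: hom_iff)
          note tm = dmapD[OF tj(1), unfolded tj]
          have "h d \<cdot> e c d \<cdot> lact (VHom C c d) (\<iota> c j) = h d \<cdot> \<iota> d j \<cdot> DAct (FOb D j) c d"
            using e\<iota>[OF c j] hA[OF c(2)] eA[OF c] \<iota>h[OF c(1) j] \<iota>h[OF c(2) j] Y(1-4) c by simp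
          also have "\<dots> = DAct n c d \<cdot> lact (VHom C c d) (h c \<cdot> \<iota> c j)"
            using tm(6)[OF c] by (simp add: h(2) c j)
          also have "\<dots> = DAct n c d \<cdot> lact (VHom C c d) (h c) \<cdot> lact (VHom C c d) (\<iota> c j)"
            using hA[OF c(1)] \<iota>h[OF c(1) j] N(1-4) c by simp
          finally show "h d \<cdot> e c d \<cdot> lact (VHom C c d) (\<iota> c j)
              = DAct n c d \<cdot> lact (VHom C c d) (h c) \<cdot> lact (VHom C c d) (\<iota> c j)" .
        qed (use c hA eA LO N(1-4) in \<open>simp_all add: hom_iff\<close>)
        then show "h d \<cdot> DAct X c d = DAct n c d \<cdot> lact (VHom C c d) (h c)" using c by (simp add: XA)
      qed (use h in \<open>simp add: XD\<close>)
      have "dmap X n h \<cdot>\<^bsub>DC\<^esub> \<kappa> j = \<tau> j" if j: "j \<in> Ob J" for j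
        by (rule dmap_eqI[OF DC.Comp_in[OF \<kappa>h[OF j] H] t[OF j]]) (simp add: \<kappa>\<iota> h j)
      then show "\<exists>h. h \<in> hom DC X n \<and> (\<forall>j\<in>Ob J. h \<cdot>\<^bsub>DC\<^esub> \<kappa> j = \<tau> j)" using H by blast }
    { fix n f g assume f: "f \<in> hom DC X n" "g \<in> hom DC X n" "\<forall>j\<in>Ob J. f \<cdot>\<^bsub>DC\<^esub> \<kappa> j = g \<cdot>\<^bsub>DC\<^esub> \<kappa> j"
      show "f = g"
      proof (rule dmap_eqI[OF f(1,2)])
        fix c assume c: "c \<in> VOb C"
        have fA: "f \<in> Ar DC" "Dom DC f = X" "Cod DC f = n" "g \<in> Ar DC" "Dom DC g = X" "Cod DC g = n"
          using f by (auto simp: hom_iff)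
        show "cmp f c = cmp g c"
        proof (rule M.colimit_eqI[OF L[OF c] evF[OF c], of _ "DOb n c"])
          fix j assume j: "j \<in> Ob J"
          have "cmp (f \<cdot>\<^bsub>DC\<^esub> \<kappa> j) c = cmp (g \<cdot>\<^bsub>DC\<^esub> \<kappa> j) c" using f(3) j by simp
          then show "cmp f c \<cdot> \<iota> c j = cmp g c \<cdot> \<iota> c j" using c by (simp add: \<kappa>\<iota>)
        qed (use dmapD[OF fA(1)] dmapD[OF fA(4)] fA c in \<open>simp_all add: hom_iff XD\<close>)
      qed }
  qed
  then show thesis using that[of X \<kappa>] XD \<kappa>\<iota> by blast
qed

text \<open>The given colimit is compared with the one built from pointwise colimits. Existence of
  the latter is a hypothesis, because \<open>M\<close> need not be cocomplete.\<close>

lemma colimit_pointwise: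
  assumes L: "\<And>c. c \<in> VOb C \<Longrightarrow> is_colimit J M (ev c D) (L c) (\<iota> c)"
    and X: "is_colimit J DC D X \<kappa>" and c: "c \<in> VOb C"
  shows "is_colimit J M (ev c D) (DOb X c) (\<lambda>j. cmp (\<kappa> j) c)"
proof -
  obtain X' \<kappa>' where X': "is_colimit J DC D X' \<kappa>'"
    "\<And>c. c \<in> VOb C \<Longrightarrow> DOb X' c = L c" "\<And>c j. \<lbrakk>c \<in> VOb C; j \<in> Ob J\<rbrakk> \<Longrightarrow> cmp (\<kappa>' j) c = \<iota> c j"
    by (rule pointwise_colimit[OF L]) (auto intro: that)
  obtain u where u: "is_iso DC u" "u \<in> hom DC X' X" "\<And>j. j \<in> Ob J \<Longrightarrow> u \<cdot>\<^bsub>DC\<^esub> \<kappa>' j = \<kappa> j"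
    using DC.colimit_iso[OF X'(1) X D] by blast
  note v = DC.is_isoD[OF u(1)]
  have uA: "u \<in> Ar DC" "Dom DC u = X'" "Cod DC u = X" using u(2) by (auto simp: hom_iff)
  note um = dmapD[OF uA(1)] and vm = dmapD[OF v(2)]
  have "cmp (inv_ar DC u) c \<cdot> cmp u c = Idn M (DOb X' c)"
    using arg_cong[OF v(5), of "\<lambda>f. cmp f c"] c uA by simp
  moreover have "cmp u c \<cdot> cmp (inv_ar DC u) c = Idn M (DOb X c)"
    using arg_cong[OF v(6), of "\<lambda>f. cmp f c"] c uA by simp
  ultimately have "is_iso M (cmp u c)"
    by (intro M.is_isoI[of "cmp u c" "cmp (inv_ar DC u) c"]) (use um vm v uA c in simp_all)
  moreover have "cmp u c \<in> hom M (L c) (DOb X c)" using um c uA X'(2) by (simp add: hom_iff)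
  ultimately have "is_colimit J M (ev c D) (DOb X c) (\<lambda>j. cmp u c \<cdot> \<iota> c j)"
    using M.colimit_iso_transfer[OF L[OF c] ev_functor[OF D c]] by blast
  then show ?thesis
  proof (rule M.colimit_cong)
    fix j assume j: "j \<in> Ob J"
    show "cmp (\<kappa> j) c = cmp u c \<cdot> \<iota> c j"
      unfolding u(3)[OF j, symmetric] using X'(3)[OF c j] c by simp
  qed (use D in \<open>auto simp: is_functor_def\<close>)
qed

end

end

section \<open>Representable diagrams and the enriched Yoneda correspondence\<close>

subsection \<open>Representable diagrams\<close>

context enriched
begin

abbreviation IA where "IA K L X \<equiv> inv_ar M (AAssoc T K L X)"

lemma IA_simps [simp]:
  assumes "K \<in> Ob V" "L \<in> Ob V" "X \<in> Ob M"
  shows "IA K L X \<in> Ar M" "Dom M (IA K L X) = AOb T K (AOb T L X)"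
    "Cod M (IA K L X) = AOb T (TOb V K L) X"
    "IA K L X \<cdot> AAssoc T K L X = Idn M (AOb T (TOb V K L) X)"
    "AAssoc T K L X \<cdot> IA K L X = Idn M (AOb T K (AOb T L X))"
  using M.is_isoD[OF T.AAssoc_iso[OF assms]] assms by simp_all

lemma IA_cancel [simp]:
  assumes "K \<in> Ob V" "L \<in> Ob V" "X \<in> Ob M" "h \<in> Ar M"
  shows "Cod M h = AOb T (TOb V K L) X \<Longrightarrow> IA K L X \<cdot> (AAssoc T K L X \<cdot> h) = h"
    "Cod M h = AOb T K (AOb T L X) \<Longrightarrow> AAssoc T K L X \<cdot> (IA K L X \<cdot> h) = h"
  using M.comp_cong_left[OF IA_simps(4)[OF assms(1-3)], of h]
    M.comp_cong_left[OF IA_simps(5)[OF assms(1-3)], of h] assms by simp_all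

lemma IA_nat:
  assumes "f \<in> Ar V" "g \<in> Ar V" "h \<in> Ar M"
  shows "IA (Cod V f) (Cod V g) (Cod M h) \<cdot> AAr T f (AAr T g h)
    = AAr T (TAr V f g) h \<cdot> IA (Dom V f) (Dom V g) (Dom M h)"
proof (rule M.iso_epi[OF T.AAssoc_iso])
  show "Dom V f \<in> Ob V" "Dom V g \<in> Ob V" "Dom M h \<in> Ob M" using assms by auto
  show "IA (Cod V f) (Cod V g) (Cod M h) \<cdot> AAr T f (AAr T g h) \<cdot> AAssoc T (Dom V f) (Dom V g) (Dom M h)
    = AAr T (TAr V f g) h \<cdot> IA (Dom V f) (Dom V g) (Dom M h) \<cdot> AAssoc T (Dom V f) (Dom V g) (Dom M h)"
    using assms by (simp add: AAssoc_nat[symmetric])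
qed (use assms in auto)

abbreviation free where "free c N \<equiv> free_diagram C M T c N"
abbreviation free_map where "free_map c i \<equiv> free_diagram_map V C M T c i"

lemma free_simps [simp]:
  "x \<in> VOb C \<Longrightarrow> DOb (free c N) x = AOb T (VHom C c x) N"
  "\<lbrakk>x \<in> VOb C; y \<in> VOb C\<rbrakk> \<Longrightarrow> DAct (free c N) x y
    = AAr T (VComp C c x y) (Idn M N) \<cdot> IA (VHom C x y) (VHom C c x) N"
  by (simp_all add: free_diagram_def restrict2_def)

text \<open>Both laws are checked after composing with an associator. The pentagon and the left
  triangle of the action then reduce them to associativity and the left unit law of
  \<open>C\<close>.\<close>

lemma free_diagram:
  assumes k: "k \<in> VOb C" and N: "N \<in> Ob M" shows "is_diagram V C M T (free k N)"
  unfolding free_diagram_def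
proof (rule diagramI)
  fix a b c assume abc: "a \<in> VOb C" "b \<in> VOb C" "c \<in> VOb C"
  let ?e = "\<lambda>x y. AAr T (VComp C k x y) (Idn M N) \<cdot> IA (VHom C x y) (VHom C k x) N"
  let ?A = "AAssoc T (TOb V (VHom C b c) (VHom C a b)) (VHom C k a) N"
  note ids = C.VHom_in V.Unit_in
  show "?e a c \<cdot> AAr T (VComp C a b c) (Idn M (AOb T (VHom C k a) N)) =
    ?e b c \<cdot> (lact (VHom C b c) (?e a b) \<cdot> AAssoc T (VHom C b c) (VHom C a b) (AOb T (VHom C k a) N))"
  proof (rule M.iso_epi[OF T.AAssoc_iso])
    show "TOb V (VHom C b c) (VHom C a b) \<in> Ob V" "VHom C k a \<in> Ob V" "N \<in> Ob M" using abc k N by auto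
    have 1: "AAr T (VComp C a b c) (Idn M (AOb T (VHom C k a) N)) \<cdot> ?A
      = AAssoc T (VHom C a c) (VHom C k a) N \<cdot> AAr T (TAr V (VComp C a b c) (Idn V (VHom C k a))) (Idn M N)"
      using AAssoc_nat[of "VComp C a b c" "Idn V (VHom C k a)" "Idn M N"] abc k N by simp
    have 2: "AAr T (TAr V (Idn V (VHom C b c)) (VComp C k a b)) (Idn M N)
        = IA (VHom C b c) (VHom C k b) N \<cdot> (lact (VHom C b c) (AAr T (VComp C k a b) (Idn M N))
           \<cdot> AAssoc T (VHom C b c) (TOb V (VHom C a b) (VHom C k a)) N)"
      using AAssoc_nat[of "Idn V (VHom C b c)" "VComp C k a b" "Idn M N", symmetric] abc k N by simp
    have 3: "VComp C k a c \<cdot>\<^bsub>V\<^esub> TAr V (VComp C a b c) (Idn V (VHom C k a))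
        = VComp C k b c \<cdot>\<^bsub>V\<^esub> (TAr V (Idn V (VHom C b c)) (VComp C k a b)
            \<cdot>\<^bsub>V\<^esub> TAssoc V (VHom C b c) (VHom C a b) (VHom C k a))"
      using C.VComp_assoc[of k a b c] abc k by simp
    have "?e a c \<cdot> AAr T (VComp C a b c) (Idn M (AOb T (VHom C k a) N)) \<cdot> ?A
        = AAr T (VComp C k a c \<cdot>\<^bsub>V\<^esub> TAr V (VComp C a b c) (Idn V (VHom C k a))) (Idn M N)"
      using abc k N by (simp add: 1)
    also have "\<dots> = AAr T (VComp C k b c) (Idn M N) \<cdot> (AAr T (TAr V (Idn V (VHom C b c)) (VComp C k a b)) (Idn M N)
        \<cdot> AAr T (TAssoc V (VHom C b c) (VHom C a b) (VHom C k a)) (Idn M N))"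
      using abc k N by (simp add: 3)
    also have "\<dots> = ?e b c \<cdot> (lact (VHom C b c) (AAr T (VComp C k a b) (Idn M N))
           \<cdot> (AAssoc T (VHom C b c) (TOb V (VHom C a b) (VHom C k a)) N
           \<cdot> AAr T (TAssoc V (VHom C b c) (VHom C a b) (VHom C k a)) (Idn M N)))"
      unfolding 2 using abc k N by simp
    also have "AAssoc T (VHom C b c) (TOb V (VHom C a b) (VHom C k a)) N
           \<cdot> AAr T (TAssoc V (VHom C b c) (VHom C a b) (VHom C k a)) (Idn M N)
        = lact (VHom C b c) (IA (VHom C a b) (VHom C k a) N)
          \<cdot> (AAssoc T (VHom C b c) (VHom C a b) (AOb T (VHom C k a) N) \<cdot> ?A)"
    proof -
      have "AAssoc T (VHom C b c) (VHom C a b) (AOb T (VHom C k a) N) \<cdot> ?A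
        = lact (VHom C b c) (AAssoc T (VHom C a b) (VHom C k a) N)
          \<cdot> (AAssoc T (VHom C b c) (TOb V (VHom C a b) (VHom C k a)) N
            \<cdot> AAr T (TAssoc V (VHom C b c) (VHom C a b) (VHom C k a)) (Idn M N))"
        using T.act_pentagon[of "VHom C b c" "VHom C a b" "VHom C k a" N] abc k N by simp
      then show ?thesis using abc k N by simp
    qed
    finally show "?e a c \<cdot> AAr T (VComp C a b c) (Idn M (AOb T (VHom C k a) N)) \<cdot> ?A
      = ?e b c \<cdot> (lact (VHom C b c) (?e a b) \<cdot> AAssoc T (VHom C b c) (VHom C a b) (AOb T (VHom C k a) N)) \<cdot> ?A"
      using abc k N by simp
  qed (use abc k N in simp_all)
next
  fix c assume c: "c \<in> VOb C"
  show "AAr T (VComp C k c c) (Idn M N) \<cdot> IA (VHom C c c) (VHom C k c) N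
      \<cdot> AAr T (VId C c) (Idn M (AOb T (VHom C k c) N)) = AUnit T (AOb T (VHom C k c) N)"
  proof (rule M.iso_epi[OF T.AAssoc_iso])
    show "Unit V \<in> Ob V" "VHom C k c \<in> Ob V" "N \<in> Ob M" using c k N by auto
    have "AAr T (VId C c) (Idn M (AOb T (VHom C k c) N)) \<cdot> AAssoc T (Unit V) (VHom C k c) N
      = AAssoc T (VHom C c c) (VHom C k c) N \<cdot> AAr T (TAr V (VId C c) (Idn V (VHom C k c))) (Idn M N)"
      using AAssoc_nat[of "VId C c" "Idn V (VHom C k c)" "Idn M N"] c k N by simp
    then show "AAr T (VComp C k c c) (Idn M N) \<cdot> IA (VHom C c c) (VHom C k c) N
        \<cdot> AAr T (VId C c) (Idn M (AOb T (VHom C k c) N)) \<cdot> AAssoc T (Unit V) (VHom C k c) N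
      = AUnit T (AOb T (VHom C k c) N) \<cdot> AAssoc T (Unit V) (VHom C k c) N"
      using c k N T.act_triangle_left[of "VHom C k c" N] C.VComp_VId_left[of k c] by simp
  qed (use c k N in simp_all)
qed (use k N in \<open>auto simp: hom_iff\<close>)

lemma free_map:
  assumes c: "c \<in> VOb C" and i: "i \<in> Ar M"
  shows "free_map c i \<in> hom DC (free c (Dom M i)) (free c (Cod M i))"
    "x \<in> VOb C \<Longrightarrow> cmp (free_map c i) x = lact (VHom C c x) i"
proof -
  have eq: "free_map c i = dmap (free c (Dom M i)) (free c (Cod M i)) (\<lambda>x. lact (VHom C c x) i)"
    by (simp add: free_diagram_map_def dmap_def)
  show "cmp (free_map c i) x = lact (VHom C c x) i" if "x \<in> VOb C" using that by (simp add: eq)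
  show "free_map c i \<in> hom DC (free c (Dom M i)) (free c (Cod M i))"
    unfolding eq
  proof (rule dmap_in)
    fix x y assume xy: "x \<in> VOb C" "y \<in> VOb C"
    have "IA (VHom C x y) (VHom C c x) (Cod M i) \<cdot> lact (VHom C x y) (lact (VHom C c x) i)
      = AAr T (Idn V (TOb V (VHom C x y) (VHom C c x))) i \<cdot> IA (VHom C x y) (VHom C c x) (Dom M i)"
      using IA_nat[of "Idn V (VHom C x y)" "Idn V (VHom C c x)" i] xy c i by simp
    then show "lact (VHom C c y) i \<cdot> DAct (free c (Dom M i)) x y
        = DAct (free c (Cod M i)) x y \<cdot> lact (VHom C x y) (lact (VHom C c x) i)"
      using xy c i by simp
  qed (use c i in \<open>auto simp: hom_iff intro: free_diagram\<close>)
qed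

text \<open>Enriched Yoneda: the map \<open>C(c, -) \<otimes> N \<rightarrow> E\<close> that
  corresponds to \<open>a : N \<rightarrow> E c\<close>.\<close>

definition ymap :: "'c \<Rightarrow> 'a \<Rightarrow> ('c, 'o, 'a) diagram \<Rightarrow> ('c, 'o, 'a) diagram_map" where
  "ymap c a E = dmap (free c (Dom M a)) E (\<lambda>x. DAct E c x \<cdot> lact (VHom C c x) a)"

lemma cmp_ymap [simp]: "x \<in> VOb C \<Longrightarrow> cmp (ymap c a E) x = DAct E c x \<cdot> lact (VHom C c x) a"
  by (simp add: ymap_def)

lemma ymap:
  assumes c: "c \<in> VOb C" and E: "is_diagram V C M T E" and a: "a \<in> hom M N (DOb E c)"
  shows "ymap c a E \<in> hom DC (free c N) E"
proof -
  note Ed = diagramD[OF E]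
  have a': "a \<in> Ar M" "Dom M a = N" "Cod M a = DOb E c" using a by (auto simp: hom_iff)
  have N: "N \<in> Ob M" using a' by force
  show ?thesis
    unfolding ymap_def a'(2)
  proof (rule dmap_in[OF free_diagram[OF c N] E])
    fix x y assume xy: "x \<in> VOb C" "y \<in> VOb C"
    have "DAct E c y \<cdot> lact (VHom C c y) a \<cdot> DAct (free c N) x y
        = DAct E x y \<cdot> lact (VHom C x y) (DAct E c x \<cdot> lact (VHom C c x) a)"
    proof (rule M.iso_epi[OF T.AAssoc_iso])
      show "VHom C x y \<in> Ob V" "VHom C c x \<in> Ob V" "N \<in> Ob M" using xy c N by auto
      have 1: "AAssoc T (VHom C x y) (VHom C c x) (DOb E c) \<cdot> lact (TOb V (VHom C x y) (VHom C c x)) a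
        = lact (VHom C x y) (lact (VHom C c x) a) \<cdot> AAssoc T (VHom C x y) (VHom C c x) N"
        using AAssoc_nat[of "Idn V (VHom C x y)" "Idn V (VHom C c x)" a] xy c a' by simp
      have "DAct E c y \<cdot> lact (VHom C c y) a \<cdot> DAct (free c N) x y \<cdot> AAssoc T (VHom C x y) (VHom C c x) N
        = DAct E c y \<cdot> AAr T (VComp C c x y) (Idn M (DOb E c)) \<cdot> lact (TOb V (VHom C x y) (VHom C c x)) a"
        using xy c N a' Ed(1-4) by simp
      also have "\<dots> = DAct E x y \<cdot> lact (VHom C x y) (DAct E c x) \<cdot>
          (AAssoc T (VHom C x y) (VHom C c x) (DOb E c) \<cdot> lact (TOb V (VHom C x y) (VHom C c x)) a)"
        unfolding Ed(5)[OF c xy] using xy c N a' Ed(1-4) by simp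
      also have "\<dots> = DAct E x y \<cdot> lact (VHom C x y) (DAct E c x \<cdot> lact (VHom C c x) a)
          \<cdot> AAssoc T (VHom C x y) (VHom C c x) N"
        unfolding 1 using xy c N a' Ed(1-4) by simp
      finally show "DAct E c y \<cdot> lact (VHom C c y) a \<cdot> DAct (free c N) x y \<cdot> AAssoc T (VHom C x y) (VHom C c x) N
        = DAct E x y \<cdot> lact (VHom C x y) (DAct E c x \<cdot> lact (VHom C c x) a)
          \<cdot> AAssoc T (VHom C x y) (VHom C c x) N" .
    qed (use xy c N a' Ed(1-4) in simp_all)
    then show "DAct E c y \<cdot> lact (VHom C c y) a \<cdot> DAct (free c N) x y
      = DAct E x y \<cdot> lact (VHom C x y) (DAct E c x \<cdot> lact (VHom C c x) a)" .
  qed (use c a' Ed in \<open>simp add: hom_iff\<close>)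
qed

text \<open>The inverse of \<open>ymap\<close>: restriction of \<open>g\<close> at \<open>c\<close>
  along the identity element \<open>I \<rightarrow> C(c, c)\<close>, with the unitor inverted to
  start at \<open>N\<close>.\<close>

definition elt :: "'c \<Rightarrow> 'o \<Rightarrow> ('c, 'o, 'a) diagram_map \<Rightarrow> 'a" where
  "elt c N g = cmp g c \<cdot> (AAr T (VId C c) (Idn M N) \<cdot> inv_ar M (AUnit T N))"

text \<open>The identity element generates the representable diagram. This is the right unit law of
  \<open>C\<close>, brought into the action by naturality of the associator and the right
  triangle.\<close>

lemma unit_free:
  assumes c: "c \<in> VOb C" and x: "x \<in> VOb C" and N: "N \<in> Ob M"
  shows "DAct (free c N) c x \<cdot> lact (VHom C c x) (AAr T (VId C c) (Idn M N) \<cdot> inv_ar M (AUnit T N))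
    = Idn M (AOb T (VHom C c x) N)"
proof -
  note u = M.is_isoD[OF T.AUnit_iso[OF N]]
  have 1: "IA (VHom C c x) (VHom C c c) N \<cdot> lact (VHom C c x) (AAr T (VId C c) (Idn M N))
      = AAr T (TAr V (Idn V (VHom C c x)) (VId C c)) (Idn M N) \<cdot> IA (VHom C c x) (Unit V) N"
    using IA_nat[of "Idn V (VHom C c x)" "VId C c" "Idn M N"] c x N by simp
  have "DAct (free c N) c x \<cdot> lact (VHom C c x) (AAr T (VId C c) (Idn M N) \<cdot> inv_ar M (AUnit T N))
    = AAr T (VComp C c c x) (Idn M N) \<cdot> (IA (VHom C c x) (VHom C c c) N \<cdot> lact (VHom C c x) (AAr T (VId C c) (Idn M N)))
      \<cdot> lact (VHom C c x) (inv_ar M (AUnit T N))"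
    using c x N u by simp
  also have "\<dots> = AAr T (RUnit V (VHom C c x)) (Idn M N) \<cdot> IA (VHom C c x) (Unit V) N
      \<cdot> lact (VHom C c x) (inv_ar M (AUnit T N))"
    unfolding 1 using c x N u C.VComp_VId_right[of c x] by simp
  also have "\<dots> = lact (VHom C c x) (AUnit T N) \<cdot> lact (VHom C c x) (inv_ar M (AUnit T N))"
    using T.act_triangle_right[of "VHom C c x" N, symmetric] c x N u by simp
  also have "\<dots> = Idn M (AOb T (VHom C c x) N)" using c x N u by simp
  finally show ?thesis .
qed

text \<open>A map \<open>g\<close> commutes with the structure maps, so it is determined by its
  value on the generating element; \<open>unit_free\<close> says that this element
  generates.\<close>

lemma ymap_elt:
  assumes c: "c \<in> VOb C" and N: "N \<in> Ob M" and g: "g \<in> hom DC (free c N) E"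
  shows "elt c N g \<in> hom M N (DOb E c)" "ymap c (elt c N g) E = g"
proof -
  have gA: "g \<in> Ar DC" "Dom DC g = free c N" "Cod DC g = E" using g by (auto simp: hom_iff)
  note G = dmapD[OF gA(1), unfolded gA]
  note Ed = diagramD[OF G(2)]
  note u = M.is_isoD[OF T.AUnit_iso[OF N]]
  show e: "elt c N g \<in> hom M N (DOb E c)"
    using G(3-5) u c N by (simp add: elt_def hom_iff)
  show "ymap c (elt c N g) E = g"
  proof (rule dmap_eqI[OF ymap[OF c G(2) e] g])
    fix x assume x: "x \<in> VOb C"
    have "cmp (ymap c (elt c N g) E) x = DAct E c x \<cdot> lact (VHom C c x) (cmp g c)
      \<cdot> lact (VHom C c x) (AAr T (VId C c) (Idn M N) \<cdot> inv_ar M (AUnit T N))"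
      using x c N G(3-5) u Ed(1-4) by (simp add: elt_def)
    also have "\<dots> = cmp g x \<cdot> (DAct (free c N) c x \<cdot> lact (VHom C c x) (AAr T (VId C c) (Idn M N) \<cdot> inv_ar M (AUnit T N)))"
      unfolding G(6)[OF c x, symmetric] using x c N G(3-5) u by simp
    also have "\<dots> = cmp g x" unfolding unit_free[OF c x N] using x c G(3-5) N by simp
    finally show "cmp (ymap c (elt c N g) E) x = cmp g x" .
  qed
qed

lemma ymap_eqD:
  assumes c: "c \<in> VOb C" and E: "is_diagram V C M T E" and a: "a \<in> hom M N (DOb E c)"
  shows "elt c N (ymap c a E) = a"
proof -
  note Ed = diagramD[OF E]
  have a': "a \<in> Ar M" "Dom M a = N" "Cod M a = DOb E c" using a by (auto simp: hom_iff)
  have N: "N \<in> Ob M" using a' by force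
  note u = M.is_isoD[OF T.AUnit_iso[OF N]]
  have "elt c N (ymap c a E) = DAct E c c \<cdot> AAr T (VId C c) (Idn M (DOb E c)) \<cdot> (lact (Unit V) a \<cdot> inv_ar M (AUnit T N))"
    using c a' N u Ed(1-4) by (simp add: elt_def)
  also have "\<dots> = AUnit T (DOb E c) \<cdot> lact (Unit V) a \<cdot> inv_ar M (AUnit T N)"
    unfolding Ed(6)[OF c] using c a' N u Ed(1-4) by simp
  also have "\<dots> = a"
    using T.AUnit_natural[OF a] a' N u by simp
  finally show ?thesis .
qed

lemma ymap_comp:
  assumes c: "c \<in> VOb C" and a: "a \<in> hom M N (DOb E c)" and f: "f \<in> hom DC E E'"
  shows "f \<cdot>\<^bsub>DC\<^esub> ymap c a E = ymap c (cmp f c \<cdot> a) E'"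
proof -
  have fA: "f \<in> Ar DC" "Dom DC f = E" "Cod DC f = E'" using f by (auto simp: hom_iff)
  note F = dmapD[OF fA(1), unfolded fA]
  have a': "a \<in> Ar M" "Dom M a = N" "Cod M a = DOb E c" using a by (auto simp: hom_iff)
  have fa: "cmp f c \<cdot> a \<in> hom M N (DOb E' c)" using a' F(3-5) c by (simp add: hom_iff)
  show ?thesis
  proof (rule dmap_eqI[OF DC.Comp_in[OF ymap[OF c F(1) a] f] ymap[OF c F(2) fa]])
    fix x assume x: "x \<in> VOb C"
    have "cmp (f \<cdot>\<^bsub>DC\<^esub> ymap c a E) x = cmp f x \<cdot> DAct E c x \<cdot> lact (VHom C c x) a"
      using x c a' F(3-5) diagramD(1-4)[OF F(1)] by simp
    also have "\<dots> = cmp (ymap c (cmp f c \<cdot> a) E') x"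
      unfolding F(6)[OF c x] using x c a' F(3-5) diagramD(1-4)[OF F(1)] diagramD(1-4)[OF F(2)] by simp
    finally show "cmp (f \<cdot>\<^bsub>DC\<^esub> ymap c a E) x = cmp (ymap c (cmp f c \<cdot> a) E') x" .
  qed
qed

lemma ymap_free_map:
  assumes c: "c \<in> VOb C" and E: "is_diagram V C M T E" and a: "a \<in> hom M N (DOb E c)"
    and i: "i \<in> hom M N' N"
  shows "ymap c a E \<cdot>\<^bsub>DC\<^esub> free_map c i = ymap c (a \<cdot> i) E"
proof -
  have a': "a \<in> Ar M" "Dom M a = N" "Cod M a = DOb E c" using a by (auto simp: hom_iff)
  have i': "i \<in> Ar M" "Dom M i = N'" "Cod M i = N" using i by (auto simp: hom_iff)
  have ai: "a \<cdot> i \<in> hom M N' (DOb E c)" using a' i' by (simp add: hom_iff)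
  show ?thesis
  proof (rule dmap_eqI[OF DC.Comp_in[OF free_map(1)[OF c i'(1), unfolded i'] ymap[OF c E a]] ymap[OF c E ai]])
    fix x assume x: "x \<in> VOb C"
    show "cmp (ymap c a E \<cdot>\<^bsub>DC\<^esub> free_map c i) x = cmp (ymap c (a \<cdot> i) E) x"
      using x c a' i' free_map(2)[OF c i'(1) x] diagramD(1-4)[OF E] by simp
  qed
qed

end

section \<open>Cells, and maps that lie pointwise in a left closed class\<close>

subsection \<open>Cell complexes of diagrams\<close>

context enriched
begin

lemma ev_span:
  assumes "f \<in> Ar DC" "g \<in> Ar DC" "Dom DC f = Dom DC g" "c \<in> VOb C"
    "is_colimit span_cat M (span M (cmp f c) (cmp g c)) L \<iota>"
  shows "is_colimit span_cat M (ev c (span DC f g)) L \<iota>"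
proof (rule M.colimit_cong[OF assms(5)])
  note F = dmapD[OF assms(1)] and G = dmapD[OF assms(2)]
  show "FOb (ev c (span DC f g)) j = FOb (span M (cmp f c) (cmp g c)) j" if "j \<in> Ob span_cat" for j
    using that assms(3,4) F(4,5) G(4,5) by (auto simp: span_def)
  show "FAr (ev c (span DC f g)) u = FAr (span M (cmp f c) (cmp g c)) u" if "u \<in> Ar span_cat" for u
    using that assms(3,4) F(4,5) G(4,5) by (auto simp: span_def)
  show "category span_cat" using span_cat[OF universe] by (simp add: small_category_def)
qed simp

lemma ev_span':
  assumes "f \<in> Ar DC" "g \<in> Ar DC" "Dom DC f = Dom DC g" "c \<in> VOb C"
    "is_colimit span_cat M (ev c (span DC f g)) L \<iota>"
  shows "is_colimit span_cat M (span M (cmp f c) (cmp g c)) L \<iota>"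
proof (rule M.colimit_cong[OF assms(5)])
  note F = dmapD[OF assms(1)] and G = dmapD[OF assms(2)]
  show "FOb (span M (cmp f c) (cmp g c)) j = FOb (ev c (span DC f g)) j" if "j \<in> Ob span_cat" for j
    using that assms(3,4) F(4,5) G(4,5) by (auto simp: span_def)
  show "FAr (span M (cmp f c) (cmp g c)) u = FAr (ev c (span DC f g)) u" if "u \<in> Ar span_cat" for u
    using that assms(3,4) F(4,5) G(4,5) by (auto simp: span_def)
  show "category span_cat" using span_cat[OF universe] by (simp add: small_category_def)
qed simp

context
  fixes f g
  assumes f: "f \<in> Ar DC" and g: "g \<in> Ar DC" and fg: "Dom DC f = Dom DC g"
    and ex: "\<And>c. c \<in> VOb C \<Longrightarrow> \<exists>p q. is_pushout M (cmp f c) (cmp g c) p q"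
begin

lemma DC_pushout_aux:
  obtains p q where "\<And>c. c \<in> VOb C \<Longrightarrow> is_colimit span_cat M (ev c (span DC f g)) (Cod M (p c))
    (span_cocone (p c \<cdot> cmp f c) (p c) (q c))"
proof -
  obtain p q where pq: "\<And>c. c \<in> VOb C \<Longrightarrow> is_pushout M (cmp f c) (cmp g c) (p c) (q c)"
    using ex by metis
  have "is_colimit span_cat M (ev c (span DC f g)) (Cod M (p c)) (span_cocone (p c \<cdot> cmp f c) (p c) (q c))"
    if c: "c \<in> VOb C" for c
    using ev_span[OF f g fg c] M.pushout_iff_colimit[of "cmp f c" "cmp g c" "p c" "q c"]
      M.pushoutD[OF pq[OF c]] pq[OF c] by simp
  then show thesis by (rule that)
qed

lemma DC_pushout_exists: "\<exists>p q. is_pushout DC f g p q"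
proof -
  obtain p q where pq: "\<And>c. c \<in> VOb C \<Longrightarrow> is_colimit span_cat M (ev c (span DC f g)) (Cod M (p c))
    (span_cocone (p c \<cdot> cmp f c) (p c) (q c))" by (rule DC_pushout_aux) blast
  obtain X \<kappa> where X: "is_colimit span_cat DC (span DC f g) X \<kappa>"
    by (rule pointwise_colimit[OF span_cat[OF universe] DC.span_functor[OF f g fg] pq]) blast
  have "is_cocone span_cat DC (span DC f g) X \<kappa>" using X by (simp add: is_colimit_def)
  then have k: "\<kappa> 1 \<in> hom DC (Cod DC f) X" "\<kappa> 2 \<in> hom DC (Cod DC g) X" "\<kappa> 1 \<cdot>\<^bsub>DC\<^esub> f = \<kappa> 2 \<cdot>\<^bsub>DC\<^esub> g"
    "\<kappa> 0 = \<kappa> 1 \<cdot>\<^bsub>DC\<^esub> f"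
    unfolding DC.span_cocone_iff[OF f g fg] by auto
  have "is_colimit span_cat DC (span DC f g) X (span_cocone (\<kappa> 1 \<cdot>\<^bsub>DC\<^esub> f) (\<kappa> 1) (\<kappa> 2))"
    by (rule DC.colimit_cong[OF X])
      (use k span_cat[OF universe] in \<open>auto simp: span_cocone_def small_category_def\<close>)
  then have "is_pushout DC f g (\<kappa> 1) (\<kappa> 2)"
    using DC.pushout_iff_colimit[OF f g fg, of "\<kappa> 1" "\<kappa> 2"] k(1) by (simp add: hom_iff)
  then show ?thesis by blast
qed

lemma DC_pushout_pointwise:
  assumes P: "is_pushout DC f g p q" and c: "c \<in> VOb C"
  shows "is_pushout M (cmp f c) (cmp g c) (cmp p c) (cmp q c)"
    "is_colimit span_cat M (ev c (span DC f g)) (DOb (Cod DC p) c) (\<lambda>j. cmp (span_cocone (p \<cdot>\<^bsub>DC\<^esub> f) p q j) c)"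
proof -
  obtain p' q' where pq: "\<And>c. c \<in> VOb C \<Longrightarrow> is_colimit span_cat M (ev c (span DC f g)) (Cod M (p' c))
    (span_cocone (p' c \<cdot> cmp f c) (p' c) (q' c))" by (rule DC_pushout_aux) blast
  note PD = DC.pushoutD[OF P]
  have L: "is_colimit span_cat DC (span DC f g) (Cod DC p) (span_cocone (p \<cdot>\<^bsub>DC\<^esub> f) p q)"
    using P DC.pushout_iff_colimit[OF f g fg PD(4)] by blast
  show C: "is_colimit span_cat M (ev c (span DC f g)) (DOb (Cod DC p) c) (\<lambda>j. cmp (span_cocone (p \<cdot>\<^bsub>DC\<^esub> f) p q j) c)"
    by (rule colimit_pointwise[OF span_cat[OF universe] DC.span_functor[OF f g fg] pq L c])
  note F = dmapD[OF f] and G = dmapD[OF g] and p = dmapD[OF PD(4)]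
  have "(\<lambda>j. cmp (span_cocone (p \<cdot>\<^bsub>DC\<^esub> f) p q j) c) = span_cocone (cmp p c \<cdot> cmp f c) (cmp p c) (cmp q c)"
    using c by (auto simp: span_cocone_def)
  with ev_span'[OF f g fg c C]
  have "is_colimit span_cat M (span M (cmp f c) (cmp g c)) (Cod M (cmp p c))
      (span_cocone (cmp p c \<cdot> cmp f c) (cmp p c) (cmp q c))"
    using p c by simp
  then show "is_pushout M (cmp f c) (cmp g c) (cmp p c) (cmp q c)"
    using M.pushout_iff_colimit[of "cmp f c" "cmp g c" "cmp p c" "cmp q c"] F G p c fg by simp
qed

end

lemma ev_transfinite:
  assumes "transfinite_seq U DC r X" "c \<in> VOb C"
    "\<And>k. is_limit r k \<Longrightarrow> is_colimit (ord_cat r (underS r k)) M (ev c X) (DOb (FOb X k) c) (\<lambda>j. cmp (FAr X (j, k)) c)"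
  shows "transfinite_seq U M r (ev c X)"
  using assms ev_functor[OF transfinite_seqD(4)[OF assms(1)] assms(2)]
  by (simp add: transfinite_seq_def)

end

text \<open>\<open>S\<close> stands for the cofibrations and also for the trivial cofibrations.
  Flatness of the hom-objects enters in the form that tensoring with them preserves
  \<open>S\<close>.\<close>

locale flat_class = enriched U V M T C
  for U :: "'s itself" and V :: "('v, 'w, 'z) moncat_scheme"
    and M :: "('o, 'a, 'y) cat_scheme" (structure)
    and T :: "('v, 'w, 'o, 'a) act" and C :: "('c, 'v, 'w) vcat" +
  fixes S :: "'a set"
  assumes left_closed: "left_closed M U S"
    and flat_hom: "\<lbrakk>x \<in> VOb C; y \<in> VOb C; f \<in> S\<rbrakk> \<Longrightarrow> lact (VHom C x y) f \<in> S"
begin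

sublocale S: left_closed M U S by (rule left_closed)

definition Gd where "Gd = {X. is_diagram V C M T X \<and> (\<forall>c\<in>VOb C. DOb X c \<in> good_obs M S)}"

text \<open>Membership in \<open>S\<close> at every object of \<open>C\<close> is what makes
  pushouts and transfinite composites of diagrams exist and be computed pointwise;
  \<open>cells_pw\<close> shows that all cells have this property.\<close>

definition pw where "pw f \<longleftrightarrow> f \<in> Ar DC \<and> (\<forall>c\<in>VOb C. cmp f c \<in> S)"

abbreviation cells where
  "cells \<equiv> cell_closure U DC Gd {free_diagram_map V C M T c i | c i. c \<in> VOb C \<and> i \<in> S}"

lemma pwD:
  assumes "pw f" shows "f \<in> Ar DC" "c \<in> VOb C \<Longrightarrow> cmp f c \<in> S" "Dom DC f \<in> Gd" "Cod DC f \<in> Gd"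
proof -
  show f: "f \<in> Ar DC" and c: "c \<in> VOb C \<Longrightarrow> cmp f c \<in> S" for c using assms by (auto simp: pw_def)
  show "Dom DC f \<in> Gd" "Cod DC f \<in> Gd"
    unfolding Gd_def using dmapD[OF f] S.S_good[OF c] by auto
qed

lemma Gd_Ob: "X \<in> Gd \<Longrightarrow> X \<in> Ob DC"
  by (simp add: Gd_def)

lemma pw_free_map: "\<lbrakk>c \<in> VOb C; i \<in> S\<rbrakk> \<Longrightarrow> pw (free_map c i)"
  using free_map[of c i] flat_hom S.S_Ar[of i] by (auto simp: pw_def hom_iff)

text \<open>At each object the pushout exists by the axioms for \<open>S\<close>, as
  \<open>f\<close> is in \<open>S\<close> and the codomain of \<open>g\<close> is good there.
  Pushouts of diagrams are then the pointwise ones.\<close>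

lemma pw_pushout:
  assumes f: "pw f" and g: "g \<in> Ar DC" "Dom DC g = Dom DC f" "Cod DC g \<in> Gd"
  shows "\<exists>p q. is_pushout DC f g p q"
    "\<lbrakk>is_pushout DC f g p q; c \<in> VOb C\<rbrakk> \<Longrightarrow> is_pushout M (cmp f c) (cmp g c) (cmp p c) (cmp q c)"
    "\<lbrakk>is_pushout DC f g p q; c \<in> VOb C\<rbrakk> \<Longrightarrow> is_colimit span_cat M (ev c (span DC f g))
       (DOb (Cod DC p) c) (\<lambda>j. cmp (span_cocone (p \<cdot>\<^bsub>DC\<^esub> f) p q j) c)"
    "is_pushout DC f g p q \<Longrightarrow> pw q"
proof -
  note F = pwD[OF f] and G = dmapD[OF g(1)]
  have fg: "Dom DC f = Dom DC g" using g by simp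
  have g': "cmp g c \<in> Ar M" "Dom M (cmp g c) = Dom M (cmp f c)" "Cod M (cmp g c) \<in> good_obs M S"
    if "c \<in> VOb C" for c
    using G g that dmapD[OF F(1)] by (auto simp: Gd_def)
  have ex: "\<exists>p q. is_pushout M (cmp f c) (cmp g c) p q" if "c \<in> VOb C" for c
    using S.pushout_exists[OF F(2)[OF that] g'[OF that]] .
  show "\<exists>p q. is_pushout DC f g p q" by (rule DC_pushout_exists[OF F(1) g(1) fg ex])
  show p: "is_pushout M (cmp f c) (cmp g c) (cmp p c) (cmp q c)"
      "is_colimit span_cat M (ev c (span DC f g))
         (DOb (Cod DC p) c) (\<lambda>j. cmp (span_cocone (p \<cdot>\<^bsub>DC\<^esub> f) p q j) c)"
    if "is_pushout DC f g p q" "c \<in> VOb C" for c p q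
    using DC_pushout_pointwise[OF F(1) g(1) fg ex that] by auto
  show "pw q" if "is_pushout DC f g p q"
    unfolding pw_def
    using S.pushout_in[OF F(2) g' p(1)[OF that]] DC.pushoutD(5)[OF that] by blast
qed

context
  fixes r :: "'s rel" and X k0
  assumes X: "transfinite_seq U DC r X" and steps: "\<And>j k. is_succ r j k \<Longrightarrow> pw (FAr X (j, k))"
    and k0: "is_least r k0" and X0: "FOb X k0 \<in> Gd"
begin

text \<open>A limit stage is a colimit of diagrams, which is known to be pointwise only once the
  pointwise colimits exist. Induction on \<open>k\<close>: below \<open>k\<close> the evaluated
  sequence is already continuous, so the closure of \<open>S\<close> yields its colimit, and
  \<open>colimit_pointwise\<close> applies.\<close>

lemma limits_pointwise:
  assumes k: "k \<in> Field r" and c: "c \<in> VOb C" and lim: "is_limit r k"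
  shows "is_colimit (ord_cat r (underS r k)) M (ev c X) (DOb (FOb X k) c) (\<lambda>j. cmp (FAr X (j, k)) c)"
  using transfinite_seqD(1)[OF X] k lim c
proof (induction arbitrary: c rule: Well_order_induct)
  case (step k)
  note D = transfinite_seqD[OF X]
  have ne: "underS r k \<noteq> {}" using step.prems(1) by (auto simp: is_limit_def)
  have sub: "underS r k \<subseteq> Field r" using underS_Field by fast
  let ?r = "init_seg r k"
  have oc: "ord_cat ?r (Field ?r) = ord_cat r (underS r k)"
    unfolding Field_init_seg[OF D(1) step.hyps(1)] by (rule ord_cat_init_seg[OF D(1) step.hyps(1) subset_refl])
  have ex: "\<exists>L \<iota>. is_colimit (ord_cat r (underS r k)) M (ev c X) L \<iota>" if c: "c \<in> VOb C" for c
  proof -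
    have "transfinite_seq U M ?r (ev c X)"
    proof (rule ev_transfinite[OF transfinite_seq_init_seg[OF X step.hyps(1) ne] c])
      fix j assume "is_limit ?r j"
      then have j: "j \<in> underS r k" "is_limit r j" using is_limit_init_seg[OF D(1) step.hyps(1)] by auto
      have "underS r j \<subseteq> underS r k" using under_trans[OF D(1) _ j(1)] by (auto simp: underS_iff)
      then show "is_colimit (ord_cat ?r (underS ?r j)) M (ev c X) (DOb (FOb X j) c) (\<lambda>i. cmp (FAr X (i, j)) c)"
        unfolding underS_init_seg[OF D(1) step.hyps(1) j(1)]
        using ord_cat_init_seg[OF D(1) step.hyps(1)] step.IH[OF j(1,2) c] by simp
    qed
    then have "\<exists>L \<iota>. is_colimit (ord_cat ?r (Field ?r)) M (ev c X) L \<iota>"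
    proof (rule S.transfinite_exists)
      show "\<forall>i j. is_succ ?r i j \<longrightarrow> FAr (ev c X) (i, j) \<in> S"
        using steps pwD(2)[OF _ c] is_succ_init_seg[OF D(1) step.hyps(1)] by simp
      show "\<forall>j. is_least ?r j \<longrightarrow> FOb (ev c X) j \<in> good_obs M S"
        using X0 c least_unique[OF D(1) k0] is_least_init_seg[OF D(1) step.hyps(1) ne] by (auto simp: Gd_def)
    qed
    then show ?thesis unfolding oc .
  qed
  then obtain L \<iota> where L: "\<And>c. c \<in> VOb C \<Longrightarrow> is_colimit (ord_cat r (underS r k)) M (ev c X) (L c) (\<iota> c)"
    by metis
  show ?case
    by (rule colimit_pointwise[OF small_category_ord[OF universe D(1) sub D(2)]
          ord_functor_subset[OF D(4,1) sub] L D(5)[OF step.prems(1)] step.prems(2)])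
qed

lemma pw_seq:
  assumes c: "c \<in> VOb C" shows "transfinite_seq U M r (ev c X)"
  by (rule ev_transfinite[OF X c], rule limits_pointwise[OF _ c]) (simp_all add: is_limit_def)

lemma pw_seq_steps:
  assumes c: "c \<in> VOb C"
  shows "\<forall>j k. is_succ r j k \<longrightarrow> FAr (ev c X) (j, k) \<in> S"
    "\<forall>k. is_least r k \<longrightarrow> FOb (ev c X) k \<in> good_obs M S"
  using X0 c least_unique[OF transfinite_seqD(1)[OF X] k0] steps pwD(2)[OF _ c] by (auto simp: Gd_def)

lemma seq_small: "small_category U (ord_cat r (Field r))"
  using small_category_ord[OF universe transfinite_seqD(1)[OF X] subset_refl transfinite_seqD(2)[OF X]] .

lemma pw_colimit_aux:
  obtains L \<iota> where "\<And>c. c \<in> VOb C \<Longrightarrow> is_colimit (ord_cat r (Field r)) M (ev c X) (L c) (\<iota> c)"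
proof -
  have "\<exists>L \<iota>. is_colimit (ord_cat r (Field r)) M (ev c X) L \<iota>" if c: "c \<in> VOb C" for c
    using S.transfinite_exists[OF pw_seq[OF c] pw_seq_steps[OF c]] .
  then show thesis using that by metis
qed

lemma pw_colimit_exists: "\<exists>L \<iota>. is_colimit (ord_cat r (Field r)) DC X L \<iota>"
proof -
  obtain L \<iota> where L: "\<And>c. c \<in> VOb C \<Longrightarrow> is_colimit (ord_cat r (Field r)) M (ev c X) (L c) (\<iota> c)"
    by (rule pw_colimit_aux) blast
  show ?thesis
    by (rule pointwise_colimit[OF seq_small transfinite_seqD(4)[OF X] L]) (assumption, intro exI)
qed

lemma pw_colimit:
  assumes L: "is_colimit (ord_cat r (Field r)) DC X L \<iota>"
  shows "c \<in> VOb C \<Longrightarrow> is_colimit (ord_cat r (Field r)) M (ev c X) (DOb L c) (\<lambda>j. cmp (\<iota> j) c)"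
    "pw (\<iota> k0)"
proof -
  obtain L' \<iota>' where L': "\<And>c. c \<in> VOb C \<Longrightarrow> is_colimit (ord_cat r (Field r)) M (ev c X) (L' c) (\<iota>' c)"
    by (rule pw_colimit_aux) blast
  show p: "is_colimit (ord_cat r (Field r)) M (ev c X) (DOb L c) (\<lambda>j. cmp (\<iota> j) c)" if "c \<in> VOb C" for c
    by (rule colimit_pointwise[OF seq_small transfinite_seqD(4)[OF X] L' L that])
  have "\<iota> k0 \<in> Ar DC" using L least_in[OF k0] by (simp add: is_colimit_def is_cocone_def hom_iff)
  then show "pw (\<iota> k0)"
    unfolding pw_def using S.transfinite_in[OF pw_seq pw_seq_steps p k0] by blast
qed

end

lemma pw_coproduct_exists:
  assumes I: "small U (I :: 's set)" and X: "\<And>i. i \<in> I \<Longrightarrow> X i \<in> Gd"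
  shows "\<exists>Y \<iota>. is_coproduct DC I X Y \<iota>" "is_coproduct DC I X Y \<iota> \<Longrightarrow> Y \<in> Gd"
proof -
  have F: "is_functor (ord_cat Id I) DC (disc DC X)"
    by (rule DC.disc_functor) (rule Gd_Ob[OF X])
  have J: "small_category U (ord_cat Id I)" using disc_cat[OF universe I] .
  have iff: "is_colimit (ord_cat Id I) M (ev c (disc DC X)) Y \<iota> \<longleftrightarrow> is_coproduct M I (\<lambda>i. DOb (X i) c) Y \<iota>"
    if c: "c \<in> VOb C" for c Y \<iota>
  proof -
    have "is_colimit (ord_cat Id I) M (ev c (disc DC X)) Y \<iota>
        \<longleftrightarrow> is_colimit (ord_cat Id I) M (disc M (\<lambda>i. DOb (X i) c)) Y \<iota>"
      using J c by (intro iffI; elim M.colimit_cong) (auto simp: disc_def small_category_def)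
    then show ?thesis unfolding M.coproduct_iff_colimit .
  qed
  have g: "\<forall>i\<in>I. DOb (X i) c \<in> good_obs M S" if "c \<in> VOb C" for c
    using X that by (auto simp: Gd_def)
  have "\<exists>Y \<iota>. is_colimit (ord_cat Id I) M (ev c (disc DC X)) Y \<iota>" if c: "c \<in> VOb C" for c
    unfolding iff[OF c] by (rule S.coproduct_exists[OF I g[OF c]])
  then obtain L \<iota>' where L: "\<And>c. c \<in> VOb C \<Longrightarrow> is_colimit (ord_cat Id I) M (ev c (disc DC X)) (L c) (\<iota>' c)"
    by metis
  show "\<exists>Y \<iota>. is_coproduct DC I X Y \<iota>"
    unfolding DC.coproduct_iff_colimit by (rule pointwise_colimit[OF J F L]) (assumption, intro exI)
  show "Y \<in> Gd" if "is_coproduct DC I X Y \<iota>"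
  proof -
    have Y: "is_colimit (ord_cat Id I) DC (disc DC X) Y \<iota>" using that unfolding DC.coproduct_iff_colimit .
    have "DOb Y c \<in> good_obs M S" if c: "c \<in> VOb C" for c
      using colimit_pointwise[OF J F L Y c] S.coproduct_good[OF I g[OF c]] unfolding iff[OF c] by blast
    moreover have "is_diagram V C M T Y" using that by (simp add: is_coproduct_def)
    ultimately show ?thesis by (simp add: Gd_def)
  qed
qed

text \<open>Coproducts need no case, being transfinite composites of cobase changes.\<close>

lemma cell_induct [consumes 1, case_names free_map cobase transfinite]:
  assumes f: "f \<in> cells"
    and gen: "\<And>c i. \<lbrakk>c \<in> VOb C; i \<in> S\<rbrakk> \<Longrightarrow> \<Phi> (free_map c i)"
    and cobase: "\<And>f g p q. \<lbrakk>pw f; \<Phi> f; Cod DC g \<in> Gd; is_pushout DC f g p q\<rbrakk> \<Longrightarrow> \<Phi> q"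
    and trans: "\<And>(r :: 's rel) X L \<iota> k0. \<lbrakk>transfinite_seq U DC r X;
        \<And>j k. is_succ r j k \<Longrightarrow> pw (FAr X (j, k)); \<And>j k. is_succ r j k \<Longrightarrow> \<Phi> (FAr X (j, k));
        is_least r k0; FOb X k0 \<in> Gd; is_colimit (ord_cat r (Field r)) DC X L \<iota>\<rbrakk> \<Longrightarrow> \<Phi> (\<iota> k0)"
  shows "pw f \<and> \<Phi> f"
proof -
  \<comment> \<open>The induction carries \<open>pw\<close> along with the property: the closure
    steps are about pushouts and composites of maps that are pointwise in \<open>S\<close>, and
    \<open>pw\<close> is itself closed under them.\<close>
  have cobase': "pw q \<and> \<Phi> q" if "pw f \<and> \<Phi> f" "Cod DC g \<in> Gd" "is_pushout DC f g p q" for f g p q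
  proof -
    note P = DC.pushoutD[OF that(3)]
    have "pw q" by (rule pw_pushout(4)[OF _ P(2) _ that(2,3)]) (use that(1) P(3) in auto)
    with cobase[OF _ _ that(2,3)] that(1) show ?thesis by blast
  qed
  have trans': "pw (\<iota> k0) \<and> \<Phi> (\<iota> k0)"
    if "transfinite_seq U DC r X" "\<And>j k. is_succ r j k \<Longrightarrow> pw (FAr X (j, k)) \<and> \<Phi> (FAr X (j, k))"
      "is_least r k0" "FOb X k0 \<in> Gd" "is_colimit (ord_cat r (Field r)) DC X L \<iota>" for r :: "'s rel" and X L \<iota> k0
    using pw_colimit(2)[OF that(1) conjunct1[OF that(2)] that(3-5)]
      trans[OF that(1) conjunct1[OF that(2)] conjunct2[OF that(2)] that(3-5)] by blast
  show ?thesis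
    using f
  proof (induction rule: cell_closure.induct)
    case (generator f)
    then show ?case using gen pw_free_map by blast
  next
    case (coproduct I f X \<iota> Y \<kappa> h)
    show ?case
    proof (rule DC.coproduct_in_closure[OF universe coproduct.hyps(1), of "\<lambda>f. pw f \<and> \<Phi> f" f Gd X \<iota> Y \<kappa> h])
      fix i assume i: "i \<in> I"
      note pwi = pwD[OF conjunct1[OF coproduct.IH[OF i]]]
      show "f i \<in> Ar DC" "Dom DC (f i) \<in> Gd" "Cod DC (f i) \<in> Gd" using pwi by auto
      show "pw (f i) \<and> \<Phi> (f i)" by (rule coproduct.IH[OF i])
      show "h \<cdot>\<^bsub>DC\<^esub> \<iota> i = \<kappa> i \<cdot>\<^bsub>DC\<^esub> f i" using coproduct.hyps(6)[OF i] .
    next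
      fix Y assume "\<And>i. i \<in> I \<Longrightarrow> Y i \<in> Gd"
      then show "\<exists>Z \<kappa>. is_coproduct DC I Y Z \<kappa>" by (rule pw_coproduct_exists(1)[OF coproduct.hyps(1)])
    next
      fix Y Z \<kappa> assume "\<And>i. i \<in> I \<Longrightarrow> Y i \<in> Gd" "is_coproduct DC I Y Z \<kappa>"
      then show "Z \<in> Gd" by (rule pw_coproduct_exists(2)[OF coproduct.hyps(1)])
    next
      fix f g p q assume "pw f \<and> \<Phi> f" "Cod DC g \<in> Gd" "is_pushout DC f g p q"
      then show "pw q \<and> \<Phi> q" by (rule cobase')
    next
      fix r :: "'s rel" and X L \<iota> k0
      assume "transfinite_seq U DC r X" "\<And>j k. is_succ r j k \<Longrightarrow> pw (FAr X (j, k)) \<and> \<Phi> (FAr X (j, k))"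
        "is_least r k0" "FOb X k0 \<in> Gd" "is_colimit (ord_cat r (Field r)) DC X L \<iota>"
      then show "pw (\<iota> k0) \<and> \<Phi> (\<iota> k0)" by (rule trans')
    qed (rule coproduct.hyps)+
  next
    case (cobase_change f g p q)
    then show ?case by (intro cobase'[of f g p q]) auto
  next
    case (transfinite_composite r X k0 L \<iota>)
    show ?case
      by (rule trans'[OF transfinite_composite.hyps(1) transfinite_composite.IH])
        (assumption | rule transfinite_composite.hyps)+
  qed
qed

lemma cells_pw: "f \<in> cells \<Longrightarrow> pw f"
  using cell_induct[of f "\<lambda>_. True"] by blast

end

section \<open>Coherence of the symmetry with units and tensor products\<close>

section \<open>Weighted cocones\<close>

subsection \<open>Coherence in the base category\<close>

context enriched
begin

abbreviation IT where "IT K L X \<equiv> inv_ar V (TAssoc V K L X)"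

lemma IT_simps [simp]:
  assumes "K \<in> Ob V" "L \<in> Ob V" "X \<in> Ob V"
  shows "IT K L X \<in> Ar V" "Dom V (IT K L X) = TOb V K (TOb V L X)"
    "Cod V (IT K L X) = TOb V (TOb V K L) X"
    "IT K L X \<cdot>\<^bsub>V\<^esub> TAssoc V K L X = Idn V (TOb V (TOb V K L) X)"
    "TAssoc V K L X \<cdot>\<^bsub>V\<^esub> IT K L X = Idn V (TOb V K (TOb V L X))"
  using V.is_isoD[OF V.TAssoc_iso[OF assms]] assms by simp_all

lemma IT_cancel [simp]:
  assumes "K \<in> Ob V" "L \<in> Ob V" "X \<in> Ob V" "h \<in> Ar V"
  shows "Cod V h = TOb V (TOb V K L) X \<Longrightarrow> IT K L X \<cdot>\<^bsub>V\<^esub> (TAssoc V K L X \<cdot>\<^bsub>V\<^esub> h) = h"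
    "Cod V h = TOb V K (TOb V L X) \<Longrightarrow> TAssoc V K L X \<cdot>\<^bsub>V\<^esub> (IT K L X \<cdot>\<^bsub>V\<^esub> h) = h"
  using V.comp_cong_left[OF IT_simps(4)[OF assms(1-3)], of h]
    V.comp_cong_left[OF IT_simps(5)[OF assms(1-3)], of h] assms by simp_all

lemma TAssoc_nat:
  assumes "f \<in> Ar V" "g \<in> Ar V" "h \<in> Ar V"
  shows "TAssoc V (Cod V f) (Cod V g) (Cod V h) \<cdot>\<^bsub>V\<^esub> TAr V (TAr V f g) h
    = TAr V f (TAr V g h) \<cdot>\<^bsub>V\<^esub> TAssoc V (Dom V f) (Dom V g) (Dom V h)"
  using V.TAssoc_natural[of f "Dom V f" "Cod V f" g "Dom V g" "Cod V g" h "Dom V h" "Cod V h"] assms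
  by (simp add: hom_iff)

lemma Symm_nat:
  assumes "f \<in> Ar V" "g \<in> Ar V"
  shows "Symm V (Cod V f) (Cod V g) \<cdot>\<^bsub>V\<^esub> TAr V f g = TAr V g f \<cdot>\<^bsub>V\<^esub> Symm V (Dom V f) (Dom V g)"
  using V.Symm_natural[of f "Dom V f" "Cod V f" g "Dom V g" "Cod V g"] assms by (simp add: hom_iff)

lemma Symm_Symm [simp]: "\<lbrakk>K \<in> Ob V; L \<in> Ob V\<rbrakk> \<Longrightarrow> Symm V L K \<cdot>\<^bsub>V\<^esub> Symm V K L = Idn V (TOb V K L)"
  by (rule V.Symm_Symm)

lemma Symm_cancel [simp]:
  assumes "K \<in> Ob V" "L \<in> Ob V" "h \<in> Ar V" "Cod V h = TOb V K L"
  shows "Symm V L K \<cdot>\<^bsub>V\<^esub> (Symm V K L \<cdot>\<^bsub>V\<^esub> h) = h"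
  using V.comp_cong_left[OF Symm_Symm[OF assms(1,2)], of h] assms by simp

lemma iso_Symm: "\<lbrakk>K \<in> Ob V; L \<in> Ob V\<rbrakk> \<Longrightarrow> is_iso V (Symm V K L)"
  by (rule V.is_isoI[of _ "Symm V L K"]) simp_all

lemma iso_TAr:
  assumes "is_iso V f" "is_iso V g" shows "is_iso V (TAr V f g)"
  using V.is_isoD[OF assms(1)] V.is_isoD[OF assms(2)]
  by (intro V.is_isoI[of _ "TAr V (inv_ar V f) (inv_ar V g)"]) simp_all

text \<open>The left unitor is a natural isomorphism from tensoring with the unit to the identity
  functor, so tensoring with the unit is faithful.\<close>

lemma TAr_Unit_faithful:
  assumes "f \<in> hom V K L" "g \<in> hom V K L" "TAr V (Idn V (Unit V)) f = TAr V (Idn V (Unit V)) g"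
  shows "f = g"
proof -
  have K: "K \<in> Ob V" using assms(1) by (force simp: hom_iff)
  have "f \<cdot>\<^bsub>V\<^esub> LUnit V K = g \<cdot>\<^bsub>V\<^esub> LUnit V K"
    using V.LUnit_natural[OF assms(1)] V.LUnit_natural[OF assms(2)] assms(3) by simp
  then show ?thesis
    by (rule V.iso_epi[OF V.LUnit_iso[OF K]]) (use assms K in \<open>simp_all add: hom_iff\<close>)
qed

lemma TAr_Unit_faithful':
  assumes "f \<in> hom V K L" "g \<in> hom V K L" "TAr V f (Idn V (Unit V)) = TAr V g (Idn V (Unit V))"
  shows "f = g"
proof -
  have K: "K \<in> Ob V" using assms(1) by (force simp: hom_iff)
  have "f \<cdot>\<^bsub>V\<^esub> RUnit V K = g \<cdot>\<^bsub>V\<^esub> RUnit V K"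
    using V.RUnit_natural[OF assms(1)] V.RUnit_natural[OF assms(2)] assms(3) by simp
  then show ?thesis
    by (rule V.iso_epi[OF V.RUnit_iso[OF K]]) (use assms K in \<open>simp_all add: hom_iff\<close>)
qed

text \<open>Kelly's argument: this triangle is tested after the faithful functor
  \<open>I \<otimes> -\<close> and after composition with two isomorphisms, where it follows from
  the pentagon, the triangle axiom and naturality.\<close>

lemma LUnit_tensor:
  assumes X: "X \<in> Ob V" and Y: "Y \<in> Ob V"
  shows "LUnit V (TOb V X Y) \<cdot>\<^bsub>V\<^esub> TAssoc V (Unit V) X Y = TAr V (LUnit V X) (Idn V Y)"
proof (rule TAr_Unit_faithful)
  let ?I = "Unit V"
  show "TAr V (Idn V ?I) (LUnit V (TOb V X Y) \<cdot>\<^bsub>V\<^esub> TAssoc V ?I X Y)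
      = TAr V (Idn V ?I) (TAr V (LUnit V X) (Idn V Y))"
  proof (rule V.iso_epi)
    show "is_iso V (TAssoc V ?I (TOb V ?I X) Y)" using X Y by (simp add: V.TAssoc_iso)
    show "TAr V (Idn V ?I) (LUnit V (TOb V X Y) \<cdot>\<^bsub>V\<^esub> TAssoc V ?I X Y) \<cdot>\<^bsub>V\<^esub> TAssoc V ?I (TOb V ?I X) Y
      = TAr V (Idn V ?I) (TAr V (LUnit V X) (Idn V Y)) \<cdot>\<^bsub>V\<^esub> TAssoc V ?I (TOb V ?I X) Y"
    proof (rule V.iso_epi)
      show "is_iso V (TAr V (TAssoc V ?I ?I X) (Idn V Y))"
        using X Y by (intro iso_TAr V.TAssoc_iso V.is_iso_Idn) simp_all
      have pent: "TAssoc V ?I ?I (TOb V X Y) \<cdot>\<^bsub>V\<^esub> TAssoc V (TOb V ?I ?I) X Y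
        = TAr V (Idn V ?I) (TAssoc V ?I X Y) \<cdot>\<^bsub>V\<^esub> (TAssoc V ?I (TOb V ?I X) Y \<cdot>\<^bsub>V\<^esub> TAr V (TAssoc V ?I ?I X) (Idn V Y))"
        using V.pentagon[of ?I ?I X Y] X Y by simp
      have tri: "TAr V (Idn V ?I) (LUnit V K) \<cdot>\<^bsub>V\<^esub> TAssoc V ?I ?I K = TAr V (RUnit V ?I) (Idn V K)"
        if "K \<in> Ob V" for K using V.triangle[of ?I K] that by simp
      have 1: "TAssoc V ?I X Y \<cdot>\<^bsub>V\<^esub> TAr V (TAr V f (Idn V X)) (Idn V Y)
          = TAr V f (Idn V (TOb V X Y)) \<cdot>\<^bsub>V\<^esub> TAssoc V K X Y" if "f \<in> hom V K ?I" for f K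
        using TAssoc_nat[of f "Idn V X" "Idn V Y"] that X Y by (simp add: hom_iff)
      have 2: "TAssoc V ?I X Y \<cdot>\<^bsub>V\<^esub> TAr V (TAr V (Idn V ?I) (LUnit V X)) (Idn V Y)
          = TAr V (Idn V ?I) (TAr V (LUnit V X) (Idn V Y)) \<cdot>\<^bsub>V\<^esub> TAssoc V ?I (TOb V ?I X) Y"
        using TAssoc_nat[of "Idn V ?I" "LUnit V X" "Idn V Y"] X Y by simp
      have "TAr V (Idn V ?I) (LUnit V (TOb V X Y) \<cdot>\<^bsub>V\<^esub> TAssoc V ?I X Y)
          \<cdot>\<^bsub>V\<^esub> TAssoc V ?I (TOb V ?I X) Y \<cdot>\<^bsub>V\<^esub> TAr V (TAssoc V ?I ?I X) (Idn V Y)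
        = TAr V (Idn V ?I) (LUnit V (TOb V X Y)) \<cdot>\<^bsub>V\<^esub> (TAr V (Idn V ?I) (TAssoc V ?I X Y)
          \<cdot>\<^bsub>V\<^esub> (TAssoc V ?I (TOb V ?I X) Y \<cdot>\<^bsub>V\<^esub> TAr V (TAssoc V ?I ?I X) (Idn V Y)))"
        using X Y by simp
      also have "\<dots> = TAr V (RUnit V ?I) (Idn V (TOb V X Y)) \<cdot>\<^bsub>V\<^esub> TAssoc V (TOb V ?I ?I) X Y"
        unfolding pent[symmetric] using X Y tri[of "TOb V X Y"]
          V.comp_cong_left[OF tri[of "TOb V X Y"], of "TAssoc V (TOb V ?I ?I) X Y"] by simp
      also have "\<dots> = TAssoc V ?I X Y \<cdot>\<^bsub>V\<^esub> TAr V (TAr V (RUnit V ?I) (Idn V X)) (Idn V Y)"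
        using 1[of "RUnit V ?I" "TOb V ?I ?I"] by (simp add: hom_iff)
      also have "\<dots> = TAssoc V ?I X Y \<cdot>\<^bsub>V\<^esub> TAr V (TAr V (Idn V ?I) (LUnit V X)) (Idn V Y)
          \<cdot>\<^bsub>V\<^esub> TAr V (TAssoc V ?I ?I X) (Idn V Y)"
        unfolding tri[OF X, symmetric] using X Y by simp
      also have "\<dots> = TAr V (Idn V ?I) (TAr V (LUnit V X) (Idn V Y)) \<cdot>\<^bsub>V\<^esub> TAssoc V ?I (TOb V ?I X) Y
          \<cdot>\<^bsub>V\<^esub> TAr V (TAssoc V ?I ?I X) (Idn V Y)"
        unfolding 2 ..
      finally show "TAr V (Idn V ?I) (LUnit V (TOb V X Y) \<cdot>\<^bsub>V\<^esub> TAssoc V ?I X Y)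
          \<cdot>\<^bsub>V\<^esub> TAssoc V ?I (TOb V ?I X) Y \<cdot>\<^bsub>V\<^esub> TAr V (TAssoc V ?I ?I X) (Idn V Y)
        = TAr V (Idn V ?I) (TAr V (LUnit V X) (Idn V Y)) \<cdot>\<^bsub>V\<^esub> TAssoc V ?I (TOb V ?I X) Y
          \<cdot>\<^bsub>V\<^esub> TAr V (TAssoc V ?I ?I X) (Idn V Y)" .
    qed (use X Y in simp_all)
  qed (use X Y in simp_all)
qed (use X Y in \<open>simp_all add: hom_iff\<close>)

text \<open>Compatibility of the symmetry with the unitors, from the hexagon with two unit factors.
  It is tested after \<open>- \<otimes> I\<close> and a composition with the symmetry, which are
  faithful and invertible respectively.\<close>

lemma LUnit_Symm:
  assumes A: "A \<in> Ob V" shows "LUnit V A \<cdot>\<^bsub>V\<^esub> Symm V A (Unit V) = RUnit V A"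
proof (rule TAr_Unit_faithful'[symmetric])
  let ?I = "Unit V"
  let ?s = "Symm V A ?I"
  show "TAr V (RUnit V A) (Idn V ?I) = TAr V (LUnit V A \<cdot>\<^bsub>V\<^esub> ?s) (Idn V ?I)"
  proof (rule V.iso_mono[OF iso_Symm[of A ?I]])
    have nat: "?s \<cdot>\<^bsub>V\<^esub> TAr V (Idn V A) (LUnit V ?I) = TAr V (LUnit V ?I) (Idn V A) \<cdot>\<^bsub>V\<^esub> Symm V A (TOb V ?I ?I)"
      using Symm_nat[of "Idn V A" "LUnit V ?I"] A by simp
    have hex: "TAssoc V ?I ?I A \<cdot>\<^bsub>V\<^esub> (Symm V A (TOb V ?I ?I) \<cdot>\<^bsub>V\<^esub> TAssoc V A ?I ?I)
        = TAr V (Idn V ?I) ?s \<cdot>\<^bsub>V\<^esub> (TAssoc V ?I A ?I \<cdot>\<^bsub>V\<^esub> TAr V ?s (Idn V ?I))"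
      using V.hexagon[of A ?I ?I] A by simp
    have "?s \<cdot>\<^bsub>V\<^esub> TAr V (RUnit V A) (Idn V ?I) = ?s \<cdot>\<^bsub>V\<^esub> TAr V (Idn V A) (LUnit V ?I) \<cdot>\<^bsub>V\<^esub> TAssoc V A ?I ?I"
      using V.triangle[of A ?I, symmetric] A by simp
    also have "\<dots> = TAr V (LUnit V ?I) (Idn V A) \<cdot>\<^bsub>V\<^esub> (Symm V A (TOb V ?I ?I) \<cdot>\<^bsub>V\<^esub> TAssoc V A ?I ?I)"
      unfolding nat using A by simp
    also have "\<dots> = LUnit V (TOb V ?I A) \<cdot>\<^bsub>V\<^esub> (TAssoc V ?I ?I A \<cdot>\<^bsub>V\<^esub> (Symm V A (TOb V ?I ?I) \<cdot>\<^bsub>V\<^esub> TAssoc V A ?I ?I))"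
      unfolding LUnit_tensor[of ?I A, OF unit_simps(1) A, symmetric] using A by simp
    also have "\<dots> = LUnit V (TOb V ?I A) \<cdot>\<^bsub>V\<^esub> TAr V (Idn V ?I) ?s \<cdot>\<^bsub>V\<^esub> (TAssoc V ?I A ?I \<cdot>\<^bsub>V\<^esub> TAr V ?s (Idn V ?I))"
      unfolding hex using A by simp
    also have "LUnit V (TOb V ?I A) \<cdot>\<^bsub>V\<^esub> TAr V (Idn V ?I) ?s = ?s \<cdot>\<^bsub>V\<^esub> LUnit V (TOb V A ?I)"
      using V.LUnit_natural[of ?s "TOb V A ?I" "TOb V ?I A"] A by (simp add: hom_iff)
    also have "?s \<cdot>\<^bsub>V\<^esub> LUnit V (TOb V A ?I) \<cdot>\<^bsub>V\<^esub> (TAssoc V ?I A ?I \<cdot>\<^bsub>V\<^esub> TAr V ?s (Idn V ?I))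
      = ?s \<cdot>\<^bsub>V\<^esub> (LUnit V (TOb V A ?I) \<cdot>\<^bsub>V\<^esub> TAssoc V ?I A ?I \<cdot>\<^bsub>V\<^esub> TAr V ?s (Idn V ?I))"
      using A by simp
    also have "\<dots> = ?s \<cdot>\<^bsub>V\<^esub> TAr V (LUnit V A \<cdot>\<^bsub>V\<^esub> ?s) (Idn V ?I)"
      unfolding LUnit_tensor[of A ?I, OF A unit_simps(1)] using A by simp
    finally show "?s \<cdot>\<^bsub>V\<^esub> TAr V (RUnit V A) (Idn V ?I) = ?s \<cdot>\<^bsub>V\<^esub> TAr V (LUnit V A \<cdot>\<^bsub>V\<^esub> ?s) (Idn V ?I)" .
  qed (use A in simp_all)
qed (use A in \<open>simp_all add: hom_iff\<close>)

text \<open>Two ways to reverse the order of three factors. After composition with the inverse of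
  the symmetry of \<open>w\<close> and \<open>b\<close>, four instances of the hexagon and
  naturality bring both sides to the same form. It converts the action of the opposite category in
  \<open>ract_assoc\<close>.\<close>

lemma Symm_tensor:
  assumes w: "w \<in> Ob V" and a: "a \<in> Ob V" and b: "b \<in> Ob V"
  shows "TAssoc V a b w \<cdot>\<^bsub>V\<^esub> (TAr V (Symm V b a) (Idn V w) \<cdot>\<^bsub>V\<^esub> (Symm V w (TOb V b a) \<cdot>\<^bsub>V\<^esub> TAssoc V w b a))
    = TAr V (Idn V a) (Symm V w b) \<cdot>\<^bsub>V\<^esub> Symm V (TOb V w b) a"
    (is "?R = _")
proof -
  have hex: "TAssoc V L N K \<cdot>\<^bsub>V\<^esub> (Symm V K (TOb V L N) \<cdot>\<^bsub>V\<^esub> TAssoc V K L N)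
      = TAr V (Idn V L) (Symm V K N) \<cdot>\<^bsub>V\<^esub> (TAssoc V L K N \<cdot>\<^bsub>V\<^esub> TAr V (Symm V K L) (Idn V N))"
    if "K \<in> Ob V" "L \<in> Ob V" "N \<in> Ob V" for K L N
    using V.hexagon[of K L N] that by simp
  have H1: "TAssoc V b a w \<cdot>\<^bsub>V\<^esub> (Symm V w (TOb V b a) \<cdot>\<^bsub>V\<^esub> TAssoc V w b a)
    = TAr V (Idn V b) (Symm V w a) \<cdot>\<^bsub>V\<^esub> (TAssoc V b w a \<cdot>\<^bsub>V\<^esub> TAr V (Symm V w b) (Idn V a))"
    by (rule hex[OF w b a])
  have H2: "TAr V (Idn V a) (Symm V b w) \<cdot>\<^bsub>V\<^esub> TAssoc V a b w \<cdot>\<^bsub>V\<^esub> TAr V (Symm V b a) (Idn V w)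
    = TAssoc V a w b \<cdot>\<^bsub>V\<^esub> (Symm V b (TOb V a w) \<cdot>\<^bsub>V\<^esub> TAssoc V b a w)"
    using hex[OF b a w] w a b by simp
  have H3: "Symm V b (TOb V w a) \<cdot>\<^bsub>V\<^esub> TAssoc V b w a \<cdot>\<^bsub>V\<^esub> TAr V (Symm V w b) (Idn V a)
    = IT w a b \<cdot>\<^bsub>V\<^esub> (TAr V (Idn V w) (Symm V b a) \<cdot>\<^bsub>V\<^esub> TAssoc V w b a)"
  proof -
    have "Symm V b (TOb V w a) \<cdot>\<^bsub>V\<^esub> TAssoc V b w a
      = IT w a b \<cdot>\<^bsub>V\<^esub> (TAssoc V w a b \<cdot>\<^bsub>V\<^esub> (Symm V b (TOb V w a) \<cdot>\<^bsub>V\<^esub> TAssoc V b w a))"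
      using w a b by simp
    also have "\<dots> = IT w a b \<cdot>\<^bsub>V\<^esub> (TAr V (Idn V w) (Symm V b a) \<cdot>\<^bsub>V\<^esub> (TAssoc V w b a \<cdot>\<^bsub>V\<^esub> TAr V (Symm V b w) (Idn V a)))"
      unfolding hex[OF b w a] ..
    finally show ?thesis using w a b by simp
  qed
  have H4: "TAssoc V a w b = Symm V (TOb V w b) a \<cdot>\<^bsub>V\<^esub> (IT w b a \<cdot>\<^bsub>V\<^esub> (TAr V (Idn V w) (Symm V a b)
      \<cdot>\<^bsub>V\<^esub> (TAssoc V w a b \<cdot>\<^bsub>V\<^esub> TAr V (Symm V a w) (Idn V b))))"
    unfolding hex[OF a w b, symmetric] using w a b by simp
  have nat: "Symm V b (TOb V a w) \<cdot>\<^bsub>V\<^esub> TAr V (Idn V b) (Symm V w a) = TAr V (Symm V w a) (Idn V b) \<cdot>\<^bsub>V\<^esub> Symm V b (TOb V w a)"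
    using Symm_nat[of "Idn V b" "Symm V w a"] w a b by simp
  have "TAr V (Idn V a) (Symm V b w) \<cdot>\<^bsub>V\<^esub> ?R
    = TAr V (Idn V a) (Symm V b w) \<cdot>\<^bsub>V\<^esub> TAssoc V a b w \<cdot>\<^bsub>V\<^esub> TAr V (Symm V b a) (Idn V w)
      \<cdot>\<^bsub>V\<^esub> (Symm V w (TOb V b a) \<cdot>\<^bsub>V\<^esub> TAssoc V w b a)"
    using w a b by simp
  also have "\<dots> = TAssoc V a w b \<cdot>\<^bsub>V\<^esub> Symm V b (TOb V a w) \<cdot>\<^bsub>V\<^esub> (TAssoc V b a w \<cdot>\<^bsub>V\<^esub> (Symm V w (TOb V b a) \<cdot>\<^bsub>V\<^esub> TAssoc V w b a))"
    unfolding H2 using w a b by simp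
  also have "\<dots> = TAssoc V a w b \<cdot>\<^bsub>V\<^esub> (Symm V b (TOb V a w) \<cdot>\<^bsub>V\<^esub> TAr V (Idn V b) (Symm V w a))
      \<cdot>\<^bsub>V\<^esub> (TAssoc V b w a \<cdot>\<^bsub>V\<^esub> TAr V (Symm V w b) (Idn V a))"
    unfolding H1 using w a b by simp
  also have "\<dots> = TAssoc V a w b \<cdot>\<^bsub>V\<^esub> TAr V (Symm V w a) (Idn V b)
      \<cdot>\<^bsub>V\<^esub> (Symm V b (TOb V w a) \<cdot>\<^bsub>V\<^esub> TAssoc V b w a \<cdot>\<^bsub>V\<^esub> TAr V (Symm V w b) (Idn V a))"
    unfolding nat using w a b by simp
  also have "\<dots> = Symm V (TOb V w b) a"
    unfolding H3 H4 using w a b by simp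
  finally have *: "TAr V (Idn V a) (Symm V b w) \<cdot>\<^bsub>V\<^esub> ?R = Symm V (TOb V w b) a" .
  have "TAr V (Idn V a) (Symm V w b) \<cdot>\<^bsub>V\<^esub> (TAr V (Idn V a) (Symm V b w) \<cdot>\<^bsub>V\<^esub> ?R) = ?R"
    using w a b by simp
  then show ?thesis unfolding * by simp
qed

end

section \<open>Weights as right modules, and cocones in place of maps out of the coend\<close>

subsection \<open>Weights and cocones\<close>

locale weighted = enriched U V M T C
  for U :: "'s itself" and V :: "('v, 'w, 'z) moncat_scheme"
    and M :: "('o, 'a, 'y) cat_scheme" (structure)
    and T :: "('v, 'w, 'o, 'a) act" and C :: "('c, 'v, 'w) vcat" +
  fixes W :: "('c, 'v, 'w) diagram"
  assumes weight: "is_weight V C W"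
begin

abbreviation Wt where "Wt c \<equiv> DOb W c"

text \<open>The right action of \<^term>\<open>C\<close> on the weight: \<open>W x \<otimes> C(y, x) \<rightarrow> W y\<close>.\<close>

definition ract where "ract x y = DAct W x y \<cdot>\<^bsub>V\<^esub> Symm V (Wt x) (VHom C y x)"

lemma Wt_Ob [simp]: "x \<in> VOb C \<Longrightarrow> Wt x \<in> Ob V"
  using weight by (simp add: is_weight_def is_diagram_def op_vcat_def)

lemma W_act [simp]:
  assumes "x \<in> VOb C" "y \<in> VOb C"
  shows "DAct W x y \<in> Ar V" "Dom V (DAct W x y) = TOb V (VHom C y x) (Wt x)" "Cod V (DAct W x y) = Wt y"
  using weight assms by (auto simp: is_weight_def is_diagram_def op_vcat_def self_action_def hom_iff)

lemma W_unit: "x \<in> VOb C \<Longrightarrow> DAct W x x \<cdot>\<^bsub>V\<^esub> TAr V (VId C x) (Idn V (Wt x)) = LUnit V (Wt x)"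
  using weight by (simp add: is_weight_def is_diagram_def op_vcat_def self_action_def)

lemma W_assoc:
  assumes "x \<in> VOb C" "y \<in> VOb C" "z \<in> VOb C"
  shows "DAct W x z \<cdot>\<^bsub>V\<^esub> TAr V (VComp C z y x \<cdot>\<^bsub>V\<^esub> Symm V (VHom C z y) (VHom C y x)) (Idn V (Wt x))
    = DAct W y z \<cdot>\<^bsub>V\<^esub> (TAr V (Idn V (VHom C z y)) (DAct W x y) \<cdot>\<^bsub>V\<^esub> TAssoc V (VHom C z y) (VHom C y x) (Wt x))"
proof -
  have "DAct W x z \<cdot>\<^bsub>V\<^esub> TAr V (VComp C z y x \<cdot>\<^bsub>V\<^esub> Symm V (VHom C z y) (VHom C y x)) (Idn V (Wt x))
    = DAct W y z \<cdot>\<^bsub>V\<^esub> TAr V (Idn V (VHom C z y)) (DAct W x y) \<cdot>\<^bsub>V\<^esub> TAssoc V (VHom C z y) (VHom C y x) (Wt x)"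
    using weight assms by (simp add: is_weight_def is_diagram_def op_vcat_def self_action_def del: V.comp_assoc)
  then show ?thesis using assms by simp
qed

lemma ract_simps [simp]:
  assumes "x \<in> VOb C" "y \<in> VOb C"
  shows "ract x y \<in> Ar V" "Dom V (ract x y) = TOb V (Wt x) (VHom C y x)" "Cod V (ract x y) = Wt y"
  using assms by (simp_all add: ract_def)

lemma ract_unit:
  assumes "x \<in> VOb C"
  shows "ract x x \<cdot>\<^bsub>V\<^esub> TAr V (Idn V (Wt x)) (VId C x) = RUnit V (Wt x)"
proof -
  have "ract x x \<cdot>\<^bsub>V\<^esub> TAr V (Idn V (Wt x)) (VId C x)
      = DAct W x x \<cdot>\<^bsub>V\<^esub> TAr V (VId C x) (Idn V (Wt x)) \<cdot>\<^bsub>V\<^esub> Symm V (Wt x) (Unit V)"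
    using Symm_nat[of "Idn V (Wt x)" "VId C x"] assms by (simp add: ract_def)
  then show ?thesis using assms by (simp add: W_unit LUnit_Symm)
qed

text \<open>The composition of the opposite category contains a symmetry, so the module law of the
  weight does as well. Moving it past the tensor product by \<open>Symm_tensor\<close> gives the law
  of a right module over \<open>C\<close>.\<close>

lemma ract_assoc:
  assumes x: "x \<in> VOb C" and y: "y \<in> VOb C" and z: "z \<in> VOb C"
  shows "ract y z \<cdot>\<^bsub>V\<^esub> TAr V (ract x y) (Idn V (VHom C z y))
    = ract x z \<cdot>\<^bsub>V\<^esub> (TAr V (Idn V (Wt x)) (VComp C z y x) \<cdot>\<^bsub>V\<^esub> TAssoc V (Wt x) (VHom C y x) (VHom C z y))"
proof -
  let ?w = "Wt x" and ?b = "VHom C y x" and ?a = "VHom C z y"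
  have 1: "Symm V (Wt y) ?a \<cdot>\<^bsub>V\<^esub> TAr V (ract x y) (Idn V ?a)
    = TAr V (Idn V ?a) (DAct W x y) \<cdot>\<^bsub>V\<^esub> (TAr V (Idn V ?a) (Symm V ?w ?b) \<cdot>\<^bsub>V\<^esub> Symm V (TOb V ?w ?b) ?a)"
    using Symm_nat[of "ract x y" "Idn V ?a"] x y z by (simp add: ract_def)
  have 2: "Symm V ?w (VHom C z x) \<cdot>\<^bsub>V\<^esub> TAr V (Idn V ?w) (VComp C z y x)
    = TAr V (VComp C z y x \<cdot>\<^bsub>V\<^esub> Symm V ?a ?b) (Idn V ?w) \<cdot>\<^bsub>V\<^esub> (TAr V (Symm V ?b ?a) (Idn V ?w) \<cdot>\<^bsub>V\<^esub> Symm V ?w (TOb V ?b ?a))"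
    using Symm_nat[of "Idn V ?w" "VComp C z y x"] x y z by simp
  have "ract y z \<cdot>\<^bsub>V\<^esub> TAr V (ract x y) (Idn V ?a)
    = DAct W y z \<cdot>\<^bsub>V\<^esub> (Symm V (Wt y) ?a \<cdot>\<^bsub>V\<^esub> TAr V (ract x y) (Idn V ?a))"
    unfolding ract_def[of y z] using x y z by simp
  also have "\<dots> = DAct W y z \<cdot>\<^bsub>V\<^esub> TAr V (Idn V ?a) (DAct W x y)
      \<cdot>\<^bsub>V\<^esub> (TAr V (Idn V ?a) (Symm V ?w ?b) \<cdot>\<^bsub>V\<^esub> Symm V (TOb V ?w ?b) ?a)"
    unfolding 1 using x y z by simp
  also have "\<dots> = DAct W y z \<cdot>\<^bsub>V\<^esub> (TAr V (Idn V ?a) (DAct W x y) \<cdot>\<^bsub>V\<^esub> TAssoc V ?a ?b ?w)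
      \<cdot>\<^bsub>V\<^esub> (TAr V (Symm V ?b ?a) (Idn V ?w) \<cdot>\<^bsub>V\<^esub> (Symm V ?w (TOb V ?b ?a) \<cdot>\<^bsub>V\<^esub> TAssoc V ?w ?b ?a))"
    using x y z by (simp add: Symm_tensor[of ?w ?a ?b, symmetric])
  also have "\<dots> = DAct W x z \<cdot>\<^bsub>V\<^esub> (TAr V (VComp C z y x \<cdot>\<^bsub>V\<^esub> Symm V ?a ?b) (Idn V ?w)
      \<cdot>\<^bsub>V\<^esub> (TAr V (Symm V ?b ?a) (Idn V ?w) \<cdot>\<^bsub>V\<^esub> Symm V ?w (TOb V ?b ?a))) \<cdot>\<^bsub>V\<^esub> TAssoc V ?w ?b ?a"
    unfolding W_assoc[OF x y z, symmetric] using x y z by simp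
  also have "\<dots> = ract x z \<cdot>\<^bsub>V\<^esub> (TAr V (Idn V ?w) (VComp C z y x) \<cdot>\<^bsub>V\<^esub> TAssoc V ?w ?b ?a)"
    unfolding 2[symmetric] ract_def[of x z] using x y z by simp
  finally show ?thesis .
qed

text \<open>A map from \<open>W \<otimes>\<^sub>C X\<close> to \<open>m\<close>, expressed without
  the coend, which may not exist. The right action is used to keep symmetries out of later
  computations; \<open>wcocone_iff\<close> translates to the two maps in the definition of the
  coend.\<close>

definition wcocone where
  "wcocone X m \<omega> \<longleftrightarrow> is_diagram V C M T X \<and> m \<in> Ob M
     \<and> (\<forall>c\<in>VOb C. \<omega> c \<in> hom M (AOb T (Wt c) (DOb X c)) m)
     \<and> (\<forall>x\<in>VOb C. \<forall>y\<in>VOb C. \<omega> x \<cdot> AAr T (ract y x) (Idn M (DOb X x))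
          = \<omega> y \<cdot> (lact (Wt y) (DAct X x y) \<cdot> AAssoc T (Wt y) (VHom C x y) (DOb X x)))"

lemma wcoconeD:
  assumes "wcocone X m \<omega>"
  shows "is_diagram V C M T X" "m \<in> Ob M" "c \<in> VOb C \<Longrightarrow> \<omega> c \<in> Ar M"
    "c \<in> VOb C \<Longrightarrow> Dom M (\<omega> c) = AOb T (Wt c) (DOb X c)" "c \<in> VOb C \<Longrightarrow> Cod M (\<omega> c) = m"
    "\<lbrakk>x \<in> VOb C; y \<in> VOb C\<rbrakk> \<Longrightarrow> \<omega> x \<cdot> AAr T (ract y x) (Idn M (DOb X x))
          = \<omega> y \<cdot> (lact (Wt y) (DAct X x y) \<cdot> AAssoc T (Wt y) (VHom C x y) (DOb X x))"
  using assms by (simp_all add: wcocone_def hom_iff)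

lemma wcocone_post:
  assumes "wcocone X m \<omega>" "h \<in> hom M m n" shows "wcocone X n (\<lambda>c. h \<cdot> \<omega> c)"
proof -
  note w = wcoconeD[OF assms(1)] and X = diagramD[OF wcoconeD(1)[OF assms(1)]]
  have h: "h \<in> Ar M" "Dom M h = m" "Cod M h = n" using assms(2) by (auto simp: hom_iff)
  have "h \<cdot> \<omega> x \<cdot> AAr T (ract y x) (Idn M (DOb X x))
      = h \<cdot> \<omega> y \<cdot> (lact (Wt y) (DAct X x y) \<cdot> AAssoc T (Wt y) (VHom C x y) (DOb X x))"
    if "x \<in> VOb C" "y \<in> VOb C" for x y
    using w(3-6) X(1-4) h that by simp
  then show ?thesis
    unfolding wcocone_def using w(1,3-5) h M.Cod_in[OF h(1)] by (auto simp: hom_iff)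
qed

lemma wcocone_pull:
  assumes "wcocone Y m \<omega>" "f \<in> hom DC X Y" shows "wcocone X m (\<lambda>c. \<omega> c \<cdot> lact (Wt c) (cmp f c))"
proof -
  have f: "f \<in> Ar DC" "Dom DC f = X" "Cod DC f = Y" using assms(2) by (auto simp: hom_iff)
  note F = dmapD[OF f(1), unfolded f]
  note w = wcoconeD[OF assms(1)] and X = diagramD[OF F(1)] and Y = diagramD[OF F(2)]
  have "\<omega> x \<cdot> lact (Wt x) (cmp f x) \<cdot> AAr T (ract y x) (Idn M (DOb X x))
      = \<omega> y \<cdot> lact (Wt y) (cmp f y) \<cdot> (lact (Wt y) (DAct X x y) \<cdot> AAssoc T (Wt y) (VHom C x y) (DOb X x))"
    if xy: "x \<in> VOb C" "y \<in> VOb C" for x y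
  proof -
    have nat: "AAssoc T (Wt y) (VHom C x y) (DOb Y x) \<cdot> lact (TOb V (Wt y) (VHom C x y)) (cmp f x)
      = lact (Wt y) (lact (VHom C x y) (cmp f x)) \<cdot> AAssoc T (Wt y) (VHom C x y) (DOb X x)"
      using AAssoc_nat[of "Idn V (Wt y)" "Idn V (VHom C x y)" "cmp f x"] xy F(3-5) by simp
    have "\<omega> x \<cdot> lact (Wt x) (cmp f x) \<cdot> AAr T (ract y x) (Idn M (DOb X x))
      = \<omega> x \<cdot> AAr T (ract y x) (Idn M (DOb Y x)) \<cdot> lact (TOb V (Wt y) (VHom C x y)) (cmp f x)"
      using w(3-5) F(3-5) X(1) Y(1) xy by simp
    also have "\<dots> = \<omega> y \<cdot> lact (Wt y) (DAct Y x y)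
        \<cdot> (AAssoc T (Wt y) (VHom C x y) (DOb Y x) \<cdot> lact (TOb V (Wt y) (VHom C x y)) (cmp f x))"
      unfolding w(6)[OF xy] using w(3-5) F(3-5) X(1-4) Y(1-4) xy by simp
    also have "\<dots> = \<omega> y \<cdot> lact (Wt y) (DAct Y x y \<cdot> lact (VHom C x y) (cmp f x)) \<cdot> AAssoc T (Wt y) (VHom C x y) (DOb X x)"
      unfolding nat using w(3-5) F(3-5) X(1-4) Y(1-4) xy by simp
    also have "\<dots> = \<omega> y \<cdot> lact (Wt y) (cmp f y) \<cdot> (lact (Wt y) (DAct X x y) \<cdot> AAssoc T (Wt y) (VHom C x y) (DOb X x))"
      unfolding F(6)[OF xy, symmetric] using w(3-5) F(3-5) X(1-4) Y(1-4) xy by simp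
    finally show ?thesis .
  qed
  then show ?thesis
    unfolding wcocone_def using F w(2-5) X(1) Y(1) by (auto simp: hom_iff)
qed

context
  fixes J :: "('j, 'k, 'x) cat_scheme" and D X \<kappa>
  assumes J: "small_category U J" and D: "is_functor J DC D"
    and \<kappa>: "is_cocone J DC D X \<kappa>"
    and X: "\<And>c. c \<in> VOb C \<Longrightarrow> is_colimit J M (ev c D) (DOb X c) (\<lambda>j. cmp (\<kappa> j) c)"
begin

lemma wcocone_colimit_eqI:
  assumes "wcocone X n \<omega>" "wcocone X n \<omega>'" "c \<in> VOb C"
    "\<And>j. j \<in> Ob J \<Longrightarrow> \<omega> c \<cdot> lact (Wt c) (cmp (\<kappa> j) c) = \<omega>' c \<cdot> lact (Wt c) (cmp (\<kappa> j) c)"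
  shows "\<omega> c = \<omega>' c"
  by (rule lact_eqI[OF J ev_functor[OF D assms(3)] X[OF assms(3)] Wt_Ob[OF assms(3)] _ _ assms(4)])
    (use wcoconeD[OF assms(1)] wcoconeD[OF assms(2)] assms(3) in \<open>simp_all add: hom_iff\<close>)

text \<open>Stands for preservation of colimits by \<open>W \<otimes>\<^sub>C -\<close>. A
  compatible family of cocones glues because \<open>W c \<otimes> -\<close> preserves the pointwise
  colimit; the cocone law is tested after tensoring the colimit cocone with
  \<open>W y \<otimes> C(x, y)\<close>.\<close>

lemma wcocone_colimit:
  assumes \<sigma>: "\<And>j. j \<in> Ob J \<Longrightarrow> wcocone (FOb D j) n (\<sigma> j)" and n: "n \<in> Ob M"
    and comp: "\<And>u c. \<lbrakk>u \<in> Ar J; c \<in> VOb C\<rbrakk> \<Longrightarrow>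
      \<sigma> (Cod J u) c \<cdot> lact (Wt c) (cmp (FAr D u) c) = \<sigma> (Dom J u) c"
  obtains \<omega> where "wcocone X n \<omega>"
    "\<And>j c. \<lbrakk>j \<in> Ob J; c \<in> VOb C\<rbrakk> \<Longrightarrow> \<omega> c \<cdot> lact (Wt c) (cmp (\<kappa> j) c) = \<sigma> j c"
proof -
  note evF = ev_functor[OF D]
  have "\<exists>h. h \<in> hom M (AOb T (Wt c) (DOb X c)) n \<and> (\<forall>j\<in>Ob J. h \<cdot> lact (Wt c) (cmp (\<kappa> j) c) = \<sigma> j c)"
    if c: "c \<in> VOb C" for c
  proof -
    have *: "\<sigma> j c \<in> hom M (AOb T (Wt c) (FOb (ev c D) j)) n" if "j \<in> Ob J" for j
      using wcoconeD(3-5)[OF \<sigma>[OF that] c] by (simp add: hom_iff)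
    have **: "\<sigma> (Cod J u) c \<cdot> lact (Wt c) (FAr (ev c D) u) = \<sigma> (Dom J u) c" if "u \<in> Ar J" for u
      using comp[OF that c] by simp
    show ?thesis
      by (rule lact_map[OF J evF[OF c] X[OF c] Wt_Ob[OF c] n * **]) auto
  qed
  then obtain \<omega> where \<omega>: "\<And>c. c \<in> VOb C \<Longrightarrow> \<omega> c \<in> hom M (AOb T (Wt c) (DOb X c)) n"
    "\<And>c j. \<lbrakk>c \<in> VOb C; j \<in> Ob J\<rbrakk> \<Longrightarrow> \<omega> c \<cdot> lact (Wt c) (cmp (\<kappa> j) c) = \<sigma> j c" by metis
  have \<omega>A: "\<omega> c \<in> Ar M" "Dom M (\<omega> c) = AOb T (Wt c) (DOb X c)" "Cod M (\<omega> c) = n" if "c \<in> VOb C" for c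
    using \<omega>(1)[OF that] by (simp_all add: hom_iff)
  have Xd: "is_diagram V C M T X" and \<kappa>h: "\<And>j. j \<in> Ob J \<Longrightarrow> \<kappa> j \<in> hom DC (FOb D j) X"
    using \<kappa> by (auto simp: is_cocone_def)
  note XD = diagramD[OF Xd]
  have "wcocone X n \<omega>"
    unfolding wcocone_def
  proof (intro conjI ballI)
    fix x y assume xy: "x \<in> VOb C" "y \<in> VOb C"
    show "\<omega> x \<cdot> AAr T (ract y x) (Idn M (DOb X x))
      = \<omega> y \<cdot> (lact (Wt y) (DAct X x y) \<cdot> AAssoc T (Wt y) (VHom C x y) (DOb X x))"
    proof (rule lact_eqI[OF J evF[OF xy(1)] X[OF xy(1)]])
      show "TOb V (Wt y) (VHom C x y) \<in> Ob V" using xy by simp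
      fix j assume j: "j \<in> Ob J"
      have k: "\<kappa> j \<in> Ar DC" "Dom DC (\<kappa> j) = FOb D j" "Cod DC (\<kappa> j) = X" using \<kappa>h[OF j] by (auto simp: hom_iff)
      note K = dmapD[OF k(1), unfolded k] and w = wcoconeD[OF \<sigma>[OF j]]
      note Y = diagramD[OF K(1)]
      let ?Y = "FOb D j"
      have nat: "AAssoc T (Wt y) (VHom C x y) (DOb X x) \<cdot> lact (TOb V (Wt y) (VHom C x y)) (cmp (\<kappa> j) x)
        = lact (Wt y) (lact (VHom C x y) (cmp (\<kappa> j) x)) \<cdot> AAssoc T (Wt y) (VHom C x y) (DOb ?Y x)"
        using AAssoc_nat[of "Idn V (Wt y)" "Idn V (VHom C x y)" "cmp (\<kappa> j) x"] xy K(3-5) by simp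
      have "\<omega> x \<cdot> AAr T (ract y x) (Idn M (DOb X x)) \<cdot> lact (TOb V (Wt y) (VHom C x y)) (cmp (\<kappa> j) x)
        = \<omega> x \<cdot> lact (Wt x) (cmp (\<kappa> j) x) \<cdot> AAr T (ract y x) (Idn M (DOb ?Y x))"
        using xy K(3-5) Y(1) \<omega>A XD(1) by simp
      also have "\<dots> = \<sigma> j y \<cdot> (lact (Wt y) (DAct ?Y x y) \<cdot> AAssoc T (Wt y) (VHom C x y) (DOb ?Y x))"
        using xy \<omega>(2)[OF xy(1) j] w(6)[OF xy] by simp
      also have "\<dots> = \<omega> y \<cdot> lact (Wt y) (cmp (\<kappa> j) y \<cdot> DAct ?Y x y) \<cdot> AAssoc T (Wt y) (VHom C x y) (DOb ?Y x)"
        unfolding \<omega>(2)[OF xy(2) j, symmetric] using xy K(3-5) Y(1-4) \<omega>A by simp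
      also have "\<dots> = \<omega> y \<cdot> lact (Wt y) (DAct X x y)
          \<cdot> (lact (Wt y) (lact (VHom C x y) (cmp (\<kappa> j) x)) \<cdot> AAssoc T (Wt y) (VHom C x y) (DOb ?Y x))"
        unfolding K(6)[OF xy] using xy K(3-5) Y(1-4) \<omega>A XD(1-4) by simp
      also have "\<dots> = \<omega> y \<cdot> (lact (Wt y) (DAct X x y) \<cdot> AAssoc T (Wt y) (VHom C x y) (DOb X x))
          \<cdot> lact (TOb V (Wt y) (VHom C x y)) (cmp (\<kappa> j) x)"
        unfolding nat[symmetric] using xy K(3-5) Y(1-4) \<omega>A XD(1-4) by simp
      finally show "\<omega> x \<cdot> AAr T (ract y x) (Idn M (DOb X x)) \<cdot> lact (TOb V (Wt y) (VHom C x y)) (cmp (\<kappa> j) x)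
        = \<omega> y \<cdot> (lact (Wt y) (DAct X x y) \<cdot> AAssoc T (Wt y) (VHom C x y) (DOb X x))
          \<cdot> lact (TOb V (Wt y) (VHom C x y)) (cmp (\<kappa> j) x)" .
    qed (use xy \<omega>A XD(1-4) in \<open>simp_all add: hom_iff\<close>)
  qed (use Xd n \<omega> in auto)
  then show thesis using that[of \<omega>] \<omega>(2) by blast
qed

end

section \<open>Cocones on representable diagrams: the co-Yoneda correspondence\<close>

subsection \<open>Cocones on representable diagrams\<close>

text \<open>Co-Yoneda: \<open>W \<otimes>\<^sub>C (C(c, -) \<otimes> N)\<close> is
  \<open>W c \<otimes> N\<close>, and this is the cocone corresponding to a map
  \<open>\<phi> : W c \<otimes> N \<rightarrow> m\<close>.\<close>

definition fcocone where
  "fcocone c N \<phi> x = \<phi> \<cdot> (AAr T (ract x c) (Idn M N) \<cdot> IA (Wt x) (VHom C c x) N)"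

abbreviation uarr where "uarr c N \<equiv> AAr T (VId C c) (Idn M N) \<cdot> inv_ar M (AUnit T N)"

lemma uarr_simps [simp]:
  assumes "c \<in> VOb C" "N \<in> Ob M"
  shows "inv_ar M (AUnit T N) \<in> Ar M" "Dom M (inv_ar M (AUnit T N)) = N"
    "Cod M (inv_ar M (AUnit T N)) = AOb T (Unit V) N" "AUnit T N \<cdot> inv_ar M (AUnit T N) = Idn M N"
  using M.is_isoD[OF T.AUnit_iso[OF assms(2)]] assms by simp_all

lemma fcocone_hom:
  assumes "c \<in> VOb C" "x \<in> VOb C" "N \<in> Ob M" "\<phi> \<in> hom M (AOb T (Wt c) N) m"
  shows "fcocone c N \<phi> x \<in> hom M (AOb T (Wt x) (AOb T (VHom C c x) N)) m"
  using assms by (simp add: fcocone_def hom_iff)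

text \<open>After composition with an associator, the cocone law becomes associativity of the right
  action, by the pentagon.\<close>

lemma wcocone_fcocone:
  assumes c: "c \<in> VOb C" and N: "N \<in> Ob M" and \<phi>: "\<phi> \<in> hom M (AOb T (Wt c) N) m"
  shows "wcocone (free c N) m (fcocone c N \<phi>)"
  unfolding wcocone_def
proof (intro conjI ballI)
  have \<phi>': "\<phi> \<in> Ar M" "Dom M \<phi> = AOb T (Wt c) N" "Cod M \<phi> = m" using \<phi> by (auto simp: hom_iff)
  show "is_diagram V C M T (free c N)" by (rule free_diagram[OF c N])
  show "m \<in> Ob M" using \<phi>' by force
  show "fcocone c N \<phi> x \<in> hom M (AOb T (Wt x) (DOb (free c N) x)) m" if "x \<in> VOb C" for x
    using fcocone_hom[OF c that N \<phi>] that by simp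
  fix x y assume xy: "x \<in> VOb C" "y \<in> VOb C"
  let ?Cx = "VHom C c x" and ?D = "VHom C x y" and ?w = "Wt y"
  let ?A = "AAssoc T (TOb V ?w ?D) ?Cx N"
  have "fcocone c N \<phi> x \<cdot> AAr T (ract y x) (Idn M (AOb T ?Cx N))
    = fcocone c N \<phi> y \<cdot> (lact ?w (DAct (free c N) x y) \<cdot> AAssoc T ?w ?D (AOb T ?Cx N))"
  proof (rule M.iso_epi[OF T.AAssoc_iso])
    show "TOb V ?w ?D \<in> Ob V" "?Cx \<in> Ob V" "N \<in> Ob M" using xy c N by auto
    have 1: "AAr T (ract y x) (Idn M (AOb T ?Cx N)) \<cdot> ?A
      = AAssoc T (Wt x) ?Cx N \<cdot> AAr T (TAr V (ract y x) (Idn V ?Cx)) (Idn M N)"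
      using AAssoc_nat[of "ract y x" "Idn V ?Cx" "Idn M N"] xy c N by simp
    have 2: "IA ?w (VHom C c y) N \<cdot> lact ?w (AAr T (VComp C c x y) (Idn M N))
      = AAr T (TAr V (Idn V ?w) (VComp C c x y)) (Idn M N) \<cdot> IA ?w (TOb V ?D ?Cx) N"
      using IA_nat[of "Idn V ?w" "VComp C c x y" "Idn M N"] xy c N by simp
    have 3: "lact ?w (IA ?D ?Cx N) \<cdot> (AAssoc T ?w ?D (AOb T ?Cx N) \<cdot> ?A)
      = AAssoc T ?w (TOb V ?D ?Cx) N \<cdot> AAr T (TAssoc V ?w ?D ?Cx) (Idn M N)"
      using T.act_pentagon[of ?w ?D ?Cx N] xy c N by simp
    have "fcocone c N \<phi> x \<cdot> AAr T (ract y x) (Idn M (AOb T ?Cx N)) \<cdot> ?A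
      = \<phi> \<cdot> AAr T (ract x c \<cdot>\<^bsub>V\<^esub> TAr V (ract y x) (Idn V ?Cx)) (Idn M N)"
      using xy c N \<phi>' by (simp add: fcocone_def 1)
    also have "\<dots> = \<phi> \<cdot> (AAr T (ract y c) (Idn M N) \<cdot> (AAr T (TAr V (Idn V ?w) (VComp C c x y)) (Idn M N)
        \<cdot> AAr T (TAssoc V ?w ?D ?Cx) (Idn M N)))"
      using xy c N \<phi>' ract_assoc[OF xy(2,1) c] by simp
    also have "AAr T (TAr V (Idn V ?w) (VComp C c x y)) (Idn M N) \<cdot> AAr T (TAssoc V ?w ?D ?Cx) (Idn M N)
      = AAr T (TAr V (Idn V ?w) (VComp C c x y)) (Idn M N) \<cdot> IA ?w (TOb V ?D ?Cx) N
        \<cdot> (AAssoc T ?w (TOb V ?D ?Cx) N \<cdot> AAr T (TAssoc V ?w ?D ?Cx) (Idn M N))"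
      using xy c N by simp
    also have "\<dots> = IA ?w (VHom C c y) N \<cdot> lact ?w (AAr T (VComp C c x y) (Idn M N))
        \<cdot> (lact ?w (IA ?D ?Cx N) \<cdot> (AAssoc T ?w ?D (AOb T ?Cx N) \<cdot> ?A))"
      unfolding 2 3 ..
    finally show "fcocone c N \<phi> x \<cdot> AAr T (ract y x) (Idn M (AOb T ?Cx N)) \<cdot> ?A
      = fcocone c N \<phi> y \<cdot> (lact ?w (DAct (free c N) x y) \<cdot> AAssoc T ?w ?D (AOb T ?Cx N)) \<cdot> ?A"
      using xy c N \<phi>' by (simp add: fcocone_def)
  qed (use xy c N \<phi>' in \<open>simp_all add: fcocone_def\<close>)
  then show "fcocone c N \<phi> x \<cdot> AAr T (ract y x) (Idn M (DOb (free c N) x))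
    = fcocone c N \<phi> y \<cdot> (lact ?w (DAct (free c N) x y) \<cdot> AAssoc T ?w ?D (DOb (free c N) x))"
    using xy by simp
qed

text \<open>A cocone on a representable diagram is determined at the identity of \<open>c\<close>:
  the cocone law for \<open>c\<close> and \<open>x\<close>, restricted along the identity element,
  gives the component at \<open>x\<close> by \<open>unit_free\<close>.\<close>

lemma fcocone_elt:
  assumes c: "c \<in> VOb C" and N: "N \<in> Ob M" and w: "wcocone (free c N) m \<omega>" and x: "x \<in> VOb C"
  shows "\<omega> x = fcocone c N (\<omega> c \<cdot> lact (Wt c) (uarr c N)) x"
proof -
  note wD = wcoconeD[OF w]
  let ?u = "uarr c N" and ?Cx = "VHom C c x"
  have 1: "AAssoc T (Wt x) ?Cx (AOb T (VHom C c c) N) \<cdot> lact (TOb V (Wt x) ?Cx) ?u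
    = lact (Wt x) (lact ?Cx ?u) \<cdot> AAssoc T (Wt x) ?Cx N"
    using AAssoc_nat[of "Idn V (Wt x)" "Idn V ?Cx" ?u] x c N by simp
  have "\<omega> c \<cdot> lact (Wt c) ?u \<cdot> AAr T (ract x c) (Idn M N)
    = \<omega> c \<cdot> AAr T (ract x c) (Idn M (AOb T (VHom C c c) N)) \<cdot> lact (TOb V (Wt x) ?Cx) ?u"
    using wD(3-5) x c N by simp
  also have "\<dots> = \<omega> x \<cdot> (lact (Wt x) (DAct (free c N) c x) \<cdot> AAssoc T (Wt x) ?Cx (AOb T (VHom C c c) N))
      \<cdot> lact (TOb V (Wt x) ?Cx) ?u"
    using wD(6)[OF c x] c by simp
  also have "\<dots> = \<omega> x \<cdot> lact (Wt x) (DAct (free c N) c x)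
      \<cdot> (AAssoc T (Wt x) ?Cx (AOb T (VHom C c c) N) \<cdot> lact (TOb V (Wt x) ?Cx) ?u)"
    using wD(3-5) x c N by simp
  also have "\<dots> = \<omega> x \<cdot> (lact (Wt x) (DAct (free c N) c x \<cdot> lact ?Cx ?u) \<cdot> AAssoc T (Wt x) ?Cx N)"
    unfolding 1 using wD(3-5) x c N by simp
  also have "\<dots> = \<omega> x \<cdot> AAssoc T (Wt x) ?Cx N"
    unfolding unit_free[OF c x N] using wD(3-5) x c N by simp
  finally have 2: "\<omega> c \<cdot> lact (Wt c) ?u \<cdot> AAr T (ract x c) (Idn M N) = \<omega> x \<cdot> AAssoc T (Wt x) ?Cx N" .
  have "fcocone c N (\<omega> c \<cdot> lact (Wt c) ?u) x
    = (\<omega> c \<cdot> lact (Wt c) ?u \<cdot> AAr T (ract x c) (Idn M N)) \<cdot> IA (Wt x) ?Cx N"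
    using wD(3-5) x c N by (simp add: fcocone_def)
  also have "\<dots> = \<omega> x" unfolding 2 using wD(3-5) x c N by simp
  finally show ?thesis ..
qed

text \<open>The other half of the correspondence, from the right unit law of the weight.\<close>

lemma elt_fcocone:
  assumes c: "c \<in> VOb C" and N: "N \<in> Ob M" and \<phi>: "\<phi> \<in> hom M (AOb T (Wt c) N) m"
  shows "fcocone c N \<phi> c \<cdot> lact (Wt c) (uarr c N) = \<phi>"
proof -
  have \<phi>': "\<phi> \<in> Ar M" "Dom M \<phi> = AOb T (Wt c) N" "Cod M \<phi> = m" using \<phi> by (auto simp: hom_iff)
  have 1: "IA (Wt c) (VHom C c c) N \<cdot> lact (Wt c) (AAr T (VId C c) (Idn M N))
    = AAr T (TAr V (Idn V (Wt c)) (VId C c)) (Idn M N) \<cdot> IA (Wt c) (Unit V) N"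
    using IA_nat[of "Idn V (Wt c)" "VId C c" "Idn M N"] c N by simp
  have "fcocone c N \<phi> c \<cdot> lact (Wt c) (uarr c N)
    = \<phi> \<cdot> AAr T (ract c c) (Idn M N) \<cdot> (IA (Wt c) (VHom C c c) N \<cdot> lact (Wt c) (AAr T (VId C c) (Idn M N)))
      \<cdot> lact (Wt c) (inv_ar M (AUnit T N))"
    using c N \<phi>' by (simp add: fcocone_def)
  also have "\<dots> = \<phi> \<cdot> AAr T (RUnit V (Wt c)) (Idn M N) \<cdot> IA (Wt c) (Unit V) N \<cdot> lact (Wt c) (inv_ar M (AUnit T N))"
    unfolding 1 using c N \<phi>' by (simp add: ract_unit)
  also have "\<dots> = \<phi> \<cdot> lact (Wt c) (AUnit T N) \<cdot> lact (Wt c) (inv_ar M (AUnit T N))"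
    using T.act_triangle_right[of "Wt c" N, symmetric] c N \<phi>' by simp
  also have "\<dots> = \<phi>" using c N \<phi>' by simp
  finally show ?thesis .
qed

lemma fcocone_nat:
  assumes c: "c \<in> VOb C" and x: "x \<in> VOb C" and i: "i \<in> hom M N' N" and \<phi>: "\<phi> \<in> hom M (AOb T (Wt c) N) m"
  shows "fcocone c N \<phi> x \<cdot> lact (Wt x) (lact (VHom C c x) i) = fcocone c N' (\<phi> \<cdot> lact (Wt c) i) x"
proof -
  have \<phi>': "\<phi> \<in> Ar M" "Dom M \<phi> = AOb T (Wt c) N" "Cod M \<phi> = m" using \<phi> by (auto simp: hom_iff)
  have i': "i \<in> Ar M" "Dom M i = N'" "Cod M i = N" using i by (auto simp: hom_iff)
  have N: "N \<in> Ob M" "N' \<in> Ob M" using i' by force+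
  have 1: "IA (Wt x) (VHom C c x) N \<cdot> lact (Wt x) (lact (VHom C c x) i)
    = AAr T (Idn V (TOb V (Wt x) (VHom C c x))) i \<cdot> IA (Wt x) (VHom C c x) N'"
    using IA_nat[of "Idn V (Wt x)" "Idn V (VHom C c x)" i] c x i' by simp
  show ?thesis using c x i' \<phi>' N by (simp add: fcocone_def 1)
qed

lemma uarr_nat:
  assumes c: "c \<in> VOb C" and i: "i \<in> hom M N' N"
  shows "uarr c N \<cdot> i = lact (VHom C c c) i \<cdot> uarr c N'"
proof -
  have i': "i \<in> Ar M" "Dom M i = N'" "Cod M i = N" using i by (auto simp: hom_iff)
  have N: "N \<in> Ob M" "N' \<in> Ob M" using i' by force+
  have "inv_ar M (AUnit T N) \<cdot> i = lact (Unit V) i \<cdot> inv_ar M (AUnit T N')"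
  proof (rule M.iso_mono[OF T.AUnit_iso[OF N(1)]])
    have "AUnit T N \<cdot> (lact (Unit V) i \<cdot> inv_ar M (AUnit T N')) = i \<cdot> (AUnit T N' \<cdot> inv_ar M (AUnit T N'))"
      using T.AUnit_natural[OF i] M.comp_cong_left[OF T.AUnit_natural[OF i], of "inv_ar M (AUnit T N')"] c i' N by simp
    then show "AUnit T N \<cdot> (inv_ar M (AUnit T N) \<cdot> i) = AUnit T N \<cdot> (lact (Unit V) i \<cdot> inv_ar M (AUnit T N'))"
      using c i' N M.comp_cong_left[OF uarr_simps(4)[OF c N(1)], of i] by simp
  qed (use c i' N in simp_all)
  then show ?thesis using c i' N by simp
qed

end

section \<open>Universal extensions of cocones: representable maps and cobase changes\<close>

subsection \<open>Universal extensions of cocones\<close>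

text \<open>\<^term>\<open>wext f m \<omega> m' h \<omega>'\<close> says that \<^term>\<open>m'\<close> is the pushout of the partially defined map
  \<open>W \<otimes>\<^sub>C f\<close> along \<^term>\<open>\<omega>\<close> \<open>: W \<otimes>\<^sub>C X \<rightarrow> m\<close>. Unlike the existence of \<open>W \<otimes>\<^sub>C X\<close> itself, its
  existence for all \<^term>\<open>\<omega>\<close> is inherited by cobase changes and by transfinite composites.\<close>

context weighted
begin

definition wext where
  "wext f m \<omega> m' h \<omega>' \<longleftrightarrow> f \<in> Ar DC \<and> wcocone (Dom DC f) m \<omega> \<and> wcocone (Cod DC f) m' \<omega>' \<and> h \<in> hom M m m'
     \<and> (\<forall>c\<in>VOb C. \<omega>' c \<cdot> lact (Wt c) (cmp f c) = h \<cdot> \<omega> c)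
     \<and> (\<forall>n k \<sigma>. k \<in> hom M m n \<and> wcocone (Cod DC f) n \<sigma>
          \<and> (\<forall>c\<in>VOb C. \<sigma> c \<cdot> lact (Wt c) (cmp f c) = k \<cdot> \<omega> c) \<longrightarrow>
          (\<exists>l. l \<in> hom M m' n \<and> l \<cdot> h = k \<and> (\<forall>c\<in>VOb C. l \<cdot> \<omega>' c = \<sigma> c)))
     \<and> (\<forall>n l l'. l \<in> hom M m' n \<and> l' \<in> hom M m' n \<and> l \<cdot> h = l' \<cdot> h
          \<and> (\<forall>c\<in>VOb C. l \<cdot> \<omega>' c = l' \<cdot> \<omega>' c) \<longrightarrow> l = l')"

lemma wextI:
  assumes "f \<in> Ar DC" "wcocone (Dom DC f) m \<omega>" "wcocone (Cod DC f) m' \<omega>'" "h \<in> hom M m m'"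
    "\<And>c. c \<in> VOb C \<Longrightarrow> \<omega>' c \<cdot> lact (Wt c) (cmp f c) = h \<cdot> \<omega> c"
    "\<And>n k \<sigma>. \<lbrakk>k \<in> hom M m n; wcocone (Cod DC f) n \<sigma>;
        \<And>c. c \<in> VOb C \<Longrightarrow> \<sigma> c \<cdot> lact (Wt c) (cmp f c) = k \<cdot> \<omega> c\<rbrakk>
      \<Longrightarrow> \<exists>l. l \<in> hom M m' n \<and> l \<cdot> h = k \<and> (\<forall>c\<in>VOb C. l \<cdot> \<omega>' c = \<sigma> c)"
    "\<And>n l l'. \<lbrakk>l \<in> hom M m' n; l' \<in> hom M m' n; l \<cdot> h = l' \<cdot> h; \<And>c. c \<in> VOb C \<Longrightarrow> l \<cdot> \<omega>' c = l' \<cdot> \<omega>' c\<rbrakk> \<Longrightarrow> l = l'"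
  shows "wext f m \<omega> m' h \<omega>'"
  unfolding wext_def using assms(1-5)
  by (intro conjI allI impI ballI) (auto intro: assms(6,7))

lemma wextD:
  assumes "wext f m \<omega> m' h \<omega>'"
  shows "f \<in> Ar DC" "wcocone (Dom DC f) m \<omega>" "wcocone (Cod DC f) m' \<omega>'" "h \<in> Ar M" "Dom M h = m" "Cod M h = m'"
    "c \<in> VOb C \<Longrightarrow> \<omega>' c \<cdot> lact (Wt c) (cmp f c) = h \<cdot> \<omega> c"
  using assms by (simp_all add: wext_def hom_iff)

lemma wext_map:
  assumes "wext f m \<omega> m' h \<omega>'" "k \<in> hom M m n" "wcocone (Cod DC f) n \<sigma>"
    "\<And>c. c \<in> VOb C \<Longrightarrow> \<sigma> c \<cdot> lact (Wt c) (cmp f c) = k \<cdot> \<omega> c"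
  obtains l where "l \<in> hom M m' n" "l \<cdot> h = k" "\<And>c. c \<in> VOb C \<Longrightarrow> l \<cdot> \<omega>' c = \<sigma> c"
proof -
  have "\<exists>l. l \<in> hom M m' n \<and> l \<cdot> h = k \<and> (\<forall>c\<in>VOb C. l \<cdot> \<omega>' c = \<sigma> c)"
    by (rule assms(1)[unfolded wext_def, THEN conjunct2, THEN conjunct2, THEN conjunct2, THEN conjunct2,
          THEN conjunct2, THEN conjunct1, THEN spec[of _ n], THEN spec[of _ k], THEN spec[of _ \<sigma>], THEN mp])
      (use assms(2-4) in auto)
  then show thesis using that by blast
qed

lemma wext_eqI:
  assumes "wext f m \<omega> m' h \<omega>'" "l \<in> hom M m' n" "l' \<in> hom M m' n" "l \<cdot> h = l' \<cdot> h"
    "\<And>c. c \<in> VOb C \<Longrightarrow> l \<cdot> \<omega>' c = l' \<cdot> \<omega>' c"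
  shows "l = l'"
  by (rule assms(1)[unfolded wext_def, THEN conjunct2, THEN conjunct2, THEN conjunct2, THEN conjunct2,
        THEN conjunct2, THEN conjunct2, THEN spec[of _ n], THEN spec[of _ l], THEN spec[of _ l'], THEN mp])
    (use assms(2-5) in auto)

lemma wext_Idn:
  assumes "wcocone X m \<omega>" shows "wext (Idn DC X) m \<omega> m (Idn M m) \<omega>"
proof -
  note w = wcoconeD[OF assms] and X = diagramD[OF wcoconeD(1)[OF assms]]
  have XO: "X \<in> Ob DC" using w(1) by simp
  have id: "lact (Wt c) (cmp (Idn DC X) c) = Idn M (AOb T (Wt c) (DOb X c))" if "c \<in> VOb C" for c
    using that X(1) by simp
  show ?thesis
  proof (rule wextI)
    show "Idn DC X \<in> Ar DC" by (rule DC.Idn_Ar[OF XO])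
    have d: "Dom DC (Idn DC X) = X" "Cod DC (Idn DC X) = X" using DC.Dom_Idn[OF XO] DC.Cod_Idn[OF XO] by auto
    show "wcocone (Dom DC (Idn DC X)) m \<omega>" "wcocone (Cod DC (Idn DC X)) m \<omega>" unfolding d by (rule assms)+
    show "Idn M m \<in> hom M m m" using w(2) by (simp add: hom_iff)
    show "\<omega> c \<cdot> lact (Wt c) (cmp (Idn DC X) c) = Idn M m \<cdot> \<omega> c" if "c \<in> VOb C" for c
      unfolding id[OF that] using w(3-5) that by simp
    fix n k \<sigma> assume k: "k \<in> hom M m n" and s: "wcocone (Cod DC (Idn DC X)) n \<sigma>"
      and e: "\<And>c. c \<in> VOb C \<Longrightarrow> \<sigma> c \<cdot> lact (Wt c) (cmp (Idn DC X) c) = k \<cdot> \<omega> c"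
    have "k \<cdot> \<omega> c = \<sigma> c" if "c \<in> VOb C" for c
      using e[OF that] wcoconeD(3-5)[OF s[unfolded d]] that unfolding id[OF that] by simp
    then show "\<exists>l. l \<in> hom M m n \<and> l \<cdot> Idn M m = k \<and> (\<forall>c\<in>VOb C. l \<cdot> \<omega> c = \<sigma> c)"
      using k by (intro exI[of _ k]) (simp add: hom_iff)
  next
    fix n l l' assume "l \<in> hom M m n" "l' \<in> hom M m n" "l \<cdot> Idn M m = l' \<cdot> Idn M m"
    then show "l = l'" by (simp add: hom_iff)
  qed
qed

text \<open>Pasting of pushout squares.\<close>

lemma wext_comp:
  assumes "wext f m \<omega> m' h \<omega>'" "wext g m' \<omega>' m'' h' \<omega>''" "Dom DC g = Cod DC f"
  shows "wext (g \<cdot>\<^bsub>DC\<^esub> f) m \<omega> m'' (h' \<cdot> h) \<omega>''"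
proof -
  note F = wextD[OF assms(1)] and G = wextD[OF assms(2)]
  note fm = dmapD[OF F(1)] and gm = dmapD[OF G(1)]
  note w = wcoconeD(3-5)[OF F(2)] and w' = wcoconeD(3-5)[OF F(3)] and w'' = wcoconeD(3-5)[OF G(3)]
  have gf: "g \<cdot>\<^bsub>DC\<^esub> f \<in> Ar DC" "Dom DC (g \<cdot>\<^bsub>DC\<^esub> f) = Dom DC f" "Cod DC (g \<cdot>\<^bsub>DC\<^esub> f) = Cod DC g"
    using DC.comp_Ar[OF F(1) G(1) assms(3)] DC.Dom_comp[OF F(1) G(1) assms(3)] DC.Cod_comp[OF F(1) G(1) assms(3)] .
  show ?thesis
  proof (rule wextI)
    show "g \<cdot>\<^bsub>DC\<^esub> f \<in> Ar DC" by (rule gf)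
    show "wcocone (Dom DC (g \<cdot>\<^bsub>DC\<^esub> f)) m \<omega>" unfolding gf by (rule F)
    show "wcocone (Cod DC (g \<cdot>\<^bsub>DC\<^esub> f)) m'' \<omega>''" unfolding gf by (rule G)
    show "h' \<cdot> h \<in> hom M m m''" using F G by (simp add: hom_iff)
    show "\<omega>'' c \<cdot> lact (Wt c) (cmp (g \<cdot>\<^bsub>DC\<^esub> f) c) = h' \<cdot> h \<cdot> \<omega> c" if c: "c \<in> VOb C" for c
    proof -
      have "\<omega>'' c \<cdot> lact (Wt c) (cmp (g \<cdot>\<^bsub>DC\<^esub> f) c) = \<omega>'' c \<cdot> lact (Wt c) (cmp g c) \<cdot> lact (Wt c) (cmp f c)"
        using c fm(3-5) gm(3-5) w'' assms(3) by simp
      also have "\<dots> = h' \<cdot> (\<omega>' c \<cdot> lact (Wt c) (cmp f c))"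
        unfolding G(7)[OF c] using c fm(3-5) w' assms(3) G(4-6) by simp
      also have "\<dots> = h' \<cdot> h \<cdot> \<omega> c" unfolding F(7)[OF c] using c w F(4-6) G(4-6) by simp
      finally show ?thesis .
    qed
    fix n k \<sigma> assume k: "k \<in> hom M m n" and s: "wcocone (Cod DC (g \<cdot>\<^bsub>DC\<^esub> f)) n \<sigma>"
      and e: "\<And>c. c \<in> VOb C \<Longrightarrow> \<sigma> c \<cdot> lact (Wt c) (cmp (g \<cdot>\<^bsub>DC\<^esub> f) c) = k \<cdot> \<omega> c"
    note s' = s[unfolded gf]
    note sD = wcoconeD(3-5)[OF s']
    have pull: "wcocone (Cod DC f) n (\<lambda>c. \<sigma> c \<cdot> lact (Wt c) (cmp g c))"
      by (rule wcocone_pull[OF s']) (use G(1) assms(3) in \<open>simp add: hom_iff\<close>)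
    have e1: "\<sigma> c \<cdot> lact (Wt c) (cmp g c) \<cdot> lact (Wt c) (cmp f c) = k \<cdot> \<omega> c" if c: "c \<in> VOb C" for c
      using e[OF c] c fm(3-5) gm(3-5) sD assms(3) by simp
    obtain l where l: "l \<in> hom M m' n" "l \<cdot> h = k" "\<And>c. c \<in> VOb C \<Longrightarrow> l \<cdot> \<omega>' c = \<sigma> c \<cdot> lact (Wt c) (cmp g c)"
      by (rule wext_map[OF assms(1) k pull e1]) auto
    obtain l' where l': "l' \<in> hom M m'' n" "l' \<cdot> h' = l" "\<And>c. c \<in> VOb C \<Longrightarrow> l' \<cdot> \<omega>'' c = \<sigma> c"
      by (rule wext_map[OF assms(2) l(1) s' l(3)[symmetric]]) auto
    have "l' \<cdot> (h' \<cdot> h) = k" using M.comp_cong_left[OF l'(2), of h] l(2) l'(1) F(4-6) G(4-6) by (simp add: hom_iff)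
    then show "\<exists>l. l \<in> hom M m'' n \<and> l \<cdot> (h' \<cdot> h) = k \<and> (\<forall>c\<in>VOb C. l \<cdot> \<omega>'' c = \<sigma> c)"
      using l' by blast
  next
    fix n l l' assume l: "l \<in> hom M m'' n" "l' \<in> hom M m'' n" "l \<cdot> (h' \<cdot> h) = l' \<cdot> (h' \<cdot> h)"
      "\<And>c. c \<in> VOb C \<Longrightarrow> l \<cdot> \<omega>'' c = l' \<cdot> \<omega>'' c"
    have lA: "l \<in> Ar M" "Dom M l = m''" "Cod M l = n" "l' \<in> Ar M" "Dom M l' = m''" "Cod M l' = n"
      using l(1,2) by (auto simp: hom_iff)
    have "l \<cdot> h' = l' \<cdot> h'"
    proof (rule wext_eqI[OF assms(1)])
      show "l \<cdot> h' \<in> hom M m' n" "l' \<cdot> h' \<in> hom M m' n" using lA G(4-6) by (simp_all add: hom_iff)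
      show "l \<cdot> h' \<cdot> h = l' \<cdot> h' \<cdot> h" using l(3) lA F(4-6) G(4-6) by simp
      fix c assume c: "c \<in> VOb C"
      have "l \<cdot> (\<omega>'' c \<cdot> lact (Wt c) (cmp g c)) = l' \<cdot> (\<omega>'' c \<cdot> lact (Wt c) (cmp g c))"
        using M.comp_cong_left[OF l(4)[OF c], of "lact (Wt c) (cmp g c)"] lA w'' gm(3-5) c by simp
      then show "l \<cdot> h' \<cdot> \<omega>' c = l' \<cdot> h' \<cdot> \<omega>' c"
        unfolding G(7)[OF c] using lA G(4-6) w' c by simp
    qed
    then show "l = l'" using wext_eqI[OF assms(2) l(1,2) _ l(4)] by blast
  qed
qed

lemma wext_unique:
  assumes "wext f m \<omega> m1 h1 \<omega>1" "wext f m \<omega> m2 h2 \<omega>2"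
  obtains u where "is_iso M u" "u \<in> hom M m1 m2" "u \<cdot> h1 = h2" "\<And>c. c \<in> VOb C \<Longrightarrow> u \<cdot> \<omega>1 c = \<omega>2 c"
proof -
  note A = wextD[OF assms(1)] and B = wextD[OF assms(2)]
  note a = wcoconeD[OF A(3)] and b = wcoconeD[OF B(3)]
  have h: "h1 \<in> hom M m m1" "h2 \<in> hom M m m2" using A B by (auto simp: hom_iff)
  obtain u where u: "u \<in> hom M m1 m2" "u \<cdot> h1 = h2" "\<And>c. c \<in> VOb C \<Longrightarrow> u \<cdot> \<omega>1 c = \<omega>2 c"
    by (rule wext_map[OF assms(1) h(2) B(3,7)]) auto
  obtain v where v: "v \<in> hom M m2 m1" "v \<cdot> h2 = h1" "\<And>c. c \<in> VOb C \<Longrightarrow> v \<cdot> \<omega>2 c = \<omega>1 c"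
    by (rule wext_map[OF assms(2) h(1) A(3,7)]) auto
  have uv: "u \<in> Ar M" "Dom M u = m1" "Cod M u = m2" "v \<in> Ar M" "Dom M v = m2" "Cod M v = m1"
    using u(1) v(1) by (auto simp: hom_iff)
  have "v \<cdot> u = Idn M m1"
    by (rule wext_eqI[OF assms(1)])
      (use uv u(2,3) v(2,3) a(2-5) A(4-6) in \<open>simp_all add: hom_iff\<close>)
  moreover have "u \<cdot> v = Idn M m2"
    by (rule wext_eqI[OF assms(2)])
      (use uv u(2,3) v(2,3) b(2-5) B(4-6) in \<open>simp_all add: hom_iff\<close>)
  ultimately have "is_iso M u" using uv by (intro M.is_isoI[of u v]) simp_all
  then show thesis using that u by blast
qed

end

locale weighted_flat = flat_class U V M T C S + weighted U V M T C W
  for U :: "'s itself" and V :: "('v, 'w, 'z) moncat_scheme"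
    and M :: "('o, 'a, 'y) cat_scheme" (structure)
    and T :: "('v, 'w, 'o, 'a) act" and C :: "('c, 'v, 'w) vcat"
    and S :: "'a set" and W :: "('c, 'v, 'w) diagram" +
  assumes flat_weight: "\<lbrakk>c \<in> VOb C; f \<in> S\<rbrakk> \<Longrightarrow> lact (Wt c) f \<in> S"
begin

text \<open>The new base \<open>m'\<close> is again good, as codomain of a map in \<open>S\<close>,
  so extensions can be continued along further maps. Hence the quantification over all good
  \<open>m\<close> and not just over a coend of the domain.\<close>

definition extendable where
  "extendable f \<longleftrightarrow> (\<forall>m \<omega>. m \<in> good_obs M S \<and> wcocone (Dom DC f) m \<omega> \<longrightarrow>
     (\<exists>m' h \<omega>'. wext f m \<omega> m' h \<omega>' \<and> h \<in> S))"

lemma extendableD: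
  assumes "extendable f" "m \<in> good_obs M S" "wcocone (Dom DC f) m \<omega>"
  obtains m' h \<omega>' where "wext f m \<omega> m' h \<omega>'" "h \<in> S"
  using assms unfolding extendable_def by blast

text \<open>By co-Yoneda the given cocone is a map
  \<open>\<phi> : W c \<otimes> A \<rightarrow> m\<close>, and cocones on the codomain are maps out
  of \<open>W c \<otimes> B\<close>. A universal extension is thus a pushout of
  \<open>W c \<otimes> i\<close> along \<open>\<phi>\<close>, which exists and stays in
  \<open>S\<close> as \<open>W c\<close> is flat.\<close>

lemma extendable_free_map:
  assumes c: "c \<in> VOb C" and i: "i \<in> S"
  shows "extendable (free_map c i)"
  unfolding extendable_def
proof (intro allI impI, elim conjE)
  fix m \<omega> assume m: "m \<in> good_obs M S"
  define A where "A = Dom M i"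
  define B where "B = Cod M i"
  have iA: "i \<in> Ar M" "Dom M i = A" "Cod M i = B" and ih: "i \<in> hom M A B"
    using S.S_Ar[OF i] by (auto simp: A_def B_def hom_iff)
  have AB: "A \<in> Ob M" "B \<in> Ob M" using iA by force+
  note fm = free_map[OF c iA(1), unfolded iA]
  have fA: "free_map c i \<in> Ar DC" "Dom DC (free_map c i) = free c A" "Cod DC (free_map c i) = free c B"
    using fm(1) by (auto simp: hom_iff)
  assume "wcocone (Dom DC (free_map c i)) m \<omega>"
  then have \<omega>: "wcocone (free c A) m \<omega>" unfolding fA .
  note w = wcoconeD[OF \<omega>]
  define \<phi> where "\<phi> = \<omega> c \<cdot> lact (Wt c) (uarr c A)"
  have \<phi>: "\<phi> \<in> Ar M" "Dom M \<phi> = AOb T (Wt c) A" "Cod M \<phi> = m"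
    using w(3-5) c AB by (simp_all add: \<phi>_def)
  have \<phi>h: "\<phi> \<in> hom M (AOb T (Wt c) A) m" using \<phi> by (simp add: hom_iff)
  have \<omega>\<phi>: "\<omega> x = fcocone c A \<phi> x" if "x \<in> VOb C" for x
    unfolding \<phi>_def by (rule fcocone_elt[OF c AB(1) \<omega> that])
  have Wi: "lact (Wt c) i \<in> S" by (rule flat_weight[OF c i])
  obtain p q where P: "is_pushout M (lact (Wt c) i) \<phi> p q"
    using S.pushout_exists[OF Wi \<phi>(1)] \<phi> m iA c by auto
  have q: "q \<in> S" by (rule S.pushout_in[OF Wi \<phi>(1) _ _ P]) (use \<phi> m iA c in auto)
  note PD = M.pushoutD[OF P]
  have pA: "p \<in> Ar M" "Dom M p = AOb T (Wt c) B" and qA: "q \<in> Ar M" "Dom M q = m" "Cod M q = Cod M p"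
    using PD \<phi> iA c by simp_all
  have ph: "p \<in> hom M (AOb T (Wt c) B) (Cod M p)" using pA by (simp add: hom_iff)
  have "wext (free_map c i) m \<omega> (Cod M p) q (fcocone c B p)"
  proof (rule wextI)
    show "free_map c i \<in> Ar DC" by (rule fA)
    show "wcocone (Dom DC (free_map c i)) m \<omega>" unfolding fA by (rule \<omega>)
    show "wcocone (Cod DC (free_map c i)) (Cod M p) (fcocone c B p)"
      unfolding fA by (rule wcocone_fcocone[OF c AB(2) ph])
    show "q \<in> hom M m (Cod M p)" using qA by (simp add: hom_iff)
    show "fcocone c B p x \<cdot> lact (Wt x) (cmp (free_map c i) x) = q \<cdot> \<omega> x" if x: "x \<in> VOb C" for x
    proof -
      have "fcocone c B p x \<cdot> lact (Wt x) (cmp (free_map c i) x) = fcocone c A (p \<cdot> lact (Wt c) i) x"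
        unfolding fm(2)[OF x] by (rule fcocone_nat[OF c x ih ph])
      also have "\<dots> = q \<cdot> \<omega> x"
        unfolding PD(9) \<omega>\<phi>[OF x] using \<phi> qA c x AB by (simp add: fcocone_def)
      finally show ?thesis .
    qed
    { fix n k \<sigma> assume k: "k \<in> hom M m n" and s: "wcocone (Cod DC (free_map c i)) n \<sigma>"
        and e: "\<And>x. x \<in> VOb C \<Longrightarrow> \<sigma> x \<cdot> lact (Wt x) (cmp (free_map c i) x) = k \<cdot> \<omega> x"
      have kA: "k \<in> Ar M" "Dom M k = m" "Cod M k = n" using k by (auto simp: hom_iff)
      note s' = s[unfolded fA]
      note sD = wcoconeD[OF s']
      define \<psi> where "\<psi> = \<sigma> c \<cdot> lact (Wt c) (uarr c B)"
      have \<psi>: "\<psi> \<in> Ar M" "Dom M \<psi> = AOb T (Wt c) B" "Cod M \<psi> = n"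
        using sD(3-5) c AB by (simp_all add: \<psi>_def)
      have "\<psi> \<cdot> lact (Wt c) i = \<sigma> c \<cdot> lact (Wt c) (uarr c B \<cdot> i)"
        using sD(3-5) c AB iA by (simp add: \<psi>_def)
      also have "\<dots> = \<sigma> c \<cdot> lact (Wt c) (cmp (free_map c i) c) \<cdot> lact (Wt c) (uarr c A)"
        unfolding uarr_nat[OF c ih] fm(2)[OF c] using sD(3-5) c AB iA by simp
      also have "\<dots> = k \<cdot> \<phi>" unfolding e[OF c] using w(3-5) c AB kA by (simp add: \<phi>_def)
      finally obtain l where l: "l \<in> hom M (Cod M p) n" "l \<cdot> p = \<psi>" "l \<cdot> q = k"
        using M.pushout_map[OF P, of \<psi> n k] \<psi> kA iA \<phi> c by (auto simp: hom_iff)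
      have "l \<cdot> fcocone c B p x = \<sigma> x" if x: "x \<in> VOb C" for x
      proof -
        have "l \<cdot> fcocone c B p x = fcocone c B \<psi> x"
          using l(1) pA c x AB M.comp_cong_left[OF l(2)] by (simp add: fcocone_def hom_iff)
        then show ?thesis using fcocone_elt[OF c AB(2) s' x] by (simp add: \<psi>_def)
      qed
      with l show "\<exists>l. l \<in> hom M (Cod M p) n \<and> l \<cdot> q = k \<and> (\<forall>x\<in>VOb C. l \<cdot> fcocone c B p x = \<sigma> x)" by blast }
    { fix n l l' assume l: "l \<in> hom M (Cod M p) n" "l' \<in> hom M (Cod M p) n" "l \<cdot> q = l' \<cdot> q"
        "\<And>x. x \<in> VOb C \<Longrightarrow> l \<cdot> fcocone c B p x = l' \<cdot> fcocone c B p x"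
      \<comment> \<open>The pushout inclusion \<open>p\<close> is recovered from its cocone at the
        identity of \<open>c\<close>; maps that agree on the cocone therefore agree on
        \<open>p\<close>.\<close>
      have *: "k \<cdot> p = k \<cdot> fcocone c B p c \<cdot> lact (Wt c) (uarr c B)" if "k \<in> hom M (Cod M p) n" for k
        using elt_fcocone[OF c AB(2) ph] fcocone_hom[OF c c AB(2) ph] that c AB by (simp add: hom_iff)
      show "l = l'"
        by (rule M.pushout_eqI[OF P l(1,2) _ l(3)]) (simp only: *[OF l(1)] *[OF l(2)] l(4)[OF c]) }
  qed
  with q show "\<exists>m' h \<omega>'. wext (free_map c i) m \<omega> m' h \<omega>' \<and> h \<in> S" by blast
qed

text \<open>The cocone is pulled back along \<open>g\<close> and extended along \<open>f\<close>.
  The same base and the same \<open>h\<close> serve for the cobase change, since pushout squares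
  paste.\<close>

lemma extendable_cobase:
  assumes f: "pw f" "extendable f" and g: "Cod DC g \<in> Gd" and P: "is_pushout DC f g p q"
  shows "extendable q"
  unfolding extendable_def
proof (intro allI impI, elim conjE)
  note PD = DC.pushoutD[OF P]
  have dg: "Dom DC g = Dom DC f" using PD(3) by simp
  note fm = dmapD[OF PD(1)] and gm = dmapD[OF PD(2)] and pm = dmapD[OF PD(4)] and qm = dmapD[OF PD(5)]
  fix m \<omega> assume m: "m \<in> good_obs M S" and w0: "wcocone (Dom DC q) m \<omega>"
  have w: "wcocone (Cod DC g) m \<omega>" using w0 PD(7) by simp
  note wD = wcoconeD[OF w]
  have gh: "g \<in> hom DC (Dom DC f) (Cod DC g)" using PD by (simp add: hom_iff)
  have fh: "f \<in> hom DC (Dom DC f) (Cod DC f)" using PD by (simp add: hom_iff)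
  have ph: "p \<in> hom DC (Cod DC f) (Cod DC p)" and qh: "q \<in> hom DC (Cod DC g) (Cod DC p)"
    using PD by (simp_all add: hom_iff)
  obtain m' h \<omega>' where e: "wext f m (\<lambda>c. \<omega> c \<cdot> lact (Wt c) (cmp g c)) m' h \<omega>'" and h: "h \<in> S"
    by (rule extendableD[OF f(2) m wcocone_pull[OF w gh]])
  note E = wextD[OF e] and w' = wcoconeD[OF wextD(3)[OF e]]
  let ?D = "span DC f g" and ?k = "span_cocone (p \<cdot>\<^bsub>DC\<^esub> f) p q"
  have J: "small_category U span_cat" by (rule span_cat[OF universe])
  have D: "is_functor span_cat DC ?D" by (rule DC.span_functor[OF PD(1-3)])
  have col: "is_colimit span_cat DC ?D (Cod DC p) ?k" using P DC.pushout_iff_colimit[OF PD(1-4)] by blast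
  then have coc: "is_cocone span_cat DC ?D (Cod DC p) ?k" by (simp add: is_colimit_def)
  note pt = pw_pushout(3)[OF f(1) PD(2) dg g P]
  \<comment> \<open>A compatible family on the span: the extended cocone on the codomain of
    \<open>f\<close>, the given one pushed forward by \<open>h\<close> on the codomain of
    \<open>g\<close>, and their common restriction at the apex. It glues to a cocone on the
    pushout.\<close>
  define \<sigma> where "\<sigma> = (\<lambda>j::nat. if j = 0 then (\<lambda>c. \<omega>' c \<cdot> lact (Wt c) (cmp f c)) else if j = 1 then \<omega>' else (\<lambda>c. h \<cdot> \<omega> c))"
  have hh: "h \<in> hom M m m'" using E by (simp add: hom_iff)
  have \<sigma>w: "wcocone (FOb ?D j) m' (\<sigma> j)" if "j \<in> Ob span_cat" for j
    using that wcocone_pull[OF E(3) fh] E(3) wcocone_post[OF w hh] by (auto simp: \<sigma>_def span_def)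
  have \<sigma>c: "\<sigma> (Cod span_cat u) c \<cdot> lact (Wt c) (cmp (FAr ?D u) c) = \<sigma> (Dom span_cat u) c"
    if u: "u \<in> Ar span_cat" and c: "c \<in> VOb C" for u c
  proof -
    note FO = diagramD(1)[OF fm(1) c] diagramD(1)[OF fm(2) c] diagramD(1)[OF gm(2) c]
    have "h \<cdot> \<omega> c \<cdot> lact (Wt c) (cmp g c) = \<omega>' c \<cdot> lact (Wt c) (cmp f c)"
      unfolding E(7)[OF c] using E(4-6) wD(3-5) gm(3-5) c by simp
    moreover have "\<sigma> j c \<cdot> lact (Wt c) (Idn M (DOb (FOb ?D j) c)) = \<sigma> j c" if "j \<in> Ob span_cat" for j
      using wcoconeD(3-5)[OF \<sigma>w[OF that] c] diagramD(1)[OF wcoconeD(1)[OF \<sigma>w[OF that]] c] c by simp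
    from this[of 0] this[of 1] this[of 2] have
      "\<sigma> 0 c \<cdot> lact (Wt c) (Idn M (DOb (Dom DC f) c)) = \<sigma> 0 c"
      "\<sigma> 1 c \<cdot> lact (Wt c) (Idn M (DOb (Cod DC f) c)) = \<sigma> 1 c"
      "\<sigma> 2 c \<cdot> lact (Wt c) (Idn M (DOb (Cod DC g) c)) = \<sigma> 2 c" by (simp_all add: span_def)
    ultimately show ?thesis using u c by (auto simp: span_def \<sigma>_def)
  qed
  obtain \<omega>'' where w'': "wcocone (Cod DC p) m' \<omega>''"
    "\<And>j c. \<lbrakk>j \<in> Ob span_cat; c \<in> VOb C\<rbrakk> \<Longrightarrow> \<omega>'' c \<cdot> lact (Wt c) (cmp (?k j) c) = \<sigma> j c"
    by (rule wcocone_colimit[OF J D coc pt \<sigma>w w'(2) \<sigma>c]) auto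
  have wp: "\<omega>'' c \<cdot> lact (Wt c) (cmp p c) = \<omega>' c" "\<omega>'' c \<cdot> lact (Wt c) (cmp q c) = h \<cdot> \<omega> c" if "c \<in> VOb C" for c
    using w''(2)[of 1 c] w''(2)[of 2 c] that by (simp_all add: span_cocone_def \<sigma>_def)
  note w''D = wcoconeD[OF w''(1)]
  have "wext q m \<omega> m' h \<omega>''"
  proof (rule wextI)
    show "q \<in> Ar DC" by (rule PD)
    show "wcocone (Dom DC q) m \<omega>" by (rule w0)
    show "wcocone (Cod DC q) m' \<omega>''" using w''(1) PD(8) by simp
    show "h \<in> hom M m m'" by (rule hh)
    show "\<omega>'' c \<cdot> lact (Wt c) (cmp q c) = h \<cdot> \<omega> c" if "c \<in> VOb C" for c using wp that by simp
    { fix n k \<tau> assume k: "k \<in> hom M m n" and t0: "wcocone (Cod DC q) n \<tau>"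
        and te: "\<And>c. c \<in> VOb C \<Longrightarrow> \<tau> c \<cdot> lact (Wt c) (cmp q c) = k \<cdot> \<omega> c"
      have t: "wcocone (Cod DC p) n \<tau>" using t0 PD(8) by simp
      note tD = wcoconeD[OF t]
      have kA: "k \<in> Ar M" "Dom M k = m" "Cod M k = n" using k by (auto simp: hom_iff)
      have pq: "cmp p c \<cdot> cmp f c = cmp q c \<cdot> cmp g c" if "c \<in> VOb C" for c
        using arg_cong[OF PD(9), of "\<lambda>f. cmp f c"] that by simp
      have tpf: "\<tau> c \<cdot> lact (Wt c) (cmp p c) \<cdot> lact (Wt c) (cmp f c) = k \<cdot> (\<omega> c \<cdot> lact (Wt c) (cmp g c))"
        if c: "c \<in> VOb C" for c
      proof -
        have "\<tau> c \<cdot> lact (Wt c) (cmp p c) \<cdot> lact (Wt c) (cmp f c) = \<tau> c \<cdot> lact (Wt c) (cmp p c \<cdot> cmp f c)"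
          using tD(3-5) pm(3-5) fm(3-5) PD c by simp
        also have "\<dots> = \<tau> c \<cdot> lact (Wt c) (cmp q c) \<cdot> lact (Wt c) (cmp g c)"
          unfolding pq[OF c] using tD(3-5) qm(3-5) gm(3-5) PD c by simp
        also have "\<dots> = k \<cdot> (\<omega> c \<cdot> lact (Wt c) (cmp g c))"
          unfolding te[OF c] using kA wD(3-5) gm(3-5) c by simp
        finally show ?thesis .
      qed
      obtain l where l: "l \<in> hom M m' n" "l \<cdot> h = k" "\<And>c. c \<in> VOb C \<Longrightarrow> l \<cdot> \<omega>' c = \<tau> c \<cdot> lact (Wt c) (cmp p c)"
        by (rule wext_map[OF e k wcocone_pull[OF t ph] tpf]) auto
      have lA: "l \<in> Ar M" "Dom M l = m'" "Cod M l = n" using l(1) by (auto simp: hom_iff)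
      have "l \<cdot> \<omega>'' c = \<tau> c" if c: "c \<in> VOb C" for c
      proof (rule wcocone_colimit_eqI[OF J D coc pt wcocone_post[OF w''(1) l(1)] t c])
        have 1: "l \<cdot> \<omega>'' c \<cdot> lact (Wt c) (cmp p c) = \<tau> c \<cdot> lact (Wt c) (cmp p c)"
          using l(3)[OF c] wp(1)[OF c] lA w''D(3-5) pm(3-5) c by simp
        have 2: "l \<cdot> \<omega>'' c \<cdot> lact (Wt c) (cmp q c) = \<tau> c \<cdot> lact (Wt c) (cmp q c)"
          using te[OF c] wp(2)[OF c] lA w''D(3-5) qm(3-5) PD(8) c
            M.comp_cong_left[OF l(2), of "\<omega> c"] wD(3-5) E(4-6) by simp
        have "l \<cdot> \<omega>'' c \<cdot> lact (Wt c) (cmp p c) \<cdot> lact (Wt c) (cmp f c)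
            = \<tau> c \<cdot> lact (Wt c) (cmp p c) \<cdot> lact (Wt c) (cmp f c)"
          unfolding 1 ..
        then have 0: "l \<cdot> \<omega>'' c \<cdot> lact (Wt c) (cmp p c \<cdot> cmp f c) = \<tau> c \<cdot> lact (Wt c) (cmp p c \<cdot> cmp f c)"
          using lA w''D(3-5) tD(3-5) pm(3-5) fm(3-5) PD(6) c by simp
        fix j assume "j \<in> Ob span_cat"
        then show "l \<cdot> \<omega>'' c \<cdot> lact (Wt c) (cmp (?k j) c) = \<tau> c \<cdot> lact (Wt c) (cmp (?k j) c)"
          using 0 1 2 c by (auto simp: span_cocone_def simp del: AAr_simps AAr_merge M.comp_assoc)
      qed
      with l show "\<exists>l. l \<in> hom M m' n \<and> l \<cdot> h = k \<and> (\<forall>c\<in>VOb C. l \<cdot> \<omega>'' c = \<tau> c)" by blast }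
    { fix n l l' assume l: "l \<in> hom M m' n" "l' \<in> hom M m' n" "l \<cdot> h = l' \<cdot> h"
        "\<And>c. c \<in> VOb C \<Longrightarrow> l \<cdot> \<omega>'' c = l' \<cdot> \<omega>'' c"
      have lA: "l \<in> Ar M" "Dom M l = m'" "l' \<in> Ar M" "Dom M l' = m'" using l by (auto simp: hom_iff)
      show "l = l'"
      proof (rule wext_eqI[OF e l(1,2,3)])
        fix c assume c: "c \<in> VOb C"
        have "l \<cdot> \<omega>'' c \<cdot> lact (Wt c) (cmp p c) = l' \<cdot> \<omega>'' c \<cdot> lact (Wt c) (cmp p c)"
          using l(4)[OF c] by simp
        then show "l \<cdot> \<omega>' c = l' \<cdot> \<omega>' c"
          unfolding wp(1)[OF c, symmetric] using lA w''D(3-5) pm(3-5) c by simp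
      qed }
  qed
  with h show "\<exists>m' h \<omega>'. wext q m \<omega> m' h \<omega>' \<and> h \<in> S" by blast
qed

end

section \<open>Universal extensions along transfinite composites\<close>

context weighted_flat
begin

context
  fixes r :: "'s rel" and X k0 L \<iota> m \<omega>
  assumes X: "transfinite_seq U DC r X" and k0: "is_least r k0"
    and lim: "\<And>k c. \<lbrakk>is_limit r k; c \<in> VOb C\<rbrakk> \<Longrightarrow>
      is_colimit (ord_cat r (underS r k)) M (ev c X) (DOb (FOb X k) c) (\<lambda>j. cmp (FAr X (j, k)) c)"
    and steps: "\<And>j k. is_succ r j k \<Longrightarrow> extendable (FAr X (j, k))"
    and L: "is_cocone (ord_cat r (Field r)) DC X L \<iota>"
    and Lpt: "\<And>c. c \<in> VOb C \<Longrightarrow> is_colimit (ord_cat r (Field r)) M (ev c X) (DOb L c) (\<lambda>j. cmp (\<iota> j) c)"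
    and m: "m \<in> good_obs M S" and \<omega>: "wcocone (FOb X k0) m \<omega>"
    and ext: "\<And>k. k \<in> Field r \<Longrightarrow> \<exists>m' h \<omega>'. wext (FAr X (k0, k)) m \<omega> m' h \<omega>' \<and> h \<in> S"
begin

text \<open>Serves limit stages and the final colimit alike. For this reason \<open>L\<close> is a
  cocone with the pointwise universal property, and extensions from the least stage to all stages
  are assumed rather than constructed.\<close>

lemma extend_to_colimit: "\<exists>m' h \<omega>'. wext (\<iota> k0) m \<omega> m' h \<omega>' \<and> h \<in> S"
proof -
  note D = transfinite_seqD[OF X]
  note R = Well_orderD[OF D(1)]
  have k0F: "k0 \<in> Field r" by (rule least_in[OF k0])
  have k0r: "(k0, k) \<in> r" if "k \<in> Field r" for k by (rule least_le[OF D(1) k0 that])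
  have FI: "j \<in> Field r" "k \<in> Field r" if "(j, k) \<in> r" for j k using that by (auto simp: Field_def)
  have XA: "FAr X (j, k) \<in> Ar DC" "Dom DC (FAr X (j, k)) = FOb X j" "Cod DC (FAr X (j, k)) = FOb X k"
    if "(j, k) \<in> r" for j k using seq_hom[OF X that] unfolding hom_iff by blast+
  have Xd: "is_diagram V C M T (FOb X k)" if "k \<in> Field r" for k
    using dmapD(1)[OF XA(1)[OF R(1)[OF that]]] XA(2)[OF R(1)[OF that]] by simp
  have Xm: "cmp (FAr X (j, k)) c \<in> Ar M" "Dom M (cmp (FAr X (j, k)) c) = DOb (FOb X j) c"
      "Cod M (cmp (FAr X (j, k)) c) = DOb (FOb X k) c" if "(j, k) \<in> r" "c \<in> VOb C" for j k c
    using dmapD(3-5)[OF XA(1)[OF that(1)] that(2)] XA(2,3)[OF that(1)] by simp_all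
  have Xcomp: "cmp (FAr X (j, l)) c = cmp (FAr X (k, l)) c \<cdot> cmp (FAr X (j, k)) c"
    if "(j, k) \<in> r" "(k, l) \<in> r" "c \<in> VOb C" for j k l c
    using arg_cong[OF seq_comp[OF X that(1,2)], of "\<lambda>f. cmp f c"] that(3) by simp
  \<comment> \<open>The extensions of \<open>\<omega>\<close> to the various stages are chosen
    independently; their universal property will supply the transition maps and make the bases
    \<open>N k\<close> into a sequence in \<open>M\<close>.\<close>
  obtain N H \<Omega> where E: "\<And>k. k \<in> Field r \<Longrightarrow> wext (FAr X (k0, k)) m \<omega> (N k) (H k) (\<Omega> k)"
    and HS: "\<And>k. k \<in> Field r \<Longrightarrow> H k \<in> S"
    using ext by metis
  note w = wcoconeD[OF \<omega>]
  have H: "H k \<in> Ar M" "Dom M (H k) = m" "Cod M (H k) = N k" "N k \<in> good_obs M S" if "k \<in> Field r" for k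
    using wextD(4-6)[OF E[OF that]] S.S_good(2)[OF HS[OF that]] by simp_all
  have \<Omega>c: "wcocone (FOb X k) (N k) (\<Omega> k)" if "k \<in> Field r" for k
    using wextD(3)[OF E[OF that]] XA(3)[OF k0r[OF that]] by simp
  note \<Omega>d = wcoconeD(3-5)[OF \<Omega>c]
  have H\<Omega>: "\<Omega> k c \<cdot> lact (Wt c) (cmp (FAr X (k0, k)) c) = H k \<cdot> \<omega> c" if "k \<in> Field r" "c \<in> VOb C" for k c
    by (rule wextD(7)[OF E[OF that(1)] that(2)])
  have pullcomp: "\<sigma> c \<cdot> lact (Wt c) (cmp (FAr X (k, l)) c) \<cdot> lact (Wt c) (cmp (FAr X (j, k)) c)
      = \<sigma> c \<cdot> lact (Wt c) (cmp (FAr X (j, l)) c)"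
    if "(j, k) \<in> r" "(k, l) \<in> r" "c \<in> VOb C" "wcocone (FOb X l) n \<sigma>" for j k l c n \<sigma>
    using Xm[OF that(1,3)] Xm[OF that(2,3)] wcoconeD(3-5)[OF that(4,3)] Xcomp[OF that(1-3)] that(3) by simp
  have "\<exists>e. e \<in> hom M (N j) (N k) \<and> e \<cdot> H j = H k \<and>
      (\<forall>c\<in>VOb C. e \<cdot> \<Omega> j c = \<Omega> k c \<cdot> lact (Wt c) (cmp (FAr X (j, k)) c))" if jk: "(j, k) \<in> r" for j k
  proof -
    note j = FI(1)[OF jk] and k = FI(2)[OF jk]
    have 1: "wcocone (Cod DC (FAr X (k0, j))) (N k) (\<lambda>c. \<Omega> k c \<cdot> lact (Wt c) (cmp (FAr X (j, k)) c))"
      unfolding XA(3)[OF k0r[OF j]] by (rule wcocone_pull[OF \<Omega>c[OF k] seq_hom[OF X jk]])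
    have 2: "\<Omega> k c \<cdot> lact (Wt c) (cmp (FAr X (j, k)) c) \<cdot> lact (Wt c) (cmp (FAr X (k0, j)) c) = H k \<cdot> \<omega> c"
      if "c \<in> VOb C" for c
      unfolding pullcomp[OF k0r[OF j] jk that \<Omega>c[OF k]] by (rule H\<Omega>[OF k that])
    have 3: "H k \<in> hom M m (N k)" using H[OF k] by (simp add: hom_iff)
    show ?thesis by (rule wext_map[OF E[OF j] 3 1 2]) auto
  qed
  then obtain e where e0: "\<And>j k. (j, k) \<in> r \<Longrightarrow> e j k \<in> hom M (N j) (N k)"
    and eH: "\<And>j k. (j, k) \<in> r \<Longrightarrow> e j k \<cdot> H j = H k"
    and e\<Omega>: "\<And>j k c. \<lbrakk>(j, k) \<in> r; c \<in> VOb C\<rbrakk> \<Longrightarrow> e j k \<cdot> \<Omega> j c = \<Omega> k c \<cdot> lact (Wt c) (cmp (FAr X (j, k)) c)"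
    by metis
  have e: "e j k \<in> Ar M" "Dom M (e j k) = N j" "Cod M (e j k) = N k" if "(j, k) \<in> r" for j k
    using e0[OF that] by (auto simp: hom_iff)
  have e_eqI: "f = g" if k: "k \<in> Field r" and fg: "f \<in> hom M (N k) n" "g \<in> hom M (N k) n" "f \<cdot> H k = g \<cdot> H k"
    "\<And>c. c \<in> VOb C \<Longrightarrow> f \<cdot> \<Omega> k c = g \<cdot> \<Omega> k c" for k n f g
    by (rule wext_eqI[OF E[OF k] fg])
  have e_id: "e k k = Idn M (N k)" if k: "k \<in> Field r" for k
  proof (rule e_eqI[OF k e0[OF R(1)[OF k]]])
    show "Idn M (N k) \<in> hom M (N k) (N k)" using S.good_Ob[OF H(4)[OF k]] by (simp add: hom_iff)
    show "e k k \<cdot> H k = Idn M (N k) \<cdot> H k" using eH[OF R(1)[OF k]] H[OF k] by simp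
    show "e k k \<cdot> \<Omega> k c = Idn M (N k) \<cdot> \<Omega> k c" if c: "c \<in> VOb C" for c
      using e\<Omega>[OF R(1)[OF k] c] seq_Idn[OF X k] \<Omega>d[OF k c] diagramD(1)[OF Xd[OF k] c] c by simp
  qed
  have e_comp: "e j l = e k l \<cdot> e j k" if jk: "(j, k) \<in> r" and kl: "(k, l) \<in> r" for j k l
  proof (rule e_eqI[OF FI(1)[OF jk]])
    have jl: "(j, l) \<in> r" using R(2) jk kl by (rule transD)
    show "e j l \<in> hom M (N j) (N l)" by (rule e0[OF jl])
    show "e k l \<cdot> e j k \<in> hom M (N j) (N l)" using e[OF jk] e[OF kl] by (simp add: hom_iff)
    show "e j l \<cdot> H j = e k l \<cdot> e j k \<cdot> H j"
      using eH[OF jl] eH[OF jk] eH[OF kl] e[OF jk] e[OF kl] H[OF FI(1)[OF jk]] by simp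
    show "e j l \<cdot> \<Omega> j c = e k l \<cdot> e j k \<cdot> \<Omega> j c" if c: "c \<in> VOb C" for c
    proof -
      have "e k l \<cdot> e j k \<cdot> \<Omega> j c = e k l \<cdot> \<Omega> k c \<cdot> lact (Wt c) (cmp (FAr X (j, k)) c)"
        using e\<Omega>[OF jk c] e[OF jk] e[OF kl] \<Omega>d[OF FI(1)[OF jk] c] \<Omega>d[OF FI(2)[OF jk] c] Xm[OF jk c] c by simp
      also have "\<dots> = e j l \<cdot> \<Omega> j c"
        unfolding e\<Omega>[OF kl c] e\<Omega>[OF jl c] by (rule pullcomp[OF jk kl c \<Omega>c[OF FI(2)[OF kl]]])
      finally show ?thesis ..
    qed
  qed
  define F where "F = ord_funct N e"
  have F: "FOb F = N" "\<And>j k. FAr F (j, k) = e j k" by (simp_all add: F_def)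
  have fF: "is_functor (ord_cat r (Field r)) M F"
    by (rule ord_functorI)
      (use M.category_axioms ord_category[OF D(1) subset_refl] S.good_Ob[OF H(4)] e0 e_id e_comp in \<open>simp_all add: F\<close>)
  \<comment> \<open>A cocone on the sequence of bases, composed with the cocones
    \<open>\<Omega> j\<close>, is a compatible family on the diagrams \<open>X j\<close> and so
    descends to their colimit.\<close>
  have glue: "\<exists>\<sigma>. wcocone Y n \<sigma> \<and> (\<forall>j\<in>K. \<forall>c\<in>VOb C. \<sigma> c \<cdot> lact (Wt c) (cmp (y j) c) = \<tau> j \<cdot> \<Omega> j c)"
    if K: "K \<subseteq> Field r" and Y: "is_cocone (ord_cat r K) DC X Y y"
      and pt: "\<And>c. c \<in> VOb C \<Longrightarrow> is_colimit (ord_cat r K) M (ev c X) (DOb Y c) (\<lambda>j. cmp (y j) c)"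
      and t: "is_cocone (ord_cat r K) M F n \<tau>" for K Y y n \<tau>
  proof -
    have n: "n \<in> Ob M" and th: "\<And>j. j \<in> K \<Longrightarrow> \<tau> j \<in> hom M (N j) n"
      and te: "\<And>j k. \<lbrakk>j \<in> K; k \<in> K; (j, k) \<in> r\<rbrakk> \<Longrightarrow> \<tau> k \<cdot> e j k = \<tau> j"
      using t by (auto simp: ord_cocone_iff F)
    have s: "wcocone (FOb X j) n (\<lambda>c. \<tau> j \<cdot> \<Omega> j c)" if "j \<in> Ob (ord_cat r K)" for j
      by (rule wcocone_post[OF \<Omega>c th]) (use that K in auto)
    have comp: "\<tau> (Cod (ord_cat r K) u) \<cdot> \<Omega> (Cod (ord_cat r K) u) c \<cdot> lact (Wt c) (cmp (FAr X u) c)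
        = \<tau> (Dom (ord_cat r K) u) \<cdot> \<Omega> (Dom (ord_cat r K) u) c"
      if u: "u \<in> Ar (ord_cat r K)" and c: "c \<in> VOb C" for u c
    proof -
      obtain j k where jk: "u = (j, k)" "j \<in> K" "k \<in> K" "(j, k) \<in> r" using u by auto
      have tA: "\<tau> k \<in> Ar M" "Dom M (\<tau> k) = N k" using th[OF jk(3)] by (auto simp: hom_iff)
      have "\<tau> k \<cdot> \<Omega> k c \<cdot> lact (Wt c) (cmp (FAr X (j, k)) c) = \<tau> k \<cdot> (e j k \<cdot> \<Omega> j c)"
        unfolding e\<Omega>[OF jk(4) c] using tA \<Omega>d[OF FI(2)[OF jk(4)] c] Xm[OF jk(4) c] c by simp
      also have "\<dots> = \<tau> j \<cdot> \<Omega> j c"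
        using M.comp_cong_left[OF te[OF jk(2-4)], of "\<Omega> j c"] tA e[OF jk(4)] \<Omega>d[OF FI(1)[OF jk(4)] c] by simp
      finally show ?thesis by (simp add: jk(1))
    qed
    show ?thesis
      by (rule wcocone_colimit[OF small_category_ord[OF universe D(1) K D(2)] ord_functor_subset[OF D(4,1) K]
            Y pt s n comp]) auto
  qed
  have glue_eqI: "\<sigma> c = \<sigma>' c"
    if K: "K \<subseteq> Field r" and Y: "is_cocone (ord_cat r K) DC X Y y"
      and pt: "\<And>c. c \<in> VOb C \<Longrightarrow> is_colimit (ord_cat r K) M (ev c X) (DOb Y c) (\<lambda>j. cmp (y j) c)"
      and s: "wcocone Y n \<sigma>" "wcocone Y n \<sigma>'" and c: "c \<in> VOb C"
      and eq: "\<And>j. j \<in> K \<Longrightarrow> \<sigma> c \<cdot> lact (Wt c) (cmp (y j) c) = \<sigma>' c \<cdot> lact (Wt c) (cmp (y j) c)" for K Y y n \<sigma> \<sigma>' c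
    by (rule wcocone_colimit_eqI[OF small_category_ord[OF universe D(1) K D(2)] ord_functor_subset[OF D(4,1) K]
            Y pt s c]) (use eq in auto)
  \<comment> \<open>Continuity of the sequence of bases: a map out of \<open>N k\<close> amounts to
    a map out of \<open>m\<close> and a cocone on \<open>X k\<close>. At a limit \<open>k\<close>
    the latter is glued from the earlier stages.\<close>
  have limF: "is_colimit (ord_cat r (underS r k)) M F (N k) (\<lambda>j. e j k)" if k: "is_limit r k" for k
  proof (rule M.is_colimitI)
    have kF: "k \<in> Field r" and ne: "underS r k \<noteq> {}" using k by (auto simp: is_limit_def)
    have sub: "\<And>j. j \<in> underS r k \<Longrightarrow> (j, k) \<in> r" by (auto simp: underS_iff)
    have K: "underS r k \<subseteq> Field r" using underS_Field by fast
    have k0k: "k0 \<in> underS r k" using least_under[OF D(1) k0 kF ne] .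
    have Y: "is_cocone (ord_cat r (underS r k)) DC X (FOb X k) (\<lambda>j. FAr X (j, k))"
      using D(5)[OF k] by (simp add: is_colimit_def)
    show "is_cocone (ord_cat r (underS r k)) M F (N k) (\<lambda>j. e j k)"
      unfolding ord_cocone_iff F using S.good_Ob[OF H(4)[OF kF]] e0[OF sub] e_comp sub by auto
    { fix n \<tau> assume t: "is_cocone (ord_cat r (underS r k)) M F n \<tau>"
      then have th: "\<And>j. j \<in> underS r k \<Longrightarrow> \<tau> j \<in> hom M (N j) n"
        and te: "\<And>j l. \<lbrakk>j \<in> underS r k; l \<in> underS r k; (j, l) \<in> r\<rbrakk> \<Longrightarrow> \<tau> l \<cdot> e j l = \<tau> j"
        by (auto simp: ord_cocone_iff F)
      have tA: "\<tau> j \<in> Ar M" "Dom M (\<tau> j) = N j" "Cod M (\<tau> j) = n" if "j \<in> underS r k" for j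
        using th[OF that] by (auto simp: hom_iff)
      obtain \<sigma> where \<sigma>: "wcocone (FOb X k) n \<sigma>"
        "\<And>j c. \<lbrakk>j \<in> underS r k; c \<in> VOb C\<rbrakk> \<Longrightarrow> \<sigma> c \<cdot> lact (Wt c) (cmp (FAr X (j, k)) c) = \<tau> j \<cdot> \<Omega> j c"
        using glue[OF K Y lim[OF k] t] by blast
      have tH: "\<tau> j \<cdot> H j = \<tau> k0 \<cdot> H k0" if j: "j \<in> underS r k" for j
      proof -
        note k0j = k0r[OF underS_Field[OF j]]
        show ?thesis
          using M.comp_cong_left[OF te[OF k0k j k0j], of "H k0"] eH[OF k0j] tA[OF j] e[OF k0j] H[OF k0F] by simp
      qed
      have 1: "\<tau> k0 \<cdot> H k0 \<in> hom M m n" using tA[OF k0k] H[OF k0F] by (simp add: hom_iff)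
      have 2: "wcocone (Cod DC (FAr X (k0, k))) n \<sigma>" using \<sigma>(1) XA(3)[OF k0r[OF kF]] by simp
      have 3: "\<sigma> c \<cdot> lact (Wt c) (cmp (FAr X (k0, k)) c) = \<tau> k0 \<cdot> H k0 \<cdot> \<omega> c" if c: "c \<in> VOb C" for c
      proof -
        have "\<Omega> k0 c = H k0 \<cdot> \<omega> c"
          using H\<Omega>[OF k0F c] seq_Idn[OF X k0F] \<Omega>d[OF k0F c] diagramD(1)[OF Xd[OF k0F] c] c by simp
        then show ?thesis using \<sigma>(2)[OF k0k c] tA[OF k0k] H[OF k0F] w(3-5)[OF c] by simp
      qed
      obtain l where l: "l \<in> hom M (N k) n" "l \<cdot> H k = \<tau> k0 \<cdot> H k0" "\<And>c. c \<in> VOb C \<Longrightarrow> l \<cdot> \<Omega> k c = \<sigma> c"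
        by (rule wext_map[OF E[OF kF] 1 2 3]) auto
      have lA: "l \<in> Ar M" "Dom M l = N k" "Cod M l = n" using l(1) by (auto simp: hom_iff)
      have "l \<cdot> e j k = \<tau> j" if j: "j \<in> underS r k" for j
      proof (rule e_eqI[OF underS_Field[OF j] _ th[OF j]])
        note jk = sub[OF j]
        show "l \<cdot> e j k \<in> hom M (N j) n" using lA e[OF jk] by (simp add: hom_iff)
        show "l \<cdot> e j k \<cdot> H j = \<tau> j \<cdot> H j"
          using lA e[OF jk] H[OF underS_Field[OF j]] eH[OF jk] l(2) tH[OF j] by simp
        show "l \<cdot> e j k \<cdot> \<Omega> j c = \<tau> j \<cdot> \<Omega> j c" if c: "c \<in> VOb C" for c
          using lA e[OF jk] \<Omega>d[OF underS_Field[OF j] c] e\<Omega>[OF jk c] \<Omega>d[OF kF c] Xm[OF jk c] c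
            M.comp_cong_left[OF l(3)[OF c], of "lact (Wt c) (cmp (FAr X (j, k)) c)"] \<sigma>(2)[OF j c] by simp
      qed
      then show "\<exists>h. h \<in> hom M (N k) n \<and> (\<forall>j\<in>Ob (ord_cat r (underS r k)). h \<cdot> e j k = \<tau> j)"
        using l(1) by auto }
    { fix n g g' assume g: "g \<in> hom M (N k) n" "g' \<in> hom M (N k) n"
        "\<forall>j\<in>Ob (ord_cat r (underS r k)). g \<cdot> e j k = g' \<cdot> e j k"
      have gA: "g \<in> Ar M" "Dom M g = N k" "g' \<in> Ar M" "Dom M g' = N k" using g by (auto simp: hom_iff)
      have ge: "g \<cdot> e j k = g' \<cdot> e j k" if "j \<in> underS r k" for j using g(3) that by simp
      show "g = g'"
      proof (rule e_eqI[OF kF g(1,2)])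
        note r0 = k0r[OF kF]
        have "g \<cdot> (e k0 k \<cdot> H k0) = g' \<cdot> (e k0 k \<cdot> H k0)"
          using M.comp_cong_left[OF ge[OF k0k], of "H k0"] gA e[OF r0] H[OF k0F] by simp
        then show "g \<cdot> H k = g' \<cdot> H k" unfolding eH[OF r0] .
        fix c assume c: "c \<in> VOb C"
        show "g \<cdot> \<Omega> k c = g' \<cdot> \<Omega> k c"
        proof (rule glue_eqI[OF K Y lim[OF k] wcocone_post[OF \<Omega>c[OF kF] g(1)] wcocone_post[OF \<Omega>c[OF kF] g(2)] c])
          fix j assume j: "j \<in> underS r k"
          note jk = sub[OF j]
          have "g \<cdot> (e j k \<cdot> \<Omega> j c) = g' \<cdot> (e j k \<cdot> \<Omega> j c)"
            using M.comp_cong_left[OF ge[OF j], of "\<Omega> j c"] gA e[OF jk] \<Omega>d[OF underS_Field[OF j] c] by simp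
          then show "g \<cdot> \<Omega> k c \<cdot> lact (Wt c) (cmp (FAr X (j, k)) c) = g' \<cdot> \<Omega> k c \<cdot> lact (Wt c) (cmp (FAr X (j, k)) c)"
            unfolding e\<Omega>[OF jk c] using gA \<Omega>d[OF kF c] Xm[OF jk c] c by simp
        qed
      qed }
  qed
  have ts: "transfinite_seq U M r F"
    unfolding transfinite_seq_def using D(1-3) fF limF by (simp add: F)
  \<comment> \<open>Extending from \<open>j\<close> to its successor by \<open>extendable\<close>
    gives another extension of \<open>\<omega>\<close> to stage \<open>k\<close>. It differs from
    the chosen \<open>N k\<close> by an isomorphism, so the transition map is in \<open>S\<close> up
    to an isomorphism, and hence in \<open>S\<close>.\<close>
  have stepS: "e j k \<in> S" if s: "is_succ r j k" for j k
  proof -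
    note jk = is_succD(1)[OF s] and j = is_succD(3)[OF s] and k = is_succD(4)[OF s]
    obtain m' h \<omega>' where x: "wext (FAr X (j, k)) (N j) (\<Omega> j) m' h \<omega>'" "h \<in> S"
      by (rule extendableD[OF steps[OF s] H(4)[OF j]]) (use \<Omega>c[OF j] XA(2)[OF jk] in simp_all)
    have "wext (FAr X (j, k) \<cdot>\<^bsub>DC\<^esub> FAr X (k0, j)) m \<omega> m' (h \<cdot> H j) \<omega>'"
      by (rule wext_comp[OF E[OF j] x(1)]) (use XA(2)[OF jk] XA(3)[OF k0r[OF j]] in simp)
    then have x': "wext (FAr X (k0, k)) m \<omega> m' (h \<cdot> H j) \<omega>'"
      unfolding seq_comp[OF X k0r[OF j] jk] .
    obtain u where u: "is_iso M u" "u \<in> hom M m' (N k)" "u \<cdot> (h \<cdot> H j) = H k" "\<And>c. c \<in> VOb C \<Longrightarrow> u \<cdot> \<omega>' c = \<Omega> k c"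
      by (rule wext_unique[OF x' E[OF k]]) auto
    note xD = wextD(4-6)[OF x(1)]
    have uA: "u \<in> Ar M" "Dom M u = m'" "Cod M u = N k" using u(2) by (auto simp: hom_iff)
    have "e j k = u \<cdot> h"
    proof (rule e_eqI[OF j e0[OF jk]])
      show "u \<cdot> h \<in> hom M (N j) (N k)" using uA xD by (simp add: hom_iff)
      show "e j k \<cdot> H j = u \<cdot> h \<cdot> H j" using eH[OF jk] u(3) uA xD H[OF j] by simp
      fix c assume c: "c \<in> VOb C"
      have 1: "\<omega>' c \<in> Ar M" "Dom M (\<omega>' c) = AOb T (Wt c) (DOb (FOb X k) c)" "Cod M (\<omega>' c) = m'"
        using wcoconeD(3-5)[OF wextD(3)[OF x(1)] c] XA(3)[OF jk] by simp_all
      have "u \<cdot> h \<cdot> \<Omega> j c = u \<cdot> (\<omega>' c \<cdot> lact (Wt c) (cmp (FAr X (j, k)) c))"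
        unfolding wextD(7)[OF x(1) c] using uA xD \<Omega>d[OF j c] by simp
      also have "\<dots> = \<Omega> k c \<cdot> lact (Wt c) (cmp (FAr X (j, k)) c)"
        using M.comp_cong_left[OF u(4)[OF c], of "lact (Wt c) (cmp (FAr X (j, k)) c)"] 1 uA Xm[OF jk c] c by simp
      finally show "e j k \<cdot> \<Omega> j c = u \<cdot> h \<cdot> \<Omega> j c" unfolding e\<Omega>[OF jk c] ..
    qed
    moreover have "u \<in> S" using S.iso_in[OF u(1)] S.S_good(2)[OF x(2)] uA xD by simp
    ultimately show ?thesis using S.S_comp[OF x(2)] uA xD by simp
  qed
  have hyp: "\<forall>j k. is_succ r j k \<longrightarrow> FAr F (j, k) \<in> S" "\<forall>k. is_least r k \<longrightarrow> FOb F k \<in> good_obs M S"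
    using stepS H(4)[OF least_in] by (auto simp: F)
  obtain m' \<gamma> where \<gamma>: "is_colimit (ord_cat r (Field r)) M F m' \<gamma>"
    using S.transfinite_exists[OF ts hyp] by blast
  have \<gamma>S: "\<gamma> k0 \<in> S" by (rule S.transfinite_in[OF ts hyp \<gamma> k0])
  have \<gamma>h: "\<gamma> j \<in> hom M (N j) m'" if "j \<in> Field r" for j
    using \<gamma> that by (auto simp: is_colimit_def ord_cocone_iff F)
  have \<gamma>A: "\<gamma> j \<in> Ar M" "Dom M (\<gamma> j) = N j" "Cod M (\<gamma> j) = m'" if "j \<in> Field r" for j
    using \<gamma>h[OF that] by (auto simp: hom_iff)
  have \<gamma>e: "\<gamma> k \<cdot> e j k = \<gamma> j" if "(j, k) \<in> r" for j k
    using \<gamma> that FI[OF that] by (simp add: is_colimit_def ord_cocone_iff F)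
  have \<iota>h: "\<iota> j \<in> hom DC (FOb X j) L" if "j \<in> Field r" for j
    using L that by (auto simp: ord_cocone_iff)
  have \<iota>A: "\<iota> j \<in> Ar DC" "Dom DC (\<iota> j) = FOb X j" "Cod DC (\<iota> j) = L" if "j \<in> Field r" for j
    using \<iota>h[OF that] unfolding hom_iff by blast+
  have \<iota>m: "cmp (\<iota> j) c \<in> Ar M" "Dom M (cmp (\<iota> j) c) = DOb (FOb X j) c" "Cod M (cmp (\<iota> j) c) = DOb L c"
    if "j \<in> Field r" "c \<in> VOb C" for j c
    using dmapD(3-5)[OF \<iota>A(1)[OF that(1)] that(2)] \<iota>A(2,3)[OF that(1)] by simp_all
  have \<iota>e: "cmp (\<iota> k) c \<cdot> cmp (FAr X (j, k)) c = cmp (\<iota> j) c" if "(j, k) \<in> r" "c \<in> VOb C" for j k c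
  proof -
    have "\<iota> k \<cdot>\<^bsub>DC\<^esub> FAr X (j, k) = \<iota> j" using L that(1) FI[OF that(1)] unfolding ord_cocone_iff by blast
    from arg_cong[OF this, of "\<lambda>f. cmp f c"] that(2) show ?thesis by simp
  qed
  have "is_cocone (ord_cat r (Field r)) M F m' \<gamma>" using \<gamma> by (simp add: is_colimit_def)
  from glue[OF subset_refl L Lpt this] obtain \<omega>' where \<omega>': "wcocone L m' \<omega>'"
    "\<And>j c. \<lbrakk>j \<in> Field r; c \<in> VOb C\<rbrakk> \<Longrightarrow> \<omega>' c \<cdot> lact (Wt c) (cmp (\<iota> j) c) = \<gamma> j \<cdot> \<Omega> j c" by blast
  note w' = wcoconeD[OF \<omega>'(1)]
  have \<Omega>0: "\<Omega> k0 c = H k0 \<cdot> \<omega> c" if c: "c \<in> VOb C" for c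
    using H\<Omega>[OF k0F c] seq_Idn[OF X k0F] \<Omega>d[OF k0F c] diagramD(1)[OF Xd[OF k0F] c] c by simp
  \<comment> \<open>The extension at the least stage is along an identity, but it was chosen like
    the others and \<open>N k0\<close> need not be \<open>m\<close>. Hence the factor
    \<open>H k0\<close> in front of the colimit inclusion.\<close>
  have "wext (\<iota> k0) m \<omega> m' (\<gamma> k0 \<cdot> H k0) \<omega>'"
  proof (rule wextI)
    show "\<iota> k0 \<in> Ar DC" by (rule \<iota>A[OF k0F])
    show "wcocone (Dom DC (\<iota> k0)) m \<omega>" "wcocone (Cod DC (\<iota> k0)) m' \<omega>'"
      unfolding \<iota>A(2,3)[OF k0F] by (rule \<omega> \<omega>'(1))+
    show "\<gamma> k0 \<cdot> H k0 \<in> hom M m m'" using \<gamma>A[OF k0F] H[OF k0F] by (simp add: hom_iff)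
    show "\<omega>' c \<cdot> lact (Wt c) (cmp (\<iota> k0) c) = \<gamma> k0 \<cdot> H k0 \<cdot> \<omega> c" if c: "c \<in> VOb C" for c
      unfolding \<omega>'(2)[OF k0F c] \<Omega>0[OF c] using \<gamma>A[OF k0F] H[OF k0F] w(3-5)[OF c] by simp
    { fix n k \<sigma> assume k: "k \<in> hom M m n" and s0: "wcocone (Cod DC (\<iota> k0)) n \<sigma>"
        and se: "\<And>c. c \<in> VOb C \<Longrightarrow> \<sigma> c \<cdot> lact (Wt c) (cmp (\<iota> k0) c) = k \<cdot> \<omega> c"
      have s: "wcocone L n \<sigma>" using s0 \<iota>A(3)[OF k0F] by simp
      note sD = wcoconeD[OF s]
      have s\<iota>: "\<sigma> c \<cdot> lact (Wt c) (cmp (\<iota> j) c) \<cdot> lact (Wt c) (cmp (FAr X (i, j)) c)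
          = \<sigma> c \<cdot> lact (Wt c) (cmp (\<iota> i) c)" if "(i, j) \<in> r" "c \<in> VOb C" for i j c
        using sD(3-5) Xm[OF that] \<iota>m[OF FI(2)[OF that(1)] that(2)] \<iota>e[OF that] that(2) by simp
      have "\<exists>l. l \<in> hom M (N j) n \<and> l \<cdot> H j = k \<and> (\<forall>c\<in>VOb C. l \<cdot> \<Omega> j c = \<sigma> c \<cdot> lact (Wt c) (cmp (\<iota> j) c))"
        if j: "j \<in> Field r" for j
      proof -
        have 1: "wcocone (Cod DC (FAr X (k0, j))) n (\<lambda>c. \<sigma> c \<cdot> lact (Wt c) (cmp (\<iota> j) c))"
          unfolding XA(3)[OF k0r[OF j]] by (rule wcocone_pull[OF s \<iota>h[OF j]])
        have 2: "\<sigma> c \<cdot> lact (Wt c) (cmp (\<iota> j) c) \<cdot> lact (Wt c) (cmp (FAr X (k0, j)) c) = k \<cdot> \<omega> c"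
          if c: "c \<in> VOb C" for c
          unfolding s\<iota>[OF k0r[OF j] c] by (rule se[OF c])
        show ?thesis by (rule wext_map[OF E[OF j] k 1 2]) auto
      qed
      then obtain \<tau> where \<tau>: "\<And>j. j \<in> Field r \<Longrightarrow> \<tau> j \<in> hom M (N j) n"
        and \<tau>H: "\<And>j. j \<in> Field r \<Longrightarrow> \<tau> j \<cdot> H j = k"
        and \<tau>\<Omega>: "\<And>j c. \<lbrakk>j \<in> Field r; c \<in> VOb C\<rbrakk> \<Longrightarrow> \<tau> j \<cdot> \<Omega> j c = \<sigma> c \<cdot> lact (Wt c) (cmp (\<iota> j) c)" by metis
      have \<tau>A: "\<tau> j \<in> Ar M" "Dom M (\<tau> j) = N j" "Cod M (\<tau> j) = n" if "j \<in> Field r" for j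
        using \<tau>[OF that] by (auto simp: hom_iff)
      have "\<tau> l \<cdot> e j l = \<tau> j" if jl: "(j, l) \<in> r" for j l
      proof (rule e_eqI[OF FI(1)[OF jl] _ \<tau>[OF FI(1)[OF jl]]])
        note j = FI(1)[OF jl] and l = FI(2)[OF jl]
        show "\<tau> l \<cdot> e j l \<in> hom M (N j) n" using \<tau>A[OF l] e[OF jl] by (simp add: hom_iff)
        show "\<tau> l \<cdot> e j l \<cdot> H j = \<tau> j \<cdot> H j" using \<tau>A[OF l] e[OF jl] H[OF j] eH[OF jl] \<tau>H[OF j] \<tau>H[OF l] by simp
        show "\<tau> l \<cdot> e j l \<cdot> \<Omega> j c = \<tau> j \<cdot> \<Omega> j c" if c: "c \<in> VOb C" for c
        proof -
          have "\<tau> l \<cdot> e j l \<cdot> \<Omega> j c = \<tau> l \<cdot> \<Omega> l c \<cdot> lact (Wt c) (cmp (FAr X (j, l)) c)"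
            using \<tau>A[OF l] e[OF jl] \<Omega>d[OF j c] \<Omega>d[OF l c] e\<Omega>[OF jl c] Xm[OF jl c] c by simp
          also have "\<dots> = \<tau> j \<cdot> \<Omega> j c" unfolding \<tau>\<Omega>[OF l c] \<tau>\<Omega>[OF j c] by (rule s\<iota>[OF jl c])
          finally show ?thesis .
        qed
      qed
      then have "is_cocone (ord_cat r (Field r)) M F n \<tau>"
        unfolding ord_cocone_iff F using sD(2) \<tau> by auto
      then obtain l where l: "l \<in> hom M m' n" "\<And>j. j \<in> Field r \<Longrightarrow> l \<cdot> \<gamma> j = \<tau> j"
        using M.colimit_map[OF \<gamma>, of n \<tau>] by auto
      have lA: "l \<in> Ar M" "Dom M l = m'" "Cod M l = n" using l(1) by (auto simp: hom_iff)
      have "l \<cdot> (\<gamma> k0 \<cdot> H k0) = k"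
        using M.comp_cong_left[OF l(2)[OF k0F], of "H k0"] \<tau>H[OF k0F] lA \<gamma>A[OF k0F] H[OF k0F] by simp
      moreover have "l \<cdot> \<omega>' c = \<sigma> c" if c: "c \<in> VOb C" for c
      proof (rule glue_eqI[OF subset_refl L Lpt wcocone_post[OF \<omega>'(1) l(1)] s c])
        fix j assume j: "j \<in> Field r"
        have "l \<cdot> \<omega>' c \<cdot> lact (Wt c) (cmp (\<iota> j) c) = l \<cdot> (\<gamma> j \<cdot> \<Omega> j c)"
          unfolding \<omega>'(2)[OF j c, symmetric] using lA w'(3-5) \<iota>m[OF j c] c by simp
        also have "\<dots> = \<sigma> c \<cdot> lact (Wt c) (cmp (\<iota> j) c)"
          using M.comp_cong_left[OF l(2)[OF j], of "\<Omega> j c"] \<tau>\<Omega>[OF j c] lA \<gamma>A[OF j] \<Omega>d[OF j c] by simp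
        finally show "l \<cdot> \<omega>' c \<cdot> lact (Wt c) (cmp (\<iota> j) c) = \<sigma> c \<cdot> lact (Wt c) (cmp (\<iota> j) c)" .
      qed
      ultimately show "\<exists>l. l \<in> hom M m' n \<and> l \<cdot> (\<gamma> k0 \<cdot> H k0) = k \<and> (\<forall>c\<in>VOb C. l \<cdot> \<omega>' c = \<sigma> c)"
        using l(1) by blast }
    { fix n l l' assume l: "l \<in> hom M m' n" "l' \<in> hom M m' n" "l \<cdot> (\<gamma> k0 \<cdot> H k0) = l' \<cdot> (\<gamma> k0 \<cdot> H k0)"
        "\<And>c. c \<in> VOb C \<Longrightarrow> l \<cdot> \<omega>' c = l' \<cdot> \<omega>' c"
      have lA: "l \<in> Ar M" "Dom M l = m'" "Cod M l = n" "l' \<in> Ar M" "Dom M l' = m'" "Cod M l' = n"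
        using l by (auto simp: hom_iff)
      show "l = l'"
      proof (rule M.colimit_eqI[OF \<gamma> fF l(1,2)])
        fix j assume "j \<in> Ob (ord_cat r (Field r))"
        then have j: "j \<in> Field r" by simp
        have r0: "\<gamma> k0 \<cdot> H k0 = \<gamma> j \<cdot> H j"
          using M.comp_cong_left[OF \<gamma>e[OF k0r[OF j]], of "H k0"] eH[OF k0r[OF j]] \<gamma>A[OF j] e[OF k0r[OF j]] H[OF k0F] by simp
        show "l \<cdot> \<gamma> j = l' \<cdot> \<gamma> j"
        proof (rule e_eqI[OF j])
          show "l \<cdot> \<gamma> j \<in> hom M (N j) n" "l' \<cdot> \<gamma> j \<in> hom M (N j) n" using lA \<gamma>A[OF j] by (simp_all add: hom_iff)
          show "l \<cdot> \<gamma> j \<cdot> H j = l' \<cdot> \<gamma> j \<cdot> H j" using l(3)[unfolded r0] lA \<gamma>A[OF j] H[OF j] by simp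
          fix c assume c: "c \<in> VOb C"
          have "l \<cdot> \<omega>' c \<cdot> lact (Wt c) (cmp (\<iota> j) c) = l' \<cdot> \<omega>' c \<cdot> lact (Wt c) (cmp (\<iota> j) c)"
            using l(4)[OF c] by simp
          then have "l \<cdot> (\<gamma> j \<cdot> \<Omega> j c) = l' \<cdot> (\<gamma> j \<cdot> \<Omega> j c)"
            unfolding \<omega>'(2)[OF j c, symmetric] using lA w'(3-5) \<iota>m[OF j c] c by simp
          then show "l \<cdot> \<gamma> j \<cdot> \<Omega> j c = l' \<cdot> \<gamma> j \<cdot> \<Omega> j c" using lA \<gamma>A[OF j] \<Omega>d[OF j c] by simp
        qed
      qed }
  qed
  moreover have "\<gamma> k0 \<cdot> H k0 \<in> S" using S.S_comp[OF HS[OF k0F] \<gamma>S] \<gamma>A[OF k0F] H[OF k0F] by simp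
  ultimately show ?thesis by blast
qed

end

text \<open>Induction provides extensions of the given cocone to every stage: successors are pasted
  on, and limit stages are \<open>extend_to_colimit\<close> for the initial segment. One more
  application of it reaches the colimit.\<close>

lemma extendable_transfinite:
  assumes X: "transfinite_seq U DC r X" and pw: "\<And>j k. is_succ r j k \<Longrightarrow> pw (FAr X (j, k))"
    and steps: "\<And>j k. is_succ r j k \<Longrightarrow> extendable (FAr X (j, k))"
    and k0: "is_least r k0" and X0: "FOb X k0 \<in> Gd"
    and L: "is_colimit (ord_cat r (Field r)) DC X L \<iota>"
  shows "extendable (\<iota> k0)"
  unfolding extendable_def
proof (intro allI impI, elim conjE)
  note D = transfinite_seqD[OF X]
  note R = Well_orderD[OF D(1)]
  have k0F: "k0 \<in> Field r" by (rule least_in[OF k0])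
  have Lc: "is_cocone (ord_cat r (Field r)) DC X L \<iota>" using L by (simp add: is_colimit_def)
  then have "\<iota> k0 \<in> hom DC (FOb X k0) L" using k0F unfolding ord_cocone_iff by blast
  then have d0: "Dom DC (\<iota> k0) = FOb X k0" unfolding hom_iff by blast
  have lim: "is_colimit (ord_cat r (underS r k)) M (ev c X) (DOb (FOb X k) c) (\<lambda>j. cmp (FAr X (j, k)) c)"
    if "is_limit r k" "c \<in> VOb C" for k c
  proof -
    have kF: "k \<in> Field r" using that(1) by (simp add: is_limit_def)
    show ?thesis by (rule limits_pointwise[OF X pw k0 X0 kF that(2,1)])
  qed
  fix m \<omega> assume m: "m \<in> good_obs M S" and "wcocone (Dom DC (\<iota> k0)) m \<omega>"
  then have \<omega>: "wcocone (FOb X k0) m \<omega>" unfolding d0 by simp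
  have ext: "\<exists>m' h \<omega>'. wext (FAr X (k0, k)) m \<omega> m' h \<omega>' \<and> h \<in> S" if "k \<in> Field r" for k
    using D(1) that
  proof (induction k rule: Well_order_induct)
    case (step k)
    from step.hyps(1) show ?case
    proof (cases rule: Well_order_cases)
      case least
      then have "k = k0" using least_unique[OF D(1) k0] by simp
      moreover have "Idn M m \<in> S" using m by (simp add: good_obs_def)
      ultimately show ?thesis using wext_Idn[OF \<omega>] seq_Idn[OF X k0F] by auto
    next
      case (succ j)
      note jk = is_succD(1)[OF succ] and j = is_succD(3)[OF succ]
      have ju: "j \<in> underS r k" using succ by (simp add: is_succ_def)
      obtain m1 h1 \<omega>1 where e1: "wext (FAr X (k0, j)) m \<omega> m1 h1 \<omega>1" "h1 \<in> S" using step.IH[OF ju] by blast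
      note k0j = least_le[OF D(1) k0 j]
      have dc: "Cod DC (FAr X (k0, j)) = FOb X j" "Dom DC (FAr X (j, k)) = FOb X j"
        using seq_hom[OF X k0j] seq_hom[OF X jk] unfolding hom_iff by blast+
      have m1: "m1 \<in> good_obs M S" using S.S_good(2)[OF e1(2)] wextD(6)[OF e1(1)] by simp
      have w1: "wcocone (Dom DC (FAr X (j, k))) m1 \<omega>1" using wextD(3)[OF e1(1)] dc by simp
      obtain m2 h2 \<omega>2 where e2: "wext (FAr X (j, k)) m1 \<omega>1 m2 h2 \<omega>2" "h2 \<in> S"
        by (rule extendableD[OF steps[OF succ] m1 w1])
      have "wext (FAr X (j, k) \<cdot>\<^bsub>DC\<^esub> FAr X (k0, j)) m \<omega> m2 (h2 \<cdot> h1) \<omega>2"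
        by (rule wext_comp[OF e1(1) e2(1)]) (simp add: dc)
      moreover have "h2 \<cdot> h1 \<in> S"
        using S.S_comp[OF e1(2) e2(2)] wextD(4-6)[OF e1(1)] wextD(4-6)[OF e2(1)] by simp
      ultimately show ?thesis unfolding seq_comp[OF X k0j jk] by blast
    next
      case limit
      have ne: "underS r k \<noteq> {}" using limit by (auto simp: is_limit_def)
      let ?r = "init_seg r k"
      have Fr: "Field ?r = underS r k" by (rule Field_init_seg[OF D(1) step.hyps(1)])
      have oc: "ord_cat ?r K = ord_cat r K" if "K \<subseteq> underS r k" for K
        by (rule ord_cat_init_seg[OF D(1) step.hyps(1) that])
      show ?thesis
      proof (rule extend_to_colimit[of ?r X k0 "FOb X k" "\<lambda>j. FAr X (j, k)"])
        show "transfinite_seq U DC ?r X" by (rule transfinite_seq_init_seg[OF X step.hyps(1) ne])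
        show "is_least ?r k0" using k0 is_least_init_seg[OF D(1) step.hyps(1) ne] by simp
        show "is_colimit (ord_cat ?r (underS ?r l)) M (ev c X) (DOb (FOb X l) c) (\<lambda>j. cmp (FAr X (j, l)) c)"
          if "is_limit ?r l" "c \<in> VOb C" for l c
        proof -
          have l: "l \<in> underS r k" "is_limit r l" using that(1) is_limit_init_seg[OF D(1) step.hyps(1)] by auto
          have "underS r l \<subseteq> underS r k" using under_trans[OF D(1) _ l(1)] by (auto simp: underS_iff)
          then show ?thesis
            unfolding underS_init_seg[OF D(1) step.hyps(1) l(1)] using oc lim[OF l(2) that(2)] by simp
        qed
        show "extendable (FAr X (i, j))" if "is_succ ?r i j" for i j
          using that is_succ_init_seg[OF D(1) step.hyps(1)] steps by simp
        show "is_cocone (ord_cat ?r (Field ?r)) DC X (FOb X k) (\<lambda>j. FAr X (j, k))"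
          unfolding Fr oc[OF subset_refl] using D(5)[OF limit] by (simp add: is_colimit_def)
        show "is_colimit (ord_cat ?r (Field ?r)) M (ev c X) (DOb (FOb X k) c) (\<lambda>j. cmp (FAr X (j, k)) c)"
          if "c \<in> VOb C" for c unfolding Fr oc[OF subset_refl] by (rule lim[OF limit that])
        show "\<exists>m' h \<omega>'. wext (FAr X (k0, j)) m \<omega> m' h \<omega>' \<and> h \<in> S" if "j \<in> Field ?r" for j
          using step.IH that unfolding Fr by blast
      qed (rule m \<omega>)+
    qed
  qed
  show "\<exists>m' h \<omega>'. wext (\<iota> k0) m \<omega> m' h \<omega>' \<and> h \<in> S"
    by (rule extend_to_colimit[OF X k0 lim steps Lc pw_colimit(1)[OF X pw k0 X0 L] m \<omega> ext])
qed

lemma cells_extendable: "f \<in> cells \<Longrightarrow> extendable f"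
  by (rule conjunct2, rule cell_induct)
    (auto intro: extendable_free_map extendable_cobase extendable_transfinite)

end

section \<open>From universal cocones to coends and back; existence of the functor\<close>

section \<open>The weighted colimit functor\<close>

text \<open>Left closed classes speak of index sets in the universe type only, whereas the coend has
  coproducts over objects of \<open>C\<close> and pairs of them. Reindexing along an injection
  bridges this.\<close>

lemma (in left_closed) small_coproduct:
  fixes I :: "'i set"
  assumes I: "small U I" and X: "\<And>i. i \<in> I \<Longrightarrow> X i \<in> good_obs A S"
  shows "\<exists>Y \<iota>. is_coproduct A I X Y \<iota>"
proof -
  obtain f :: "'i \<Rightarrow> 's" where f: "inj_on f I" using small_inj[OF I] by blast
  define g where "g = inv_into I f"
  have g: "g (f i) = i" if "i \<in> I" for i using f that by (simp add: g_def)
  obtain Y \<iota> where Y: "is_coproduct A (f ` I) (\<lambda>j. X (g j)) Y \<iota>"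
    using coproduct_exists[OF small_image[OF I], of f "\<lambda>j. X (g j)"] X g by auto
  have YO: "Y \<in> Ob A" and \<iota>h: "\<And>i. i \<in> I \<Longrightarrow> \<iota> (f i) \<in> hom A (X i) Y"
    using Y g by (auto simp: is_coproduct_def)
  have "is_coproduct A I X Y (\<lambda>i. \<iota> (f i))"
  proof (rule is_coproductI)
    fix n \<tau> assume n: "n \<in> Ob A" and t: "\<forall>i\<in>I. \<tau> i \<in> hom A (X i) n"
    obtain h where "h \<in> hom A Y n" "\<And>j. j \<in> f ` I \<Longrightarrow> h \<cdot> \<iota> j = \<tau> (g j)"
      by (rule coproduct_map[OF Y n, of "\<lambda>j. \<tau> (g j)"]) (use t g in auto)
    then show "\<exists>h. h \<in> hom A Y n \<and> (\<forall>i\<in>I. h \<cdot> \<iota> (f i) = \<tau> i)" using g by auto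
  next
    fix n h h' assume h: "h \<in> hom A Y n" "h' \<in> hom A Y n" "\<forall>i\<in>I. h \<cdot> \<iota> (f i) = h' \<cdot> \<iota> (f i)"
    show "h = h'" by (rule coproduct_eqI[OF Y h(1,2)]) (use h(3) in auto)
  qed (use YO \<iota>h in auto)
  then show ?thesis by blast
qed

context category
begin

lemma coequalizerD:
  assumes "is_coequalizer A s t q"
  shows "s \<in> Ar A" "t \<in> Ar A" "Dom A t = Dom A s" "Cod A t = Cod A s" "q \<in> Ar A" "Dom A q = Cod A s"
    "q \<cdot> s = q \<cdot> t"
  using assms by (auto simp: is_coequalizer_def hom_iff)

lemma coequalizer_ex1:
  assumes "is_coequalizer A s t q" "q' \<in> hom A (Cod A s) n" "q' \<cdot> s = q' \<cdot> t"
  shows "\<exists>!h. h \<in> hom A (Cod A q) n \<and> h \<cdot> q = q'"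
proof -
  have "q' \<in> Ar A" "Dom A q' = Cod A s" "Cod A q' = n" using assms(2) by (auto simp: hom_iff)
  with assms(1,3) show ?thesis unfolding is_coequalizer_def by blast
qed

end

context weighted
begin

text \<open>The universal property of the coend, freed from its presentation as a coequalizer of
  coproducts that might not exist.\<close>

definition wuniv where
  "wuniv X L \<omega> \<longleftrightarrow> wcocone X L \<omega>
     \<and> (\<forall>n \<sigma>. wcocone X n \<sigma> \<longrightarrow> (\<exists>h. h \<in> hom M L n \<and> (\<forall>c\<in>VOb C. h \<cdot> \<omega> c = \<sigma> c)))
     \<and> (\<forall>n h h'. h \<in> hom M L n \<and> h' \<in> hom M L n \<and> (\<forall>c\<in>VOb C. h \<cdot> \<omega> c = h' \<cdot> \<omega> c) \<longrightarrow> h = h')"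

lemma wunivD:
  assumes "wuniv X L \<omega>"
  shows "wcocone X L \<omega>" "wcocone X n \<sigma> \<Longrightarrow> \<exists>h. h \<in> hom M L n \<and> (\<forall>c\<in>VOb C. h \<cdot> \<omega> c = \<sigma> c)"
    "\<lbrakk>h \<in> hom M L n; h' \<in> hom M L n; \<And>c. c \<in> VOb C \<Longrightarrow> h \<cdot> \<omega> c = h' \<cdot> \<omega> c\<rbrakk> \<Longrightarrow> h = h'"
proof -
  note w = assms[unfolded wuniv_def]
  show "wcocone X L \<omega>" using w by blast
  show "wcocone X n \<sigma> \<Longrightarrow> \<exists>h. h \<in> hom M L n \<and> (\<forall>c\<in>VOb C. h \<cdot> \<omega> c = \<sigma> c)"
    by (rule w[THEN conjunct2, THEN conjunct1, THEN spec, THEN spec, THEN mp])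
  show "\<lbrakk>h \<in> hom M L n; h' \<in> hom M L n; \<And>c. c \<in> VOb C \<Longrightarrow> h \<cdot> \<omega> c = h' \<cdot> \<omega> c\<rbrakk> \<Longrightarrow> h = h'"
    by (rule w[THEN conjunct2, THEN conjunct2, THEN spec[of _ n], THEN spec[of _ h], THEN spec[of _ h'], THEN mp]) auto
qed

lemma wuniv_iso:
  assumes "wuniv X L \<omega>" "wuniv X L' \<omega>'"
  obtains u where "is_iso M u" "u \<in> hom M L L'" "\<And>c. c \<in> VOb C \<Longrightarrow> u \<cdot> \<omega> c = \<omega>' c"
proof -
  obtain u where u: "u \<in> hom M L L'" "\<And>c. c \<in> VOb C \<Longrightarrow> u \<cdot> \<omega> c = \<omega>' c"
    using wunivD(2)[OF assms(1) wunivD(1)[OF assms(2)]] by blast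
  obtain v where v: "v \<in> hom M L' L" "\<And>c. c \<in> VOb C \<Longrightarrow> v \<cdot> \<omega>' c = \<omega> c"
    using wunivD(2)[OF assms(2) wunivD(1)[OF assms(1)]] by blast
  note a = wcoconeD[OF wunivD(1)[OF assms(1)]] and b = wcoconeD[OF wunivD(1)[OF assms(2)]]
  have uv: "u \<in> Ar M" "Dom M u = L" "Cod M u = L'" "v \<in> Ar M" "Dom M v = L'" "Cod M v = L"
    using u(1) v(1) by (auto simp: hom_iff)
  have "v \<cdot> u = Idn M L"
    by (rule wunivD(3)[OF assms(1)]) (use uv u v a(2-5) in \<open>simp_all add: hom_iff\<close>)
  moreover have "u \<cdot> v = Idn M L'"
    by (rule wunivD(3)[OF assms(2)]) (use uv u v b(2-5) in \<open>simp_all add: hom_iff\<close>)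
  ultimately have "is_iso M u" using uv by (intro M.is_isoI[of u v]) simp_all
  then show thesis using that u by blast
qed

text \<open>If the cocone on \<open>X\<close> is universal, its base is
  \<open>W \<otimes>\<^sub>C X\<close>. An extension along \<open>f\<close> is then a pushout of
  \<open>W \<otimes>\<^sub>C f\<close> along an identity, whose corner is
  \<open>W \<otimes>\<^sub>C Y\<close>.\<close>

lemma wext_wuniv:
  assumes X: "wuniv X L \<omega>" and e: "wext f L \<omega> L' h \<omega>'" and f: "f \<in> hom DC X Y"
  shows "wuniv Y L' \<omega>'"
  unfolding wuniv_def
proof (intro conjI allI impI; (elim conjE)?)
  have fA: "Dom DC f = X" "Cod DC f = Y" using f by (auto simp: hom_iff)
  note E = wextD[OF e, unfolded fA]
  note a = wcoconeD[OF E(2)] and b = wcoconeD[OF E(3)]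
  note fm = dmapD[OF E(1), unfolded fA]
  show "wcocone Y L' \<omega>'" by (rule E)
  fix n
  { fix \<sigma> assume s: "wcocone Y n \<sigma>"
    obtain k where k: "k \<in> hom M L n" "\<And>c. c \<in> VOb C \<Longrightarrow> k \<cdot> \<omega> c = \<sigma> c \<cdot> lact (Wt c) (cmp f c)"
      using wunivD(2)[OF X wcocone_pull[OF s f]] by blast
    have s': "wcocone (Cod DC f) n \<sigma>" using s fA by simp
    obtain l where "l \<in> hom M L' n" "l \<cdot> h = k" "\<And>c. c \<in> VOb C \<Longrightarrow> l \<cdot> \<omega>' c = \<sigma> c"
      by (rule wext_map[OF e k(1) s' k(2)[symmetric]]) auto
    then show "\<exists>l. l \<in> hom M L' n \<and> (\<forall>c\<in>VOb C. l \<cdot> \<omega>' c = \<sigma> c)" by blast }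
  { fix l l' assume l: "l \<in> hom M L' n" "l' \<in> hom M L' n" "\<forall>c\<in>VOb C. l \<cdot> \<omega>' c = l' \<cdot> \<omega>' c"
    have lA: "l \<in> Ar M" "Dom M l = L'" "Cod M l = n" "l' \<in> Ar M" "Dom M l' = L'" "Cod M l' = n"
      using l by (auto simp: hom_iff)
    have "l \<cdot> h = l' \<cdot> h"
    proof (rule wunivD(3)[OF X])
      show "l \<cdot> h \<in> hom M L n" "l' \<cdot> h \<in> hom M L n" using lA E(4-6) by (simp_all add: hom_iff)
      fix c assume c: "c \<in> VOb C"
      have "l \<cdot> \<omega>' c \<cdot> lact (Wt c) (cmp f c) = l' \<cdot> \<omega>' c \<cdot> lact (Wt c) (cmp f c)"
        using l(3) c by simp
      then have "l \<cdot> (h \<cdot> \<omega> c) = l' \<cdot> (h \<cdot> \<omega> c)"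
        unfolding E(7)[OF c, symmetric] using lA b(3-5) fm(3-5) c by simp
      then show "l \<cdot> h \<cdot> \<omega> c = l' \<cdot> h \<cdot> \<omega> c" using lA E(4-6) a(3-5) c by simp
    qed
    then show "l = l'" by (rule wext_eqI[OF e l(1,2)]) (use l(3) in auto) }
qed

lemma coend_maps:
  assumes "is_diagram V C M T X" "x \<in> VOb C" "y \<in> VOb C"
  shows "coend_left M T W X (x, y) \<in> hom M (coend_source C V T W X (x, y)) (coend_target T W X x)"
    "coend_right V C M T W X (x, y) \<in> hom M (coend_source C V T W X (x, y)) (coend_target T W X y)"
  using assms diagramD[OF assms(1)]
  by (simp_all add: coend_left_def coend_right_def coend_source_def coend_target_def hom_iff)

text \<open>The coend has \<open>C(x, y) \<otimes> W y\<close> in its source, the cocone law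
  \<open>W y \<otimes> C(x, y)\<close>. The two conditions become each other by composition with the
  symmetry, which is invertible.\<close>

lemma wcocone_iff:
  assumes X: "is_diagram V C M T X"
  shows "wcocone X m \<omega> \<longleftrightarrow> m \<in> Ob M \<and> (\<forall>c\<in>VOb C. \<omega> c \<in> hom M (coend_target T W X c) m)
     \<and> (\<forall>x\<in>VOb C. \<forall>y\<in>VOb C. \<omega> x \<cdot> coend_left M T W X (x, y) = \<omega> y \<cdot> coend_right V C M T W X (x, y))"
proof -
  note XD = diagramD[OF X]
  have "\<omega> x \<cdot> AAr T (ract y x) (Idn M (DOb X x))
      = \<omega> y \<cdot> (lact (Wt y) (DAct X x y) \<cdot> AAssoc T (Wt y) (VHom C x y) (DOb X x))
    \<longleftrightarrow> \<omega> x \<cdot> coend_left M T W X (x, y) = \<omega> y \<cdot> coend_right V C M T W X (x, y)"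
    if xy: "x \<in> VOb C" "y \<in> VOb C" and w: "\<omega> x \<in> hom M (coend_target T W X x) m" "\<omega> y \<in> hom M (coend_target T W X y) m" for x y
  proof -
    have wA: "\<omega> x \<in> Ar M" "Dom M (\<omega> x) = AOb T (Wt x) (DOb X x)" "\<omega> y \<in> Ar M" "Dom M (\<omega> y) = AOb T (Wt y) (DOb X y)"
      using w by (auto simp: hom_iff coend_target_def)
    let ?s = "AAr T (Symm V (VHom C x y) (Wt y)) (Idn M (DOb X x))"
    let ?s' = "AAr T (Symm V (Wt y) (VHom C x y)) (Idn M (DOb X x))"
    have 1: "AAr T (ract y x) (Idn M (DOb X x)) = coend_left M T W X (x, y) \<cdot> ?s'"
      using xy XD(1) by (simp add: coend_left_def ract_def)
    have 2: "lact (Wt y) (DAct X x y) \<cdot> AAssoc T (Wt y) (VHom C x y) (DOb X x) = coend_right V C M T W X (x, y) \<cdot> ?s'"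
      using xy XD(1-4) by (simp add: coend_right_def)
    have 3: "is_iso M ?s'"
      by (rule M.is_isoI[of _ ?s]) (use xy XD(1) in simp_all)
    have c: "coend_left M T W X (x, y) \<in> Ar M" "Cod M (coend_left M T W X (x, y)) = Dom M (\<omega> x)"
      "coend_right V C M T W X (x, y) \<in> Ar M" "Cod M (coend_right V C M T W X (x, y)) = Dom M (\<omega> y)"
      "Dom M (coend_left M T W X (x, y)) = Cod M ?s'" "Dom M (coend_right V C M T W X (x, y)) = Cod M ?s'"
      using coend_maps[OF X xy] wA xy XD(1) by (simp_all add: hom_iff coend_target_def coend_source_def)
    show ?thesis
      unfolding 1 2
    proof
      assume "\<omega> x \<cdot> (coend_left M T W X (x, y) \<cdot> ?s') = \<omega> y \<cdot> (coend_right V C M T W X (x, y) \<cdot> ?s')"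
      then have "\<omega> x \<cdot> coend_left M T W X (x, y) \<cdot> ?s' = \<omega> y \<cdot> coend_right V C M T W X (x, y) \<cdot> ?s'"
        using c wA M.is_isoD(1)[OF 3] by simp
      then show "\<omega> x \<cdot> coend_left M T W X (x, y) = \<omega> y \<cdot> coend_right V C M T W X (x, y)"
        by (rule M.iso_epi[OF 3]) (use c wA in simp_all)
    next
      assume "\<omega> x \<cdot> coend_left M T W X (x, y) = \<omega> y \<cdot> coend_right V C M T W X (x, y)"
      then have "\<omega> x \<cdot> coend_left M T W X (x, y) \<cdot> ?s' = \<omega> y \<cdot> coend_right V C M T W X (x, y) \<cdot> ?s'" by simp
      then show "\<omega> x \<cdot> (coend_left M T W X (x, y) \<cdot> ?s') = \<omega> y \<cdot> (coend_right V C M T W X (x, y) \<cdot> ?s')"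
        using c wA M.is_isoD(1)[OF 3] by simp
    qed
  qed
  then show ?thesis
    unfolding wcocone_def using X by (auto simp: coend_target_def)
qed

lemma weighted_colimit_wuniv:
  assumes X: "is_diagram V C M T X" and w: "is_weighted_colimit V C M T W X L \<omega>"
  shows "wuniv X L \<omega>"
proof -
  obtain P \<pi> Q \<kappa> s t q where P: "is_coproduct M (VOb C \<times> VOb C) (coend_source C V T W X) P \<pi>"
    and Q: "is_coproduct M (VOb C) (coend_target T W X) Q \<kappa>"
    and s: "s \<in> hom M P Q" and t: "t \<in> hom M P Q"
    and s': "\<And>x y. \<lbrakk>x \<in> VOb C; y \<in> VOb C\<rbrakk> \<Longrightarrow> s \<cdot> \<pi> (x, y) = \<kappa> x \<cdot> coend_left M T W X (x, y)"
    and t': "\<And>x y. \<lbrakk>x \<in> VOb C; y \<in> VOb C\<rbrakk> \<Longrightarrow> t \<cdot> \<pi> (x, y) = \<kappa> y \<cdot> coend_right V C M T W X (x, y)"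
    and q: "is_coequalizer M s t q" "Cod M q = L" and \<omega>: "\<And>c. c \<in> VOb C \<Longrightarrow> \<omega> c = q \<cdot> \<kappa> c"
    using w unfolding is_weighted_colimit_def by blast
  note qD = M.coequalizerD[OF q(1)]
  have sA: "Dom M s = P" "Cod M s = Q" using s by (auto simp: hom_iff)
  have \<kappa>A: "\<kappa> c \<in> Ar M" "Dom M (\<kappa> c) = coend_target T W X c" "Cod M (\<kappa> c) = Q" if "c \<in> VOb C" for c
    using Q that by (auto simp: is_coproduct_def hom_iff)
  have \<pi>A: "\<pi> (x, y) \<in> Ar M" "Dom M (\<pi> (x, y)) = coend_source C V T W X (x, y)" "Cod M (\<pi> (x, y)) = P"
    if "x \<in> VOb C" "y \<in> VOb C" for x y
    using P that by (auto simp: is_coproduct_def hom_iff)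
  have cA: "coend_left M T W X (x, y) \<in> Ar M" "Cod M (coend_left M T W X (x, y)) = coend_target T W X x"
      "coend_right V C M T W X (x, y) \<in> Ar M" "Cod M (coend_right V C M T W X (x, y)) = coend_target T W X y"
      if "x \<in> VOb C" "y \<in> VOb C" for x y using coend_maps[OF X that] by (simp_all add: hom_iff)
  have pre: "f \<cdot> s \<cdot> \<pi> (x, y) = f \<cdot> \<kappa> x \<cdot> coend_left M T W X (x, y)"
    "f \<cdot> t \<cdot> \<pi> (x, y) = f \<cdot> \<kappa> y \<cdot> coend_right V C M T W X (x, y)"
    if "f \<in> hom M Q n" "x \<in> VOb C" "y \<in> VOb C" for f n x y
    using that s'[OF that(2,3)] t'[OF that(2,3)] qD sA \<kappa>A[OF that(2)] \<kappa>A[OF that(3)] \<pi>A[OF that(2,3)] cA[OF that(2,3)]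
    by (simp_all add: hom_iff)
  have qh: "q \<in> hom M Q L" using qD sA q(2) by (simp add: hom_iff)
  have LO: "L \<in> Ob M" using qD(5) q(2) by force
  have "wcocone X L \<omega>"
    unfolding wcocone_iff[OF X]
  proof (intro conjI ballI)
    show "\<omega> c \<in> hom M (coend_target T W X c) L" if "c \<in> VOb C" for c
      using \<omega>[OF that] \<kappa>A[OF that] qh by (simp add: hom_iff)
    show "\<omega> x \<cdot> coend_left M T W X (x, y) = \<omega> y \<cdot> coend_right V C M T W X (x, y)"
      if xy: "x \<in> VOb C" "y \<in> VOb C" for x y
      using pre[OF qh xy] qD(7) \<omega>[OF xy(1)] \<omega>[OF xy(2)] by simp
  qed (rule LO)
  moreover have "\<exists>h. h \<in> hom M L n \<and> (\<forall>c\<in>VOb C. h \<cdot> \<omega> c = \<sigma> c)" if sg: "wcocone X n \<sigma>" for n \<sigma>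
  proof -
    note S = sg[unfolded wcocone_iff[OF X]]
    obtain f where f: "f \<in> hom M Q n" "\<And>c. c \<in> VOb C \<Longrightarrow> f \<cdot> \<kappa> c = \<sigma> c"
      by (rule M.coproduct_map[OF Q, of n \<sigma>]) (use S in auto)
    have "f \<cdot> s = f \<cdot> t"
    proof (rule M.coproduct_eqI[OF P])
      show "f \<cdot> s \<in> hom M P n" "f \<cdot> t \<in> hom M P n" using f(1) s t by (auto simp: hom_iff)
      fix i assume "i \<in> VOb C \<times> VOb C"
      then obtain x y where i: "i = (x, y)" "x \<in> VOb C" "y \<in> VOb C" by blast
      show "f \<cdot> s \<cdot> \<pi> i = f \<cdot> t \<cdot> \<pi> i"
        unfolding i(1) pre[OF f(1) i(2,3)] f(2)[OF i(2)] f(2)[OF i(3)] using S i by blast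
    qed
    then obtain h where h: "h \<in> hom M L n" "h \<cdot> q = f"
      using ex1_implies_ex[OF M.coequalizer_ex1[OF q(1), of f n]] f(1) sA q(2) by auto
    have "h \<cdot> \<omega> c = \<sigma> c" if c: "c \<in> VOb C" for c
      unfolding \<omega>[OF c] f(2)[OF c, symmetric] using M.comp_cong_left[OF h(2), of "\<kappa> c"] h(1) \<kappa>A[OF c] qh
      by (simp add: hom_iff)
    with h(1) show ?thesis by blast
  qed
  moreover have "h = h'" if h: "h \<in> hom M L n" "h' \<in> hom M L n" "\<forall>c\<in>VOb C. h \<cdot> \<omega> c = h' \<cdot> \<omega> c" for n h h'
  proof -
    have hA: "h \<in> Ar M" "Dom M h = L" "Cod M h = n" "h' \<in> Ar M" "Dom M h' = L" "Cod M h' = n"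
      using h by (auto simp: hom_iff)
    have hq: "h \<cdot> q = h' \<cdot> q"
    proof (rule M.coproduct_eqI[OF Q])
      show "h \<cdot> q \<in> hom M Q n" "h' \<cdot> q \<in> hom M Q n" using hA qh by (auto simp: hom_iff)
      show "h \<cdot> q \<cdot> \<kappa> c = h' \<cdot> q \<cdot> \<kappa> c" if c: "c \<in> VOb C" for c
      proof -
        have "h \<cdot> (q \<cdot> \<kappa> c) = h' \<cdot> (q \<cdot> \<kappa> c)" using h(3) c unfolding \<omega>[OF c, symmetric] by blast
        then show ?thesis using hA qh \<kappa>A[OF c] by (simp add: hom_iff)
      qed
    qed
    have 1: "h \<cdot> q \<in> hom M (Cod M s) n" using hA qh sA by (simp add: hom_iff)
    have 2: "h \<cdot> q \<cdot> s = h \<cdot> q \<cdot> t" using hA qh qD s t by (simp add: hom_iff)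
    show "h = h'"
      by (rule ex1_eqI[OF M.coequalizer_ex1[OF q(1) 1 2]]) (use h q(2) hq in simp_all)
  qed
  ultimately show ?thesis unfolding wuniv_def by blast
qed

text \<open>A choice of coends determines the rest: a map of diagrams goes to the map induced by the
  pulled back cocone, and functoriality is the uniqueness in the universal property.\<close>

lemma weighted_colimit_functor_exists: "\<exists>F \<omega>. is_weighted_colimit_functor V C M T W F \<omega>"
proof -
  let ?D = "wcolim_domain V C M T W"
  have Dd: "is_diagram V C M T X" if "X \<in> ?D" for X using that by (simp add: wcolim_domain_def)
  have "\<forall>X. \<exists>p. X \<in> ?D \<longrightarrow> is_weighted_colimit V C M T W X (fst p) (snd p)"
    by (auto simp: wcolim_domain_def)
  then obtain p where p: "\<And>X. X \<in> ?D \<Longrightarrow> is_weighted_colimit V C M T W X (fst (p X)) (snd (p X))" by metis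
  define L where "L X = fst (p X)" for X
  define \<omega> where "\<omega> X = snd (p X)" for X
  have w: "is_weighted_colimit V C M T W X (L X) (\<omega> X)" if "X \<in> ?D" for X using p[OF that] by (simp add: L_def \<omega>_def)
  have u: "wuniv X (L X) (\<omega> X)" if "X \<in> ?D" for X by (rule weighted_colimit_wuniv[OF Dd[OF that] w[OF that]])
  let ?P = "\<lambda>f h. h \<in> hom M (L (Dom DC f)) (L (Cod DC f)) \<and>
      (\<forall>c\<in>VOb C. h \<cdot> \<omega> (Dom DC f) c = \<omega> (Cod DC f) c \<cdot> lact (Wt c) (cmp f c))"
  have "\<exists>h. ?P f h" if f: "f \<in> Ar DC" "Dom DC f \<in> ?D" "Cod DC f \<in> ?D" for f
  proof -
    have "f \<in> hom DC (Dom DC f) (Cod DC f)" unfolding hom_iff using f(1) by blast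
    from wunivD(2)[OF u[OF f(2)] wcocone_pull[OF wunivD(1)[OF u[OF f(3)]] this]] show ?thesis .
  qed
  then obtain h where h: "\<And>f. \<lbrakk>f \<in> Ar DC; Dom DC f \<in> ?D; Cod DC f \<in> ?D\<rbrakk> \<Longrightarrow> ?P f (h f)" by metis
  define F where "F = \<lparr>FOb = L, FAr = h\<rparr>"
  let ?C = "full_subcat DC ?D"
  have LO: "L X \<in> Ob M" if "X \<in> ?D" for X using wcoconeD(2)[OF wunivD(1)[OF u[OF that]]] .
  have C: "f \<in> Ar ?C \<longleftrightarrow> f \<in> Ar DC \<and> Dom DC f \<in> ?D \<and> Cod DC f \<in> ?D" "Dom ?C = Dom DC" "Cod ?C = Cod DC"
    "Idn ?C = Idn DC" "Comp ?C = Comp DC" "Ob ?C = ?D" for f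
    by (auto simp: full_subcat_def)
  have XO: "X \<in> Ob DC" if "X \<in> ?D" for X using Dd[OF that] by simp
  have catC: "category ?C"
  proof
    show "Dom ?C f \<in> Ob ?C" "Cod ?C f \<in> Ob ?C" if "f \<in> Ar ?C" for f using that C by auto
    show "Idn ?C X \<in> hom ?C X X" if "X \<in> Ob ?C" for X
      using that DC.Idn_Ar[OF XO] DC.Dom_Idn[OF XO] DC.Cod_Idn[OF XO] unfolding hom_iff C by simp
    show "Comp ?C g f \<in> hom ?C X Z" if "f \<in> hom ?C X Y" "g \<in> hom ?C Y Z" for f g X Y Z
      using that DC.Comp_in[of f X Y g Z] unfolding hom_iff C by auto
    show "Comp ?C (Idn ?C Y) f = f" "Comp ?C f (Idn ?C X) = f" if "f \<in> hom ?C X Y" for f X Y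
      using that DC.Comp_Idn_left[of f X Y] DC.Comp_Idn_right[of f X Y] unfolding hom_iff C by auto
    show "Comp ?C (Comp ?C k g) f = Comp ?C k (Comp ?C g f)"
      if "f \<in> hom ?C A X" "g \<in> hom ?C X Y" "k \<in> hom ?C Y Z" for f g k A X Y Z
      using that DC.Comp_assoc[of f A X g Y k Z] unfolding hom_iff C by auto
  qed
  have hA: "h f \<in> hom M (L (Dom DC f)) (L (Cod DC f))"
    "c \<in> VOb C \<Longrightarrow> h f \<cdot> \<omega> (Dom DC f) c = \<omega> (Cod DC f) c \<cdot> lact (Wt c) (cmp f c)" if "f \<in> Ar ?C" for f c
    using h that C by auto
  have "is_functor ?C M F"
    unfolding is_functor_def
  proof (intro conjI ballI impI)
    show "category ?C" "category M" by (rule catC M.category_axioms)+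
    show "FOb F X \<in> Ob M" if "X \<in> Ob ?C" for X using LO that by (simp add: F_def C)
    show "FAr F f \<in> hom M (FOb F (Dom ?C f)) (FOb F (Cod ?C f))" if "f \<in> Ar ?C" for f
      using hA(1)[OF that] by (simp add: F_def C)
    show "FAr F (Idn ?C X) = Idn M (FOb F X)" if "X \<in> Ob ?C" for X
    proof -
      have X: "X \<in> ?D" using that by (simp add: C)
      note I = DC.Idn_Ar[OF XO[OF X]] DC.Dom_Idn[OF XO[OF X]] DC.Cod_Idn[OF XO[OF X]]
      have IC: "Idn DC X \<in> Ar ?C" using I X unfolding C by simp
      note hI = hA[OF IC, unfolded I(2,3)]
      have "h (Idn DC X) = Idn M (L X)"
      proof (rule wunivD(3)[OF u[OF X] hI(1)])
        show "Idn M (L X) \<in> hom M (L X) (L X)" using LO[OF X] by (simp add: hom_iff)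
        fix c assume c: "c \<in> VOb C"
        show "h (Idn DC X) \<cdot> \<omega> X c = Idn M (L X) \<cdot> \<omega> X c"
          using hI(2)[OF c] wcoconeD(3-5)[OF wunivD(1)[OF u[OF X]] c] diagramD(1)[OF Dd[OF X] c] c by simp
      qed
      then show ?thesis by (simp add: F_def C)
    qed
    show "FAr F (Comp ?C g f) = FAr F g \<cdot> FAr F f"
      if f: "f \<in> Ar ?C" and g: "g \<in> Ar ?C" and fg: "Cod ?C f = Dom ?C g" for f g
    proof -
      have gd: "Dom DC g = Cod DC f" using fg by (simp add: C)
      have fD: "f \<in> Ar DC" "Dom DC f \<in> ?D" "Cod DC f \<in> ?D" and gD: "g \<in> Ar DC" "Cod DC g \<in> ?D"
        using f g unfolding C by auto
      note K = DC.comp_Ar[OF fD(1) gD(1) gd] DC.Dom_comp[OF fD(1) gD(1) gd] DC.Cod_comp[OF fD(1) gD(1) gd]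
      have gf: "g \<cdot>\<^bsub>DC\<^esub> f \<in> Ar ?C" using K fD gD unfolding C by simp
      note hK = hA[OF gf, unfolded K(2,3)] and hf = hA[OF f] and hg = hA[OF g, unfolded gd]
      note fm = dmapD[OF fD(1)] and gm = dmapD[OF gD(1), unfolded gd]
      note wf = wcoconeD(3-5)[OF wunivD(1)[OF u[OF fD(2)]]] and wg = wcoconeD(3-5)[OF wunivD(1)[OF u[OF fD(3)]]]
        and wk = wcoconeD(3-5)[OF wunivD(1)[OF u[OF gD(2)]]]
      have hfA: "h f \<in> Ar M" "Dom M (h f) = L (Dom DC f)" "Cod M (h f) = L (Cod DC f)"
        and hgA: "h g \<in> Ar M" "Dom M (h g) = L (Cod DC f)" "Cod M (h g) = L (Cod DC g)"
        using hf(1) hg(1) by (auto simp: hom_iff)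
      have "h (g \<cdot>\<^bsub>DC\<^esub> f) = h g \<cdot> h f"
      proof (rule wunivD(3)[OF u[OF fD(2)] hK(1)])
        show "h g \<cdot> h f \<in> hom M (L (Dom DC f)) (L (Cod DC g))" using hfA hgA by (simp add: hom_iff)
        fix c assume c: "c \<in> VOb C"
        have "h g \<cdot> h f \<cdot> \<omega> (Dom DC f) c = h g \<cdot> \<omega> (Cod DC f) c \<cdot> lact (Wt c) (cmp f c)"
          using hf(2)[OF c] hfA hgA wf[OF c] wg[OF c] fm(3-5) c by simp
        also have "\<dots> = h (g \<cdot>\<^bsub>DC\<^esub> f) \<cdot> \<omega> (Dom DC f) c"
          unfolding hg(2)[OF c] hK(2)[OF c] using wk[OF c] fm(3-5) gm(3-5) c by simp
        finally show "h (g \<cdot>\<^bsub>DC\<^esub> f) \<cdot> \<omega> (Dom DC f) c = h g \<cdot> h f \<cdot> \<omega> (Dom DC f) c" ..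
      qed
      then show ?thesis by (simp add: F_def C)
    qed
  qed
  moreover have "h (X, Y, \<tau>) \<cdot> \<omega> X c = \<omega> Y c \<cdot> lact (Wt c) (\<tau> c)"
    if "X \<in> ?D" "Y \<in> ?D" "is_diagram_map V C M T (X, Y, \<tau>)" "c \<in> VOb C" for X Y \<tau> c
  proof -
    have d: "Dom DC (X, Y, \<tau>) = X" "Cod DC (X, Y, \<tau>) = Y" by (auto simp: diagram_cat_def)
    have "(X, Y, \<tau>) \<in> Ar ?C" using that(1-3) d unfolding C by simp
    from hA(2)[OF this that(4)] show ?thesis unfolding d by (simp add: cmp_def)
  qed
  ultimately have "is_weighted_colimit_functor V C M T W F \<omega>"
    unfolding is_weighted_colimit_functor_def using w by (auto simp: F_def)
  then show ?thesis by blast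
qed

end

context weighted_flat
begin

lemma good_tensor:
  assumes "c \<in> VOb C" "N \<in> good_obs M S"
  shows "AOb T (Wt c) N \<in> good_obs M S" "d \<in> VOb C \<Longrightarrow> AOb T (VHom C c d) N \<in> good_obs M S"
proof -
  have N: "N \<in> Ob M" "Idn M N \<in> S" using assms(2) by (auto simp: good_obs_def)
  show "AOb T (Wt c) N \<in> good_obs M S"
    using S.S_good(1)[OF flat_weight[OF assms(1) N(2)]] assms(1) N by simp
  show "AOb T (VHom C c d) N \<in> good_obs M S" if "d \<in> VOb C"
    using S.S_good(1)[OF flat_hom[OF assms(1) that N(2)]] assms(1) N that by simp
qed

text \<open>A universal cocone is a coend as soon as the coproducts in its presentation exist. They
  do for pointwise good diagrams, because flatness makes all summands good.\<close>

lemma wuniv_weighted_colimit: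
  assumes X: "X \<in> Gd" and u: "wuniv X L \<omega>"
  shows "is_weighted_colimit V C M T W X L \<omega>"
proof -
  have Xd: "is_diagram V C M T X" and g: "DOb X c \<in> good_obs M S" if "c \<in> VOb C" for c
    using X that by (auto simp: Gd_def)
  have Xd: "is_diagram V C M T X" using X by (simp add: Gd_def)
  note XD = diagramD[OF Xd]
  have tg: "coend_target T W X c \<in> good_obs M S" if "c \<in> VOb C" for c
    unfolding coend_target_def by (rule good_tensor[OF that g[OF that]])
  obtain Q \<kappa> where Q: "is_coproduct M (VOb C) (coend_target T W X) Q \<kappa>"
    using S.small_coproduct[OF small_C, of "coend_target T W X"] tg by blast
  have sg: "coend_source C V T W X i \<in> good_obs M S" if i: "i \<in> VOb C \<times> VOb C" for i
  proof -
    obtain x y where xy: "i = (x, y)" "x \<in> VOb C" "y \<in> VOb C" using i by blast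
    \<comment> \<open>Flatness concerns the hom-objects and the values of the weight separately. The
      isomorphism \<open>?e\<close> carries \<open>W y \<otimes> (C(x, y) \<otimes> X x)\<close>,
      which is good by two uses of it, to the summand in question.\<close>
    let ?e = "AAr T (Symm V (Wt y) (VHom C x y)) (Idn M (DOb X x)) \<cdot> IA (Wt y) (VHom C x y) (DOb X x)"
    have e: "is_iso M ?e"
      by (rule M.is_isoI[of _ "AAssoc T (Wt y) (VHom C x y) (DOb X x) \<cdot> AAr T (Symm V (VHom C x y) (Wt y)) (Idn M (DOb X x))"])
        (use xy XD(1) in simp_all)
    have "AOb T (Wt y) (AOb T (VHom C x y) (DOb X x)) \<in> good_obs M S"
      by (intro good_tensor g xy)
    then show ?thesis using S.iso_good[OF e] xy XD(1) by (simp add: coend_source_def)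
  qed
  obtain P \<pi> where P: "is_coproduct M (VOb C \<times> VOb C) (coend_source C V T W X) P \<pi>"
    using S.small_coproduct[OF small_Times[OF universe small_C small_C], of "coend_source C V T W X"] sg by blast
  have \<kappa>A: "\<kappa> c \<in> Ar M" "Dom M (\<kappa> c) = coend_target T W X c" "Cod M (\<kappa> c) = Q" if "c \<in> VOb C" for c
    using Q that by (auto simp: is_coproduct_def hom_iff)
  have \<pi>A: "\<pi> (x, y) \<in> Ar M" "Dom M (\<pi> (x, y)) = coend_source C V T W X (x, y)" "Cod M (\<pi> (x, y)) = P"
    if "x \<in> VOb C" "y \<in> VOb C" for x y
    using P that by (auto simp: is_coproduct_def hom_iff)
  have cA: "coend_left M T W X (x, y) \<in> Ar M" "Cod M (coend_left M T W X (x, y)) = coend_target T W X x"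
      "coend_right V C M T W X (x, y) \<in> Ar M" "Cod M (coend_right V C M T W X (x, y)) = coend_target T W X y"
      "Dom M (coend_left M T W X (x, y)) = coend_source C V T W X (x, y)"
      "Dom M (coend_right V C M T W X (x, y)) = coend_source C V T W X (x, y)"
      if "x \<in> VOb C" "y \<in> VOb C" for x y using coend_maps[OF Xd that] by (simp_all add: hom_iff)
  have QO: "Q \<in> Ob M" using Q by (simp add: is_coproduct_def)
  obtain s where s: "s \<in> hom M P Q" "\<And>i. i \<in> VOb C \<times> VOb C \<Longrightarrow> s \<cdot> \<pi> i = \<kappa> (fst i) \<cdot> coend_left M T W X i"
    by (rule M.coproduct_map[OF P QO, of "\<lambda>i. \<kappa> (fst i) \<cdot> coend_left M T W X i"])
      (use \<kappa>A cA in \<open>auto simp: hom_iff\<close>)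
  obtain t where t: "t \<in> hom M P Q" "\<And>i. i \<in> VOb C \<times> VOb C \<Longrightarrow> t \<cdot> \<pi> i = \<kappa> (snd i) \<cdot> coend_right V C M T W X i"
    by (rule M.coproduct_map[OF P QO, of "\<lambda>i. \<kappa> (snd i) \<cdot> coend_right V C M T W X i"])
      (use \<kappa>A cA in \<open>auto simp: hom_iff\<close>)
  have sA: "s \<in> Ar M" "Dom M s = P" "Cod M s = Q" "t \<in> Ar M" "Dom M t = P" "Cod M t = Q"
    using s t by (auto simp: hom_iff)
  have pre: "f \<cdot> s \<cdot> \<pi> (x, y) = f \<cdot> \<kappa> x \<cdot> coend_left M T W X (x, y)"
    "f \<cdot> t \<cdot> \<pi> (x, y) = f \<cdot> \<kappa> y \<cdot> coend_right V C M T W X (x, y)"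
    if "f \<in> hom M Q n" "x \<in> VOb C" "y \<in> VOb C" for f n x y
    using that s(2)[of "(x, y)"] t(2)[of "(x, y)"] sA \<kappa>A[OF that(2)] \<kappa>A[OF that(3)] \<pi>A[OF that(2,3)] cA[OF that(2,3)]
    by (simp_all add: hom_iff)
  have coc: "f \<cdot> s = f \<cdot> t \<longleftrightarrow> wcocone X n (\<lambda>c. f \<cdot> \<kappa> c)" if f: "f \<in> hom M Q n" for f n
  proof
    assume e: "f \<cdot> s = f \<cdot> t"
    have "n \<in> Ob M" using f by (force simp: hom_iff)
    moreover have "f \<cdot> \<kappa> c \<in> hom M (coend_target T W X c) n" if "c \<in> VOb C" for c
      using f \<kappa>A[OF that] by (simp add: hom_iff)
    moreover have "f \<cdot> \<kappa> x \<cdot> coend_left M T W X (x, y) = f \<cdot> \<kappa> y \<cdot> coend_right V C M T W X (x, y)"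
      if "x \<in> VOb C" "y \<in> VOb C" for x y
      using e pre[OF f that] by simp
    ultimately show "wcocone X n (\<lambda>c. f \<cdot> \<kappa> c)" unfolding wcocone_iff[OF Xd] by blast
  next
    assume w: "wcocone X n (\<lambda>c. f \<cdot> \<kappa> c)"
    show "f \<cdot> s = f \<cdot> t"
    proof (rule M.coproduct_eqI[OF P])
      show "f \<cdot> s \<in> hom M P n" "f \<cdot> t \<in> hom M P n" using f sA by (auto simp: hom_iff)
      fix i assume "i \<in> VOb C \<times> VOb C"
      then obtain x y where i: "i = (x, y)" "x \<in> VOb C" "y \<in> VOb C" by blast
      show "f \<cdot> s \<cdot> \<pi> i = f \<cdot> t \<cdot> \<pi> i"
        unfolding i(1) pre[OF f i(2,3)] using w[unfolded wcocone_iff[OF Xd]] i by blast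
    qed
  qed
  note w = wunivD(1)[OF u]
  note wD = wcoconeD[OF w]
  obtain q where q: "q \<in> hom M Q L" "\<And>c. c \<in> VOb C \<Longrightarrow> q \<cdot> \<kappa> c = \<omega> c"
    by (rule M.coproduct_map[OF Q wD(2), of \<omega>]) (use wD(3-5) in \<open>auto simp: hom_iff coend_target_def\<close>)
  have qA: "q \<in> Ar M" "Dom M q = Q" "Cod M q = L" using q(1) by (auto simp: hom_iff)
  have "wcocone X L (\<lambda>c. q \<cdot> \<kappa> c)" using w q(2) by (simp add: wcocone_def)
  then have qst: "q \<cdot> s = q \<cdot> t" using coc[OF q(1)] by simp
  have "is_coequalizer M s t q"
    unfolding is_coequalizer_def
  proof (intro conjI ballI impI; (elim conjE)?)
    fix q' assume q': "q' \<in> Ar M" "Dom M q' = Cod M s" "q' \<cdot> s = q' \<cdot> t"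
    then have q'h: "q' \<in> hom M Q (Cod M q')" using sA by (simp add: hom_iff)
    then have "wcocone X (Cod M q') (\<lambda>c. q' \<cdot> \<kappa> c)" using coc q'(3) by blast
    then obtain h where h: "h \<in> hom M L (Cod M q')" "\<And>c. c \<in> VOb C \<Longrightarrow> h \<cdot> \<omega> c = q' \<cdot> \<kappa> c"
      using wunivD(2)[OF u] by blast
    have hq: "k \<cdot> q = q' \<longleftrightarrow> (\<forall>c\<in>VOb C. k \<cdot> \<omega> c = q' \<cdot> \<kappa> c)" if k: "k \<in> hom M L (Cod M q')" for k
    proof
      assume "k \<cdot> q = q'"
      then show "\<forall>c\<in>VOb C. k \<cdot> \<omega> c = q' \<cdot> \<kappa> c"
        using q(2) k qA \<kappa>A M.comp_cong_left[of k q q'] by (auto simp: hom_iff)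
    next
      assume a: "\<forall>c\<in>VOb C. k \<cdot> \<omega> c = q' \<cdot> \<kappa> c"
      show "k \<cdot> q = q'"
      proof (rule M.coproduct_eqI[OF Q])
        show "k \<cdot> q \<in> hom M Q (Cod M q')" "q' \<in> hom M Q (Cod M q')" using k qA q'h by (auto simp: hom_iff)
        show "k \<cdot> q \<cdot> \<kappa> c = q' \<cdot> \<kappa> c" if c: "c \<in> VOb C" for c
          using a c q(2)[OF c] k qA \<kappa>A[OF c] by (simp add: hom_iff)
      qed
    qed
    show "\<exists>!h. h \<in> hom M (Cod M q) (Cod M q') \<and> h \<cdot> q = q'"
    proof (intro ex1I[of _ h])
      show "h \<in> hom M (Cod M q) (Cod M q') \<and> h \<cdot> q = q'" using h hq[OF h(1)] qA by simp
      fix k assume k: "k \<in> hom M (Cod M q) (Cod M q') \<and> k \<cdot> q = q'"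
      then have kh: "k \<in> hom M L (Cod M q')" using qA by simp
      show "k = h"
        by (rule wunivD(3)[OF u kh h(1)]) (use hq[OF kh] k h(2) in auto)
    qed
  qed (use sA qA qst in \<open>simp_all add: hom_iff\<close>)
  then show ?thesis
    unfolding is_weighted_colimit_def
    by (intro exI[of _ P] exI[of _ \<pi>] exI[of _ Q] exI[of _ \<kappa>] exI[of _ s] exI[of _ t] exI[of _ q])
      (use P Q s t q qA in auto)
qed

text \<open>The initial diagram is an empty colimit, hence pointwise initial, and every object of
  \<open>M\<close> carries exactly one cocone on it. Universal cocones on it therefore have
  precisely the initial objects as bases.\<close>

lemma initial_diagram:
  assumes Z: "is_initial DC Z"
  shows "Z \<in> Gd" "is_initial M L \<Longrightarrow> \<exists>\<omega>. wuniv Z L \<omega>" "wuniv Z L \<omega> \<Longrightarrow> is_initial M L"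
proof -
  let ?X = "\<lambda>_::'s. Z" and ?\<kappa> = "\<lambda>_::'s. Idn DC Z"
  have cop: "is_coproduct DC ({} :: 's set) ?X Z ?\<kappa>" using Z DC.initial_iff_coproduct by blast
  show "Z \<in> Gd" by (rule pw_coproduct_exists(2)[OF small_empty _ cop]) simp
  have J: "small_category U (ord_cat Id ({} :: 's set))" by (rule disc_cat[OF universe small_empty])
  have F: "is_functor (ord_cat Id ({} :: 's set)) DC (disc DC ?X)" by (rule DC.disc_functor) simp
  have col: "is_colimit (ord_cat Id ({} :: 's set)) DC (disc DC ?X) Z ?\<kappa>" using cop unfolding DC.coproduct_iff_colimit .
  have coc: "is_cocone (ord_cat Id ({} :: 's set)) DC (disc DC ?X) Z ?\<kappa>" using col by (simp add: is_colimit_def)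
  \<comment> \<open>Over the empty index category all cocones with a given vertex agree, and a
    colimit is the same as an initial object.\<close>
  have evF: "is_colimit (ord_cat Id ({} :: 's set)) M (ev c (disc DC ?X)) Y \<tau> \<longleftrightarrow> is_initial M Y" for c Y \<tau>
    unfolding is_colimit_def is_initial_def is_cocone_def by auto
  obtain I where I: "is_initial M I"
    using S.coproduct_exists[OF small_empty, of "\<lambda>_. undefined"] M.initial_iff_coproduct by blast
  have pt: "is_colimit (ord_cat Id ({} :: 's set)) M (ev c (disc DC ?X)) (DOb Z c) (\<lambda>j. cmp (?\<kappa> j) c)"
    if c: "c \<in> VOb C" for c
    by (rule colimit_pointwise[OF J F _ col c, of "\<lambda>_. I" "\<lambda>_ _. undefined"]) (simp add: evF I)
  have ex: "\<exists>\<sigma>. wcocone Z n \<sigma>" if n: "n \<in> Ob M" for n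
    by (rule wcocone_colimit[OF J F coc pt, of n "\<lambda>_ _. undefined"]) (use n in auto)
  have eq: "\<sigma> c = \<sigma>' c" if "wcocone Z n \<sigma>" "wcocone Z n \<sigma>'" "c \<in> VOb C" for \<sigma> \<sigma>' n c
    by (rule wcocone_colimit_eqI[OF J F coc pt that]) simp_all
  show "\<exists>\<omega>. wuniv Z L \<omega>" if L: "is_initial M L"
  proof -
    obtain \<omega> where \<omega>: "wcocone Z L \<omega>" using ex[of L] L by (auto simp: is_initial_def)
    have "wuniv Z L \<omega>"
      unfolding wuniv_def
    proof (intro conjI allI impI; (elim conjE)?)
      show "wcocone Z L \<omega>" by (rule \<omega>)
      fix n \<sigma> assume s: "wcocone Z n \<sigma>"
      then obtain h where h: "h \<in> hom M L n" using L wcoconeD(2)[OF s] unfolding is_initial_def by blast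
      then show "\<exists>h. h \<in> hom M L n \<and> (\<forall>c\<in>VOb C. h \<cdot> \<omega> c = \<sigma> c)" using eq[OF wcocone_post[OF \<omega> h] s] by blast
    next
      fix n h h' assume h: "h \<in> hom M L n" "h' \<in> hom M L n"
      then have "n \<in> Ob M" by (force simp: hom_iff)
      then have "\<exists>!f. f \<in> hom M L n" using L by (simp add: is_initial_def)
      then show "h = h'" by (rule ex1_eqI) (rule h)+
    qed
    then show ?thesis by blast
  qed
  show "is_initial M L" if u: "wuniv Z L \<omega>"
    unfolding is_initial_def
  proof (intro conjI ballI)
    note w = wunivD(1)[OF u]
    show "L \<in> Ob M" by (rule wcoconeD(2)[OF w])
    fix n assume n: "n \<in> Ob M"
    obtain \<sigma> where "wcocone Z n \<sigma>" using ex[OF n] by blast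
    then obtain h where h: "h \<in> hom M L n" using wunivD(2)[OF u] by blast
    show "\<exists>!f. f \<in> hom M L n"
    proof (rule ex1I[of _ h])
      show "g = h" if "g \<in> hom M L n" for g
        by (rule wunivD(3)[OF u that h]) (rule eq[OF wcocone_post[OF w that] wcocone_post[OF w h]])
    qed (rule h)
  qed
qed

end

section \<open>Lifting against pointwise weak equivalences up to trivial cells\<close>

section \<open>Lifting against pointwise weak equivalences\<close>

lemma (in enriched) free_map_comp:
  assumes c: "c \<in> VOb C" and f: "f \<in> Ar M" and g: "g \<in> Ar M" "Dom M g = Cod M f"
  shows "free_map c (g \<cdot> f) = free_map c g \<cdot>\<^bsub>DC\<^esub> free_map c f"
proof (rule dmap_eqI)
  show "free_map c (g \<cdot> f) \<in> hom DC (free c (Dom M f)) (free c (Cod M g))"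
    using free_map(1)[OF c, of "g \<cdot> f"] f g by simp
  show "free_map c g \<cdot>\<^bsub>DC\<^esub> free_map c f \<in> hom DC (free c (Dom M f)) (free c (Cod M g))"
    using DC.Comp_in[OF free_map(1)[OF c f] free_map(1)[OF c g(1), unfolded g(2)]] .
  show "cmp (free_map c (g \<cdot> f)) x = cmp (free_map c g \<cdot>\<^bsub>DC\<^esub> free_map c f) x" if "x \<in> VOb C" for x
    using free_map(2)[OF c _ that] f g c that by simp
qed

locale projective = enriched U V M T C
  for U :: "'s itself" and V :: "('v, 'w, 'z) moncat_scheme"
    and M :: "('o, 'a, 'y) cofcat_scheme" (structure)
    and T :: "('v, 'w, 'o, 'a) act" and C :: "('c, 'v, 'w) vcat" +
  assumes cofibration_category: "cofibration_category M U"
    and flat_hom_Cof: "\<lbrakk>x \<in> VOb C; y \<in> VOb C; f \<in> Cof M\<rbrakk> \<Longrightarrow> lact (VHom C x y) f \<in> Cof M"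
    and flat_hom_Weq: "\<lbrakk>x \<in> VOb C; y \<in> VOb C; w \<in> Weq M; Dom M w \<in> good M; Cod M w \<in> good M\<rbrakk>
      \<Longrightarrow> lact (VHom C x y) w \<in> Weq M"
begin

sublocale K: cofibration_category M U by (rule cofibration_category)

sublocale cof: flat_class U V M T C "Cof M"
  by (intro flat_class.intro flat_class_axioms.intro enriched_axioms K.Cof_left_closed flat_hom_Cof)

lemma triv_lact:
  assumes "x \<in> VOb C" "y \<in> VOb C" "f \<in> Weq M \<inter> Cof M" shows "lact (VHom C x y) f \<in> Weq M \<inter> Cof M"
  using assms flat_hom_Cof flat_hom_Weq cof.S.S_good[of f] by auto

sublocale triv: flat_class U V M T C "Weq M \<inter> Cof M"
  by (intro flat_class.intro flat_class_axioms.intro enriched_axioms K.trivial_Cof_left_closed triv_lact)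

lemma triv_Gd: "triv.Gd = cof.Gd"
  by (simp add: triv.Gd_def cof.Gd_def K.good_trivial)

definition pweq where "pweq f \<longleftrightarrow> (\<forall>c\<in>VOb C. cmp f c \<in> Weq M)"

lemma pweq_cancel:
  assumes "f \<in> hom DC X Y" "g \<in> hom DC Y Z" "pweq f" "pweq (g \<cdot>\<^bsub>DC\<^esub> f)" shows "pweq g"
  unfolding pweq_def
proof
  fix c assume c: "c \<in> VOb C"
  have A: "f \<in> Ar DC" "Dom DC f = X" "Cod DC f = Y" "g \<in> Ar DC" "Dom DC g = Y" "Cod DC g = Z"
    using assms(1,2) unfolding hom_iff by blast+
  have "cmp f c \<in> Weq M" "cmp g c \<cdot> cmp f c \<in> Weq M" using assms(3,4) c by (simp_all add: pweq_def)
  then show "cmp g c \<in> Weq M"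
    by (rule K.Weq_cancel_right[rotated 3])
      (use A dmapD(3-5)[OF A(1) c] dmapD(3-5)[OF A(4) c] in simp_all)
qed

text \<open>Cofibrations lift against pointwise weak equivalences up to enlarging the domain of the latter
  by a cell complex of trivial cofibrations. This replaces the retract argument of model category
  theory, for which fibrations would be needed.\<close>

definition liftable where
  "liftable i \<longleftrightarrow> i \<in> Ar DC \<and> (\<forall>E D g p b. g \<in> hom DC (Dom DC i) E \<and> p \<in> hom DC E D \<and> b \<in> hom DC (Cod DC i) D
      \<and> E \<in> cof.Gd \<and> pweq p \<and> b \<cdot>\<^bsub>DC\<^esub> i = p \<cdot>\<^bsub>DC\<^esub> g \<longrightarrow>
      (\<exists>E' j p' s. j \<in> triv.cells \<and> j \<in> hom DC E E' \<and> p' \<in> hom DC E' D \<and> s \<in> hom DC (Cod DC i) E'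
         \<and> p' \<cdot>\<^bsub>DC\<^esub> j = p \<and> s \<cdot>\<^bsub>DC\<^esub> i = j \<cdot>\<^bsub>DC\<^esub> g \<and> p' \<cdot>\<^bsub>DC\<^esub> s = b))"

lemma liftableD:
  assumes "liftable i" "g \<in> hom DC (Dom DC i) E" "p \<in> hom DC E D" "b \<in> hom DC (Cod DC i) D"
    "E \<in> cof.Gd" "pweq p" "b \<cdot>\<^bsub>DC\<^esub> i = p \<cdot>\<^bsub>DC\<^esub> g"
  obtains E' j p' s where "j \<in> triv.cells" "j \<in> hom DC E E'" "p' \<in> hom DC E' D" "s \<in> hom DC (Cod DC i) E'"
    "p' \<cdot>\<^bsub>DC\<^esub> j = p" "s \<cdot>\<^bsub>DC\<^esub> i = j \<cdot>\<^bsub>DC\<^esub> g" "p' \<cdot>\<^bsub>DC\<^esub> s = b"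
proof -
  have "\<exists>E' j p' s. j \<in> triv.cells \<and> j \<in> hom DC E E' \<and> p' \<in> hom DC E' D \<and> s \<in> hom DC (Cod DC i) E'
         \<and> p' \<cdot>\<^bsub>DC\<^esub> j = p \<and> s \<cdot>\<^bsub>DC\<^esub> i = j \<cdot>\<^bsub>DC\<^esub> g \<and> p' \<cdot>\<^bsub>DC\<^esub> s = b"
    by (rule assms(1)[unfolded liftable_def, THEN conjunct2, THEN spec[of _ E], THEN spec[of _ D],
          THEN spec[of _ g], THEN spec[of _ p], THEN spec[of _ b], THEN mp]) (intro conjI assms)
  then show thesis by (elim exE conjE) (rule that)
qed

text \<open>By Yoneda the square is one in \<open>M\<close> at the object \<open>c\<close>. The map
  from the pushout of \<open>i\<close> and \<open>\<alpha>\<close> to \<open>D c\<close> is factored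
  as a cofibration \<open>u\<close> and a weak equivalence \<open>v\<close> with middle object
  \<open>N\<close>. The resulting \<open>n : E c \<rightarrow> N\<close> is a trivial cofibration,
  and attaching the cell \<open>C(c, -) \<otimes> n\<close> to \<open>E\<close> creates room for the
  lift.\<close>

lemma liftable_free_map:
  assumes c: "c \<in> VOb C" and i: "i \<in> Cof M"
  shows "liftable (free_map c i)"
  unfolding liftable_def
proof (intro conjI allI impI; (elim conjE)?)
  define A where "A = Dom M i"
  define B where "B = Cod M i"
  have iA: "i \<in> Ar M" "Dom M i = A" "Cod M i = B" and ih: "i \<in> hom M A B"
    using cof.S.S_Ar[OF i] by (auto simp: A_def B_def hom_iff)
  have AB: "A \<in> Ob M" "B \<in> Ob M" using iA by force+
  note fm = free_map[OF c iA(1), unfolded iA]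
  have fA: "Dom DC (free_map c i) = free c A" "Cod DC (free_map c i) = free c B" and "free_map c i \<in> Ar DC"
    using fm(1) unfolding hom_iff by blast+
  then show "free_map c i \<in> Ar DC" by blast
  fix E D g p b assume "g \<in> hom DC (Dom DC (free_map c i)) E" "b \<in> hom DC (Cod DC (free_map c i)) D"
  then have g: "g \<in> hom DC (free c A) E" and b: "b \<in> hom DC (free c B) D" by (simp_all add: fA)
  assume p: "p \<in> hom DC E D" and E: "E \<in> cof.Gd" and pq: "pweq p" and sq: "b \<cdot>\<^bsub>DC\<^esub> free_map c i = p \<cdot>\<^bsub>DC\<^esub> g"
  have pA: "p \<in> Ar DC" "Dom DC p = E" "Cod DC p = D" using p unfolding hom_iff by blast+
  note pm = dmapD[OF pA(1), unfolded pA]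
  define \<alpha> where "\<alpha> = elt c A g"
  define \<beta> where "\<beta> = elt c B b"
  have \<alpha>: "\<alpha> \<in> hom M A (DOb E c)" "ymap c \<alpha> E = g" using ymap_elt[OF c AB(1) g] by (simp_all add: \<alpha>_def)
  have \<beta>: "\<beta> \<in> hom M B (DOb D c)" "ymap c \<beta> D = b" using ymap_elt[OF c AB(2) b] by (simp_all add: \<beta>_def)
  have \<alpha>A: "\<alpha> \<in> Ar M" "Dom M \<alpha> = A" "Cod M \<alpha> = DOb E c" and \<beta>A: "\<beta> \<in> Ar M" "Dom M \<beta> = B" "Cod M \<beta> = DOb D c"
    using \<alpha> \<beta> by (auto simp: hom_iff)
  have pc: "cmp p c \<in> Ar M" "Dom M (cmp p c) = DOb E c" "Cod M (cmp p c) = DOb D c" using pm(3-5)[OF c] .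
  have e: "ymap c (\<beta> \<cdot> i) D = ymap c (cmp p c \<cdot> \<alpha>) D"
    using sq unfolding \<alpha>(2)[symmetric] \<beta>(2)[symmetric] ymap_free_map[OF c pm(2) \<beta>(1) ih] ymap_comp[OF c \<alpha>(1) p] .
  have h: "\<beta> \<cdot> i \<in> hom M A (DOb D c)" "cmp p c \<cdot> \<alpha> \<in> hom M A (DOb D c)"
    using \<alpha>A \<beta>A iA pc by (simp_all add: hom_iff)
  have sq': "\<beta> \<cdot> i = cmp p c \<cdot> \<alpha>"
    using ymap_eqD[OF c pm(2) h(1)] ymap_eqD[OF c pm(2) h(2)] unfolding e by (rule trans[OF sym])
  have Eg: "DOb E c \<in> good M" using E c by (simp add: cof.Gd_def)
  obtain x y where P: "is_pushout M i \<alpha> x y"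
    using cof.S.pushout_exists[OF i \<alpha>A(1)] \<alpha>A iA Eg by auto
  have yC: "y \<in> Cof M" by (rule cof.S.pushout_in[OF i \<alpha>A(1) _ _ P]) (use \<alpha>A iA Eg in auto)
  note PD = M.pushoutD[OF P]
  obtain k where k: "k \<in> hom M (Cod M x) (DOb D c)" "k \<cdot> x = \<beta>" "k \<cdot> y = cmp p c"
    by (rule M.pushout_map[OF P _ _ sq', of "DOb D c"]) (use \<beta>A iA \<alpha>A pc in \<open>auto simp: hom_iff\<close>)
  have kA: "k \<in> Ar M" "Dom M k = Cod M x" "Cod M k = DOb D c" using k(1) by (auto simp: hom_iff)
  have "Dom M k \<in> good M" using cof.S.S_good(2)[OF yC] kA PD by simp
  then obtain u v where uv: "u \<in> Cof M" "v \<in> Weq M" "Cod M u = Dom M v" "k = v \<cdot> u"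
    using K.factorization[OF kA(1)] by blast
  have vA: "v \<in> Ar M" and uA: "u \<in> Ar M" using K.Weq_Ar[OF uv(2)] cof.S.S_Ar[OF uv(1)] .
  define N where "N = Cod M u"
  have uD: "Dom M u = Cod M x" "Cod M u = N" "Dom M v = N" "Cod M v = DOb D c"
    using kA uA vA uv(3,4) by (auto simp: N_def)
  define n where "n = u \<cdot> y"
  have yA: "y \<in> Ar M" "Dom M y = DOb E c" "Cod M y = Cod M x" and xA: "x \<in> Ar M" "Dom M x = B"
    using PD \<alpha>A iA by simp_all
  have nA: "n \<in> Ar M" "Dom M n = DOb E c" "Cod M n = N" using yA uA uD by (simp_all add: n_def)
  have vn: "v \<cdot> n = cmp p c" using k(3) uv(4) yA uA vA uD by (simp add: n_def)
  \<comment> \<open>Both \<open>v\<close> and \<open>v \<cdot> n\<close>, which is the component of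
    \<open>p\<close> at \<open>c\<close>, are weak equivalences. This is the only place in this
    lemma where \<open>p\<close> being a weak equivalence enters.\<close>
  have "n \<in> Weq M"
    by (rule K.Weq_cancel_left[of n v]) (use nA vA uD uv(2) vn pq c in \<open>simp_all add: pweq_def\<close>)
  moreover have "n \<in> Cof M" unfolding n_def using cof.S.S_comp[OF yC uv(1)] yA uD by simp
  ultimately have nS: "n \<in> Weq M \<inter> Cof M" by blast
  have Ed: "is_diagram V C M T E" using E by (simp add: cof.Gd_def)
  have EO: "DOb E c \<in> Ob M" using diagramD(1)[OF Ed c] .
  \<comment> \<open>The attaching map of the new cell, corresponding to the identity of
    \<open>E c\<close>.\<close>
  define \<epsilon> where "\<epsilon> = ymap c (Idn M (DOb E c)) E"
  have \<epsilon>h: "\<epsilon> \<in> hom DC (free c (DOb E c)) E"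
    unfolding \<epsilon>_def by (rule ymap[OF c Ed]) (use EO in \<open>simp add: hom_iff\<close>)
  have \<epsilon>A: "\<epsilon> \<in> Ar DC" "Dom DC \<epsilon> = free c (DOb E c)" "Cod DC \<epsilon> = E" using \<epsilon>h unfolding hom_iff by blast+
  have fn: "free_map c n \<in> hom DC (free c (DOb E c)) (free c N)" using free_map(1)[OF c nA(1)] nA by simp
  have fnA: "Dom DC (free_map c n) = free c (DOb E c)" "Cod DC (free_map c n) = free c N"
    using fn unfolding hom_iff by blast+
  have fnc: "free_map c n \<in> triv.cells" using c nS by (blast intro: cell_closure.generator)
  have pwn: "triv.pw (free_map c n)" by (rule triv.cells_pw[OF fnc])
  obtain P' j where PO: "is_pushout DC (free_map c n) \<epsilon> P' j"
    using triv.pw_pushout(1)[OF pwn \<epsilon>A(1)] \<epsilon>A fnA E triv_Gd by auto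
  note PO' = DC.pushoutD[OF PO]
  define E' where "E' = Cod DC P'"
  have Ph: "P' \<in> hom DC (free c N) E'" and jh: "j \<in> hom DC E E'"
    using PO' fnA \<epsilon>A unfolding hom_iff E'_def by auto
  have jc: "j \<in> triv.cells"
    by (rule cell_closure.cobase_change[OF fnc _ _ PO])
      (use triv.pwD(3)[OF pwn] \<epsilon>A E triv_Gd in auto)
  have vh: "v \<in> hom M N (DOb D c)" using vA uD by (simp add: hom_iff)
  have sq2: "ymap c v D \<cdot>\<^bsub>DC\<^esub> free_map c n = p \<cdot>\<^bsub>DC\<^esub> \<epsilon>"
  proof -
    have "ymap c v D \<cdot>\<^bsub>DC\<^esub> free_map c n = ymap c (v \<cdot> n) D"
      by (rule ymap_free_map[OF c pm(2) vh]) (use nA in \<open>simp add: hom_iff\<close>)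
    moreover have "p \<cdot>\<^bsub>DC\<^esub> \<epsilon> = ymap c (cmp p c \<cdot> Idn M (DOb E c)) D"
      unfolding \<epsilon>_def by (rule ymap_comp[OF c _ p]) (use EO in \<open>simp add: hom_iff\<close>)
    ultimately show ?thesis using vn pc by simp
  qed
  have yv: "ymap c v D \<in> hom DC (free c N) D" by (rule ymap[OF c pm(2) vh])
  obtain p' where p': "p' \<in> hom DC E' D" "p' \<cdot>\<^bsub>DC\<^esub> P' = ymap c v D" "p' \<cdot>\<^bsub>DC\<^esub> j = p"
    by (rule DC.pushout_map[OF PO, of "ymap c v D" D p]) (use yv p sq2 fnA \<epsilon>A in \<open>simp_all add: E'_def\<close>)
  have ux: "u \<cdot> x \<in> Ar M" "Dom M (u \<cdot> x) = B" "Cod M (u \<cdot> x) = N" using xA uA uD by simp_all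
  have fux: "free_map c (u \<cdot> x) \<in> hom DC (free c B) (free c N)" using free_map(1)[OF c ux(1)] ux by simp
  \<comment> \<open>The lift: \<open>B\<close> maps through the pushout to \<open>N\<close>, and the
    free map on this composite is followed by the inclusion of the attached cell.\<close>
  define s where "s = P' \<cdot>\<^bsub>DC\<^esub> free_map c (u \<cdot> x)"
  have sh: "s \<in> hom DC (free c B) E'" unfolding s_def by (rule DC.Comp_in[OF fux Ph])
  have f\<alpha>: "free_map c \<alpha> \<in> hom DC (free c A) (free c (DOb E c))" using free_map(1)[OF c \<alpha>A(1)] \<alpha>A by simp
  have "s \<cdot>\<^bsub>DC\<^esub> free_map c i = P' \<cdot>\<^bsub>DC\<^esub> free_map c (u \<cdot> x \<cdot> i)"
    unfolding s_def using DC.Comp_assoc[OF fm(1) fux Ph] free_map_comp[OF c iA(1) ux(1)] ux iA by simp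
  also have "u \<cdot> x \<cdot> i = n \<cdot> \<alpha>" using PD(9) xA yA uA uD \<alpha>A iA by (simp add: n_def)
  also have "P' \<cdot>\<^bsub>DC\<^esub> free_map c (n \<cdot> \<alpha>) = j \<cdot>\<^bsub>DC\<^esub> (\<epsilon> \<cdot>\<^bsub>DC\<^esub> free_map c \<alpha>)"
  proof -
    have "P' \<cdot>\<^bsub>DC\<^esub> free_map c (n \<cdot> \<alpha>) = P' \<cdot>\<^bsub>DC\<^esub> (free_map c n \<cdot>\<^bsub>DC\<^esub> free_map c \<alpha>)"
      using free_map_comp[OF c \<alpha>A(1) nA(1)] nA \<alpha>A by simp
    also have "\<dots> = (P' \<cdot>\<^bsub>DC\<^esub> free_map c n) \<cdot>\<^bsub>DC\<^esub> free_map c \<alpha>"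
      by (rule DC.Comp_assoc[OF f\<alpha> fn Ph, symmetric])
    also have "\<dots> = j \<cdot>\<^bsub>DC\<^esub> (\<epsilon> \<cdot>\<^bsub>DC\<^esub> free_map c \<alpha>)"
      unfolding PO'(9) by (rule DC.Comp_assoc[OF f\<alpha> \<epsilon>h jh])
    finally show ?thesis .
  qed
  also have "\<epsilon> \<cdot>\<^bsub>DC\<^esub> free_map c \<alpha> = g"
  proof -
    have "\<epsilon> \<cdot>\<^bsub>DC\<^esub> free_map c \<alpha> = ymap c (Idn M (DOb E c) \<cdot> \<alpha>) E"
      unfolding \<epsilon>_def by (rule ymap_free_map[OF c Ed _ \<alpha>(1)]) (use EO in \<open>simp add: hom_iff\<close>)
    then show ?thesis using \<alpha>(2) \<alpha>A by simp
  qed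
  finally have si: "s \<cdot>\<^bsub>DC\<^esub> free_map c i = j \<cdot>\<^bsub>DC\<^esub> g" .
  have "p' \<cdot>\<^bsub>DC\<^esub> s = ymap c v D \<cdot>\<^bsub>DC\<^esub> free_map c (u \<cdot> x)"
    unfolding s_def p'(2)[symmetric] by (rule DC.Comp_assoc[OF fux Ph p'(1), symmetric])
  also have "\<dots> = ymap c (v \<cdot> (u \<cdot> x)) D"
    by (rule ymap_free_map[OF c pm(2) vh]) (use ux in \<open>simp add: hom_iff\<close>)
  also have "v \<cdot> (u \<cdot> x) = \<beta>" using k(2) uv(4) uA vA uD xA by simp
  finally have ps: "p' \<cdot>\<^bsub>DC\<^esub> s = b" unfolding \<beta>(2) .
  show "\<exists>E' j p' s. j \<in> triv.cells \<and> j \<in> hom DC E E' \<and> p' \<in> hom DC E' D \<and> s \<in> hom DC (Cod DC (free_map c i)) E'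
         \<and> p' \<cdot>\<^bsub>DC\<^esub> j = p \<and> s \<cdot>\<^bsub>DC\<^esub> free_map c i = j \<cdot>\<^bsub>DC\<^esub> g \<and> p' \<cdot>\<^bsub>DC\<^esub> s = b"
    unfolding fA
    by (intro exI[of _ E'] exI[of _ j] exI[of _ p'] exI[of _ s] conjI) (rule jc jh p' sh si ps)+
qed

text \<open>The enlargement found for \<open>f\<close> also serves for its cobase change; the
  universal property of the pushout combines the lift with \<open>j \<cdot> g\<close>.\<close>

lemma liftable_cobase:
  assumes f: "liftable f" and P: "is_pushout DC f g0 p0 q0"
  shows "liftable q0"
  unfolding liftable_def
proof (intro conjI allI impI; (elim conjE)?)
  note PD = DC.pushoutD[OF P]
  show "q0 \<in> Ar DC" by (rule PD)
  fix E D g p b assume "g \<in> hom DC (Dom DC q0) E" and "b \<in> hom DC (Cod DC q0) D"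
  then have g: "g \<in> hom DC (Cod DC g0) E" and b: "b \<in> hom DC (Cod DC p0) D" using PD(7,8) by auto
  assume p: "p \<in> hom DC E D" and E: "E \<in> cof.Gd" and pq: "pweq p" and sq: "b \<cdot>\<^bsub>DC\<^esub> q0 = p \<cdot>\<^bsub>DC\<^esub> g"
  have g0: "g0 \<in> hom DC (Dom DC f) (Cod DC g0)" and p0: "p0 \<in> hom DC (Cod DC f) (Cod DC p0)"
    and f0: "f \<in> hom DC (Dom DC f) (Cod DC f)" and q0: "q0 \<in> hom DC (Cod DC g0) (Cod DC p0)"
    using PD unfolding hom_iff by auto
  have "(b \<cdot>\<^bsub>DC\<^esub> p0) \<cdot>\<^bsub>DC\<^esub> f = b \<cdot>\<^bsub>DC\<^esub> (q0 \<cdot>\<^bsub>DC\<^esub> g0)"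
    unfolding PD(9)[symmetric] by (rule DC.Comp_assoc[OF f0 p0 b])
  also have "\<dots> = (p \<cdot>\<^bsub>DC\<^esub> g) \<cdot>\<^bsub>DC\<^esub> g0"
    unfolding sq[symmetric] by (rule DC.Comp_assoc[OF g0 q0 b, symmetric])
  also have "\<dots> = p \<cdot>\<^bsub>DC\<^esub> (g \<cdot>\<^bsub>DC\<^esub> g0)" by (rule DC.Comp_assoc[OF g0 g p])
  finally have sq': "(b \<cdot>\<^bsub>DC\<^esub> p0) \<cdot>\<^bsub>DC\<^esub> f = p \<cdot>\<^bsub>DC\<^esub> (g \<cdot>\<^bsub>DC\<^esub> g0)" .
  obtain E' j p' s0 where L: "j \<in> triv.cells" "j \<in> hom DC E E'" "p' \<in> hom DC E' D" "s0 \<in> hom DC (Cod DC f) E'"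
      "p' \<cdot>\<^bsub>DC\<^esub> j = p" "s0 \<cdot>\<^bsub>DC\<^esub> f = j \<cdot>\<^bsub>DC\<^esub> (g \<cdot>\<^bsub>DC\<^esub> g0)" "p' \<cdot>\<^bsub>DC\<^esub> s0 = b \<cdot>\<^bsub>DC\<^esub> p0"
    by (rule liftableD[OF f DC.Comp_in[OF g0 g] p DC.Comp_in[OF p0 b] E pq sq'])
  have "s0 \<cdot>\<^bsub>DC\<^esub> f = (j \<cdot>\<^bsub>DC\<^esub> g) \<cdot>\<^bsub>DC\<^esub> g0"
    unfolding L(6) by (rule DC.Comp_assoc[OF g0 g L(2), symmetric])
  then obtain s where s: "s \<in> hom DC (Cod DC p0) E'" "s \<cdot>\<^bsub>DC\<^esub> p0 = s0" "s \<cdot>\<^bsub>DC\<^esub> q0 = j \<cdot>\<^bsub>DC\<^esub> g"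
    by (rule DC.pushout_map[OF P L(4) DC.Comp_in[OF g L(2)]])
  have "p' \<cdot>\<^bsub>DC\<^esub> s = b"
  proof (rule DC.pushout_eqI[OF P DC.Comp_in[OF s(1) L(3)] b])
    show "p' \<cdot>\<^bsub>DC\<^esub> s \<cdot>\<^bsub>DC\<^esub> p0 = b \<cdot>\<^bsub>DC\<^esub> p0"
      unfolding L(7)[symmetric] s(2)[symmetric] by (rule DC.Comp_assoc[OF p0 s(1) L(3)])
    have "p' \<cdot>\<^bsub>DC\<^esub> s \<cdot>\<^bsub>DC\<^esub> q0 = p' \<cdot>\<^bsub>DC\<^esub> (j \<cdot>\<^bsub>DC\<^esub> g)"
      unfolding s(3)[symmetric] by (rule DC.Comp_assoc[OF q0 s(1) L(3)])
    also have "\<dots> = (p' \<cdot>\<^bsub>DC\<^esub> j) \<cdot>\<^bsub>DC\<^esub> g" by (rule DC.Comp_assoc[OF g L(2,3), symmetric])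
    finally show "p' \<cdot>\<^bsub>DC\<^esub> s \<cdot>\<^bsub>DC\<^esub> q0 = b \<cdot>\<^bsub>DC\<^esub> q0" unfolding L(5) sq .
  qed
  then show "\<exists>E' j p' s. j \<in> triv.cells \<and> j \<in> hom DC E E' \<and> p' \<in> hom DC E' D \<and> s \<in> hom DC (Cod DC q0) E'
      \<and> p' \<cdot>\<^bsub>DC\<^esub> j = p \<and> s \<cdot>\<^bsub>DC\<^esub> q0 = j \<cdot>\<^bsub>DC\<^esub> g \<and> p' \<cdot>\<^bsub>DC\<^esub> s = b"
    using L s PD(8) by (intro exI[of _ E'] exI[of _ j] exI[of _ p'] exI[of _ s]) simp
qed

end

type_synonym ('s, 'c, 'o, 'a) lift_state =
  "('c, 'o, 'a) diagram \<times> ('s \<Rightarrow> ('c, 'o, 'a) diagram_map) \<times> ('c, 'o, 'a) diagram_map \<times> ('c, 'o, 'a) diagram_map"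

context projective
begin

definition sE :: "('s, 'c, 'o, 'a) lift_state \<Rightarrow> ('c, 'o, 'a) diagram" where "sE = fst"
definition se :: "('s, 'c, 'o, 'a) lift_state \<Rightarrow> 's \<Rightarrow> ('c, 'o, 'a) diagram_map" where "se s = fst (snd s)"
definition sa :: "('s, 'c, 'o, 'a) lift_state \<Rightarrow> ('c, 'o, 'a) diagram_map" where "sa s = fst (snd (snd s))"
definition sp :: "('s, 'c, 'o, 'a) lift_state \<Rightarrow> ('c, 'o, 'a) diagram_map" where "sp s = snd (snd (snd s))"

lemma state_simps [simp]: "sE (E, e, a, p) = E" "se (E, e, a, p) = e" "sa (E, e, a, p) = a" "sp (E, e, a, p) = p"
  by (simp_all add: sE_def se_def sa_def sp_def)

definition sF :: "('s \<Rightarrow> ('s, 'c, 'o, 'a) lift_state) \<Rightarrow> ('s, 's \<times> 's, ('c, 'o, 'a) diagram, ('c, 'o, 'a) diagram_map) funct"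
  where "sF f = ord_funct (\<lambda>k. sE (f k)) (\<lambda>j k. se (f k) j)"

lemma sF_simps [simp]: "FOb (sF f) k = sE (f k)" "FAr (sF f) (j, k) = se (f k) j"
  by (simp_all add: sF_def)

text \<open>Stage \<^term>\<open>k\<close> of the construction, given the previous stages \<^term>\<open>f\<close>: an object \<^term>\<open>sE s\<close>
  over \<^term>\<open>D\<close>, the map \<^term>\<open>sp s\<close> to \<^term>\<open>D\<close>, the maps \<^term>\<open>se s j\<close> from the stages
  \<^term>\<open>j\<close> up to \<^term>\<open>k\<close>, and a lift \<^term>\<open>sa s\<close> of \<^term>\<open>bb k\<close> to \<^term>\<open>sE s\<close>.\<close>

definition stage where
  "stage r X bb D k0 E0 p0 g0 f k s \<longleftrightarrow> sE s \<in> cof.Gd \<and> sa s \<in> hom DC (FOb X k) (sE s) \<and> sp s \<in> hom DC (sE s) D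
     \<and> pweq (sp s) \<and> sp s \<cdot>\<^bsub>DC\<^esub> sa s = bb k \<and> se s k = Idn DC (sE s)
     \<and> (\<forall>j\<in>underS r k. se s j \<in> hom DC (sE (f j)) (sE s) \<and> se s j \<cdot>\<^bsub>DC\<^esub> sa (f j) = sa s \<cdot>\<^bsub>DC\<^esub> FAr X (j, k)
          \<and> sp s \<cdot>\<^bsub>DC\<^esub> se s j = sp (f j))
     \<and> (\<forall>j\<in>underS r k. \<forall>i. (i, j) \<in> r \<longrightarrow> se s j \<cdot>\<^bsub>DC\<^esub> se (f j) i = se s i)
     \<and> (k = k0 \<longrightarrow> sE s = E0 \<and> sp s = p0 \<and> sa s = g0)
     \<and> (\<forall>j. is_succ r j k \<longrightarrow> se s j \<in> triv.cells)
     \<and> (is_limit r k \<longrightarrow> is_colimit (ord_cat r (underS r k)) DC (sF f) (sE s) (se s))"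

text \<open>\<open>stage\<close> consults \<open>f\<close> below \<open>k\<close> only, which is the
  compatibility required for choices along a well-founded relation.\<close>

lemma stage_cong:
  assumes "stage r X bb D k0 E0 p0 g0 f k s" "Well_order r" "\<And>j. j \<in> underS r k \<Longrightarrow> f j = g j"
  shows "stage r X bb D k0 E0 p0 g0 g k s"
proof -
  have "is_colimit (ord_cat r (underS r k)) DC (sF g) (sE s) (se s)" if k: "is_limit r k"
  proof -
    have c: "is_colimit (ord_cat r (underS r k)) DC (sF f) (sE s) (se s)"
      using assms(1) k unfolding stage_def by blast
    have "underS r k \<subseteq> Field r" using underS_Field by fast
    show ?thesis
      by (rule DC.colimit_cong[OF c]) (use assms(3) ord_category[OF assms(2) \<open>underS r k \<subseteq> Field r\<close>] in auto)
  qed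
  then show ?thesis using assms(1,3) unfolding stage_def by auto
qed

lemma stage_init_seg:
  assumes r: "Well_order r" "k \<in> Field r" and j: "j \<in> underS r k" and s: "stage r X bb D k0 E0 p0 g0 f j s"
  shows "stage (init_seg r k) X bb D k0 E0 p0 g0 f j s"
proof -
  have u: "underS (init_seg r k) j = underS r j" by (rule underS_init_seg[OF r j])
  have "underS r j \<subseteq> underS r k" using under_trans[OF r(1) _ j] by (auto simp: underS_iff)
  then have oc: "ord_cat (init_seg r k) (underS r j) = ord_cat r (underS r j)"
    by (rule ord_cat_init_seg[OF r])
  show ?thesis
    using s unfolding stage_def u oc is_succ_init_seg[OF r] is_limit_init_seg[OF r]
    by (simp add: j init_seg_iff[OF r])
qed

context
  fixes r X bb D k0 E0 p0 g0 f
  assumes X: "transfinite_seq U DC r X" and k0: "is_least r k0"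
    and st: "\<And>k. k \<in> Field r \<Longrightarrow> stage r X bb D k0 E0 p0 g0 f k (f k)"
begin

lemma stageD:
  assumes "k \<in> Field r"
  shows "sE (f k) \<in> cof.Gd" "sa (f k) \<in> hom DC (FOb X k) (sE (f k))" "sp (f k) \<in> hom DC (sE (f k)) D"
    "pweq (sp (f k))" "sp (f k) \<cdot>\<^bsub>DC\<^esub> sa (f k) = bb k" "se (f k) k = Idn DC (sE (f k))"
    "k = k0 \<Longrightarrow> sE (f k) = E0" "k = k0 \<Longrightarrow> sp (f k) = p0" "k = k0 \<Longrightarrow> sa (f k) = g0"
    "is_succ r j k \<Longrightarrow> se (f k) j \<in> triv.cells"
    "is_limit r k \<Longrightarrow> is_colimit (ord_cat r (underS r k)) DC (sF f) (sE (f k)) (se (f k))"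
    "\<lbrakk>j \<in> underS r k; (i, j) \<in> r\<rbrakk> \<Longrightarrow> se (f k) j \<cdot>\<^bsub>DC\<^esub> se (f j) i = se (f k) i"
    "j \<in> underS r k \<Longrightarrow> se (f k) j \<in> hom DC (sE (f j)) (sE (f k))"
    "j \<in> underS r k \<Longrightarrow> se (f k) j \<cdot>\<^bsub>DC\<^esub> sa (f j) = sa (f k) \<cdot>\<^bsub>DC\<^esub> FAr X (j, k)"
    "j \<in> underS r k \<Longrightarrow> sp (f k) \<cdot>\<^bsub>DC\<^esub> se (f k) j = sp (f j)"
  using st[OF assms] unfolding stage_def by blast+

lemma stage_le:
  assumes "(j, k) \<in> r"
  shows "se (f k) j \<in> hom DC (sE (f j)) (sE (f k))"
    "se (f k) j \<cdot>\<^bsub>DC\<^esub> sa (f j) = sa (f k) \<cdot>\<^bsub>DC\<^esub> FAr X (j, k)"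
    "sp (f k) \<cdot>\<^bsub>DC\<^esub> se (f k) j = sp (f j)"
proof -
  have F: "j \<in> Field r" "k \<in> Field r" using assms by (auto simp: Field_def)
  have EO: "sE (f k) \<in> Ob DC" using cof.Gd_Ob[OF stageD(1)[OF F(2)]] .
  have "se (f k) j \<in> hom DC (sE (f j)) (sE (f k)) \<and>
    se (f k) j \<cdot>\<^bsub>DC\<^esub> sa (f j) = sa (f k) \<cdot>\<^bsub>DC\<^esub> FAr X (j, k) \<and> sp (f k) \<cdot>\<^bsub>DC\<^esub> se (f k) j = sp (f j)"
  proof (cases "j = k")
    case True
    have 1: "Idn DC (sE (f k)) \<cdot>\<^bsub>DC\<^esub> sa (f k) = sa (f k)" by (rule DC.Comp_Idn_left[OF stageD(2)[OF F(2)]])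
    have 2: "sa (f k) \<cdot>\<^bsub>DC\<^esub> Idn DC (FOb X k) = sa (f k)" by (rule DC.Comp_Idn_right[OF stageD(2)[OF F(2)]])
    have 3: "sp (f k) \<cdot>\<^bsub>DC\<^esub> Idn DC (sE (f k)) = sp (f k)" by (rule DC.Comp_Idn_right[OF stageD(3)[OF F(2)]])
    show ?thesis
      unfolding True stageD(6)[OF F(2)] seq_Idn[OF X F(2)] using 1 2 3 DC.Idn_in[OF EO] by simp
  next
    case False
    then have "j \<in> underS r k" using assms by (simp add: underS_iff)
    then show ?thesis using stageD(13-15)[OF F(2)] by blast
  qed
  then show "se (f k) j \<in> hom DC (sE (f j)) (sE (f k))"
    "se (f k) j \<cdot>\<^bsub>DC\<^esub> sa (f j) = sa (f k) \<cdot>\<^bsub>DC\<^esub> FAr X (j, k)"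
    "sp (f k) \<cdot>\<^bsub>DC\<^esub> se (f k) j = sp (f j)" by blast+
qed

lemma stage_seq: "transfinite_seq U DC r (sF f)"
  unfolding transfinite_seq_def
proof (intro conjI allI impI)
  note D = transfinite_seqD[OF X]
  note R = Well_orderD[OF D(1)]
  show "Well_order r" "small U (Field r)" "Field r \<noteq> {}" by (rule D)+
  show "is_functor (ord_cat r (Field r)) DC (sF f)"
  proof (rule ord_functorI)
    show "category DC" by (rule DC.category_axioms)
    show "category (ord_cat r (Field r))" by (rule ord_category[OF D(1) subset_refl])
    show "FOb (sF f) k \<in> Ob DC" if "k \<in> Field r" for k using cof.Gd_Ob[OF stageD(1)[OF that]] by simp
    show "FAr (sF f) (j, k) \<in> hom DC (FOb (sF f) j) (FOb (sF f) k)" if "(j, k) \<in> r" for j k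
      using stage_le(1)[OF that] by simp
    show "FAr (sF f) (k, k) = Idn DC (FOb (sF f) k)" if "k \<in> Field r" for k
      using stageD(6)[OF that] by simp
    show "FAr (sF f) (i, k) = FAr (sF f) (j, k) \<cdot>\<^bsub>DC\<^esub> FAr (sF f) (i, j)"
      if "k \<in> Field r" "(i, j) \<in> r" "(j, k) \<in> r" for i j k
    proof (cases "j = k")
      case True
      then have 1: "se (f k) i \<in> hom DC (sE (f i)) (sE (f k))" using stage_le(1) that(2) by blast
      show ?thesis using DC.Comp_Idn_left[OF 1] stageD(6)[OF that(1)] True by simp
    next
      case False
      then have "j \<in> underS r k" using that by (simp add: underS_iff)
      then show ?thesis using stageD(12)[OF that(1) _ that(2)] by simp
    qed
  qed
  fix k assume k: "is_limit r k"
  then have "k \<in> Field r" by (simp add: is_limit_def)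
  from stageD(11)[OF this k]
  show "is_colimit (ord_cat r (underS r k)) DC (sF f) (FOb (sF f) k) (\<lambda>j. FAr (sF f) (j, k))" by simp
qed

text \<open>Passage to the colimit of the stages, used for limit stages through initial segments and
  once at the end. The steps are trivial cells, so the colimit of the enlargements exists and the
  inclusion of the first one is again a trivial cell.\<close>

lemma stage_colimit:
  assumes Y: "is_colimit (ord_cat r (Field r)) DC X Y y" and b: "b \<in> hom DC Y D"
    and bby: "\<And>k. k \<in> Field r \<Longrightarrow> b \<cdot>\<^bsub>DC\<^esub> y k = bb k"
  obtains E' \<gamma> s p' where "is_colimit (ord_cat r (Field r)) DC (sF f) E' \<gamma>" "s \<in> hom DC Y E'"
    "p' \<in> hom DC E' D" "\<And>k. k \<in> Field r \<Longrightarrow> s \<cdot>\<^bsub>DC\<^esub> y k = \<gamma> k \<cdot>\<^bsub>DC\<^esub> sa (f k)"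
    "\<And>k. k \<in> Field r \<Longrightarrow> p' \<cdot>\<^bsub>DC\<^esub> \<gamma> k = sp (f k)" "p' \<cdot>\<^bsub>DC\<^esub> s = b" "\<gamma> k0 \<in> triv.cells" "pweq p'" "E' \<in> cof.Gd"
    "\<And>k. k \<in> Field r \<Longrightarrow> \<gamma> k \<in> hom DC (sE (f k)) E'"
    "\<And>j k. (j, k) \<in> r \<Longrightarrow> \<gamma> k \<cdot>\<^bsub>DC\<^esub> se (f k) j = \<gamma> j"
proof -
  note D = transfinite_seqD[OF X]
  have k0F: "k0 \<in> Field r" by (rule least_in[OF k0])
  have FI: "j \<in> Field r" "k \<in> Field r" if "(j, k) \<in> r" for j k using that by (auto simp: Field_def)
  have cells: "FAr (sF f) (j, k) \<in> triv.cells" if "is_succ r j k" for j k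
    using stageD(10)[OF is_succD(4)[OF that] that] by simp
  have pw: "triv.pw (FAr (sF f) (j, k))" if "is_succ r j k" for j k
    by (rule triv.cells_pw[OF cells[OF that]])
  have g0: "FOb (sF f) k0 \<in> triv.Gd" using stageD(1)[OF k0F] by (simp add: triv_Gd)
  obtain E' \<gamma> where \<gamma>: "is_colimit (ord_cat r (Field r)) DC (sF f) E' \<gamma>"
    using triv.pw_colimit_exists[OF stage_seq pw k0 g0] by blast
  have \<gamma>c: "\<gamma> k0 \<in> triv.cells"
    by (rule cell_closure.transfinite_composite[OF stage_seq cells k0 g0 \<gamma>])
  have \<gamma>pw: "triv.pw (\<gamma> k0)" by (rule triv.cells_pw[OF \<gamma>c])
  have \<gamma>h: "\<gamma> k \<in> hom DC (sE (f k)) E'" if "k \<in> Field r" for k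
    using \<gamma> that unfolding is_colimit_def ord_cocone_iff by simp
  have \<gamma>e: "\<gamma> k \<cdot>\<^bsub>DC\<^esub> se (f k) j = \<gamma> j" if "(j, k) \<in> r" for j k
    using \<gamma> that FI[OF that] unfolding is_colimit_def ord_cocone_iff by simp
  have yh: "y k \<in> hom DC (FOb X k) Y" if "k \<in> Field r" for k
    using Y that unfolding is_colimit_def ord_cocone_iff by blast
  have E'g: "E' \<in> cof.Gd"
    using triv.pwD(4)[OF \<gamma>pw] \<gamma>h[OF k0F] unfolding hom_iff triv_Gd by blast
  have E'O: "E' \<in> Ob DC" and DO: "D \<in> Ob DC"
    using cof.Gd_Ob[OF E'g] b DC.Cod_in[of b] unfolding hom_iff by blast+
  have "is_cocone (ord_cat r (Field r)) DC X E' (\<lambda>k. \<gamma> k \<cdot>\<^bsub>DC\<^esub> sa (f k))"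
    unfolding ord_cocone_iff
  proof (intro conjI ballI impI)
    show "\<gamma> k \<cdot>\<^bsub>DC\<^esub> sa (f k) \<in> hom DC (FOb X k) E'" if "k \<in> Field r" for k
      by (rule DC.Comp_in[OF stageD(2)[OF that] \<gamma>h[OF that]])
    fix j k assume jk: "j \<in> Field r" "k \<in> Field r" "(j, k) \<in> r"
    have "\<gamma> k \<cdot>\<^bsub>DC\<^esub> sa (f k) \<cdot>\<^bsub>DC\<^esub> FAr X (j, k) = \<gamma> k \<cdot>\<^bsub>DC\<^esub> (se (f k) j \<cdot>\<^bsub>DC\<^esub> sa (f j))"
      unfolding stage_le(2)[OF jk(3)] by (rule DC.Comp_assoc[OF seq_hom[OF X jk(3)] stageD(2)[OF jk(2)] \<gamma>h[OF jk(2)]])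
    also have "\<dots> = \<gamma> k \<cdot>\<^bsub>DC\<^esub> se (f k) j \<cdot>\<^bsub>DC\<^esub> sa (f j)"
      by (rule DC.Comp_assoc[OF stageD(2)[OF jk(1)] stage_le(1)[OF jk(3)] \<gamma>h[OF jk(2)], symmetric])
    finally show "\<gamma> k \<cdot>\<^bsub>DC\<^esub> sa (f k) \<cdot>\<^bsub>DC\<^esub> FAr X (j, k) = \<gamma> j \<cdot>\<^bsub>DC\<^esub> sa (f j)" unfolding \<gamma>e[OF jk(3)] .
  qed (rule E'O)
  then obtain s where s: "s \<in> hom DC Y E'" "\<And>k. k \<in> Field r \<Longrightarrow> s \<cdot>\<^bsub>DC\<^esub> y k = \<gamma> k \<cdot>\<^bsub>DC\<^esub> sa (f k)"
    by (rule DC.colimit_map[OF Y]) auto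
  have "is_cocone (ord_cat r (Field r)) DC (sF f) D (\<lambda>k. sp (f k))"
    unfolding ord_cocone_iff using stageD(3) stage_le(3) DO by simp
  then obtain p' where p': "p' \<in> hom DC E' D" "\<And>k. k \<in> Field r \<Longrightarrow> p' \<cdot>\<^bsub>DC\<^esub> \<gamma> k = sp (f k)"
    by (rule DC.colimit_map[OF \<gamma>]) auto
  have ps: "p' \<cdot>\<^bsub>DC\<^esub> s = b"
  proof (rule DC.colimit_eqI[OF Y D(4) DC.Comp_in[OF s(1) p'(1)] b])
    fix k assume "k \<in> Ob (ord_cat r (Field r))"
    then have k: "k \<in> Field r" by simp
    have "p' \<cdot>\<^bsub>DC\<^esub> s \<cdot>\<^bsub>DC\<^esub> y k = p' \<cdot>\<^bsub>DC\<^esub> (\<gamma> k \<cdot>\<^bsub>DC\<^esub> sa (f k))"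
      unfolding s(2)[OF k, symmetric] by (rule DC.Comp_assoc[OF yh[OF k] s(1) p'(1)])
    also have "\<dots> = p' \<cdot>\<^bsub>DC\<^esub> \<gamma> k \<cdot>\<^bsub>DC\<^esub> sa (f k)"
      by (rule DC.Comp_assoc[OF stageD(2)[OF k] \<gamma>h[OF k] p'(1), symmetric])
    finally show "p' \<cdot>\<^bsub>DC\<^esub> s \<cdot>\<^bsub>DC\<^esub> y k = b \<cdot>\<^bsub>DC\<^esub> y k"
      by (simp only: p'(2)[OF k] stageD(5)[OF k] bby[OF k])
  qed
  \<comment> \<open>2-out-of-3: the composite of \<open>\<gamma> k0\<close> with \<open>p'\<close>
    is the map to \<open>D\<close> at the least stage, a pointwise weak equivalence.\<close>
  have "pweq (\<gamma> k0)" using triv.pwD(2)[OF \<gamma>pw] by (auto simp: pweq_def)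
  then have "pweq p'"
    by (rule pweq_cancel[OF \<gamma>h[OF k0F] p'(1)]) (simp add: p'(2)[OF k0F] stageD(4)[OF k0F])
  from that[OF \<gamma> s(1) p'(1) s(2) p'(2) ps \<gamma>c this E'g \<gamma>h \<gamma>e] show thesis .
qed

end

text \<open>Each step enlarges \<open>E\<close> further, in a way that depends on the earlier
  choices, so the stages are chosen by recursion along the well-order. Compatibility with all
  earlier stages and continuity at limits have to be part of the recursion, hence the maps recorded
  in a stage.\<close>

lemma liftable_transfinite:
  assumes X: "transfinite_seq U DC r X" and steps: "\<And>j k. is_succ r j k \<Longrightarrow> liftable (FAr X (j, k))"
    and k0: "is_least r k0" and L: "is_colimit (ord_cat r (Field r)) DC X L \<iota>"
  shows "liftable (\<iota> k0)"
  unfolding liftable_def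
proof (intro conjI allI impI; (elim conjE)?)
  note D' = transfinite_seqD[OF X]
  note R = Well_orderD[OF D'(1)]
  have k0F: "k0 \<in> Field r" by (rule least_in[OF k0])
  have \<iota>h: "\<iota> k \<in> hom DC (FOb X k) L" if "k \<in> Field r" for k
    using L that unfolding is_colimit_def ord_cocone_iff by blast
  have \<iota>e: "\<iota> k \<cdot>\<^bsub>DC\<^esub> FAr X (j, k) = \<iota> j" if jk: "(j, k) \<in> r" for j k
  proof -
    have "j \<in> Field r" "k \<in> Field r" using jk by (auto simp: Field_def)
    then show ?thesis using L jk unfolding is_colimit_def ord_cocone_iff by blast
  qed
  show "\<iota> k0 \<in> Ar DC" using \<iota>h[OF k0F] unfolding hom_iff by blast
  have d0: "Dom DC (\<iota> k0) = FOb X k0" "Cod DC (\<iota> k0) = L" using \<iota>h[OF k0F] unfolding hom_iff by blast+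
  fix E0 D g0 p0 b assume g0: "g0 \<in> hom DC (Dom DC (\<iota> k0)) E0" and b0: "b \<in> hom DC (Cod DC (\<iota> k0)) D"
  note g0 = g0[unfolded d0] and b = b0[unfolded d0]
  assume p0: "p0 \<in> hom DC E0 D" and E0: "E0 \<in> cof.Gd" and pq0: "pweq p0" and sq: "b \<cdot>\<^bsub>DC\<^esub> \<iota> k0 = p0 \<cdot>\<^bsub>DC\<^esub> g0"
  define bb where "bb k = b \<cdot>\<^bsub>DC\<^esub> \<iota> k" for k
  have bbX: "bb k \<cdot>\<^bsub>DC\<^esub> FAr X (j, k) = bb j" if jk: "(j, k) \<in> r" for j k
  proof -
    have k: "k \<in> Field r" using jk by (auto simp: Field_def)
    show ?thesis
      unfolding bb_def \<iota>e[OF jk, symmetric] by (rule DC.Comp_assoc[OF seq_hom[OF X jk] \<iota>h[OF k] b])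
  qed
  have bbh: "bb k \<in> hom DC (FOb X k) D" if "k \<in> Field r" for k
    unfolding bb_def by (rule DC.Comp_in[OF \<iota>h[OF that] b])
  let ?st = "stage r X bb D k0 E0 p0 g0"
  have "\<exists>f. \<forall>k. k \<in> Field r \<longrightarrow> ?st f k (f k)"
  proof (rule dependent_wf_choice[OF R(5)])
    fix f g :: "'s \<Rightarrow> ('s, 'c, 'o, 'a) lift_state" and k s assume "\<And>z. (z, k) \<in> r - Id \<Longrightarrow> f z = g z"
    then have eq: "f z = g z" if "z \<in> underS r k" for z using that by (auto simp: underS_iff)
    show "(k \<in> Field r \<longrightarrow> ?st f k s) = (k \<in> Field r \<longrightarrow> ?st g k s)"
      using stage_cong[OF _ D'(1), of X bb D k0 E0 p0 g0 f k s g] stage_cong[OF _ D'(1), of X bb D k0 E0 p0 g0 g k s f] eq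
      by auto
  next
    fix k and f :: "'s \<Rightarrow> ('s, 'c, 'o, 'a) lift_state" assume IH0: "\<And>y. (y, k) \<in> r - Id \<Longrightarrow> y \<in> Field r \<longrightarrow> ?st f y (f y)"
    show "\<exists>s. k \<in> Field r \<longrightarrow> ?st f k s"
    proof (cases "k \<in> Field r")
      case kF: True
      have IH: "?st f y (f y)" if "y \<in> underS r k" for y
        using IH0[of y] that underS_Field[OF that] by (auto simp: underS_iff)
      from kF show ?thesis
      proof (cases rule: Well_order_cases)
        case least
        then have k: "k = k0" using least_unique[OF D'(1) k0] by simp
        have u: "underS r k0 = {}" using k0 by (simp add: is_least_def)
        \<comment> \<open>No stage lies below the least one; of the constant family of identities
          only the map from the stage to itself matters.\<close>
        have "?st f k0 (E0, \<lambda>_. Idn DC E0, g0, p0)"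
          unfolding stage_def u
          using E0 g0 p0 pq0 sq least_not_succ[OF k0] u by (auto simp: bb_def is_limit_def)
        then show ?thesis using k by blast
      next
        case (succ j)
        note jk = is_succD(1)[OF succ] and j = is_succD(3)[OF succ]
        have ju: "j \<in> underS r k" using succ by (simp add: is_succ_def)
        note uk = succ_underS[OF D'(1) succ]
        note S = IH[OF ju, unfolded stage_def]
        have Sj: "sE (f j) \<in> cof.Gd" "sa (f j) \<in> hom DC (FOb X j) (sE (f j))" "sp (f j) \<in> hom DC (sE (f j)) D"
          "pweq (sp (f j))" "sp (f j) \<cdot>\<^bsub>DC\<^esub> sa (f j) = bb j" "se (f j) j = Idn DC (sE (f j))" using S by blast+
        have XA: "Dom DC (FAr X (j, k)) = FOb X j" "Cod DC (FAr X (j, k)) = FOb X k"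
          using seq_hom[OF X jk] unfolding hom_iff by blast+
        have 1: "sa (f j) \<in> hom DC (Dom DC (FAr X (j, k))) (sE (f j))" "bb k \<in> hom DC (Cod DC (FAr X (j, k))) D"
          using Sj(2) bbh[OF kF] by (simp_all only: XA)
        have 2: "bb k \<cdot>\<^bsub>DC\<^esub> FAr X (j, k) = sp (f j) \<cdot>\<^bsub>DC\<^esub> sa (f j)" unfolding Sj(5) by (rule bbX[OF jk])
        obtain E' e' p' s' where L: "e' \<in> triv.cells" "e' \<in> hom DC (sE (f j)) E'" "p' \<in> hom DC E' D"
          "s' \<in> hom DC (Cod DC (FAr X (j, k))) E'" "p' \<cdot>\<^bsub>DC\<^esub> e' = sp (f j)" "s' \<cdot>\<^bsub>DC\<^esub> FAr X (j, k) = e' \<cdot>\<^bsub>DC\<^esub> sa (f j)"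
          "p' \<cdot>\<^bsub>DC\<^esub> s' = bb k"
          by (rule liftableD[OF steps[OF succ] 1(1) Sj(3) 1(2) Sj(1,4) 2])
        note pwe = triv.cells_pw[OF L(1)]
        have eA: "Cod DC e' = E'" using L(2) unfolding hom_iff by blast
        have E'g: "E' \<in> cof.Gd" using triv.pwD(4)[OF pwe] eA by (simp add: triv_Gd)
        have E'O: "E' \<in> Ob DC" by (rule cof.Gd_Ob[OF E'g])
        have "pweq e'" using triv.pwD(2)[OF pwe] by (auto simp: pweq_def)
        then have pq': "pweq p'" by (rule pweq_cancel[OF L(2,3)]) (simp add: L(5) Sj(4))
        \<comment> \<open>Maps from earlier stages pass through the predecessor \<open>j\<close> and
          then the new enlargement \<open>e'\<close>; the stage \<open>k\<close> itself receives the
          identity.\<close>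
        define e where "e i = (if i = k then Idn DC E' else e' \<cdot>\<^bsub>DC\<^esub> se (f j) i)" for i
        have ei: "e i = e' \<cdot>\<^bsub>DC\<^esub> se (f j) i" if "i \<in> underS r k" for i using that by (simp add: e_def underS_iff)
        have ej: "e j = e'" unfolding ei[OF ju] Sj(6) by (rule DC.Comp_Idn_right[OF L(2)])
        have sej: "se (f j) i \<in> hom DC (sE (f i)) (sE (f j)) \<and> se (f j) i \<cdot>\<^bsub>DC\<^esub> sa (f i) = sa (f j) \<cdot>\<^bsub>DC\<^esub> FAr X (i, j)
            \<and> sp (f j) \<cdot>\<^bsub>DC\<^esub> se (f j) i = sp (f i)" if "i \<in> underS r k" for i
        proof (cases "i = j")
          case True
          have a: "Idn DC (sE (f j)) \<cdot>\<^bsub>DC\<^esub> sa (f j) = sa (f j)" by (rule DC.Comp_Idn_left[OF Sj(2)])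
          have b: "sa (f j) \<cdot>\<^bsub>DC\<^esub> Idn DC (FOb X j) = sa (f j)" by (rule DC.Comp_Idn_right[OF Sj(2)])
          have c: "sp (f j) \<cdot>\<^bsub>DC\<^esub> Idn DC (sE (f j)) = sp (f j)" by (rule DC.Comp_Idn_right[OF Sj(3)])
          show ?thesis
            unfolding True Sj(6) seq_Idn[OF X j] using a b c DC.Idn_in[OF cof.Gd_Ob[OF Sj(1)]] by simp
        next
          case False
          then have "i \<in> underS r j" using that uk by (simp add: underS_iff[of i r j])
          then show ?thesis using S by blast
        qed
        have "?st f k (E', e, s', p')"
          unfolding stage_def state_simps
        proof (intro conjI ballI allI impI)
          show "E' \<in> cof.Gd" "p' \<in> hom DC E' D" "pweq p'" "p' \<cdot>\<^bsub>DC\<^esub> s' = bb k" by (rule E'g L(3) pq' L(7))+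
          show "s' \<in> hom DC (FOb X k) E'" using L(4) by (simp only: XA)
          show "e k = Idn DC E'" by (simp add: e_def)
          show "e i \<in> triv.cells" if "is_succ r i k" for i
          proof -
            have "i = j" using that succ R(3) by (auto simp: is_succ_def antisym_def)
            then show ?thesis using ej L(1) by simp
          qed
          show "is_colimit (ord_cat r (underS r k)) DC (sF f) E' e" if "is_limit r k"
            using that succ by (auto simp: is_limit_def)
          show "E' = E0" "p' = p0" "s' = g0" if "k = k0" using least_not_succ[OF k0] succ that by auto
          fix i assume i: "i \<in> underS r k"
          note s = sej[OF i]
          have ij: "(i, j) \<in> r" using i uk by simp
          show "e i \<in> hom DC (sE (f i)) E'"
            unfolding ei[OF i] by (rule DC.Comp_in[OF _ L(2)]) (use s in blast)
          have "e' \<cdot>\<^bsub>DC\<^esub> se (f j) i \<cdot>\<^bsub>DC\<^esub> sa (f i) = e' \<cdot>\<^bsub>DC\<^esub> (sa (f j) \<cdot>\<^bsub>DC\<^esub> FAr X (i, j))"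
            using DC.Comp_assoc[OF _ conjunct1[OF s] L(2), of "sa (f i)" "FOb X i"] s IH[OF i]
            unfolding stage_def by simp
          also have "\<dots> = e' \<cdot>\<^bsub>DC\<^esub> sa (f j) \<cdot>\<^bsub>DC\<^esub> FAr X (i, j)"
            by (rule DC.Comp_assoc[OF seq_hom[OF X ij] Sj(2) L(2), symmetric])
          also have "\<dots> = s' \<cdot>\<^bsub>DC\<^esub> (FAr X (j, k) \<cdot>\<^bsub>DC\<^esub> FAr X (i, j))"
            unfolding L(6)[symmetric] by (rule DC.Comp_assoc[OF seq_hom[OF X ij] seq_hom[OF X jk] L(4)[unfolded XA]])
          finally show "e i \<cdot>\<^bsub>DC\<^esub> sa (f i) = s' \<cdot>\<^bsub>DC\<^esub> FAr X (i, k)"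
            unfolding ei[OF i] seq_comp[OF X ij jk] .
          have "p' \<cdot>\<^bsub>DC\<^esub> (e' \<cdot>\<^bsub>DC\<^esub> se (f j) i) = p' \<cdot>\<^bsub>DC\<^esub> e' \<cdot>\<^bsub>DC\<^esub> se (f j) i"
            by (rule DC.Comp_assoc[OF conjunct1[OF s] L(2,3), symmetric])
          then show "p' \<cdot>\<^bsub>DC\<^esub> e i = sp (f i)" unfolding ei[OF i] L(5) using s by simp
          fix l assume li: "(l, i) \<in> r"
          have lk: "l \<in> underS r k" by (rule under_trans[OF D'(1) li i])
          have lh: "se (f i) l \<in> hom DC (sE (f l)) (sE (f i))"
          proof (cases "l = i")
            case True
            then show ?thesis using IH[OF i] DC.Idn_in[OF cof.Gd_Ob, of "sE (f i)"] unfolding stage_def by simp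
          next
            case False
            then have "l \<in> underS r i" using li by (simp add: underS_iff)
            then show ?thesis using IH[OF i] unfolding stage_def by blast
          qed
          have "e' \<cdot>\<^bsub>DC\<^esub> se (f j) i \<cdot>\<^bsub>DC\<^esub> se (f i) l = e' \<cdot>\<^bsub>DC\<^esub> (se (f j) i \<cdot>\<^bsub>DC\<^esub> se (f i) l)"
            by (rule DC.Comp_assoc[OF lh conjunct1[OF s] L(2)])
          also have "se (f j) i \<cdot>\<^bsub>DC\<^esub> se (f i) l = se (f j) l"
          proof (cases "i = j")
            case True
            show ?thesis using DC.Comp_Idn_left[OF lh] Sj(6) by (simp add: True)
          next
            case False
            then have "i \<in> underS r j" using ij by (simp add: underS_iff)
            then show ?thesis using S li by blast
          qed
          finally show "e i \<cdot>\<^bsub>DC\<^esub> se (f i) l = e l" unfolding ei[OF i] ei[OF lk] .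
        qed
        then show ?thesis by blast
      next
        case limit
        have ne: "underS r k \<noteq> {}" using limit by (auto simp: is_limit_def)
        let ?r = "init_seg r k"
        have Fr: "Field ?r = underS r k" by (rule Field_init_seg[OF D'(1) kF])
        have oc: "ord_cat ?r (underS r k) = ord_cat r (underS r k)"
          by (rule ord_cat_init_seg[OF D'(1) kF subset_refl])
        have Xr: "transfinite_seq U DC ?r X" by (rule transfinite_seq_init_seg[OF X kF ne])
        have k0r: "is_least ?r k0" using k0 is_least_init_seg[OF D'(1) kF ne] by simp
        have st: "stage ?r X bb D k0 E0 p0 g0 f y (f y)" if "y \<in> Field ?r" for y
          using stage_init_seg[OF D'(1) kF _ IH] that unfolding Fr by blast
        have Y: "is_colimit (ord_cat ?r (Field ?r)) DC X (FOb X k) (\<lambda>j. FAr X (j, k))"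
          unfolding Fr oc by (rule D'(5)[OF limit])
        have bY: "bb k \<cdot>\<^bsub>DC\<^esub> FAr X (j, k) = bb j" if "j \<in> Field ?r" for j
          by (rule bbX) (use that in \<open>simp add: Fr underS_iff\<close>)
        obtain E' \<gamma> s' p' where Q: "is_colimit (ord_cat ?r (Field ?r)) DC (sF f) E' \<gamma>" "s' \<in> hom DC (FOb X k) E'"
          "p' \<in> hom DC E' D" "\<And>j. j \<in> Field ?r \<Longrightarrow> s' \<cdot>\<^bsub>DC\<^esub> FAr X (j, k) = \<gamma> j \<cdot>\<^bsub>DC\<^esub> sa (f j)"
          "\<And>j. j \<in> Field ?r \<Longrightarrow> p' \<cdot>\<^bsub>DC\<^esub> \<gamma> j = sp (f j)" "p' \<cdot>\<^bsub>DC\<^esub> s' = bb k" "\<gamma> k0 \<in> triv.cells" "pweq p'" "E' \<in> cof.Gd"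
          "\<And>j. j \<in> Field ?r \<Longrightarrow> \<gamma> j \<in> hom DC (sE (f j)) E'"
          "\<And>i j. (i, j) \<in> ?r \<Longrightarrow> \<gamma> j \<cdot>\<^bsub>DC\<^esub> se (f j) i = \<gamma> i"
          by (rule stage_colimit[OF Xr k0r st Y bbh[OF kF] bY]) (assumption | rule that)+
        define e where "e i = (if i = k then Idn DC E' else \<gamma> i)" for i
        have ei: "e i = \<gamma> i" if "i \<in> underS r k" for i using that by (simp add: e_def underS_iff)
        have "?st f k (E', e, s', p')"
          unfolding stage_def state_simps
        proof (intro conjI ballI allI impI)
          show "E' \<in> cof.Gd" "s' \<in> hom DC (FOb X k) E'" "p' \<in> hom DC E' D" "pweq p'" "p' \<cdot>\<^bsub>DC\<^esub> s' = bb k" by (rule Q)+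
          show "e k = Idn DC E'" by (simp add: e_def)
          show "e i \<in> triv.cells" if "is_succ r i k" for i using that limit by (auto simp: is_limit_def)
          show "E' = E0" "p' = p0" "s' = g0" if "k = k0" using k0 ne that by (auto simp: is_least_def)
          show "is_colimit (ord_cat r (underS r k)) DC (sF f) E' e"
            by (rule DC.colimit_cong[OF Q(1)[unfolded Fr oc]])
              (use ei ord_category[OF D'(1), of "underS r k"] underS_Field in fastforce)+
          fix i assume i: "i \<in> underS r k"
          have iF: "i \<in> Field ?r" using i by (simp add: Fr)
          show "e i \<in> hom DC (sE (f i)) E'" "p' \<cdot>\<^bsub>DC\<^esub> e i = sp (f i)" "e i \<cdot>\<^bsub>DC\<^esub> sa (f i) = s' \<cdot>\<^bsub>DC\<^esub> FAr X (i, k)"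
            unfolding ei[OF i] using Q(10,5,4)[OF iF] by simp_all
          fix l assume li: "(l, i) \<in> r"
          have lk: "l \<in> underS r k" by (rule under_trans[OF D'(1) li i])
          show "e i \<cdot>\<^bsub>DC\<^esub> se (f i) l = e l"
            unfolding ei[OF i] ei[OF lk] by (rule Q(11)) (simp add: init_seg_iff[OF D'(1) kF] i lk li)
        qed
        then show ?thesis by blast
      qed
    qed simp
  qed
  then obtain f where f: "\<And>k. k \<in> Field r \<Longrightarrow> ?st f k (f k)" by blast
  obtain E' \<gamma> s p' where Q: "is_colimit (ord_cat r (Field r)) DC (sF f) E' \<gamma>" "s \<in> hom DC L E'"
    "p' \<in> hom DC E' D" "\<And>k. k \<in> Field r \<Longrightarrow> s \<cdot>\<^bsub>DC\<^esub> \<iota> k = \<gamma> k \<cdot>\<^bsub>DC\<^esub> sa (f k)"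
    "\<And>k. k \<in> Field r \<Longrightarrow> p' \<cdot>\<^bsub>DC\<^esub> \<gamma> k = sp (f k)" "p' \<cdot>\<^bsub>DC\<^esub> s = b" "\<gamma> k0 \<in> triv.cells" "pweq p'" "E' \<in> cof.Gd"
    "\<And>k. k \<in> Field r \<Longrightarrow> \<gamma> k \<in> hom DC (sE (f k)) E'" "\<And>j k. (j, k) \<in> r \<Longrightarrow> \<gamma> k \<cdot>\<^bsub>DC\<^esub> se (f k) j = \<gamma> j"
    by (rule stage_colimit[OF X k0 f L b bb_def[symmetric]]) (assumption | rule that)+
  have f0: "sE (f k0) = E0" "sp (f k0) = p0" "sa (f k0) = g0" using f[OF k0F] unfolding stage_def by blast+
  show "\<exists>E' j p' s. j \<in> triv.cells \<and> j \<in> hom DC E0 E' \<and> p' \<in> hom DC E' D \<and> s \<in> hom DC (Cod DC (\<iota> k0)) E'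
      \<and> p' \<cdot>\<^bsub>DC\<^esub> j = p0 \<and> s \<cdot>\<^bsub>DC\<^esub> \<iota> k0 = j \<cdot>\<^bsub>DC\<^esub> g0 \<and> p' \<cdot>\<^bsub>DC\<^esub> s = b"
    by (intro exI[of _ E'] exI[of _ "\<gamma> k0"] exI[of _ p'] exI[of _ s] conjI)
      (use Q(2,3,6,7) Q(4)[OF k0F] Q(5)[OF k0F] Q(10)[OF k0F] f0 d0 in simp_all)
qed

lemma cells_liftable: "f \<in> cof.cells \<Longrightarrow> liftable f"
  by (rule conjunct2, rule cof.cell_induct)
    (auto intro: liftable_free_map liftable_cobase liftable_transfinite)

end

section \<open>Cofibrations and weak equivalences under the weighted colimit functor\<close>

section \<open>The weighted colimit functor is left Quillen\<close>

context weighted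
begin

context
  fixes F \<omega>
  assumes F: "is_weighted_colimit_functor V C M T W F \<omega>"
begin

abbreviation (input) "Dm \<equiv> wcolim_domain V C M T W"

lemma wcf_wuniv: "X \<in> Dm \<Longrightarrow> wuniv X (FOb F X) (\<omega> X)"
  using F weighted_colimit_wuniv[of X] unfolding is_weighted_colimit_functor_def wcolim_domain_def by blast

lemma wcf_map:
  assumes f: "f \<in> hom DC X Y" and X: "X \<in> Dm" and Y: "Y \<in> Dm"
  shows "FAr F f \<in> hom M (FOb F X) (FOb F Y)"
    "c \<in> VOb C \<Longrightarrow> FAr F f \<cdot> \<omega> X c = \<omega> Y c \<cdot> lact (Wt c) (cmp f c)"
proof -
  have fA: "f \<in> Ar DC" "Dom DC f = X" "Cod DC f = Y" using f unfolding hom_iff by blast+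
  then have f': "f \<in> Ar (full_subcat DC Dm)" "Dom (full_subcat DC Dm) f = X" "Cod (full_subcat DC Dm) f = Y"
    using X Y by (simp_all add: full_subcat_def)
  have "is_functor (full_subcat DC Dm) M F" using F by (simp add: is_weighted_colimit_functor_def)
  then have "\<forall>f\<in>Ar (full_subcat DC Dm). FAr F f \<in> hom M (FOb F (Dom (full_subcat DC Dm) f)) (FOb F (Cod (full_subcat DC Dm) f))"
    unfolding is_functor_def by blast
  from bspec[OF this f'(1)] show "FAr F f \<in> hom M (FOb F X) (FOb F Y)" unfolding f'(2,3) .
  obtain \<tau> where ft: "f = (X, Y, \<tau>)" using fA by (cases f) (auto simp: diagram_cat_def)
  have "is_diagram_map V C M T (X, Y, \<tau>)" using fA(1) ft by simp
  then show "FAr F f \<cdot> \<omega> X c = \<omega> Y c \<cdot> lact (Wt c) (cmp f c)" if "c \<in> VOb C"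
    using F X Y that unfolding is_weighted_colimit_functor_def ft by (simp add: cmp_def)
qed

lemma wcf_comp:
  assumes f: "f \<in> hom DC X Y" and g: "g \<in> hom DC Y Z" and D: "X \<in> Dm" "Y \<in> Dm" "Z \<in> Dm"
  shows "FAr F (g \<cdot>\<^bsub>DC\<^esub> f) = FAr F g \<cdot> FAr F f"
proof -
  have f': "f \<in> Ar (full_subcat DC Dm)" "g \<in> Ar (full_subcat DC Dm)"
      "Cod (full_subcat DC Dm) f = Dom (full_subcat DC Dm) g"
    using f g D unfolding hom_iff by (auto simp: full_subcat_def)
  have "is_functor (full_subcat DC Dm) M F" using F by (simp add: is_weighted_colimit_functor_def)
  then have "FAr F (Comp (full_subcat DC Dm) g f) = FAr F g \<cdot> FAr F f"
    using f' unfolding is_functor_def by blast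
  then show ?thesis by (simp add: full_subcat_def)
qed

lemma wcf_Idn: "X \<in> Dm \<Longrightarrow> FAr F (Idn DC X) = Idn M (FOb F X)"
proof -
  assume X: "X \<in> Dm"
  have "is_functor (full_subcat DC Dm) M F" using F by (simp add: is_weighted_colimit_functor_def)
  then have "\<forall>X\<in>Ob (full_subcat DC Dm). FAr F (Idn (full_subcat DC Dm) X) = Idn M (FOb F X)"
    unfolding is_functor_def by blast
  then show ?thesis using X by (simp add: full_subcat_def)
qed

end

end

text \<open>The universal cocone of \<open>X\<close> is extended along \<open>f\<close>. The result
  is universal for \<open>Y\<close>, so the image of \<open>f\<close> is the map \<open>h\<close> in
  \<open>S\<close> followed by an isomorphism between two coends of \<open>Y\<close>.\<close>

lemma (in weighted_flat) wcf_cells: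
  assumes F: "is_weighted_colimit_functor V C M T W F \<omega>" and f: "f \<in> cells" "f \<in> hom DC X Y"
    and X: "X \<in> wcolim_domain V C M T W" "FOb F X \<in> good_obs M S"
  shows "Y \<in> wcolim_domain V C M T W" "FOb F Y \<in> good_obs M S" "FAr F f \<in> S"
proof -
  have fA: "f \<in> Ar DC" "Dom DC f = X" "Cod DC f = Y" using f(2) unfolding hom_iff by blast+
  note uX = wcf_wuniv[OF F X(1)]
  note w = wcoconeD[OF wunivD(1)[OF uX]]
  have wX: "wcocone (Dom DC f) (FOb F X) (\<omega> X)" using wunivD(1)[OF uX] fA by simp
  obtain m' h \<omega>' where e: "wext f (FOb F X) (\<omega> X) m' h \<omega>'" and h: "h \<in> S"
    by (rule extendableD[OF cells_extendable[OF f(1)] X(2) wX])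
  note E = wextD[OF e, unfolded fA]
  have u': "wuniv Y m' \<omega>'" by (rule wext_wuniv[OF uX e f(2)])
  have YG: "Y \<in> Gd" using pwD(4)[OF cells_pw[OF f(1)]] fA by simp
  show Y: "Y \<in> wcolim_domain V C M T W"
    using wuniv_weighted_colimit[OF YG u'] YG by (auto simp: wcolim_domain_def Gd_def)
  note uY = wcf_wuniv[OF F Y]
  obtain v where v: "is_iso M v" "v \<in> hom M m' (FOb F Y)" "\<And>c. c \<in> VOb C \<Longrightarrow> v \<cdot> \<omega>' c = \<omega> Y c"
    by (rule wuniv_iso[OF u' uY]) auto
  have vA: "v \<in> Ar M" "Dom M v = m'" "Cod M v = FOb F Y" using v(2) by (auto simp: hom_iff)
  have m': "m' \<in> good_obs M S" using S.S_good(2)[OF h] E(6) by simp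
  show "FOb F Y \<in> good_obs M S" using S.iso_good[OF v(1)] vA m' by simp
  have "FAr F f = v \<cdot> h"
  proof (rule wunivD(3)[OF uX wcf_map(1)[OF F f(2) X(1) Y]])
    show "v \<cdot> h \<in> hom M (FOb F X) (FOb F Y)" using vA E(4-6) by (simp add: hom_iff)
    fix c assume c: "c \<in> VOb C"
    note fm = dmapD(3-5)[OF fA(1) c, unfolded fA]
    have "v \<cdot> h \<cdot> \<omega> X c = v \<cdot> (\<omega>' c \<cdot> lact (Wt c) (cmp f c))"
      unfolding E(7)[OF c] using vA E(4-6) w(3-5)[OF c] by simp
    also have "\<dots> = \<omega> Y c \<cdot> lact (Wt c) (cmp f c)"
      using M.comp_cong_left[OF v(3)[OF c], of "lact (Wt c) (cmp f c)"] vA fm c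
        wcoconeD(3-5)[OF wunivD(1)[OF u'] c] by simp
    finally show "FAr F f \<cdot> \<omega> X c = v \<cdot> h \<cdot> \<omega> X c" using wcf_map(2)[OF F f(2) X(1) Y c] by simp
  qed
  moreover have "v \<in> S" using S.iso_in[OF v(1)] vA m' by simp
  ultimately show "FAr F f \<in> S" using S.S_comp[OF h] vA E by simp
qed

lemma projective_cofcat_simps:
  "Ob (projective_cofcat U V C M T) = Ob (diagram_cat V C M T)"
  "Ar (projective_cofcat U V C M T) = Ar (diagram_cat V C M T)"
  "Dom (projective_cofcat U V C M T) = Dom (diagram_cat V C M T)"
  "Cod (projective_cofcat U V C M T) = Cod (diagram_cat V C M T)"
  "Idn (projective_cofcat U V C M T) = Idn (diagram_cat V C M T)"
  "Comp (projective_cofcat U V C M T) = Comp (diagram_cat V C M T)"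
  "Cof (projective_cofcat U V C M T) = projective_cofibrations U V C M T"
  "Weq (projective_cofcat U V C M T) = pointwise_weqs V C M T"
  by (simp_all add: projective_cofcat_def cat.extend_def cofcat.fields_def)

lemma projective_cofcat_hom: "hom (projective_cofcat U V C M T) = hom (diagram_cat V C M T)"
  by (intro ext) (simp add: hom_def projective_cofcat_simps)

lemma projective_cofcat_initial:
  "is_initial (projective_cofcat U V C M T) Z \<longleftrightarrow> is_initial (diagram_cat V C M T) Z"
  by (simp add: is_initial_def projective_cofcat_simps projective_cofcat_hom)

lemma projective_cofcat_functor:
  "is_functor (full_subcat (projective_cofcat U V C M T) D) M F
    \<longleftrightarrow> is_functor (full_subcat (diagram_cat V C M T) D) M F"
  by (simp add: is_functor_def category_def full_subcat_def hom_def projective_cofcat_simps)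

locale projective_weighted = projective U V M T C + weighted U V M T C W
  for U :: "'s itself" and V :: "('v, 'w, 'z) moncat_scheme"
    and M :: "('o, 'a, 'y) cofcat_scheme" (structure)
    and T :: "('v, 'w, 'o, 'a) act" and C :: "('c, 'v, 'w) vcat" and W :: "('c, 'v, 'w) diagram" +
  assumes flat_weight_Cof: "\<lbrakk>c \<in> VOb C; f \<in> Cof M\<rbrakk> \<Longrightarrow> lact (Wt c) f \<in> Cof M"
    and flat_weight_Weq: "\<lbrakk>c \<in> VOb C; w \<in> Weq M; Dom M w \<in> good M; Cod M w \<in> good M\<rbrakk>
      \<Longrightarrow> lact (Wt c) w \<in> Weq M"
begin

sublocale cofw: weighted_flat U V M T C "Cof M" W
  by (intro weighted_flat.intro weighted_flat_axioms.intro cof.flat_class_axioms weighted_axioms flat_weight_Cof)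

lemma triv_weight:
  assumes "c \<in> VOb C" "f \<in> Weq M \<inter> Cof M" shows "lact (Wt c) f \<in> Weq M \<inter> Cof M"
  using assms flat_weight_Cof flat_weight_Weq cof.S.S_good[of f] by auto

sublocale trivw: weighted_flat U V M T C "Weq M \<inter> Cof M" W
  by (intro weighted_flat.intro weighted_flat_axioms.intro triv.flat_class_axioms weighted_axioms triv_weight)

abbreviation (input) PC where "PC \<equiv> projective_cofcat U V C M T"

lemma pointwise_good: "pointwise_good V C M T = cof.Gd"
  by (simp add: pointwise_good_def cof.Gd_def)

lemma Cof_PC: "f \<in> Cof PC \<Longrightarrow> f \<in> cof.cells"
  unfolding projective_cofcat_simps projective_cofibrations_def pointwise_good by blast

text \<open>Trivial cofibrations are cofibrations, so the same closure argument applies. It is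
  needed to lift along the enlargements themselves in \<open>wcf_Weq\<close>.\<close>

lemma triv_cells_liftable: "f \<in> triv.cells \<Longrightarrow> liftable f"
  by (rule conjunct2, rule triv.cell_induct)
    (auto intro: liftable_free_map liftable_cobase liftable_transfinite)

lemma pweq_cancel_left:
  assumes "f \<in> hom DC X Y" "g \<in> hom DC Y Z" "pweq g" "pweq (g \<cdot>\<^bsub>DC\<^esub> f)" shows "pweq f"
  unfolding pweq_def
proof
  fix c assume c: "c \<in> VOb C"
  have A: "f \<in> Ar DC" "Dom DC f = X" "Cod DC f = Y" "g \<in> Ar DC" "Dom DC g = Y" "Cod DC g = Z"
    using assms(1,2) unfolding hom_iff by blast+
  have "cmp g c \<in> Weq M" "cmp g c \<cdot> cmp f c \<in> Weq M" using assms(3,4) c by (simp_all add: pweq_def)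
  then show "cmp f c \<in> Weq M"
    by (rule K.Weq_cancel_left[rotated 3])
      (use A dmapD(3-5)[OF A(1) c] dmapD(3-5)[OF A(4) c] in simp_all)
qed

lemma pweq_Idn: "X \<in> Ob DC \<Longrightarrow> pweq (Idn DC X)"
  using K.Weq_iso M.is_iso_Idn diagramD(1)[of X] by (auto simp: pweq_def)

context
  fixes F \<omega>
  assumes F: "is_weighted_colimit_functor V C M T W F \<omega>"
begin

text \<open>The coend of the initial diagram exists and is initial, hence good. The map from the
  initial diagram to \<open>X\<close> is a cell, and \<open>wcf_cells\<close> carries both
  properties over to \<open>X\<close>.\<close>

lemma cofibrant_domain:
  assumes "cofibrant PC X"
  obtains Z i where "is_initial DC Z" "i \<in> hom DC Z X" "i \<in> cof.cells"
    "X \<in> wcolim_domain V C M T W" "FOb F X \<in> good M" "X \<in> cof.Gd"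
proof -
  obtain Z i where Z: "is_initial DC Z" "i \<in> hom DC Z X" "i \<in> cof.cells"
    using assms Cof_PC unfolding cofibrant_def projective_cofcat_initial projective_cofcat_hom by blast
  obtain I where I: "is_initial M I"
    using cof.S.coproduct_exists[OF small_empty, of "\<lambda>_. undefined"] M.initial_iff_coproduct by blast
  obtain \<omega>0 where "wuniv Z I \<omega>0" using cofw.initial_diagram(2)[OF Z(1) I] by blast
  then have "is_weighted_colimit V C M T W Z I \<omega>0"
    by (rule cofw.wuniv_weighted_colimit[OF cofw.initial_diagram(1)[OF Z(1)]])
  then have ZD: "Z \<in> wcolim_domain V C M T W"
    using Z(1) by (auto simp: wcolim_domain_def is_initial_def)
  have "is_initial M (FOb F Z)" by (rule cofw.initial_diagram(3)[OF Z(1) wcf_wuniv[OF F ZD]])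
  then have "FOb F Z \<in> good M" by (rule cof.S.initial_good)
  note c = cofw.wcf_cells[OF F Z(3,2) ZD this]
  have "X \<in> cof.Gd" using cof.pwD(4)[OF cof.cells_pw[OF Z(3)]] Z(2) unfolding hom_iff by blast
  from that[OF Z c(1,2) this] show thesis .
qed

text \<open>A lifting problem that starts at an initial diagram commutes for trivial
  reasons.\<close>

lemma initial_square:
  assumes Z: "is_initial DC Z" and i: "i \<in> hom DC Z X" and b: "b \<in> hom DC X D" and p: "p \<in> hom DC E D"
  obtains g where "g \<in> hom DC Z E" "b \<cdot>\<^bsub>DC\<^esub> i = p \<cdot>\<^bsub>DC\<^esub> g"
proof -
  have E: "E \<in> Ob DC" "D \<in> Ob DC" using p DC.Dom_in[of p] DC.Cod_in[of p] unfolding hom_iff by blast+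
  obtain g where g: "g \<in> hom DC Z E" using Z E unfolding is_initial_def by blast
  have "\<exists>!f. f \<in> hom DC Z D" using Z E(2) unfolding is_initial_def by blast
  from ex1_eqI[OF this DC.Comp_in[OF i b] DC.Comp_in[OF g p]] g that show thesis by blast
qed

text \<open>Two lifts exhibit \<^term>\<open>f\<close>, up to trivial cofibrations, as a retraction \<^term>\<open>p\<close> whose section
  \<^term>\<open>s\<close> is itself, up to a trivial cofibration, a retraction \<^term>\<open>q\<close>.\<close>

lemma wcf_Weq:
  assumes f: "f \<in> hom DC X Y" "pweq f" and X: "cofibrant PC X" and Y: "cofibrant PC Y"
  shows "FAr F f \<in> Weq M"
proof -
  let ?w = "FAr F" and ?D = "wcolim_domain V C M T W"
  obtain Zx ix where X': "is_initial DC Zx" "ix \<in> hom DC Zx X" "ix \<in> cof.cells" "X \<in> ?D" "FOb F X \<in> good M" "X \<in> cof.Gd"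
    by (rule cofibrant_domain[OF X])
  obtain Zy iy where Y': "is_initial DC Zy" "iy \<in> hom DC Zy Y" "iy \<in> cof.cells" "Y \<in> ?D" "FOb F Y \<in> good M" "Y \<in> cof.Gd"
    by (rule cofibrant_domain[OF Y])
  have ixA: "Dom DC ix = Zx" "Cod DC ix = X" and iyA: "Dom DC iy = Zy" "Cod DC iy = Y"
    using X'(2) Y'(2) unfolding hom_iff by blast+
  have YO: "Y \<in> Ob DC" by (rule cof.Gd_Ob[OF Y'(6)])
  \<comment> \<open>All objects met below arise from \<open>X\<close> or \<open>Y\<close> by
    attaching trivial cells, so the functor stays defined with good values, and the attaching maps
    are sent to weak equivalences.\<close>
  have triv: "E' \<in> ?D \<and> FOb F E' \<in> good M \<and> ?w j \<in> Weq M \<and> pweq j \<and> E' \<in> cof.Gd"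
    if j: "j \<in> triv.cells" "j \<in> hom DC E E'" and E: "E \<in> ?D" "FOb F E \<in> good M" for j E E'
  proof -
    have "FOb F E \<in> good_obs M (Weq M \<inter> Cof M)" using E(2) by (simp add: K.good_trivial)
    note w = trivw.wcf_cells[OF F j E(1) this]
    note pw = triv.pwD[OF triv.cells_pw[OF j(1)]]
    have "E' \<in> cof.Gd" using pw(4) j(2) unfolding hom_iff triv_Gd by blast
    then show ?thesis using w pw(2) by (auto simp: K.good_trivial pweq_def)
  qed
  obtain gy where gy: "gy \<in> hom DC Zy X" "Idn DC Y \<cdot>\<^bsub>DC\<^esub> iy = f \<cdot>\<^bsub>DC\<^esub> gy"
    by (rule initial_square[OF Y'(1,2) DC.Idn_in[OF YO] f(1)])
  have idY: "Idn DC Y \<in> hom DC (Cod DC iy) Y" unfolding iyA by (rule DC.Idn_in[OF YO])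
  \<comment> \<open>Lifting the identity of \<open>Y\<close> against \<open>f\<close> gives
    \<open>f = p \<cdot> j\<close> with \<open>j\<close> a trivial cell and \<open>s\<close> a
    section of \<open>p\<close>. By 2-out-of-3 the images of \<open>f\<close>, \<open>p\<close> and
    \<open>s\<close> are weak equivalences together.\<close>
  obtain E j p s where L1: "j \<in> triv.cells" "j \<in> hom DC X E" "p \<in> hom DC E Y" "s \<in> hom DC (Cod DC iy) E"
    "p \<cdot>\<^bsub>DC\<^esub> j = f" "s \<cdot>\<^bsub>DC\<^esub> iy = j \<cdot>\<^bsub>DC\<^esub> gy" "p \<cdot>\<^bsub>DC\<^esub> s = Idn DC Y"
    by (rule liftableD[OF cells_liftable[OF Y'(3)] gy(1)[folded iyA(1)] f(1) idY X'(6) f(2) gy(2)])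
  note sh = L1(4)[unfolded iyA]
  note tE = triv[OF L1(1,2) X'(4,5)]
  have pp: "pweq p" by (rule pweq_cancel[OF L1(2,3)]) (use tE f(2) L1(5) in simp_all)
  have ps: "pweq s" by (rule pweq_cancel_left[OF sh L1(3) pp]) (simp add: L1(7) pweq_Idn[OF YO])
  have EO: "E \<in> Ob DC" using tE cof.Gd_Ob by blast
  obtain gx where gx: "gx \<in> hom DC Zx Y" "j \<cdot>\<^bsub>DC\<^esub> ix = s \<cdot>\<^bsub>DC\<^esub> gx"
    by (rule initial_square[OF X'(1,2) L1(2) sh])
  \<comment> \<open>\<open>E\<close> is reached from the initial diagram through \<open>X\<close>,
    by the cells \<open>ix\<close> and \<open>j\<close>. Its identity is accordingly lifted against
    \<open>s\<close> in two steps: first its restriction to \<open>X\<close>, and next, in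
    \<open>L3\<close>, along the trivial cell \<open>j\<close>.\<close>
  obtain Y1 k1 q1 t1 where L2: "k1 \<in> triv.cells" "k1 \<in> hom DC Y Y1" "q1 \<in> hom DC Y1 E" "t1 \<in> hom DC (Cod DC ix) Y1"
    "q1 \<cdot>\<^bsub>DC\<^esub> k1 = s" "t1 \<cdot>\<^bsub>DC\<^esub> ix = k1 \<cdot>\<^bsub>DC\<^esub> gx" "q1 \<cdot>\<^bsub>DC\<^esub> t1 = j"
    by (rule liftableD[OF cells_liftable[OF X'(3)] gx(1)[folded ixA(1)] sh L1(2)[folded ixA(2)] Y'(6) ps gx(2)])
  note t1h = L2(4)[unfolded ixA]
  note tY1 = triv[OF L2(1,2) Y'(4,5)]
  have pq1: "pweq q1" by (rule pweq_cancel[OF L2(2,3)]) (use tY1 ps L2(5) in simp_all)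
  have jA: "Dom DC j = X" "Cod DC j = E" using L1(2) unfolding hom_iff by blast+
  have idE: "Idn DC E \<in> hom DC (Cod DC j) E" unfolding jA by (rule DC.Idn_in[OF EO])
  have sq: "Idn DC E \<cdot>\<^bsub>DC\<^esub> j = q1 \<cdot>\<^bsub>DC\<^esub> t1" unfolding L2(7) by (rule DC.Comp_Idn_left[OF L1(2)])
  obtain Y2 k2 q t where L3: "k2 \<in> triv.cells" "k2 \<in> hom DC Y1 Y2" "q \<in> hom DC Y2 E" "t \<in> hom DC (Cod DC j) Y2"
    "q \<cdot>\<^bsub>DC\<^esub> k2 = q1" "t \<cdot>\<^bsub>DC\<^esub> j = k2 \<cdot>\<^bsub>DC\<^esub> t1" "q \<cdot>\<^bsub>DC\<^esub> t = Idn DC E"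
    by (rule liftableD[OF triv_cells_liftable[OF L1(1)] t1h[folded jA(1)] L2(3) idE _ pq1 sq]) (use tY1 in auto)
  note th = L3(4)[unfolded jA]
  note tY2 = triv[OF L3(1,2) conjunct1[OF tY1] conjunct1[OF conjunct2[OF tY1]]]
  have D: "X \<in> ?D" "Y \<in> ?D" "E \<in> ?D" "Y1 \<in> ?D" "Y2 \<in> ?D" using X' Y' tE tY1 tY2 by blast+
  have hom: "?w g \<in> Ar M \<and> Dom M (?w g) = FOb F A \<and> Cod M (?w g) = FOb F B"
    if "g \<in> hom DC A B" "A \<in> ?D" "B \<in> ?D" for g A B
    using wcf_map(1)[OF F that] by (simp add: hom_iff)
  note wj = hom[OF L1(2) D(1,3)] and wp = hom[OF L1(3) D(3,2)] and ws = hom[OF sh D(2,3)]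
    and wk1 = hom[OF L2(2) D(2,4)] and wq1 = hom[OF L2(3) D(4,3)]
    and wk2 = hom[OF L3(2) D(4,5)] and wq = hom[OF L3(3) D(5,3)] and wt = hom[OF th D(3,5)]
  have c1: "?w p \<cdot> ?w j = ?w f" using wcf_comp[OF F L1(2,3) D(1,3,2)] L1(5) by simp
  have c2: "?w p \<cdot> ?w s = Idn M (FOb F Y)"
    using wcf_comp[OF F sh L1(3) D(2,3,2)] L1(7) wcf_Idn[OF F D(2)] by simp
  have c3: "?w q1 \<cdot> ?w k1 = ?w s" using wcf_comp[OF F L2(2,3) D(2,4,3)] L2(5) by simp
  have c4: "?w q \<cdot> ?w k2 = ?w q1" using wcf_comp[OF F L3(2,3) D(4,5,3)] L3(5) by simp
  have c5: "?w q \<cdot> ?w t = Idn M (FOb F E)"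
    using wcf_comp[OF F th L3(3) D(3,5,3)] L3(7) wcf_Idn[OF F D(3)] by simp
  have FO: "FOb F A \<in> Ob M" if "A \<in> ?D" for A using wcoconeD(2)[OF wunivD(1)[OF wcf_wuniv[OF F that]]] .
  have idW: "Idn M (FOb F A) \<in> Weq M" if "A \<in> ?D" for A by (rule K.Weq_iso[OF M.is_iso_Idn[OF FO[OF that]]])
  define k where "k = ?w k2 \<cdot> ?w k1"
  have k: "k \<in> Weq M" unfolding k_def by (rule K.Weq_comp) (use tY1 tY2 wk1 wk2 in auto)
  have kA: "k \<in> Ar M" "Dom M k = FOb F Y" "Cod M k = FOb F Y2" using wk1 wk2 by (simp_all add: k_def)
  have qk: "?w q \<cdot> k = ?w s"
    unfolding k_def using M.comp_cong_left[OF c4, of "?w k1"] c3 wk1 wk2 wq by simp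
  \<comment> \<open>As \<open>q \<cdot> k = s\<close> and \<open>p \<cdot> s = id\<close> on images,
    \<open>v\<close> is a left inverse of the weak equivalence \<open>k\<close> and so is one
    itself. The section \<open>t\<close> of \<open>q\<close> yields
    \<open>v \<cdot> (t \<cdot> q) = v\<close>, and cancelling \<open>v\<close> shows that
    \<open>t \<cdot> q\<close> is a weak equivalence.\<close>
  define v where "v = ?w p \<cdot> ?w q"
  have vA: "v \<in> Ar M" "Dom M v = FOb F Y2" "Cod M v = FOb F Y" using wp wq by (simp_all add: v_def)
  have "v \<cdot> k = Idn M (FOb F Y)" using qk c2 wp wq kA by (simp add: v_def)
  then have v: "v \<in> Weq M" by (intro K.Weq_cancel_right[of k v]) (use kA vA k idW[OF D(2)] in simp_all)
  have "v \<cdot> (?w t \<cdot> ?w q) = v"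
    using M.comp_cong_left[OF c5, of "?w q"] wp wq wt FO[OF D(3)] by (simp add: v_def)
  then have tq: "?w t \<cdot> ?w q \<in> Weq M"
    by (intro K.Weq_cancel_left[of "?w t \<cdot> ?w q" v]) (use vA v wq wt in simp_all)
  have "?w q \<cdot> ?w t \<in> Weq M" unfolding c5 by (rule idW[OF D(3)])
  \<comment> \<open>One composite of the images of \<open>q\<close> and \<open>t\<close> is an
    identity, the other a weak equivalence. 2-out-of-3 by itself draws no conclusion from this;
    \<open>two_sided_weq\<close> does.\<close>
  then have "?w q \<in> Weq M"
    by (rule K.two_sided_weq[OF universe wcf_map(1)[OF F L3(3) D(5,3)] wcf_map(1)[OF F th D(3,5)]
      conjunct1[OF conjunct2[OF tY2]] tq])
  then have "?w q \<cdot> k \<in> Weq M" by (rule K.Weq_comp[OF k]) (use kA wq in simp)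
  then have "?w s \<in> Weq M" unfolding qk .
  then have "?w p \<in> Weq M" by (intro K.Weq_cancel_right[of "?w s" "?w p"]) (use ws wp c2 idW[OF D(2)] in simp_all)
  then have "?w p \<cdot> ?w j \<in> Weq M" by (intro K.Weq_comp) (use tE wj wp in auto)
  then show ?thesis unfolding c1 .
qed

lemma weighted_colimit_left_quillen:
  assumes good_cofibrant: "\<forall>X\<in>good M. cofibrant M X"
  shows "left_quillen PC M (wcolim_domain V C M T W) F"
  unfolding left_quillen_def
proof (intro conjI allI impI ballI subsetI; (elim conjE)?)
  let ?D = "wcolim_domain V C M T W"
  show "X \<in> Ob PC" if "X \<in> ?D" for X using that by (simp add: projective_cofcat_simps wcolim_domain_def)
  show "X \<in> ?D" if "X \<in> {X \<in> Ob PC. cofibrant PC X}" for X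
    using that by (auto elim: cofibrant_domain)
  show "is_functor (full_subcat PC ?D) M F"
    unfolding projective_cofcat_functor using F by (simp add: is_weighted_colimit_functor_def)
  show "is_initial M (FOb F Z)" if "Z \<in> ?D" "is_initial PC Z" for Z
    using cofw.initial_diagram(3)[OF _ wcf_wuniv[OF F that(1)]] that(2) unfolding projective_cofcat_initial .
  show "strong_cofibration M (FAr F f)" if "strong_cofibration PC f" for f
  proof -
    have f: "f \<in> cof.cells" "cofibrant PC (Dom DC f)"
      using that Cof_PC unfolding strong_cofibration_def projective_cofcat_simps by auto
    have fh: "f \<in> hom DC (Dom DC f) (Cod DC f)"
      using cof.pwD(1)[OF cof.cells_pw[OF f(1)]] unfolding hom_iff by blast
    obtain Z i where X: "is_initial DC Z" "i \<in> hom DC Z (Dom DC f)" "i \<in> cof.cells" "Dom DC f \<in> ?D"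
      "FOb F (Dom DC f) \<in> good M" "Dom DC f \<in> cof.Gd" by (rule cofibrant_domain[OF f(2)])
    note w = cofw.wcf_cells[OF F f(1) fh X(4,5)]
    have "FAr F f \<in> hom M (FOb F (Dom DC f)) (FOb F (Cod DC f))" by (rule wcf_map(1)[OF F fh X(4) w(1)])
    \<comment> \<open>Both ends of the image are good, hence cofibrant by the assumption on
      \<open>M\<close>.\<close>
    then show ?thesis
      unfolding strong_cofibration_def using w X(5) good_cofibrant by (simp add: hom_iff)
  qed
  show "FAr F f \<in> Weq M" if "f \<in> Weq PC" "cofibrant PC (Dom PC f)" "cofibrant PC (Cod PC f)" for f
  proof -
    have f: "f \<in> Ar DC" "pweq f"
      using that(1) unfolding projective_cofcat_simps
      by (auto simp: pointwise_weqs_def pweq_def cmp_def)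
    show ?thesis
      by (rule wcf_Weq[of f "Dom DC f" "Cod DC f"])
        (use f that(2,3) in \<open>simp_all add: hom_iff projective_cofcat_simps\<close>)
  qed
qed

end

end

text \<open>Flatness is formulated for strong cofibrations and for weak equivalences between
  cofibrant objects. Good objects being cofibrant, every cofibration is strong; the clauses for the
  codomain of \<open>0 \<rightarrow> K\<close> then give both properties.\<close>

lemma flat_obD:
  fixes M :: "('o, 'a, 'y) cofcat_scheme"
  assumes K: "flat_ob V M T K" and M: "cofibration_category M U" and good: "\<forall>X\<in>good M. cofibrant M X"
  shows "f \<in> Cof M \<Longrightarrow> AAr T (Idn V K) f \<in> Cof M"
    "\<lbrakk>w \<in> Weq M; Dom M w \<in> good M; Cod M w \<in> good M\<rbrakk> \<Longrightarrow> AAr T (Idn V K) w \<in> Weq M"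
proof -
  obtain i where i: "Cod V i = K" "flat_map V M T i"
    using K by (auto simp: flat_ob_def hom_iff)
  note fl = i(2)[unfolded flat_map_def Let_def i(1), THEN conjunct2]
  show "AAr T (Idn V K) f \<in> Cof M" if f: "f \<in> Cof M"
  proof -
    have "strong_cofibration M f"
      unfolding strong_cofibration_def
      using f good left_closed.S_good[OF cofibration_category.Cof_left_closed[OF M] f] by blast
    then show ?thesis using fl by blast
  qed
  show "AAr T (Idn V K) w \<in> Weq M" if "w \<in> Weq M" "Dom M w \<in> good M" "Cod M w \<in> good M"
    using fl good that by blast
qed

theorem mainTheorem3:
  fixes U :: "'s itself"
    and V :: "('v, 'w) moncat"
    and M :: "('o, 'a) cofcat"
    and T :: "('v, 'w, 'o, 'a) act"
    and C :: "('c, 'v, 'w) vcat"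
    and W :: "('c, 'v, 'w) diagram"
  assumes "universe U"
    and "cocomplete_symmetric_monoidal U V"
    and "cofibration_V_category U V M T"
    and good_cofibrant: "\<forall>X\<in>good M. cofibrant M X"
    and "V_category V C" and "small U (VOb C)" and "locally_flat V M T C"
    and "is_weight V C W" and "\<forall>c\<in>VOb C. flat_ob V M T (DOb W c)"
  shows "(\<exists>F \<omega>. is_weighted_colimit_functor V C M T W F \<omega>)
    \<and> (\<forall>F \<omega>. is_weighted_colimit_functor V C M T W F \<omega> \<longrightarrow>
         left_quillen (projective_cofcat U V C M T) M (wcolim_domain V C M T W) F)"
proof -
  have M: "cofibration_category M U" and T: "monoidal_action V M T"
      and pres: "preserves_colimits_each_variable U V M T"
    using assms(3) by (auto simp: cofibration_V_category_def)
  have V: "symmetric_monoidal V" using assms(2) by (simp add: cocomplete_symmetric_monoidal_def)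
  have hom: "flat_ob V M T (VHom C x y)" if "x \<in> VOb C" "y \<in> VOb C" for x y
    using assms(7) that by (simp add: locally_flat_def)
  have wt: "flat_ob V M T (DOb W c)" if "c \<in> VOb C" for c using assms(9) that by blast
  have "enriched U V M T C"
    by (rule enriched.intro[OF assms(1) V T _ assms(5,6)])
      (use pres in \<open>simp add: preserves_colimits_each_variable_def\<close>)
  \<comment> \<open>Local flatness of \<open>C\<close> and flatness of the values of
    \<open>W\<close> are turned by \<open>flat_obD\<close> into the preservation properties on which
    the lifting and extension arguments rest.\<close>
  then interpret projective_weighted U V M T C W
    by (intro projective_weighted.intro projective.intro weighted.intro projective_axioms.intro
        weighted_axioms.intro projective_weighted_axioms.intro M assms(8)
        flat_obD[OF hom M good_cofibrant] flat_obD[OF wt M good_cofibrant])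
  show ?thesis
    using weighted_colimit_functor_exists weighted_colimit_left_quillen[OF _ good_cofibrant] by blast
qed

end
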